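(* Let $(R,\mathfrak{m},k)$ be a Noetherian local ring, let $S:=R[X_1,\ldots,X_n]$ be a polynomial ring over $R$ graded with $\deg X_i>0$ for all $i$ (and $R$ in degree $0$), and let $\mathbb{M}$ be a finitely generated graded $S$-module. Set $d:=\dim(\mathbb{M}\otimes_R k)$. Then $H^i_{S_+}(\mathbb{M})=0$ for $i>d$, and the natural graded map $$H^d_{S_+}(\mathbb{M})\otimes_R k\longrightarrow H^d_{S_+}(\mathbb{M}\otimes_R k)$$ is an isomorphism.
   Context: $S_+=(X_1,\dots,X_n)$; $H^i_{S_+}$ denotes local cohomology with support in $S_+$. $\dim$ is Krull dimension. *)

theory Defs
  imports "HOL-Algebra.Algebra" "HOL-Library.Extended_Real"
begin

section \<open>Rings and ideals\<close>

definition local_ring :: "('a, 'z) ring_scheme \<Rightarrow> 'a set \<Rightarrow> bool" where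
  "local_ring R m \<longleftrightarrow> cring R \<and> maximalideal m R \<and> (\<forall>J. maximalideal J R \<longrightarrow> J = m)"

text \<open>The supremum is taken in the extended reals, so that the zero ring, which has no prime
  ideals, gets dimension \<open>-\<infinity>\<close>.\<close>

definition krull_dim :: "('a, 'z) ring_scheme \<Rightarrow> ereal" where
  "krull_dim A =
    (SUP l \<in> {l. \<exists>P :: nat \<Rightarrow> 'a set.
                 (\<forall>j\<le>l. primeideal (P j) A) \<and> (\<forall>j<l. P j \<subset> P (Suc j))}. ereal (real l))"


section \<open>Polynomial rings\<close>

text \<open>Polynomials are functions from monomials (multisets of indices) to coefficients, as in
  \<open>HOL-Algebra.Indexed_Polynomials\<close>, which provides the carrier and the addition but no
  multiplication of polynomials; the product below is convolution.\<close>

definition mpoly_ring :: "('a, 'z) ring_scheme \<Rightarrow> nat \<Rightarrow> (nat multiset \<Rightarrow> 'a) ring" where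
  "mpoly_ring R n =
    \<lparr>carrier = ring.indexed_pset R {..<n} (carrier R),
     monoid.mult = (\<lambda>P Q u. \<Oplus>\<^bsub>R\<^esub>v\<in>{v. v \<subseteq># u}. P v \<otimes>\<^bsub>R\<^esub> Q (u - v)),
     one = ring.indexed_const R \<one>\<^bsub>R\<^esub>,
     ring.zero = ring.indexed_const R \<zero>\<^bsub>R\<^esub>,
     add = ring.indexed_padd R\<rparr>"

definition mpoly_grading ::
    "('a, 'z) ring_scheme \<Rightarrow> nat \<Rightarrow> (nat \<Rightarrow> nat) \<Rightarrow> int \<Rightarrow> (nat multiset \<Rightarrow> 'a) set" where
  "mpoly_grading R n w j =
    {f \<in> carrier (mpoly_ring R n). \<forall>u. f u \<noteq> \<zero>\<^bsub>R\<^esub> \<longrightarrow> (\<Sum>i\<in>#u. int (w i)) = j}"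

definition irrelevant_ideal :: "('a, 'z) ring_scheme \<Rightarrow> nat \<Rightarrow> (nat multiset \<Rightarrow> 'a) set" where
  "irrelevant_ideal R n = genideal (mpoly_ring R n) (ring.indexed_var R ` {..<n})"


section \<open>Modules\<close>

text \<open>The type \<^typ>\<open>('s, 'm) module\<close> extends the ring record.  The locale \<^locale>\<open>module\<close> does
  not constrain the fields \<open>mult\<close> and \<open>one\<close>, and they carry no meaning below.\<close>

definition module_hom ::
    "('s, 'z) ring_scheme \<Rightarrow> ('s, 'm) module \<Rightarrow> ('s, 'n) module \<Rightarrow> ('m \<Rightarrow> 'n) set" where
  "module_hom S M N =
    {f \<in> carrier M \<rightarrow> carrier N.
       (\<forall>x\<in>carrier M. \<forall>y\<in>carrier M. f (x \<oplus>\<^bsub>M\<^esub> y) = f x \<oplus>\<^bsub>N\<^esub> f y) \<and>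
       (\<forall>a\<in>carrier S. \<forall>x\<in>carrier M. f (a \<odot>\<^bsub>M\<^esub> x) = a \<odot>\<^bsub>N\<^esub> f x)}"

definition finitely_generated_module ::
    "('s, 'z) ring_scheme \<Rightarrow> ('s, 'm) module \<Rightarrow> bool" where
  "finitely_generated_module S M \<longleftrightarrow> module S M \<and>
    (\<exists>G. finite G \<and> G \<subseteq> carrier M \<and>
         (\<forall>N. submodule N S M \<and> G \<subseteq> N \<longrightarrow> N = carrier M))"

definition quotient_module :: "('s, 'm) module \<Rightarrow> 'm set \<Rightarrow> ('s, 'm set) module" where
  "quotient_module M N =
    \<lparr>carrier = a_rcosets\<^bsub>M\<^esub> N, monoid.mult = (\<lambda>_ _. N), one = N, ring.zero = N, add = set_add M,
     smult = (\<lambda>a C. \<Union>x\<in>C. N +>\<^bsub>M\<^esub> (a \<odot>\<^bsub>M\<^esub> x))\<rparr>"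

definition annihilator :: "('s, 'z) ring_scheme \<Rightarrow> ('s, 'm) module \<Rightarrow> 's set" where
  "annihilator S M = {a \<in> carrier S. \<forall>x\<in>carrier M. a \<odot>\<^bsub>M\<^esub> x = \<zero>\<^bsub>M\<^esub>}"

definition module_dim :: "('s, 'z) ring_scheme \<Rightarrow> ('s, 'm) module \<Rightarrow> ereal" where
  "module_dim S M = krull_dim (S Quot (annihilator S M))"

definition residue_module :: "('a, 'z) ring_scheme \<Rightarrow> 'a set \<Rightarrow> ('a, 'a set) module" where
  "residue_module R m =
    ring.extend (R Quot m) (module.fields (\<lambda>r c. (m +>\<^bsub>R\<^esub> r) \<otimes>\<^bsub>R Quot m\<^esub> c))"


section \<open>Graded modules\<close>

definition graded_module ::
    "('s, 'z) ring_scheme \<Rightarrow> (int \<Rightarrow> 's set) \<Rightarrow> ('s, 'm) module \<Rightarrow> (int \<Rightarrow> 'm set) \<Rightarrow> bool" where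
  "graded_module S Sg M Mg \<longleftrightarrow> module S M \<and>
    (\<forall>j. subgroup (Mg j) (add_monoid M)) \<and>
    (\<forall>i j. \<forall>a\<in>Sg i. \<forall>x\<in>Mg j. a \<odot>\<^bsub>M\<^esub> x \<in> Mg (i + j)) \<and>
    (\<forall>x\<in>carrier M. \<exists>!c. (\<forall>j. c j \<in> Mg j) \<and> finite {j. c j \<noteq> \<zero>\<^bsub>M\<^esub>} \<and>
                        x = (\<Oplus>\<^bsub>M\<^esub>j\<in>{j. c j \<noteq> \<zero>\<^bsub>M\<^esub>}. c j))"

definition graded_hom ::
    "('s, 'z) ring_scheme \<Rightarrow> ('s, 'm) module \<Rightarrow> (int \<Rightarrow> 'm set) \<Rightarrow>
     ('s, 'n) module \<Rightarrow> (int \<Rightarrow> 'n set) \<Rightarrow> ('m \<Rightarrow> 'n) set" where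
  "graded_hom S M Mg N Ng = {f \<in> module_hom S M N. \<forall>j. f ` Mg j \<subseteq> Ng j}"


section \<open>Tensor products\<close>

text \<open>For a ring homomorphism \<open>h : R \<rightarrow> S\<close>, an \<open>S\<close>-module \<open>A\<close> and an \<open>R\<close>-module \<open>B\<close>, this is
  \<open>A \<otimes>\<^sub>R B\<close>, an \<open>S\<close>-module through the left factor: the free abelian group on pairs modulo the
  bilinearity relations.\<close>

definition tensor_relations ::
    "('r \<Rightarrow> 's) \<Rightarrow> ('r, 'z) ring_scheme \<Rightarrow> ('s, 'm) module \<Rightarrow> ('r, 'n) module \<Rightarrow>
     ('m \<times> 'n \<Rightarrow>\<^sub>0 int) set" where
  "tensor_relations h R A B = generate (free_Abelian_group (carrier A \<times> carrier B))
    ({frag_of (x \<oplus>\<^bsub>A\<^esub> x', y) - frag_of (x, y) - frag_of (x', y) | x x' y.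
        x \<in> carrier A \<and> x' \<in> carrier A \<and> y \<in> carrier B} \<union>
     {frag_of (x, y \<oplus>\<^bsub>B\<^esub> y') - frag_of (x, y) - frag_of (x, y') | x y y'.
        x \<in> carrier A \<and> y \<in> carrier B \<and> y' \<in> carrier B} \<union>
     {frag_of (h r \<odot>\<^bsub>A\<^esub> x, y) - frag_of (x, r \<odot>\<^bsub>B\<^esub> y) | r x y.
        r \<in> carrier R \<and> x \<in> carrier A \<and> y \<in> carrier B})"

definition pure_tensor ::
    "('r \<Rightarrow> 's) \<Rightarrow> ('r, 'z) ring_scheme \<Rightarrow> ('s, 'm) module \<Rightarrow> ('r, 'n) module \<Rightarrow>
     'm \<Rightarrow> 'n \<Rightarrow> ('m \<times> 'n \<Rightarrow>\<^sub>0 int) set" where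
  "pure_tensor h R A B x y =
    tensor_relations h R A B #>\<^bsub>free_Abelian_group (carrier A \<times> carrier B)\<^esub> frag_of (x, y)"

definition tensor_module ::
    "('r \<Rightarrow> 's) \<Rightarrow> ('r, 'z) ring_scheme \<Rightarrow> ('s, 'm) module \<Rightarrow> ('r, 'n) module \<Rightarrow>
     ('s, ('m \<times> 'n \<Rightarrow>\<^sub>0 int) set) module" where
  "tensor_module h R A B =
    (let F = free_Abelian_group (carrier A \<times> carrier B); K = tensor_relations h R A B in
     \<lparr>carrier = carrier (F Mod K), monoid.mult = (\<lambda>_ _. K), one = K,
      ring.zero = \<one>\<^bsub>F Mod K\<^esub>, add = monoid.mult (F Mod K),
      smult = (\<lambda>s T. \<Union>t\<in>T. K #>\<^bsub>F\<^esub> frag_extend (\<lambda>(x, y). frag_of (s \<odot>\<^bsub>A\<^esub> x, y)) t)\<rparr>)"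

text \<open>The grading of \<open>A \<otimes>\<^sub>R B\<close> for graded \<open>A\<close>, with \<open>R\<close> and \<open>B\<close> concentrated in degree 0.\<close>

definition tensor_grading ::
    "('r \<Rightarrow> 's) \<Rightarrow> ('r, 'z) ring_scheme \<Rightarrow> ('s, 'm) module \<Rightarrow> (int \<Rightarrow> 'm set) \<Rightarrow>
     ('r, 'n) module \<Rightarrow> int \<Rightarrow> ('m \<times> 'n \<Rightarrow>\<^sub>0 int) set set" where
  "tensor_grading h R A Ag B j = generate (add_monoid (tensor_module h R A B))
    {pure_tensor h R A B x y | x y. x \<in> Ag j \<and> y \<in> carrier B}"


section \<open>Injective resolutions\<close>

text \<open>The test modules \<open>B\<close> have carriers in the element type of the ring.  These include the ring
  itself (with every shift of its grading, in the graded case), so by Baer's criterion this is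
  injectivity with respect to modules over any type.\<close>

definition injective_module :: "('s, 'z) ring_scheme \<Rightarrow> ('s, 'e) module \<Rightarrow> bool" where
  "injective_module S E \<longleftrightarrow> module S E \<and>
    (\<forall>(B :: ('s, 's) module) A f.
       module S B \<and> submodule A S B \<and> f \<in> module_hom S (B\<lparr>carrier := A\<rparr>) E \<longrightarrow>
       (\<exists>g\<in>module_hom S B E. \<forall>x\<in>A. g x = f x))"

definition graded_injective_module ::
    "('s, 'z) ring_scheme \<Rightarrow> (int \<Rightarrow> 's set) \<Rightarrow> ('s, 'e) module \<Rightarrow> (int \<Rightarrow> 'e set) \<Rightarrow> bool" where
  "graded_injective_module S Sg E Eg \<longleftrightarrow> graded_module S Sg E Eg \<and>
    (\<forall>(B :: ('s, 's) module) Bg A f.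
       graded_module S Sg B Bg \<and> submodule A S B \<and>
       graded_module S Sg (B\<lparr>carrier := A\<rparr>) (\<lambda>j. A \<inter> Bg j) \<and>
       f \<in> graded_hom S (B\<lparr>carrier := A\<rparr>) (\<lambda>j. A \<inter> Bg j) E Eg \<longrightarrow>
       (\<exists>g\<in>graded_hom S B Bg E Eg. \<forall>x\<in>A. g x = f x))"

text \<open>\<open>0 \<rightarrow> M \<rightarrow> E 0 \<rightarrow> E 1 \<rightarrow> \<dots>\<close> with augmentation \<open>e\<close> and differentials \<open>d j : E j \<rightarrow> E (j + 1)\<close>.\<close>

definition right_resolution ::
    "('s, 'z) ring_scheme \<Rightarrow> ('s, 'm) module \<Rightarrow>
     (nat \<Rightarrow> ('s, 'e) module) \<Rightarrow> (nat \<Rightarrow> 'e \<Rightarrow> 'e) \<Rightarrow> ('m \<Rightarrow> 'e) \<Rightarrow> bool" where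
  "right_resolution S M E d e \<longleftrightarrow>
    e \<in> module_hom S M (E 0) \<and> (\<forall>j. d j \<in> module_hom S (E j) (E (Suc j))) \<and>
    inj_on e (carrier M) \<and>
    e ` carrier M = {x \<in> carrier (E 0). d 0 x = \<zero>\<^bsub>E 1\<^esub>} \<and>
    (\<forall>j. d j ` carrier (E j) = {x \<in> carrier (E (Suc j)). d (Suc j) x = \<zero>\<^bsub>E (Suc (Suc j))\<^esub>})"

definition injective_resolution ::
    "('s, 'z) ring_scheme \<Rightarrow> ('s, 'm) module \<Rightarrow>
     (nat \<Rightarrow> ('s, 'e) module) \<Rightarrow> (nat \<Rightarrow> 'e \<Rightarrow> 'e) \<Rightarrow> ('m \<Rightarrow> 'e) \<Rightarrow> bool" where
  "injective_resolution S M E d e \<longleftrightarrow>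
    right_resolution S M E d e \<and> (\<forall>j. injective_module S (E j))"

definition graded_injective_resolution ::
    "('s, 'z) ring_scheme \<Rightarrow> (int \<Rightarrow> 's set) \<Rightarrow> ('s, 'm) module \<Rightarrow> (int \<Rightarrow> 'm set) \<Rightarrow>
     (nat \<Rightarrow> ('s, 'e) module) \<Rightarrow> (nat \<Rightarrow> int \<Rightarrow> 'e set) \<Rightarrow> (nat \<Rightarrow> 'e \<Rightarrow> 'e) \<Rightarrow> ('m \<Rightarrow> 'e) \<Rightarrow>
     bool" where
  "graded_injective_resolution S Sg M Mg E Eg d e \<longleftrightarrow>
    right_resolution S M E d e \<and> (\<forall>j. graded_injective_module S Sg (E j) (Eg j)) \<and>
    e \<in> graded_hom S M Mg (E 0) (Eg 0) \<and>
    (\<forall>j. d j \<in> graded_hom S (E j) (Eg j) (E (Suc j)) (Eg (Suc j)))"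

text \<open>\<open>\<phi>\<close> is a morphism of complexes extending \<open>f : M \<rightarrow> N\<close> to resolutions of \<open>M\<close> and \<open>N\<close>.\<close>

definition resolution_lift ::
    "('s, 'z) ring_scheme \<Rightarrow> ('s, 'm) module \<Rightarrow> ('m \<Rightarrow> 'n) \<Rightarrow>
     (nat \<Rightarrow> ('s, 'e) module) \<Rightarrow> (nat \<Rightarrow> 'e \<Rightarrow> 'e) \<Rightarrow> ('m \<Rightarrow> 'e) \<Rightarrow>
     (nat \<Rightarrow> ('s, 'f) module) \<Rightarrow> (nat \<Rightarrow> 'f \<Rightarrow> 'f) \<Rightarrow> ('n \<Rightarrow> 'f) \<Rightarrow>
     (nat \<Rightarrow> 'e \<Rightarrow> 'f) \<Rightarrow> bool" where
  "resolution_lift S M f E dE eE F dF eF \<phi> \<longleftrightarrow>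
    (\<forall>j. \<phi> j \<in> module_hom S (E j) (F j)) \<and>
    (\<forall>x\<in>carrier M. \<phi> 0 (eE x) = eF (f x)) \<and>
    (\<forall>j. \<forall>x\<in>carrier (E j). \<phi> (Suc j) (dE j x) = dF j (\<phi> j x))"


section \<open>Local cohomology\<close>

definition torsion_part ::
    "('s, 'z) ring_scheme \<Rightarrow> 's set \<Rightarrow> ('s, 'm) module \<Rightarrow> 'm set" where
  "torsion_part S I M =
    {x \<in> carrier M. \<exists>N::nat. \<forall>a \<in> I [^]\<^bsub>ideals_set S\<^esub> N. a \<odot>\<^bsub>M\<^esub> x = \<zero>\<^bsub>M\<^esub>}"

definition torsion_cocycles ::
    "('s, 'z) ring_scheme \<Rightarrow> 's set \<Rightarrow> (nat \<Rightarrow> ('s, 'e) module) \<Rightarrow> (nat \<Rightarrow> 'e \<Rightarrow> 'e) \<Rightarrow>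
     nat \<Rightarrow> 'e set" where
  "torsion_cocycles S I E d i = {x \<in> torsion_part S I (E i). d i x = \<zero>\<^bsub>E (Suc i)\<^esub>}"

definition torsion_coboundaries ::
    "('s, 'z) ring_scheme \<Rightarrow> 's set \<Rightarrow> (nat \<Rightarrow> ('s, 'e) module) \<Rightarrow> (nat \<Rightarrow> 'e \<Rightarrow> 'e) \<Rightarrow>
     nat \<Rightarrow> 'e set" where
  "torsion_coboundaries S I E d i =
    (case i of 0 \<Rightarrow> {\<zero>\<^bsub>E 0\<^esub>} | Suc j \<Rightarrow> d j ` torsion_part S I (E j))"

text \<open>The \<open>i\<close>-th right derived functor of the \<open>I\<close>-torsion functor, computed by the (graded)
  injective resolution \<open>E\<close>.\<close>

definition local_cohomology ::
    "('s, 'z) ring_scheme \<Rightarrow> 's set \<Rightarrow> (nat \<Rightarrow> ('s, 'e) module) \<Rightarrow> (nat \<Rightarrow> 'e \<Rightarrow> 'e) \<Rightarrow>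
     nat \<Rightarrow> ('s, 'e set) module" where
  "local_cohomology S I E d i =
    quotient_module ((E i)\<lparr>carrier := torsion_cocycles S I E d i\<rparr>) (torsion_coboundaries S I E d i)"

definition local_cohomology_grading ::
    "('s, 'z) ring_scheme \<Rightarrow> 's set \<Rightarrow> (nat \<Rightarrow> ('s, 'e) module) \<Rightarrow> (nat \<Rightarrow> int \<Rightarrow> 'e set) \<Rightarrow>
     (nat \<Rightarrow> 'e \<Rightarrow> 'e) \<Rightarrow> nat \<Rightarrow> int \<Rightarrow> 'e set set" where
  "local_cohomology_grading S I E Eg d i j =
    (\<lambda>x. torsion_coboundaries S I E d i +>\<^bsub>E i\<^esub> x) ` (torsion_cocycles S I E d i \<inter> Eg i j)"

definition local_cohomology_map ::
    "('s, 'z) ring_scheme \<Rightarrow> 's set \<Rightarrow> (nat \<Rightarrow> ('s, 'f) module) \<Rightarrow> (nat \<Rightarrow> 'f \<Rightarrow> 'f) \<Rightarrow>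
     (nat \<Rightarrow> 'e \<Rightarrow> 'f) \<Rightarrow> nat \<Rightarrow> 'e set \<Rightarrow> 'f set" where
  "local_cohomology_map S I F dF \<phi> i C =
    (\<Union>x\<in>C. torsion_coboundaries S I F dF i +>\<^bsub>F i\<^esub> \<phi> i x)"

text \<open>Let \<open>HM\<close>, \<open>HN\<close> be \<open>S\<close>-modules and \<open>q : HM \<rightarrow> HN\<close> a map.  A homomorphism \<open>\<psi>\<close> as below from
  \<open>HM \<otimes>\<^sub>R (R/m)\<close> to \<open>HN\<close> is unique on the carrier.  For \<open>HM = H\<^sup>i(M)\<close>,
  \<open>HN = H\<^sup>i(M \<otimes>\<^sub>R R/m)\<close> and \<open>q\<close> induced by \<open>x \<mapsto> x \<otimes> 1\<close> it is the natural map, since \<open>x \<mapsto> x \<otimes> c\<close>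
  with \<open>c\<close> the class of \<open>r\<close> is \<open>r\<close> times \<open>x \<mapsto> x \<otimes> 1\<close>.\<close>

definition natural_tensor_map ::
    "('r \<Rightarrow> 's) \<Rightarrow> ('r, 'z) ring_scheme \<Rightarrow> 'r set \<Rightarrow> ('s, 'y) ring_scheme \<Rightarrow>
     ('s, 'p) module \<Rightarrow> ('s, 'q) module \<Rightarrow> ('p \<Rightarrow> 'q) \<Rightarrow>
     (('p \<times> 'r set \<Rightarrow>\<^sub>0 int) set \<Rightarrow> 'q) \<Rightarrow> bool" where
  "natural_tensor_map h R m S HM HN q \<psi> \<longleftrightarrow>
    \<psi> \<in> module_hom S (tensor_module h R HM (residue_module R m)) HN \<and>
    (\<forall>z\<in>carrier HM. \<forall>r\<in>carrier R.
       \<psi> (pure_tensor h R HM (residue_module R m) z (m +>\<^bsub>R\<^esub> r)) = h r \<odot>\<^bsub>HN\<^esub> q z)"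

end

theory Submission
  imports Defs
begin

text \<open>Local cohomology is computed on elements of a complex of modules in which power torsion is
  divisible up to further torsion, as holds for injective and for graded injective modules over a
  Noetherian ring.  Adjoining one element \<open>f\<close> to the set of elements whose power torsion is taken
  raises the bound on the degrees with cohomology by at most one, and if a map of two such
  complexes is, on cohomology in the bounding degree, the reduction modulo an ideal, then the same
  holds one degree higher: both follow from the long exact sequence that ends in the localization
  at \<open>f\<close> of the old top cohomology.  Without any torsion condition the resolutions of \<open>M\<close> and of
  \<open>M \<otimes> k\<close> have cohomology only in degree 0, where the map is the reduction modulo \<open>m\<close>.

  It remains to compute \<open>S\<^sub>+\<close>-torsion with \<open>d\<close> elements.  Graded prime avoidance yields homogeneous
  elements \<open>f\<^sub>1, \<dots>, f\<^sub>d\<close> of positive degree that generate \<open>S\<^sub>+\<close> up to radical modulo \<open>m S\<close> and the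
  annihilator of \<open>M\<close>, and a graded Nakayama argument removes \<open>m S\<close>: some power of each \<open>X\<^sub>i\<close> is
  congruent modulo \<open>(f\<^sub>1, \<dots>, f\<^sub>d)\<close> to a homogeneous \<open>c\<^sub>i\<close> that kills \<open>M\<close>.  Imposing torsion for
  the \<open>c\<^sub>i\<close> as well does not change the cohomology.\<close>

section \<open>Power torsion in modules\<close>

text \<open>The modules of a resolution are not killed by the annihilator of \<open>M\<close>, so on
  them torsion for the parameters and torsion for \<open>S_+\<close> may differ although the two
  ideals agree up to radical modulo that annihilator. This is why the \<open>c i\<close> are
  adjoined: among elements that are torsion for all \<open>c i\<close> the two notions coincide.

  The localization at \<open>f\<close> is never built as a module. By divisibility,
  \<open>T G / T (insert f G)\<close> already is the localization of \<open>T G\<close>, and a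
  fraction \<open>z / f^t\<close> is represented by an element of \<open>T G\<close>. Each use of
  the long exact sequence becomes a division of elements. If \<open>A\<close> is the cohomology in
  the bounding degree, the new top cohomology is the cokernel of the map from \<open>A\<close> to
  its localization at \<open>f\<close>, a right exact functor of \<open>A\<close>; this is why
  reduction modulo \<open>m\<close> passes from one degree to the next.

  Divisibility of torsion serves injective and graded injective modules alike. The price is that in
  the graded case only homogeneous elements may be adjoined, so parameters and \<open>c i\<close>
  have to be homogeneous.\<close>

context module
begin

lemma smult_pow_add:
  "a \<in> carrier R \<Longrightarrow> x \<in> carrier M \<Longrightarrow> a [^] (i + j :: nat) \<odot>\<^bsub>M\<^esub> x = a [^] i \<odot>\<^bsub>M\<^esub> (a [^] j \<odot>\<^bsub>M\<^esub> x)"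
  by (simp add: R.nat_pow_mult[symmetric] smult_assoc1)

lemma smult_comm:
  "a \<in> carrier R \<Longrightarrow> b \<in> carrier R \<Longrightarrow> x \<in> carrier M \<Longrightarrow> a \<odot>\<^bsub>M\<^esub> (b \<odot>\<^bsub>M\<^esub> x) = b \<odot>\<^bsub>M\<^esub> (a \<odot>\<^bsub>M\<^esub> x)"
  by (metis R.m_comm smult_assoc1)

lemma diff_self: "x \<in> carrier M \<Longrightarrow> x \<ominus>\<^bsub>M\<^esub> x = \<zero>\<^bsub>M\<^esub>"
  by (simp only: M.minus_eq M.r_neg)

lemma smult_r_diff:
  "a \<in> carrier R \<Longrightarrow> x \<in> carrier M \<Longrightarrow> y \<in> carrier M \<Longrightarrow>
    a \<odot>\<^bsub>M\<^esub> (x \<ominus>\<^bsub>M\<^esub> y) = a \<odot>\<^bsub>M\<^esub> x \<ominus>\<^bsub>M\<^esub> a \<odot>\<^bsub>M\<^esub> y"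
  by (simp add: M.minus_eq smult_r_distr smult_r_minus)

lemma smult_pow_zero_mono:
  assumes "a \<in> carrier R" "x \<in> carrier M" "a [^] i \<odot>\<^bsub>M\<^esub> x = \<zero>\<^bsub>M\<^esub>" "i \<le> j"
  shows "a [^] (j::nat) \<odot>\<^bsub>M\<^esub> x = \<zero>\<^bsub>M\<^esub>"
proof -
  have "a [^] j \<odot>\<^bsub>M\<^esub> x = a [^] (j - i) \<odot>\<^bsub>M\<^esub> (a [^] i \<odot>\<^bsub>M\<^esub> x)"
    using assms smult_pow_add[of a x "j - i" i] by simp
  then show ?thesis using assms by simp
qed

lemma minus_plus_cancel: "x \<in> carrier M \<Longrightarrow> y \<in> carrier M \<Longrightarrow> y \<oplus>\<^bsub>M\<^esub> (x \<ominus>\<^bsub>M\<^esub> y) = x"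
  by (metis M.a_comm M.add.inv_closed M.add.inv_solve_right M.minus_eq M.minus_closed)

end

text \<open>For finite \<open>G\<close> this is torsion for powers of the ideal generated by
  \<open>G\<close>; the elementwise form makes adjoining one element (\<open>tors_insert\<close>)
  trivial.\<close>

definition tors :: "('s, 'z) ring_scheme \<Rightarrow> ('s, 'm, 'w) module_scheme \<Rightarrow> 's set \<Rightarrow> 'm set" where
  "tors S M G = {x \<in> carrier M. \<forall>g\<in>G. \<exists>t::nat. g [^]\<^bsub>S\<^esub> t \<odot>\<^bsub>M\<^esub> x = \<zero>\<^bsub>M\<^esub>}"

text \<open>The equation says that \<open>f\<^sup>t y = z\<close> up to \<open>f\<close>-power torsion.\<close>

definition divides_into :: "('s, 'z) ring_scheme \<Rightarrow> ('s, 'm, 'w) module_scheme \<Rightarrow> 's \<Rightarrow> 'm set \<Rightarrow> 'm set \<Rightarrow> bool" where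
  "divides_into S M f Z Y \<longleftrightarrow>
    (\<forall>z\<in>Z. \<forall>t::nat. \<exists>y\<in>Y. \<exists>N::nat. f [^]\<^bsub>S\<^esub> (N + t) \<odot>\<^bsub>M\<^esub> y = f [^]\<^bsub>S\<^esub> N \<odot>\<^bsub>M\<^esub> z)"

text \<open>For \<open>f\<close> in \<open>H\<close> the map from the \<open>G\<close>-torsion to
  its localization at \<open>f\<close> is onto: every fraction \<open>z / f^t\<close> is the image
  of some \<open>y\<close>. This is what the cohomological part asks of the modules in a
  resolution.\<close>

definition tors_divisible :: "('s, 'z) ring_scheme \<Rightarrow> 's set \<Rightarrow> ('s, 'm, 'w) module_scheme \<Rightarrow> bool" where
  "tors_divisible S H M \<longleftrightarrow>
    (\<forall>G f. finite G \<longrightarrow> G \<subseteq> H \<longrightarrow> f \<in> H \<longrightarrow> divides_into S M f (tors S M G) (tors S M G))"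

lemma tors_empty [simp]: "tors S M {} = carrier M"
  by (simp add: tors_def)

lemma tors_insert:
  "tors S M (insert f G) = {x \<in> tors S M G. \<exists>t::nat. f [^]\<^bsub>S\<^esub> t \<odot>\<^bsub>M\<^esub> x = \<zero>\<^bsub>M\<^esub>}"
  by (auto simp: tors_def)

context module
begin

lemma submodule_tors:
  assumes "G \<subseteq> carrier R"
  shows "submodule (tors R M G) R M"
proof (rule submoduleI)
  fix a x assume a: "a \<in> carrier R" and x: "x \<in> tors R M G"
  then have xM: "x \<in> carrier M" by (simp add: tors_def)
  have "\<exists>t::nat. g [^] t \<odot>\<^bsub>M\<^esub> (a \<odot>\<^bsub>M\<^esub> x) = \<zero>\<^bsub>M\<^esub>" if g: "g \<in> G" for g
  proof -
    have gR: "g \<in> carrier R" using g assms by auto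
    obtain t :: nat where t: "g [^] t \<odot>\<^bsub>M\<^esub> x = \<zero>\<^bsub>M\<^esub>" using x g by (auto simp: tors_def)
    have "g [^] t \<odot>\<^bsub>M\<^esub> (a \<odot>\<^bsub>M\<^esub> x) = a \<odot>\<^bsub>M\<^esub> (g [^] t \<odot>\<^bsub>M\<^esub> x)"
      by (rule smult_comm) (use gR a xM in auto)
    then show ?thesis using t a by (intro exI[of _ t]) simp
  qed
  then show "a \<odot>\<^bsub>M\<^esub> x \<in> tors R M G" using a xM by (simp add: tors_def)
next
  fix x y assume xy: "x \<in> tors R M G" "y \<in> tors R M G"
  then have car: "x \<in> carrier M" "y \<in> carrier M" by (auto simp: tors_def)
  have "\<exists>t::nat. g [^] t \<odot>\<^bsub>M\<^esub> (x \<oplus>\<^bsub>M\<^esub> y) = \<zero>\<^bsub>M\<^esub>" if g: "g \<in> G" for g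
  proof -
    have gR: "g \<in> carrier R" using g assms by auto
    obtain i :: nat where i: "g [^] i \<odot>\<^bsub>M\<^esub> x = \<zero>\<^bsub>M\<^esub>" using xy g by (auto simp: tors_def)
    obtain j :: nat where j: "g [^] j \<odot>\<^bsub>M\<^esub> y = \<zero>\<^bsub>M\<^esub>" using xy g by (auto simp: tors_def)
    have "g [^] (max i j) \<odot>\<^bsub>M\<^esub> x = \<zero>\<^bsub>M\<^esub>" "g [^] (max i j) \<odot>\<^bsub>M\<^esub> y = \<zero>\<^bsub>M\<^esub>"
      using smult_pow_zero_mono[OF gR car(1) i] smult_pow_zero_mono[OF gR car(2) j] by auto
    then show ?thesis using gR car by (intro exI[of _ "max i j"]) (simp add: smult_r_distr)
  qed
  then show "x \<oplus>\<^bsub>M\<^esub> y \<in> tors R M G" using car by (simp add: tors_def)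
next
  fix x assume x: "x \<in> tors R M G"
  have "\<exists>t::nat. g [^] t \<odot>\<^bsub>M\<^esub> (\<ominus>\<^bsub>M\<^esub> x) = \<zero>\<^bsub>M\<^esub>" if g: "g \<in> G" for g
  proof -
    have gR: "g \<in> carrier R" using g assms by auto
    obtain i :: nat where i: "g [^] i \<odot>\<^bsub>M\<^esub> x = \<zero>\<^bsub>M\<^esub>" using x g by (auto simp: tors_def)
    then show ?thesis using gR x by (intro exI[of _ i]) (simp add: smult_r_minus tors_def)
  qed
  then show "\<ominus>\<^bsub>M\<^esub> x \<in> tors R M G" using x by (simp add: tors_def)
qed (use assms in \<open>auto simp: tors_def\<close>)

lemma submodule_diff:
  assumes "submodule Y R M" "x \<in> Y" "y \<in> Y"
  shows "x \<ominus>\<^bsub>M\<^esub> y \<in> Y"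
  using submoduleE[OF assms(1)] assms by (simp add: M.minus_eq)

lemmas tors_add = submoduleE(5)[OF submodule_tors]
  and tors_neg = submoduleE(3)[OF submodule_tors]
  and tors_smult = submoduleE(4)[OF submodule_tors]
  and tors_diff = submodule_diff[OF submodule_tors]

lemma zero_tors: "G \<subseteq> carrier R \<Longrightarrow> \<zero>\<^bsub>M\<^esub> \<in> tors R M G"
  by (auto simp: tors_def)

text \<open>If \<open>y\<close> is \<open>f^t x\<close> divided by \<open>f^t\<close> up to torsion,
  then \<open>x\<close> and \<open>y\<close> have the same image in the localization at
  \<open>f\<close>, so their difference is \<open>f\<close>-torsion. It stays
  \<open>G\<close>-torsion because \<open>Y\<close> consists of \<open>G\<close>-torsion
  elements.\<close>

lemma tors_divided:
  assumes f: "f \<in> carrier R" and ZM: "Z \<subseteq> carrier M" and YM: "Y \<subseteq> tors R M G"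
    and G: "G \<subseteq> carrier R" and ZY: "divides_into R M f Z Y"
    and x: "x \<in> tors R M G" and fx: "f [^] (t::nat) \<odot>\<^bsub>M\<^esub> x \<in> Z"
  shows "\<exists>y\<in>Y. x \<ominus>\<^bsub>M\<^esub> y \<in> tors R M (insert f G)"
proof -
  obtain y N where y: "y \<in> Y" and eq: "f [^] (N + t) \<odot>\<^bsub>M\<^esub> y = f [^] N \<odot>\<^bsub>M\<^esub> (f [^] t \<odot>\<^bsub>M\<^esub> x)"
    using bspec[OF ZY[unfolded divides_into_def] fx] by metis
  have car: "x \<in> carrier M" "y \<in> carrier M" using x y YM by (auto simp: tors_def)
  have "f [^] (N + t) \<odot>\<^bsub>M\<^esub> (x \<ominus>\<^bsub>M\<^esub> y) = \<zero>\<^bsub>M\<^esub>"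
  proof -
    have "f [^] (N + t) \<odot>\<^bsub>M\<^esub> x = f [^] (N + t) \<odot>\<^bsub>M\<^esub> y"
      unfolding eq by (rule smult_pow_add[OF f car(1)])
    moreover have "f [^] (N + t) \<odot>\<^bsub>M\<^esub> (x \<ominus>\<^bsub>M\<^esub> y) = f [^] (N + t) \<odot>\<^bsub>M\<^esub> x \<ominus>\<^bsub>M\<^esub> f [^] (N + t) \<odot>\<^bsub>M\<^esub> y"
      by (rule smult_r_diff) (use f car in auto)
    moreover have "f [^] (N + t) \<odot>\<^bsub>M\<^esub> y \<in> carrier M" using f car by blast
    ultimately show ?thesis by (simp only: diff_self)
  qed
  moreover have "x \<ominus>\<^bsub>M\<^esub> y \<in> tors R M G" using tors_diff[OF G] x y YM by blast
  ultimately show ?thesis using y by (auto simp: tors_insert)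
qed

lemma divides_into_scale:
  assumes f: "f \<in> carrier R" and y: "y \<in> carrier M" "z \<in> carrier M"
    and eq: "f [^] (N + t :: nat) \<odot>\<^bsub>M\<^esub> y = f [^] N \<odot>\<^bsub>M\<^esub> z" and "N \<le> N'"
  shows "f [^] (N' + t) \<odot>\<^bsub>M\<^esub> y = f [^] N' \<odot>\<^bsub>M\<^esub> z"
proof -
  have "f [^] ((N' - N) + (N + t)) \<odot>\<^bsub>M\<^esub> y = f [^] ((N' - N) + N) \<odot>\<^bsub>M\<^esub> z"
    using f y eq by (simp only: smult_pow_add)
  then show ?thesis using \<open>N \<le> N'\<close> by (simp add: add.assoc[symmetric])
qed

lemma divides_into_add:
  assumes f: "f \<in> carrier R" and sub: "Z \<subseteq> carrier M" "Y \<subseteq> carrier M" "Z' \<subseteq> carrier M" "Y' \<subseteq> carrier M"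
    and 1: "divides_into R M f Z Y" and 2: "divides_into R M f Z' Y'"
  shows "divides_into R M f (Z <+>\<^bsub>M\<^esub> Z') (Y <+>\<^bsub>M\<^esub> Y')"
  unfolding divides_into_def
proof (intro ballI allI)
  fix z t assume "z \<in> Z <+>\<^bsub>M\<^esub> Z'"
  then obtain a b where ab: "a \<in> Z" "b \<in> Z'" "z = a \<oplus>\<^bsub>M\<^esub> b" by (auto simp: set_add_def')
  obtain y N where y: "y \<in> Y" "f [^] (N + t) \<odot>\<^bsub>M\<^esub> y = f [^] (N::nat) \<odot>\<^bsub>M\<^esub> a"
    using bspec[OF 1[unfolded divides_into_def] ab(1)] by metis
  obtain y' N' where y': "y' \<in> Y'" "f [^] (N' + t) \<odot>\<^bsub>M\<^esub> y' = f [^] (N'::nat) \<odot>\<^bsub>M\<^esub> b"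
    using bspec[OF 2[unfolded divides_into_def] ab(2)] by metis
  have car: "a \<in> carrier M" "b \<in> carrier M" "y \<in> carrier M" "y' \<in> carrier M"
    using ab y y' sub by auto
  have "f [^] (max N N' + t) \<odot>\<^bsub>M\<^esub> y = f [^] (max N N') \<odot>\<^bsub>M\<^esub> a"
       "f [^] (max N N' + t) \<odot>\<^bsub>M\<^esub> y' = f [^] (max N N') \<odot>\<^bsub>M\<^esub> b"
    using divides_into_scale[OF f _ _ y(2)] divides_into_scale[OF f _ _ y'(2)] car by auto
  then have "f [^] (max N N' + t) \<odot>\<^bsub>M\<^esub> (y \<oplus>\<^bsub>M\<^esub> y') = f [^] (max N N') \<odot>\<^bsub>M\<^esub> z"
    using ab f car by (simp add: smult_r_distr)
  moreover have "y \<oplus>\<^bsub>M\<^esub> y' \<in> Y <+>\<^bsub>M\<^esub> Y'" using y y' by (auto simp: set_add_def')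
  ultimately show "\<exists>y\<in>Y <+>\<^bsub>M\<^esub> Y'. \<exists>N. f [^] (N + t) \<odot>\<^bsub>M\<^esub> y = f [^] N \<odot>\<^bsub>M\<^esub> z" by blast
qed

lemma divides_into_zero: "f \<in> carrier R \<Longrightarrow> divides_into R M f {\<zero>\<^bsub>M\<^esub>} {\<zero>\<^bsub>M\<^esub>}"
  by (auto simp: divides_into_def)

text \<open>Only an additive span, yet stable under scalars in two cases: if \<open>Z\<close> is a
  submodule, scalars are absorbed by \<open>Z\<close> and \<open>mm\<close> may be any set; if
  \<open>mm\<close> is an ideal, they are absorbed by \<open>mm\<close> and \<open>Z\<close> may be
  any set, such as a single graded piece.\<close>

definition mspan :: "'a set \<Rightarrow> 'c set \<Rightarrow> 'c set" where
  "mspan mm Z = generate (add_monoid M) {\<mu> \<odot>\<^bsub>M\<^esub> z | \<mu> z. \<mu> \<in> mm \<and> z \<in> Z}"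

lemma mspan_carrier: "mm \<subseteq> carrier R \<Longrightarrow> Z \<subseteq> carrier M \<Longrightarrow> mspan mm Z \<subseteq> carrier M"
  unfolding mspan_def using M.add.generate_incl[of "{\<mu> \<odot>\<^bsub>M\<^esub> z | \<mu> z. \<mu> \<in> mm \<and> z \<in> Z}"] by auto

lemma mspan_induct [consumes 3, case_names zero smult neg add]:
  assumes "v \<in> mspan mm Z" "mm \<subseteq> carrier R" "Z \<subseteq> carrier M"
    "P \<zero>\<^bsub>M\<^esub>" "\<And>\<mu> z. \<mu> \<in> mm \<Longrightarrow> z \<in> Z \<Longrightarrow> P (\<mu> \<odot>\<^bsub>M\<^esub> z)"
    "\<And>x. x \<in> mspan mm Z \<Longrightarrow> P x \<Longrightarrow> P (\<ominus>\<^bsub>M\<^esub> x)"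
    "\<And>x y. x \<in> mspan mm Z \<Longrightarrow> y \<in> mspan mm Z \<Longrightarrow> P x \<Longrightarrow> P y \<Longrightarrow> P (x \<oplus>\<^bsub>M\<^esub> y)"
  shows "P v"
  using assms(1)[unfolded mspan_def]
proof (induction rule: generate.induct)
  case one then show ?case using assms(4) by simp
next
  case (incl x) then show ?case using assms(5) by blast
next
  case (inv x)
  then have "P x" "x \<in> mspan mm Z" using assms(5) by (auto simp: mspan_def intro: generate.incl)
  then show ?case using assms(6) by (simp add: a_inv_def)
next
  case (eng x y)
  then show ?case using assms(7) by (auto simp: mspan_def)
qed

lemma subgroup_mspan:
  "mm \<subseteq> carrier R \<Longrightarrow> Z \<subseteq> carrier M \<Longrightarrow> subgroup (mspan mm Z) (add_monoid M)"
  unfolding mspan_def by (rule M.add.generate_is_subgroup) auto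

lemma mspan_add: "x \<in> mspan mm Z \<Longrightarrow> y \<in> mspan mm Z \<Longrightarrow> x \<oplus>\<^bsub>M\<^esub> y \<in> mspan mm Z"
  unfolding mspan_def using generate.eng[of x "add_monoid M"] by auto

lemma mspan_neg: "mm \<subseteq> carrier R \<Longrightarrow> Z \<subseteq> carrier M \<Longrightarrow> x \<in> mspan mm Z \<Longrightarrow> \<ominus>\<^bsub>M\<^esub> x \<in> mspan mm Z"
  using subgroup.m_inv_closed[OF subgroup_mspan] by (auto simp: a_inv_def)

lemma mspan_zero: "\<zero>\<^bsub>M\<^esub> \<in> mspan mm Z"
  unfolding mspan_def using generate.one[of "add_monoid M"] by auto

lemma mspan_incl: "\<mu> \<in> mm \<Longrightarrow> z \<in> Z \<Longrightarrow> \<mu> \<odot>\<^bsub>M\<^esub> z \<in> mspan mm Z"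
  unfolding mspan_def by (auto intro: generate.incl)

lemma mspan_subset:
  assumes "submodule Y R M" "mm \<subseteq> carrier R" "Z \<subseteq> Y"
  shows "mspan mm Z \<subseteq> Y"
proof -
  note Y = submoduleE[OF assms(1)]
  have Z: "Z \<subseteq> carrier M" using Y(1) assms(3) by (rule subset_trans[rotated])
  show ?thesis
  proof
    fix v assume "v \<in> mspan mm Z"
    then show "v \<in> Y" using assms(2) Z
    proof (induction rule: mspan_induct)
      case zero then show ?case using subgroup.one_closed[OF submodule.axioms(1)[OF assms(1)]] by simp
    next
      case (smult \<mu> z)
      then show ?case using Y(4)[of \<mu> z] assms by auto
    qed (use Y(3,5) in blast)+
  qed
qed

lemma mspan_mono: "Z \<subseteq> Z' \<Longrightarrow> mspan mm Z \<subseteq> mspan mm Z'"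
  unfolding mspan_def by (rule M.add.mono_generate) auto

lemma divides_into_mspan:
  assumes f: "f \<in> carrier R" and mm: "mm \<subseteq> carrier R" and ZY: "Z \<subseteq> carrier M" "Y \<subseteq> carrier M"
    and d: "divides_into R M f Z Y"
  shows "divides_into R M f (mspan mm Z) (mspan mm Y)"
  unfolding divides_into_def
proof (intro ballI allI)
  fix z t assume "z \<in> mspan mm Z"
  then show "\<exists>y\<in>mspan mm Y. \<exists>N. f [^] (N + t) \<odot>\<^bsub>M\<^esub> y = f [^] (N::nat) \<odot>\<^bsub>M\<^esub> z" using mm ZY(1)
  proof (induction rule: mspan_induct)
    case zero then show ?case using f mspan_zero by (intro bexI[of _ "\<zero>\<^bsub>M\<^esub>"]) auto
  next
    case (smult \<mu> z)
    then obtain y N where y: "y \<in> Y" "f [^] (N + t) \<odot>\<^bsub>M\<^esub> y = f [^] (N::nat) \<odot>\<^bsub>M\<^esub> z"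
      using bspec[OF d[unfolded divides_into_def] smult(2)] by metis
    have car: "y \<in> carrier M" "z \<in> carrier M" "\<mu> \<in> carrier R" using y smult mm ZY by auto
    have "f [^] (N + t) \<odot>\<^bsub>M\<^esub> (\<mu> \<odot>\<^bsub>M\<^esub> y) = \<mu> \<odot>\<^bsub>M\<^esub> (f [^] (N + t) \<odot>\<^bsub>M\<^esub> y)"
      by (rule smult_comm) (use f car in auto)
    also have "\<dots> = f [^] N \<odot>\<^bsub>M\<^esub> (\<mu> \<odot>\<^bsub>M\<^esub> z)"
      unfolding y(2) by (rule smult_comm) (use f car in auto)
    finally show ?case using mspan_incl[OF smult(1) y(1)] by metis
  next
    case (neg x)
    obtain y N where y: "y \<in> mspan mm Y" "f [^] (N + t) \<odot>\<^bsub>M\<^esub> y = f [^] (N::nat) \<odot>\<^bsub>M\<^esub> x"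
      using neg(2) by metis
    have "x \<in> carrier M" "y \<in> carrier M"
      using subsetD[OF mspan_carrier[OF mm ZY(1)]] subsetD[OF mspan_carrier[OF mm ZY(2)]]
        neg(1) y(1) by auto
    then have "f [^] (N + t) \<odot>\<^bsub>M\<^esub> (\<ominus>\<^bsub>M\<^esub> y) = f [^] N \<odot>\<^bsub>M\<^esub> (\<ominus>\<^bsub>M\<^esub> x)"
      using y f by (simp add: smult_r_minus)
    then show ?case using mspan_neg[OF mm ZY(2) y(1)] by metis
  next
    case (add x x')
    obtain y N where y: "y \<in> mspan mm Y" "f [^] (N + t) \<odot>\<^bsub>M\<^esub> y = f [^] (N::nat) \<odot>\<^bsub>M\<^esub> x"
      using add(3) by metis
    obtain y' N' where y': "y' \<in> mspan mm Y" "f [^] (N' + t) \<odot>\<^bsub>M\<^esub> y' = f [^] (N'::nat) \<odot>\<^bsub>M\<^esub> x'"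
      using add(4) by metis
    have car: "x \<in> carrier M" "x' \<in> carrier M" "y \<in> carrier M" "y' \<in> carrier M"
      using subsetD[OF mspan_carrier[OF mm ZY(1)]] subsetD[OF mspan_carrier[OF mm ZY(2)]]
        add(1,2) y(1) y'(1) by auto
    have "f [^] (max N N' + t) \<odot>\<^bsub>M\<^esub> y = f [^] (max N N') \<odot>\<^bsub>M\<^esub> x"
       "f [^] (max N N' + t) \<odot>\<^bsub>M\<^esub> y' = f [^] (max N N') \<odot>\<^bsub>M\<^esub> x'"
      using divides_into_scale[OF f _ _ y(2)] divides_into_scale[OF f _ _ y'(2)] car by auto
    then have "f [^] (max N N' + t) \<odot>\<^bsub>M\<^esub> (y \<oplus>\<^bsub>M\<^esub> y') = f [^] (max N N') \<odot>\<^bsub>M\<^esub> (x \<oplus>\<^bsub>M\<^esub> x')"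
      using f car by (simp add: smult_r_distr)
    then show ?case using mspan_add[OF y(1) y'(1)] by metis
  qed
qed

end

section \<open>Module homomorphisms and torsion\<close>

context module
begin

text \<open>To place \<open>x\<close> in \<open>Y\<close> up to \<open>f\<close>-torsion it suffices
  that some multiple \<open>f^t x\<close> lies in \<open>Z\<close>.\<close>

lemma tors_divided':
  assumes "f \<in> carrier R" "Z \<subseteq> carrier M" "Y \<subseteq> tors R M G" "G \<subseteq> carrier R" "divides_into R M f Z Y"
    and x: "x \<in> tors R M G" "f [^] (t::nat) \<odot>\<^bsub>M\<^esub> x \<in> Z"
  obtains y e where "y \<in> Y" "e \<in> tors R M (insert f G)" "x = y \<oplus>\<^bsub>M\<^esub> e"
proof -
  obtain y where y: "y \<in> Y" "x \<ominus>\<^bsub>M\<^esub> y \<in> tors R M (insert f G)"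
    using tors_divided[OF assms] by metis
  have "x \<in> carrier M" "y \<in> carrier M" using x y assms(3) by (auto simp: tors_def)
  then have "x = y \<oplus>\<^bsub>M\<^esub> (x \<ominus>\<^bsub>M\<^esub> y)" by (simp only: minus_plus_cancel)
  then show ?thesis using y that by metis
qed

lemma eq_diffI: "p \<in> carrier M \<Longrightarrow> q \<in> carrier M \<Longrightarrow> (p \<oplus>\<^bsub>M\<^esub> q) \<ominus>\<^bsub>M\<^esub> p = q"
  by (metis M.a_comm M.add.inv_solve_right M.add.m_closed M.minus_eq)

lemma tors_summand:
  assumes "G \<subseteq> carrier R" "p \<in> tors R M G" "q \<in> carrier M" "p \<oplus>\<^bsub>M\<^esub> q \<in> tors R M G"
  shows "q \<in> tors R M G"
proof -
  have "(p \<oplus>\<^bsub>M\<^esub> q) \<ominus>\<^bsub>M\<^esub> p \<in> tors R M G" using tors_diff assms by metis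
  moreover have "p \<in> carrier M" using assms by (simp add: tors_def)
  ultimately show ?thesis using eq_diffI assms(3) by metis
qed

lemma smult_pow_tors:
  assumes "f \<in> carrier R" "G \<subseteq> carrier R" "x \<in> tors R M G" "f [^] (t::nat) \<odot>\<^bsub>M\<^esub> x \<in> tors R M {f}"
  shows "x \<in> tors R M (insert f G)"
proof -
  obtain s :: nat where "f [^] s \<odot>\<^bsub>M\<^esub> (f [^] t \<odot>\<^bsub>M\<^esub> x) = \<zero>\<^bsub>M\<^esub>" using assms by (auto simp: tors_def)
  then have "f [^] (s + t) \<odot>\<^bsub>M\<^esub> x = \<zero>\<^bsub>M\<^esub>"
    using smult_pow_add[of f x s t] assms by (simp add: tors_def)
  then show ?thesis using assms by (auto simp: tors_insert)
qed

end

locale module_homomorphism = A: module S A + B: module S B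
  for S :: "('s, 'z) ring_scheme" (structure) and A :: "('s, 'm) module" and B :: "('s, 'n) module" +
  fixes \<alpha>
  assumes hom: "\<alpha> \<in> module_hom S A B"
begin

lemma closed [simp]: "x \<in> carrier A \<Longrightarrow> \<alpha> x \<in> carrier B"
  using hom by (auto simp: module_hom_def)

lemma add: "x \<in> carrier A \<Longrightarrow> y \<in> carrier A \<Longrightarrow> \<alpha> (x \<oplus>\<^bsub>A\<^esub> y) = \<alpha> x \<oplus>\<^bsub>B\<^esub> \<alpha> y"
  using hom by (auto simp: module_hom_def)

lemma smult: "a \<in> carrier S \<Longrightarrow> x \<in> carrier A \<Longrightarrow> \<alpha> (a \<odot>\<^bsub>A\<^esub> x) = a \<odot>\<^bsub>B\<^esub> \<alpha> x"
  using hom by (auto simp: module_hom_def)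

lemma zero [simp]: "\<alpha> \<zero>\<^bsub>A\<^esub> = \<zero>\<^bsub>B\<^esub>"
proof -
  have "\<alpha> \<zero>\<^bsub>A\<^esub> = \<alpha> (\<zero>\<^bsub>S\<^esub> \<odot>\<^bsub>A\<^esub> \<zero>\<^bsub>A\<^esub>)" by simp
  also have "\<dots> = \<zero>\<^bsub>S\<^esub> \<odot>\<^bsub>B\<^esub> \<alpha> \<zero>\<^bsub>A\<^esub>" by (rule smult) auto
  finally show ?thesis by simp
qed

lemma neg: "x \<in> carrier A \<Longrightarrow> \<alpha> (\<ominus>\<^bsub>A\<^esub> x) = \<ominus>\<^bsub>B\<^esub> \<alpha> x"
  by (metis A.M.add.inv_closed A.M.l_neg B.M.minus_equality add closed zero)

lemma diff: "x \<in> carrier A \<Longrightarrow> y \<in> carrier A \<Longrightarrow> \<alpha> (x \<ominus>\<^bsub>A\<^esub> y) = \<alpha> x \<ominus>\<^bsub>B\<^esub> \<alpha> y"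
  by (simp add: A.M.minus_eq B.M.minus_eq add neg)

lemma tors: "G \<subseteq> carrier S \<Longrightarrow> x \<in> tors S A G \<Longrightarrow> \<alpha> x \<in> tors S B G"
proof -
  assume G: "G \<subseteq> carrier S" and x: "x \<in> tors S A G"
  then have xA: "x \<in> carrier A" by (simp add: tors_def)
  have "\<exists>t::nat. g [^] t \<odot>\<^bsub>B\<^esub> \<alpha> x = \<zero>\<^bsub>B\<^esub>" if g: "g \<in> G" for g
  proof -
    have gS: "g \<in> carrier S" using g G by auto
    obtain t :: nat where t: "g [^] t \<odot>\<^bsub>A\<^esub> x = \<zero>\<^bsub>A\<^esub>" using x g by (auto simp: tors_def)
    have "g [^] t \<odot>\<^bsub>B\<^esub> \<alpha> x = \<alpha> (g [^] t \<odot>\<^bsub>A\<^esub> x)" by (rule smult[symmetric]) (use gS xA in auto)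
    then show ?thesis using t by (intro exI[of _ t]) simp
  qed
  then show ?thesis using xA by (simp add: tors_def)
qed

lemma divides_into_image:
  assumes "f \<in> carrier S" "Z \<subseteq> carrier A" "Y \<subseteq> carrier A" "divides_into S A f Z Y"
  shows "divides_into S B f (\<alpha> ` Z) (\<alpha> ` Y)"
  unfolding divides_into_def
proof (intro ballI allI)
  fix z' t assume "z' \<in> \<alpha> ` Z"
  then obtain z where z: "z \<in> Z" "z' = \<alpha> z" by auto
  obtain y N where y: "y \<in> Y" "f [^] (N + t) \<odot>\<^bsub>A\<^esub> y = f [^] (N::nat) \<odot>\<^bsub>A\<^esub> z"
    using bspec[OF assms(4)[unfolded divides_into_def] z(1)] by metis
  have "y \<in> carrier A" "z \<in> carrier A" using y z assms by auto
  then have "f [^] (N + t) \<odot>\<^bsub>B\<^esub> \<alpha> y = f [^] N \<odot>\<^bsub>B\<^esub> z'"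
    using arg_cong[OF y(2), of \<alpha>] assms(1) z(2) by (simp add: smult)
  then show "\<exists>y\<in>\<alpha> ` Y. \<exists>N. f [^] (N + t) \<odot>\<^bsub>B\<^esub> y = f [^] N \<odot>\<^bsub>B\<^esub> z'" using y(1) by blast
qed

lemma mspan_image:
  assumes mm: "mm \<subseteq> carrier S" and Z: "Z \<subseteq> carrier A" and v: "v \<in> A.mspan mm Z"
  shows "\<alpha> v \<in> B.mspan mm (\<alpha> ` Z)"
proof -
  have Z': "\<alpha> ` Z \<subseteq> carrier B" using Z by auto
  note hom_smult = smult and hom_neg = neg and hom_add = add
  note car = subsetD[OF A.mspan_carrier[OF mm Z]]
  show ?thesis using v mm Z
  proof (induction rule: A.mspan_induct)
    case zero then show ?case by (simp add: B.mspan_zero)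
  next
    case (smult \<mu> z)
    then have "\<alpha> (\<mu> \<odot>\<^bsub>A\<^esub> z) = \<mu> \<odot>\<^bsub>B\<^esub> \<alpha> z" using mm Z by (intro hom_smult) auto
    then show ?case using B.mspan_incl[OF smult(1), of "\<alpha> z" "\<alpha> ` Z"] smult by simp
  next
    case (neg x) then show ?case using car[OF neg(1)] B.mspan_neg[OF mm Z'] by (simp add: hom_neg)
  next
    case (add x y) then show ?case using car[OF add(1)] car[OF add(2)] B.mspan_add by (simp add: hom_add)
  qed
qed

end

section \<open>Torsion cohomology of complexes\<close>

text \<open>Cohomology of the complex of \<open>G\<close>-torsion is kept as a pair of cocycles and
  coboundaries. Vanishing becomes \<open>cocyc \<subseteq> cobd\<close>, and quotients are formed
  only at the end.\<close>

definition cocyc :: "('s, 'z) ring_scheme \<Rightarrow> (nat \<Rightarrow> ('s, 'e) module) \<Rightarrow> (nat \<Rightarrow> 'e \<Rightarrow> 'e) \<Rightarrow> 's set \<Rightarrow> nat \<Rightarrow> 'e set" where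
  "cocyc S E d G i = {x \<in> tors S (E i) G. d i x = \<zero>\<^bsub>E (Suc i)\<^esub>}"

definition cobd :: "('s, 'z) ring_scheme \<Rightarrow> (nat \<Rightarrow> ('s, 'e) module) \<Rightarrow> (nat \<Rightarrow> 'e \<Rightarrow> 'e) \<Rightarrow> 's set \<Rightarrow> nat \<Rightarrow> 'e set" where
  "cobd S E d G i = (case i of 0 \<Rightarrow> {\<zero>\<^bsub>E 0\<^esub>} | Suc j \<Rightarrow> d j ` tors S (E j) G)"

text \<open>\<open>H\<close> collects the elements that may be adjoined to \<open>G\<close>. It is a
  parameter because graded injective modules supply divisibility for homogeneous elements
  only.\<close>

locale module_complex =
  fixes S :: "('s, 'z) ring_scheme" (structure) and E :: "nat \<Rightarrow> ('s, 'e) module" and d :: "nat \<Rightarrow> 'e \<Rightarrow> 'e"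
    and H :: "'s set"
  assumes mod: "\<And>j. module S (E j)"
    and d_hom: "\<And>j. d j \<in> module_hom S (E j) (E (Suc j))"
    and dd: "\<And>j x. x \<in> carrier (E j) \<Longrightarrow> d (Suc j) (d j x) = \<zero>\<^bsub>E (Suc (Suc j))\<^esub>"
    and H: "H \<subseteq> carrier S"
    and divisible: "\<And>j. tors_divisible S H (E j)"
begin

sublocale E: module S "E j" for j by (rule mod)

sublocale d: module_homomorphism S "E j" "E (Suc j)" "d j" for j
  by unfold_locales (rule d_hom)

abbreviation "T G j \<equiv> tors S (E j) G"
abbreviation "Z \<equiv> cocyc S E d"
abbreviation "B \<equiv> cobd S E d"

lemma T_carrier: "x \<in> T G j \<Longrightarrow> x \<in> carrier (E j)"
  by (simp add: tors_def)

lemma T_mono: "G \<subseteq> G' \<Longrightarrow> x \<in> T G' j \<Longrightarrow> x \<in> T G j"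
  by (auto simp: tors_def)

lemma B_T: "G \<subseteq> carrier S \<Longrightarrow> x \<in> B G i \<Longrightarrow> x \<in> T G i"
  by (cases i) (auto simp: cobd_def intro: E.zero_tors d.tors)

lemma B_carrier: "G \<subseteq> carrier S \<Longrightarrow> B G i \<subseteq> carrier (E i)"
  using B_T T_carrier by blast

lemma d_B: "G \<subseteq> carrier S \<Longrightarrow> x \<in> B G i \<Longrightarrow> d i x = \<zero>\<^bsub>E (Suc i)\<^esub>"
  by (cases i) (auto simp: cobd_def dd T_carrier)

lemma B_Z: "G \<subseteq> carrier S \<Longrightarrow> x \<in> B G i \<Longrightarrow> x \<in> Z G i"
  using d_B B_T by (simp add: cocyc_def)

lemma B_SucI: "y \<in> T G i \<Longrightarrow> d i y \<in> B G (Suc i)"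
  by (simp add: cobd_def)

lemma zero_B: "G \<subseteq> carrier S \<Longrightarrow> \<zero>\<^bsub>E i\<^esub> \<in> B G i"
proof (cases i)
  case (Suc j)
  assume "G \<subseteq> carrier S"
  then have "\<zero>\<^bsub>E j\<^esub> \<in> T G j" by (rule E.zero_tors)
  then have "d j \<zero>\<^bsub>E j\<^esub> \<in> B G i" unfolding Suc cobd_def nat.case(2) by (rule imageI)
  then show ?thesis using Suc by simp
qed (simp add: cobd_def)

lemma B_add:
  assumes G: "G \<subseteq> carrier S" and xy: "x \<in> B G i" "y \<in> B G i"
  shows "x \<oplus>\<^bsub>E i\<^esub> y \<in> B G i"
proof (cases i)
  case 0 then show ?thesis using xy by (simp add: cobd_def)
next
  case (Suc j)
  obtain u v where uv: "u \<in> T G j" "v \<in> T G j" "x = d j u" "y = d j v" using xy Suc by (auto simp: cobd_def)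
  then have "x \<oplus>\<^bsub>E i\<^esub> y = d j (u \<oplus>\<^bsub>E j\<^esub> v)" using Suc by (simp add: d.add T_carrier)
  then show ?thesis using E.tors_add[OF G uv(1,2)] Suc by (simp add: cobd_def)
qed

lemma B_mono: "G \<subseteq> G' \<Longrightarrow> B G' i \<subseteq> B G i"
  by (cases i) (auto simp: cobd_def intro: T_mono)

lemma Z_mono: "G \<subseteq> G' \<Longrightarrow> Z G' i \<subseteq> Z G i"
  by (auto simp: cocyc_def intro: T_mono)

lemma Z_carrier: "Z G i \<subseteq> carrier (E i)"
  by (auto simp: cocyc_def tors_def)

lemma divides_T: "finite G \<Longrightarrow> G \<subseteq> H \<Longrightarrow> f \<in> H \<Longrightarrow> divides_into S (E j) f (T G j) (T G j)"
  using divisible[of j] by (simp add: tors_divisible_def)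

lemma divides_B:
  assumes "finite G" "G \<subseteq> H" "f \<in> H"
  shows "divides_into S (E i) f (B G i) (B G i)"
proof (cases i)
  case 0 then show ?thesis using E.divides_into_zero assms H by (auto simp: cobd_def)
next
  case (Suc j)
  have "divides_into S (E (Suc j)) f (d j ` T G j) (d j ` T G j)"
    by (rule d.divides_into_image) (use assms H divides_T in \<open>auto simp: T_carrier\<close>)
  then show ?thesis using Suc by (simp add: cobd_def)
qed

text \<open>Cocycles of \<open>T G\<close> modulo \<open>T (insert f G)\<close>, the complex that
  represents the localization at \<open>f\<close>. On them \<open>d i\<close> is the connecting map
  into the cohomology of \<open>T (insert f G)\<close> one degree up.\<close>

definition Zs :: "'s \<Rightarrow> 's set \<Rightarrow> nat \<Rightarrow> 'e set" where
  "Zs f G i = {y \<in> T G i. d i y \<in> Z (insert f G) (Suc i)}"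

lemma Zs_T: "Zs f G i \<subseteq> T G i" by (auto simp: Zs_def)

text \<open>Dividing a cocycle by \<open>f^t\<close> gives a cocycle only up to
  \<open>f\<close>-torsion, since \<open>f^(N + t)\<close> kills \<open>d y\<close>. So the quotient
  lands in \<open>Zs\<close> and not in \<open>Z G\<close>.\<close>

lemma divides_Zs:
  assumes G: "finite G" "G \<subseteq> H" and f: "f \<in> H"
  shows "divides_into S (E i) f (Z G i) (Zs f G i)"
  unfolding divides_into_def
proof (intro ballI allI)
  fix z t assume z: "z \<in> Z G i"
  then have zT: "z \<in> T G i" and dz: "d i z = \<zero>\<^bsub>E (Suc i)\<^esub>" by (auto simp: cocyc_def)
  obtain y N where y: "y \<in> T G i" and eq: "f [^] (N + t) \<odot>\<^bsub>E i\<^esub> y = f [^] (N::nat) \<odot>\<^bsub>E i\<^esub> z"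
    using bspec[OF divides_T[OF G f, unfolded divides_into_def] zT] by metis
  have car: "f \<in> carrier S" "y \<in> carrier (E i)" "z \<in> carrier (E i)" "G \<subseteq> carrier S"
    using f H G y zT by (auto simp: T_carrier)
  have "f [^] (N + t) \<odot>\<^bsub>E (Suc i)\<^esub> d i y = d i (f [^] N \<odot>\<^bsub>E i\<^esub> z)"
    using car by (simp add: d.smult flip: eq)
  also have "\<dots> = \<zero>\<^bsub>E (Suc i)\<^esub>" using car dz by (simp add: d.smult)
  finally have "d i y \<in> T (insert f G) (Suc i)" using d.tors[OF car(4) y] by (auto simp: tors_insert)
  then have "y \<in> Zs f G i" using y car by (simp add: Zs_def cocyc_def dd)
  then show "\<exists>y\<in>Zs f G i. \<exists>N. f [^] (N + t) \<odot>\<^bsub>E i\<^esub> y = f [^] N \<odot>\<^bsub>E i\<^esub> z" using eq by metis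
qed

text \<open>A class that dies on passing from \<open>insert f G\<close> to \<open>G\<close> comes
  from the connecting map: \<open>y\<close> stands for the fraction with the cocycle
  \<open>f^t y\<close> as numerator and denominator \<open>f^t\<close>.\<close>

lemma boundary_lift:
  assumes G: "G \<subseteq> carrier S" and f: "f \<in> carrier S" and w: "w \<in> Z (insert f G) (Suc i)" "w \<in> B G (Suc i)"
  obtains y t where "y \<in> T G i" "w = d i y" "f [^] (t::nat) \<odot>\<^bsub>E (Suc i)\<^esub> w = \<zero>\<^bsub>E (Suc i)\<^esub>" "f [^] t \<odot>\<^bsub>E i\<^esub> y \<in> Z G i"
proof -
  obtain y where y: "y \<in> T G i" "w = d i y" using w(2) by (auto simp: cobd_def)
  obtain t :: nat where t: "f [^] t \<odot>\<^bsub>E (Suc i)\<^esub> w = \<zero>\<^bsub>E (Suc i)\<^esub>" using w(1) by (auto simp: cocyc_def tors_def)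
  have "f [^] t \<odot>\<^bsub>E i\<^esub> y \<in> T G i" using E.tors_smult[OF G] y f by blast
  moreover have "d i (f [^] t \<odot>\<^bsub>E i\<^esub> y) = \<zero>\<^bsub>E (Suc i)\<^esub>" using t y f by (simp add: d.smult T_carrier)
  ultimately show ?thesis using that y t by (auto simp: cocyc_def)
qed

text \<open>In the long exact sequence the group for \<open>insert f G\<close> in degree
  \<open>Suc i\<close> sits between the localized \<open>G\<close>-cohomology in degree
  \<open>i\<close> and the \<open>G\<close>-cohomology in degree \<open>Suc i\<close>.\<close>

lemma vanish_step:
  assumes G: "finite G" "G \<subseteq> H" and f: "f \<in> H"
    and V: "Z G (Suc i) \<subseteq> B G (Suc i)" "Z G i \<subseteq> B G i"
  shows "Z (insert f G) (Suc i) \<subseteq> B (insert f G) (Suc i)"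
proof
  fix w assume w: "w \<in> Z (insert f G) (Suc i)"
  have car: "G \<subseteq> carrier S" "f \<in> carrier S" using G f H by auto
  have "w \<in> B G (Suc i)" using w Z_mono[of G "insert f G"] V(1) by blast
  then obtain y t where y: "y \<in> T G i" "w = d i y" "f [^] (t::nat) \<odot>\<^bsub>E i\<^esub> y \<in> Z G i"
    using boundary_lift[OF car w] by metis
  have "f [^] t \<odot>\<^bsub>E i\<^esub> y \<in> B G i" using y V(2) by blast
  \<comment> \<open>\<open>b\<close> is a boundary, hence a cocycle. Removing it leaves
    \<open>d y\<close> unchanged and turns the preimage of \<open>w\<close> into an
    \<open>f\<close>-torsion element.\<close>
  then obtain b e where be: "b \<in> B G i" "e \<in> T (insert f G) i" "y = b \<oplus>\<^bsub>E i\<^esub> e"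
    using E.tors_divided'[OF car(2) B_carrier[OF car(1)] _ car(1) divides_B[OF G f] y(1)] B_T[OF car(1)] by blast
  then have "w = d i e"
    using y B_T[OF car(1) be(1)] d_B[OF car(1) be(1)] by (simp add: d.add T_carrier)
  then show "w \<in> B (insert f G) (Suc i)" using be B_SucI by simp
qed

lemma vanish_steps:
  assumes "finite G" "G \<subseteq> H" "set fs \<subseteq> H" and V: "\<And>i. i > k \<Longrightarrow> Z G i \<subseteq> B G i"
  shows "i > k + length (fs :: 's list) \<Longrightarrow> Z (G \<union> set fs) i \<subseteq> B (G \<union> set fs) i"
  using assms(3)
proof (induction fs arbitrary: i)
  case Nil then show ?case using V by simp
next
  case (Cons f fs)
  obtain j where j: "i = Suc j" "j > k + length fs" using Cons.prems by (cases i) auto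
  have "Z (insert f (G \<union> set fs)) (Suc j) \<subseteq> B (insert f (G \<union> set fs)) (Suc j)"
    by (rule vanish_step) (use assms Cons j in auto)
  then show ?case using j by simp
qed

text \<open>For \<open>G \<subseteq> G'\<close> this says that the quotient of the \<open>G\<close>-torsion by the \<open>G'\<close>-torsion complex is
  exact.\<close>

definition rel_exact :: "'s set \<Rightarrow> 's set \<Rightarrow> bool" where
  "rel_exact G' G \<longleftrightarrow> (\<forall>i. \<forall>x\<in>T G i. d i x \<in> T G' (Suc i) \<longrightarrow> (\<exists>b\<in>B G i. \<exists>e\<in>T G' i. x = b \<oplus>\<^bsub>E i\<^esub> e))"

lemma rel_exactD:
  assumes "rel_exact G' G" "x \<in> T G i" "d i x \<in> T G' (Suc i)"
  obtains b e where "b \<in> B G i" "e \<in> T G' i" "x = b \<oplus>\<^bsub>E i\<^esub> e"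
  using assms unfolding rel_exact_def by metis

lemma rel_exact_refl: "G \<subseteq> carrier S \<Longrightarrow> rel_exact G G"
  unfolding rel_exact_def using zero_B E.M.l_zero T_carrier by metis

lemma rel_exact_trans:
  assumes 1: "rel_exact G'' G'" and 2: "rel_exact G' G" and sub: "G \<subseteq> G'" "G' \<subseteq> G''" "G'' \<subseteq> carrier S"
  shows "rel_exact G'' G"
  unfolding rel_exact_def
proof (intro allI ballI impI)
  fix i x assume x: "x \<in> T G i" "d i x \<in> T G'' (Suc i)"
  have G: "G \<subseteq> carrier S" "G' \<subseteq> carrier S" using sub by auto
  have "d i x \<in> T G' (Suc i)" by (rule T_mono[OF sub(2) x(2)])
  then obtain b e where be: "b \<in> B G i" "e \<in> T G' i" "x = b \<oplus>\<^bsub>E i\<^esub> e" by (rule rel_exactD[OF 2 x(1)])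
  have car: "b \<in> carrier (E i)" "e \<in> carrier (E i)" using be B_T[OF G(1)] T_carrier by metis+
  have "d i x = d i e" using be car d_B[OF G(1) be(1)] by (simp add: d.add)
  then have "d i e \<in> T G'' (Suc i)" using x by simp
  then obtain b' e' where be': "b' \<in> B G' i" "e' \<in> T G'' i" "e = b' \<oplus>\<^bsub>E i\<^esub> e'" by (rule rel_exactD[OF 1 be(2)])
  have b': "b' \<in> B G i" using be'(1) B_mono[OF sub(1)] by blast
  have "x = (b \<oplus>\<^bsub>E i\<^esub> b') \<oplus>\<^bsub>E i\<^esub> e'"
    using be be' car B_T[OF G(1) b'] by (simp add: E.M.a_assoc T_carrier)
  then show "\<exists>b\<in>B G i. \<exists>e\<in>T G'' i. x = b \<oplus>\<^bsub>E i\<^esub> e" using be'(2) B_add[OF G(1) be(1) b'] by metis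
qed

text \<open>The quotient complex is the localization of \<open>T G\<close> at \<open>f\<close>, so
  its cohomology is the localized \<open>G\<close>-cohomology: zero in positive degrees by
  \<open>V\<close>, and in degree 0 because every cocycle is killed by a power of
  \<open>f\<close>.\<close>

lemma rel_exact_insert:
  assumes G: "finite G" "G \<subseteq> H" and f: "f \<in> H"
    and V: "\<And>i. i > 0 \<Longrightarrow> Z G i \<subseteq> B G i" and Z0: "Z G 0 \<subseteq> T {f} 0"
  shows "rel_exact (insert f G) G"
  unfolding rel_exact_def
proof (intro allI ballI impI)
  fix i x assume x: "x \<in> T G i" "d i x \<in> T (insert f G) (Suc i)"
  have car: "G \<subseteq> carrier S" "f \<in> carrier S" using G f H by auto
  have "x \<in> T {} i" using x T_carrier by simp
  moreover have "d i x \<in> Z (insert f {}) (Suc i)" using x T_mono[of "{f}" "insert f G"] dd[OF T_carrier[OF x(1)]]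
    by (auto simp: cocyc_def)
  ultimately obtain t where t: "f [^] (t::nat) \<odot>\<^bsub>E (Suc i)\<^esub> d i x = \<zero>\<^bsub>E (Suc i)\<^esub>"
    by (auto simp: cocyc_def tors_def)
  have "f [^] t \<odot>\<^bsub>E i\<^esub> x \<in> T G i" using E.tors_smult[OF car(1)] x car by blast
  moreover have "d i (f [^] t \<odot>\<^bsub>E i\<^esub> x) = \<zero>\<^bsub>E (Suc i)\<^esub>" using t x car by (simp add: d.smult T_carrier)
  ultimately have fZ: "f [^] t \<odot>\<^bsub>E i\<^esub> x \<in> Z G i" by (simp add: cocyc_def)
  show "\<exists>b\<in>B G i. \<exists>e\<in>T (insert f G) i. x = b \<oplus>\<^bsub>E i\<^esub> e"
  proof (cases i)
    case 0
    then have "x \<in> T (insert f G) i"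
      using fZ Z0 E.smult_pow_tors[OF car(2,1) x(1)] by blast
    then show ?thesis using zero_B[OF car(1)] E.M.l_zero T_carrier by metis
  next
    case (Suc j)
    then have "f [^] t \<odot>\<^bsub>E i\<^esub> x \<in> B G i" using fZ V[of i] by blast
    then show ?thesis
      using E.tors_divided'[OF car(2) B_carrier[OF car(1)] _ car(1) divides_B[OF G f] x(1)] B_T[OF car(1)] by blast
  qed
qed

text \<open>With an exact quotient complex the inclusion of \<open>T G'\<close> into
  \<open>T G\<close> is an isomorphism on cohomology. Here its injectivity is used;
  \<open>rel_exact_Z\<close> is its surjectivity.\<close>

lemma rel_exact_vanish:
  assumes "rel_exact G' G" "G \<subseteq> G'" "G' \<subseteq> carrier S" and V: "Z G i \<subseteq> B G i"
  shows "Z G' i \<subseteq> B G' i"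
proof
  fix w assume w: "w \<in> Z G' i"
  have G: "G \<subseteq> carrier S" using assms by auto
  have wB: "w \<in> B G i" using w Z_mono[OF assms(2)] V by blast
  show "w \<in> B G' i"
  proof (cases i)
    case 0 then show ?thesis using wB by (simp add: cobd_def)
  next
    case (Suc j)
    then obtain y where y: "y \<in> T G j" "w = d j y" using wB by (auto simp: cobd_def)
    have "d j y \<in> T G' (Suc j)" using w y Suc by (simp add: cocyc_def)
    then obtain b e where be: "b \<in> B G j" "e \<in> T G' j" "y = b \<oplus>\<^bsub>E j\<^esub> e" by (rule rel_exactD[OF assms(1) y(1)])
    then have "w = d j e" using y B_T[OF G be(1)] d_B[OF G be(1)] by (simp add: d.add T_carrier)
    then show ?thesis using Suc be by (simp add: cobd_def)
  qed
qed

lemma rel_exact_Z: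
  assumes "rel_exact G' G" "G \<subseteq> G'" "G' \<subseteq> carrier S" and w: "w \<in> Z G i"
  obtains b e where "b \<in> B G i" "e \<in> Z G' i" "w = b \<oplus>\<^bsub>E i\<^esub> e"
proof -
  have G: "G \<subseteq> carrier S" using assms by auto
  have "w \<in> T G i" "d i w \<in> T G' (Suc i)" using w E.zero_tors[OF assms(3)] by (auto simp: cocyc_def)
  then obtain b e where be: "b \<in> B G i" "e \<in> T G' i" "w = b \<oplus>\<^bsub>E i\<^esub> e" by (rule rel_exactD[OF assms(1)])
  then have "d i e = d i w" using B_T[OF G be(1)] d_B[OF G be(1)] by (simp add: d.add T_carrier)
  then have "e \<in> Z G' i" using be w by (simp add: cocyc_def)
  then show ?thesis using that be by metis
qed

lemma rel_exact_vanish':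
  assumes "rel_exact G' G" "G \<subseteq> G'" "G' \<subseteq> carrier S" and V: "Z G' i \<subseteq> B G' i"
  shows "Z G i \<subseteq> B G i"
proof
  fix w assume w: "w \<in> Z G i"
  have G: "G \<subseteq> carrier S" using assms by auto
  obtain b e where be: "b \<in> B G i" "e \<in> Z G' i" "w = b \<oplus>\<^bsub>E i\<^esub> e" using rel_exact_Z[OF assms(1-3) w] by metis
  then show "w \<in> B G i" using V B_mono[OF assms(2)] B_add[OF G be(1)] by blast
qed

text \<open>Let \<open>Q\<close> be the exact quotient of \<open>T G\<close> by \<open>T G'\<close>.
  By divisibility \<open>Q\<close> maps onto its localization at \<open>f\<close>, and the new
  quotient complex is the kernel of this surjection of exact complexes, hence exact. The proof runs
  this argument on elements.\<close>

lemma rel_exact_insert_both: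
  assumes r: "rel_exact G' G" and sub: "G \<subseteq> G'" "G' \<subseteq> H" "finite G'" and f: "f \<in> H"
  shows "rel_exact (insert f G') (insert f G)"
  unfolding rel_exact_def
proof (intro allI ballI impI)
  fix i x assume x: "x \<in> T (insert f G) i" "d i x \<in> T (insert f G') (Suc i)"
  have car: "G \<subseteq> carrier S" "G' \<subseteq> carrier S" "f \<in> carrier S" "insert f G \<subseteq> carrier S" using sub f H by auto
  have fin: "finite G" "G \<subseteq> H" using sub finite_subset by auto
  have "x \<in> T G i" "d i x \<in> T G' (Suc i)" using x by (auto simp: tors_insert)
  then obtain b e where be: "b \<in> B G i" "e \<in> T G' i" "x = b \<oplus>\<^bsub>E i\<^esub> e" by (rule rel_exactD[OF r])
  have bc: "b \<in> carrier (E i)" "e \<in> carrier (E i)" "x \<in> carrier (E i)" using be x B_T[OF car(1)] T_carrier by metis+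
  show "\<exists>b\<in>B (insert f G) i. \<exists>e\<in>T (insert f G') i. x = b \<oplus>\<^bsub>E i\<^esub> e"
  proof (cases i)
    case 0
    then have "x = e" using be bc by (simp add: cobd_def)
    then have "x \<in> T (insert f G') i" using x be by (auto simp: tors_insert)
    then show ?thesis using zero_B[OF car(4)] E.M.l_zero bc by metis
  next
    case (Suc j)
    then obtain u where u: "u \<in> T G j" "b = d j u" using be by (auto simp: cobd_def)
    have uc: "u \<in> carrier (E j)" using u T_carrier by metis
    obtain t :: nat where t: "f [^] t \<odot>\<^bsub>E i\<^esub> x = \<zero>\<^bsub>E i\<^esub>" using x by (auto simp: tors_insert)
    \<comment> \<open>Since \<open>f^t x = 0\<close>, the boundary \<open>f^t b\<close> is minus
      \<open>f^t e\<close>. So \<open>f^t u\<close> is again a cocycle relative to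
      \<open>G'\<close>, and \<open>rel_exact\<close> applies once more, one degree lower.\<close>
    have "f [^] t \<odot>\<^bsub>E i\<^esub> b \<oplus>\<^bsub>E i\<^esub> f [^] t \<odot>\<^bsub>E i\<^esub> e = \<zero>\<^bsub>E i\<^esub>"
      using t be(3) bc car by (simp add: E.smult_r_distr)
    then have "f [^] t \<odot>\<^bsub>E i\<^esub> b = \<ominus>\<^bsub>E i\<^esub> (f [^] t \<odot>\<^bsub>E i\<^esub> e)"
      using bc car by (simp add: E.M.minus_equality)
    moreover have "\<ominus>\<^bsub>E i\<^esub> (f [^] t \<odot>\<^bsub>E i\<^esub> e) \<in> T G' i"
      by (intro E.tors_neg E.tors_smult) (use car be in auto)
    ultimately have "d j (f [^] t \<odot>\<^bsub>E j\<^esub> u) \<in> T G' (Suc j)"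
      using u uc car Suc by (simp add: d.smult)
    moreover have fu: "f [^] t \<odot>\<^bsub>E j\<^esub> u \<in> T G j" using E.tors_smult[OF car(1)] u car by blast
    ultimately obtain b1 e1 where "b1 \<in> B G j" "e1 \<in> T G' j" "f [^] t \<odot>\<^bsub>E j\<^esub> u = b1 \<oplus>\<^bsub>E j\<^esub> e1"
      using rel_exactD[OF r] by metis
    then have fuZ: "f [^] t \<odot>\<^bsub>E j\<^esub> u \<in> B G j <+>\<^bsub>E j\<^esub> T G' j" by (auto simp: set_add_def')
    have sub1: "B G j \<subseteq> carrier (E j)" "T G' j \<subseteq> carrier (E j)" using B_carrier[OF car(1)] T_carrier by auto
    have sub2: "B G j <+>\<^bsub>E j\<^esub> T G' j \<subseteq> T G j"
      using B_T[OF car(1)] T_mono[OF sub(1)] E.tors_add[OF car(1)] by (auto simp: set_add_def')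
    have dv: "divides_into S (E j) f (B G j <+>\<^bsub>E j\<^esub> T G' j) (B G j <+>\<^bsub>E j\<^esub> T G' j)"
      by (rule E.divides_into_add[OF car(3) sub1(1) sub1(1) sub1(2) sub1(2) divides_B[OF fin f] divides_T[OF sub(3,2) f]])
    have sub3: "B G j <+>\<^bsub>E j\<^esub> T G' j \<subseteq> carrier (E j)" using sub2 T_carrier by (rule_tac subset_trans) auto
    \<comment> \<open>Division by \<open>f^t\<close> inside the sum of boundaries and
      \<open>G'\<close>-torsion recovers \<open>u\<close> up to the \<open>f\<close>-torsion element
      \<open>s\<close>. This splits \<open>b\<close> as \<open>d c \<oplus> d s\<close>, where
      \<open>d s\<close> is a boundary for \<open>insert f G\<close>.\<close>
    obtain p s where p: "p \<in> B G j <+>\<^bsub>E j\<^esub> T G' j" and s: "s \<in> T (insert f G) j" "u = p \<oplus>\<^bsub>E j\<^esub> s"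
      by (rule E.tors_divided'[OF car(3) sub3 sub2 car(1) dv u(1) fuZ])
    obtain b2 c where bc2: "b2 \<in> B G j" "c \<in> T G' j" "p = b2 \<oplus>\<^bsub>E j\<^esub> c" using p by (auto simp: set_add_def')
    have cc: "b2 \<in> carrier (E j)" "c \<in> carrier (E j)" "s \<in> carrier (E j)"
      using bc2 s B_T[OF car(1)] T_carrier by metis+
    have "b = d j c \<oplus>\<^bsub>E i\<^esub> d j s" using u s bc2 cc d_B[OF car(1) bc2(1)] Suc by (simp add: d.add)
    then have xe: "x = d j s \<oplus>\<^bsub>E i\<^esub> (d j c \<oplus>\<^bsub>E i\<^esub> e)" using be cc bc Suc by (simp add: E.M.a_ac)
    have sT: "d j s \<in> T (insert f G) i" using d.tors[OF car(4) s(1)] Suc by simp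
    have e1: "d j c \<oplus>\<^bsub>E i\<^esub> e \<in> T G' i" using E.tors_add[OF car(2)] d.tors[OF car(2) bc2(2)] be Suc by blast
    \<comment> \<open>The \<open>f\<close>-torsion of this summand is inherited from
      \<open>x\<close> and \<open>d j s\<close>, its \<open>G'\<close>-torsion from \<open>c\<close>
      and \<open>e\<close>.\<close>
    then have "d j c \<oplus>\<^bsub>E i\<^esub> e \<in> T (insert f G) i"
      using E.tors_summand[OF car(4) sT _ ] x xe T_carrier by metis
    then have "d j c \<oplus>\<^bsub>E i\<^esub> e \<in> T (insert f G') i" using e1 by (auto simp: tors_insert)
    moreover have "d j s \<in> B (insert f G) i" using s Suc B_SucI by simp
    ultimately show ?thesis using xe by blast
  qed
qed

lemma rel_exact_Un:
  assumes "rel_exact G' G" "G \<subseteq> G'" "G' \<subseteq> H" "finite G'" "finite Y" "Y \<subseteq> H"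
  shows "rel_exact (G' \<union> Y) (G \<union> Y)"
  using assms(5,6)
proof (induction Y)
  case empty then show ?case using assms by simp
next
  case (insert f Y)
  have "rel_exact (insert f (G' \<union> Y)) (insert f (G \<union> Y))"
    by (rule rel_exact_insert_both) (use insert assms in auto)
  then show ?case by simp
qed

text \<open>The elements of \<open>G\<close> are adjoined one at a time. Cohomology stays in degree
  0, and \<open>Z G 0 \<subseteq> Z {} 0\<close> keeps it killed by powers of the elements still to
  come.\<close>

lemma rel_exact_killed:
  assumes "finite G" "G \<subseteq> H" and V: "\<And>i. i > 0 \<Longrightarrow> Z {} i \<subseteq> B {} i" and Z0: "Z {} 0 \<subseteq> T G 0"
  shows "rel_exact G {}"
  using assms(1,2,4)
proof (induction G)
  case empty then show ?case by (simp add: rel_exact_refl)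
next
  case (insert f G)
  then have r: "rel_exact G {}" using T_mono[of G "insert f G"] by blast
  have G: "G \<subseteq> carrier S" "insert f G \<subseteq> carrier S" using insert H by auto
  have "rel_exact (insert f G) G"
  proof (rule rel_exact_insert)
    show "Z G i \<subseteq> B G i" if "i > 0" for i
      by (rule rel_exact_vanish[OF r]) (use that V G in auto)
    have "Z G 0 \<subseteq> Z {} 0" by (rule Z_mono) simp
    also have "\<dots> \<subseteq> T (insert f G) 0" by fact
    also have "\<dots> \<subseteq> T {f} 0" by (auto intro: T_mono)
    finally show "Z G 0 \<subseteq> T {f} 0" .
  qed (use insert in auto)
  then show ?case by (rule rel_exact_trans[OF _ r]) (use G in auto)
qed

text \<open>Pass from \<open>{}\<close> to \<open>G\<close> without change, to
  \<open>G \<union> set fs\<close> at the cost of \<open>length fs\<close> degrees, rewrite the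
  torsion as that for \<open>G \<union> Y\<close>, and drop \<open>G\<close> again without change.
  In the application \<open>G\<close> kills the resolved module, \<open>fs\<close> are the
  parameters and \<open>Y\<close> the variables.\<close>

lemma vanish:
  assumes G: "finite G" "G \<subseteq> H" and V: "\<And>i. i > 0 \<Longrightarrow> Z {} i \<subseteq> B {} i" and Z0: "Z {} 0 \<subseteq> T G 0"
    and fs: "set fs \<subseteq> H" and Y: "finite Y" "Y \<subseteq> H"
    and eq: "\<And>j. T (G \<union> set fs) j = T (G \<union> Y) j" and i: "i > length fs"
  shows "Z Y i \<subseteq> B Y i"
proof -
  have r: "rel_exact G {}" by (rule rel_exact_killed[OF G V Z0])
  have car: "G \<subseteq> carrier S" "G \<union> Y \<subseteq> carrier S" using G Y H by auto
  have "Z (G \<union> set fs) i \<subseteq> B (G \<union> set fs) i"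
  proof (rule vanish_steps[OF G fs, of 0])
    show "Z G i \<subseteq> B G i" if "i > 0" for i
      by (rule rel_exact_vanish[OF r]) (use that V car in auto)
  qed (use i in simp)
  moreover have "Z (G \<union> set fs) = Z (G \<union> Y)" "B (G \<union> set fs) = B (G \<union> Y)"
    by (auto simp: fun_eq_iff cocyc_def cobd_def eq split: nat.splits)
  ultimately have "Z (G \<union> Y) i \<subseteq> B (G \<union> Y) i" by simp
  moreover have "rel_exact (G \<union> Y) ({} \<union> Y)" by (rule rel_exact_Un[OF r]) (use G Y in auto)
  ultimately show ?thesis using rel_exact_vanish'[of "G \<union> Y" Y i] car by auto
qed

end

section \<open>Maps of complexes\<close>

locale module_complex_map =
  E: module_complex S E dE H + F: module_complex S F dF H
  for S :: "('s, 'z) ring_scheme" (structure) and E :: "nat \<Rightarrow> ('s, 'e) module" and dE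
    and F :: "nat \<Rightarrow> ('s, 'f) module" and dF and H +
  fixes \<phi> :: "nat \<Rightarrow> 'e \<Rightarrow> 'f" and mm :: "'s set"
  assumes \<phi>_hom: "\<And>j. \<phi> j \<in> module_hom S (E j) (F j)"
    and \<phi>_d: "\<And>j x. x \<in> carrier (E j) \<Longrightarrow> \<phi> (Suc j) (dE j x) = dF j (\<phi> j x)"
    and mm: "mm \<subseteq> carrier S"
begin

sublocale \<phi>: module_homomorphism S "E j" "F j" "\<phi> j" for j
  by unfold_locales (rule \<phi>_hom)

lemma \<phi>_Z: "G \<subseteq> carrier S \<Longrightarrow> z \<in> E.Z G i \<Longrightarrow> \<phi> i z \<in> F.Z G i"
  using \<phi>.tors[of G z i] \<phi>_d[of z i] by (simp add: cocyc_def tors_def)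

lemma \<phi>_B:
  assumes "G \<subseteq> carrier S" "b \<in> E.B G i" shows "\<phi> i b \<in> F.B G i"
proof (cases i)
  case 0 then show ?thesis using assms by (simp add: cobd_def)
next
  case (Suc j)
  then obtain y where "y \<in> E.T G j" "b = dE j y" using assms by (auto simp: cobd_def)
  then show ?thesis using Suc \<phi>_d[of y j] F.B_SucI[OF \<phi>.tors[OF assms(1), of y j]] E.T_carrier by simp
qed

text \<open>In terms of cohomology: \<open>k\<close> bounds the degrees, and the map in degree \<open>k\<close> is reduction modulo
  \<open>mm\<close>.\<close>

definition reduction :: "'s set \<Rightarrow> nat \<Rightarrow> bool" where
  "reduction G k \<longleftrightarrow>
    (\<forall>i>k. E.Z G i \<subseteq> E.B G i) \<and> (\<forall>i>k. F.Z G i \<subseteq> F.B G i) \<and>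
    (\<forall>w\<in>F.Z G k. \<exists>z\<in>E.Z G k. \<exists>b\<in>F.B G k. w = \<phi> k z \<oplus>\<^bsub>F k\<^esub> b) \<and>
    (\<forall>w\<in>E.Z G k. \<phi> k w \<in> F.B G k \<longrightarrow> (\<exists>v\<in>E.E.mspan k mm (E.Z G k). \<exists>b\<in>E.B G k. w = v \<oplus>\<^bsub>E k\<^esub> b)) \<and>
    (\<forall>w\<in>F.Z G k. \<forall>\<mu>\<in>mm. \<mu> \<odot>\<^bsub>F k\<^esub> w \<in> F.B G k)"

lemma reductionD:
  assumes "reduction G k"
  shows "i > k \<Longrightarrow> E.Z G i \<subseteq> E.B G i" "i > k \<Longrightarrow> F.Z G i \<subseteq> F.B G i"
    "w \<in> F.Z G k \<Longrightarrow> \<exists>z\<in>E.Z G k. \<exists>b\<in>F.B G k. w = \<phi> k z \<oplus>\<^bsub>F k\<^esub> b"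
    "v \<in> E.Z G k \<Longrightarrow> \<phi> k v \<in> F.B G k \<Longrightarrow> \<exists>u\<in>E.E.mspan k mm (E.Z G k). \<exists>b\<in>E.B G k. v = u \<oplus>\<^bsub>E k\<^esub> b"
    "w \<in> F.Z G k \<Longrightarrow> \<mu> \<in> mm \<Longrightarrow> \<mu> \<odot>\<^bsub>F k\<^esub> w \<in> F.B G k"
  using assms unfolding reduction_def by simp_all

context
  fixes G f k
  assumes G: "finite G" "G \<subseteq> H" and f: "f \<in> H" and red: "reduction G k"
begin

lemma carG: "G \<subseteq> carrier S" "f \<in> carrier S" "insert f G \<subseteq> carrier S"
  using G f E.H by auto

text \<open>Cohomology vanishes above \<open>k\<close>, so the class of \<open>w\<close> comes from
  a fraction \<open>y\<close> with numerator \<open>f^t y\<close>, a cocycle. Surjectivity in degree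
  \<open>k\<close> lifts the numerator to \<open>E\<close>, and the division by \<open>f^t\<close>
  is carried out there.\<close>

lemma reduction_step_surj:
  assumes w: "w \<in> F.Z (insert f G) (Suc k)"
  shows "\<exists>z\<in>E.Z (insert f G) (Suc k). \<exists>b\<in>F.B (insert f G) (Suc k). w = \<phi> (Suc k) z \<oplus>\<^bsub>F (Suc k)\<^esub> b"
proof -
  have "w \<in> F.Z G (Suc k)" using w F.Z_mono[of G "insert f G"] by blast
  then have "w \<in> F.B G (Suc k)" using reductionD(2)[OF red, of "Suc k"] by blast
  then obtain y t where y: "y \<in> F.T G k" "w = dF k y" "f [^] (t::nat) \<odot>\<^bsub>F k\<^esub> y \<in> F.Z G k"
    using F.boundary_lift[OF carG(1,2) w] by metis
  let ?Z = "(\<phi> k ` E.Z G k) <+>\<^bsub>F k\<^esub> F.B G k" and ?Y = "(\<phi> k ` E.Zs f G k) <+>\<^bsub>F k\<^esub> F.B G k"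
  have sub: "\<phi> k ` E.Z G k \<subseteq> carrier (F k)" "\<phi> k ` E.Zs f G k \<subseteq> F.T G k"
    using E.Z_carrier E.Zs_T \<phi>.tors[OF carG(1)] by fastforce+
  then have sub': "\<phi> k ` E.Zs f G k \<subseteq> carrier (F k)" using F.T_carrier by blast
  have B: "F.B G k \<subseteq> F.T G k" "F.B G k \<subseteq> carrier (F k)" using F.B_T[OF carG(1)] F.B_carrier[OF carG(1)] by auto
  have dv: "divides_into S (F k) f ?Z ?Y"
  proof (rule F.E.divides_into_add[OF carG(2) sub(1) sub' B(2) B(2)])
    show "divides_into S (F k) f (\<phi> k ` E.Z G k) (\<phi> k ` E.Zs f G k)"
      by (rule \<phi>.divides_into_image[OF carG(2) E.Z_carrier _ E.divides_Zs[OF G f]])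
        (auto simp: E.Zs_def E.T_carrier)
  qed (rule F.divides_B[OF G f])
  have ZF: "?Z \<subseteq> carrier (F k)" using sub(1) B(2) by (auto simp: set_add_def')
  have YT: "?Y \<subseteq> F.T G k"
    using subsetD[OF sub(2) imageI] subsetD[OF B(1)] F.E.tors_add[OF carG(1)]
    by (auto simp: set_add_def')
  have "f [^] t \<odot>\<^bsub>F k\<^esub> y \<in> ?Z" using reductionD(3)[OF red y(3)] by (auto simp: set_add_def')
  then obtain p e where p: "p \<in> ?Y" and e: "e \<in> F.T (insert f G) k" and yp: "y = p \<oplus>\<^bsub>F k\<^esub> e"
    by (rule F.E.tors_divided'[OF carG(2) ZF YT carG(1) dv y(1)])
  from p obtain z b where z: "z \<in> E.Zs f G k" and b: "b \<in> F.B G k" and pz: "p = \<phi> k z \<oplus>\<^bsub>F k\<^esub> b"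
    by (auto simp: set_add_def')
  have z': "z \<in> carrier (E k)" "dE k z \<in> E.Z (insert f G) (Suc k)" using z by (auto simp: E.Zs_def E.T_carrier)
  have bc: "b \<in> carrier (F k)" "e \<in> carrier (F k)" using b B e F.T_carrier by auto
  have "w = \<phi> (Suc k) (dE k z) \<oplus>\<^bsub>F (Suc k)\<^esub> dF k e"
    using y(2) yp pz z' bc F.d_B[OF carG(1) b] by (simp add: F.d.add \<phi>_d)
  moreover have "dF k e \<in> F.B (insert f G) (Suc k)" by (rule F.B_SucI[OF e])
  ultimately show ?thesis using z'(2) by metis
qed

text \<open>Write \<open>w\<close> as \<open>d y\<close>. Once \<open>y\<close> is corrected by a
  cocycle and multiplied by a power of \<open>f\<close>, its image is a boundary, and the kernel
  clause in degree \<open>k\<close> applies to this numerator. Spans over \<open>mm\<close> are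
  compatible with dividing by the power of \<open>f\<close> afterwards.\<close>

lemma reduction_step_ker:
  assumes w: "w \<in> E.Z (insert f G) (Suc k)" and \<phi>w: "\<phi> (Suc k) w \<in> F.B (insert f G) (Suc k)"
  shows "\<exists>v\<in>E.E.mspan (Suc k) mm (E.Z (insert f G) (Suc k)). \<exists>b\<in>E.B (insert f G) (Suc k).
      w = v \<oplus>\<^bsub>E (Suc k)\<^esub> b"
proof -
  have "w \<in> E.Z G (Suc k)" using w E.Z_mono[of G "insert f G"] by blast
  then have "w \<in> E.B G (Suc k)" using reductionD(1)[OF red, of "Suc k"] by blast
  then obtain y t where y: "y \<in> E.T G k" "w = dE k y" "f [^] (t::nat) \<odot>\<^bsub>E (Suc k)\<^esub> w = \<zero>\<^bsub>E (Suc k)\<^esub>"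
    using E.boundary_lift[OF carG(1,2) w] by metis
  obtain v where v: "v \<in> F.T (insert f G) k" "\<phi> (Suc k) w = dF k v" using \<phi>w by (auto simp: cobd_def)
  obtain s :: nat where s: "f [^] s \<odot>\<^bsub>F k\<^esub> v = \<zero>\<^bsub>F k\<^esub>" using v by (auto simp: tors_def)
  have vT: "v \<in> F.T G k" using v(1) by (auto simp: tors_insert)
  have yc: "y \<in> carrier (E k)" "v \<in> carrier (F k)" "w \<in> carrier (E (Suc k))"
    using subsetD[OF E.Z_carrier w] E.T_carrier[OF y(1)] F.T_carrier[OF vT] by auto
  \<comment> \<open>Both \<open>\<phi> k y\<close> and \<open>v\<close> are preimages of the image
    of \<open>w\<close> under \<open>dF k\<close>, so they differ by a cocycle, which lifts to
    \<open>E\<close> up to a boundary.\<close>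
  have "\<phi> k y \<ominus>\<^bsub>F k\<^esub> v \<in> F.T G k" by (rule F.E.tors_diff[OF carG(1) \<phi>.tors[OF carG(1) y(1)] vT])
  moreover have "dF k (\<phi> k y \<ominus>\<^bsub>F k\<^esub> v) = \<zero>\<^bsub>F (Suc k)\<^esub>"
    using yc v(2) y(2) F.E.diff_self by (simp add: F.d.diff flip: \<phi>_d)
  ultimately have "\<phi> k y \<ominus>\<^bsub>F k\<^esub> v \<in> F.Z G k" by (simp add: cocyc_def)
  then obtain z b where z: "z \<in> E.Z G k" and b: "b \<in> F.B G k" and zb: "\<phi> k y \<ominus>\<^bsub>F k\<^esub> v = \<phi> k z \<oplus>\<^bsub>F k\<^esub> b"
    using reductionD(3)[OF red] by metis
  have zc: "z \<in> carrier (E k)" "b \<in> carrier (F k)" "z \<in> E.T G k" "dE k z = \<zero>\<^bsub>E (Suc k)\<^esub>"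
    using z subsetD[OF E.Z_carrier z] subsetD[OF F.B_carrier[OF carG(1)] b] by (auto simp: cocyc_def)
  have \<phi>y: "\<phi> k y = \<phi> k z \<oplus>\<^bsub>F k\<^esub> (v \<oplus>\<^bsub>F k\<^esub> b)"
    using F.E.minus_plus_cancel[OF \<phi>.closed[OF yc(1)] yc(2)] zb yc zc by (simp add: F.E.M.a_ac)
  \<comment> \<open>Changing \<open>y\<close> by the cocycle \<open>z\<close> keeps its boundary
    \<open>w\<close> and makes its image an \<open>f\<close>-torsion element plus a
    coboundary.\<close>
  define y1 where "y1 = y \<ominus>\<^bsub>E k\<^esub> z"
  have y1T: "y1 \<in> E.T G k" unfolding y1_def by (rule E.E.tors_diff[OF carG(1) y(1) zc(3)])
  then have y1c: "y1 \<in> carrier (E k)" by (rule E.T_carrier)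
  have dy1: "dE k y1 = w" 
    unfolding y1_def E.d.diff[OF yc(1) zc(1)] zc(4) y(2)[symmetric] using yc by (simp add: E.E.M.minus_eq)
  have \<phi>y1: "\<phi> k y1 = v \<oplus>\<^bsub>F k\<^esub> b"
    unfolding y1_def using \<phi>y F.E.eq_diffI[of "\<phi> k z" k "v \<oplus>\<^bsub>F k\<^esub> b"] yc zc by (simp add: \<phi>.diff)
  \<comment> \<open>\<open>f^t\<close> kills \<open>w\<close> and \<open>f^s\<close> kills
    \<open>v\<close>. Beyond both exponents, \<open>f^r y1\<close> is a cocycle and its image is the
    coboundary \<open>f^r b\<close>.\<close>
  let ?r = "max t s"
  have r1: "f [^] ?r \<odot>\<^bsub>E (Suc k)\<^esub> w = \<zero>\<^bsub>E (Suc k)\<^esub>"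
    by (rule E.E.smult_pow_zero_mono[OF carG(2) yc(3) y(3)]) simp
  have r2: "f [^] ?r \<odot>\<^bsub>F k\<^esub> v = \<zero>\<^bsub>F k\<^esub>"
    by (rule F.E.smult_pow_zero_mono[OF carG(2) yc(2) s]) simp
  have fr: "f [^] ?r \<in> carrier S" using carG(2) by simp
  have fy1: "f [^] ?r \<odot>\<^bsub>E k\<^esub> y1 \<in> E.Z G k"
    using E.E.tors_smult[OF carG(1) fr y1T] r1 dy1 y1c fr by (simp add: cocyc_def E.d.smult)
  have "\<phi> k (f [^] ?r \<odot>\<^bsub>E k\<^esub> y1) = f [^] ?r \<odot>\<^bsub>F k\<^esub> b"
    using \<phi>y1 y1c r2 fr yc zc by (simp add: \<phi>.smult F.E.smult_r_distr)
  moreover have "f [^] ?r \<odot>\<^bsub>F k\<^esub> b \<in> F.B G k"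
  proof (cases k)
    case 0 then show ?thesis using b fr by (simp add: cobd_def)
  next
    case (Suc j)
    then obtain u where u: "u \<in> F.T G j" "b = dF j u" using b by (auto simp: cobd_def)
    have "f [^] ?r \<odot>\<^bsub>F k\<^esub> b = dF j (f [^] ?r \<odot>\<^bsub>F j\<^esub> u)"
      using u Suc fr F.T_carrier by (simp add: F.d.smult)
    then show ?thesis using F.E.tors_smult[OF carG(1) fr u(1)] Suc by (simp add: cobd_def)
  qed
  ultimately have "\<exists>u\<in>E.E.mspan k mm (E.Z G k). \<exists>b\<in>E.B G k. f [^] ?r \<odot>\<^bsub>E k\<^esub> y1 = u \<oplus>\<^bsub>E k\<^esub> b"
    using reductionD(4)[OF red fy1] by simp
  then have fyZ: "f [^] ?r \<odot>\<^bsub>E k\<^esub> y1 \<in> E.E.mspan k mm (E.Z G k) <+>\<^bsub>E k\<^esub> E.B G k"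
    by (auto simp: set_add_def')
  have Zsc: "E.Zs f G k \<subseteq> carrier (E k)" by (auto simp: E.Zs_def E.T_carrier)
  have sub: "E.E.mspan k mm (E.Z G k) \<subseteq> carrier (E k)" "E.E.mspan k mm (E.Zs f G k) \<subseteq> carrier (E k)"
    "E.E.mspan k mm (E.Zs f G k) \<subseteq> E.T G k"
    by (rule E.E.mspan_carrier[OF mm E.Z_carrier], rule E.E.mspan_carrier[OF mm Zsc],
        rule E.E.mspan_subset[OF E.E.submodule_tors[OF carG(1)] mm E.Zs_T])
  have B: "E.B G k \<subseteq> E.T G k" "E.B G k \<subseteq> carrier (E k)" using E.B_T[OF carG(1)] E.B_carrier[OF carG(1)] by auto
  have dv: "divides_into S (E k) f (E.E.mspan k mm (E.Z G k) <+>\<^bsub>E k\<^esub> E.B G k)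
      (E.E.mspan k mm (E.Zs f G k) <+>\<^bsub>E k\<^esub> E.B G k)"
    by (rule E.E.divides_into_add[OF carG(2) sub(1,2) B(2) B(2)
          E.E.divides_into_mspan[OF carG(2) mm E.Z_carrier Zsc E.divides_Zs[OF G f]] E.divides_B[OF G f]])
  have ZF: "E.E.mspan k mm (E.Z G k) <+>\<^bsub>E k\<^esub> E.B G k \<subseteq> carrier (E k)"
    using sub(1) B(2) by (auto simp: set_add_def')
  have YT: "E.E.mspan k mm (E.Zs f G k) <+>\<^bsub>E k\<^esub> E.B G k \<subseteq> E.T G k"
    using subsetD[OF sub(3)] subsetD[OF B(1)] E.E.tors_add[OF carG(1)] by (auto simp: set_add_def')
  obtain p e where p: "p \<in> E.E.mspan k mm (E.Zs f G k) <+>\<^bsub>E k\<^esub> E.B G k"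
    and e: "e \<in> E.T (insert f G) k" and ype: "y1 = p \<oplus>\<^bsub>E k\<^esub> e"
    by (rule E.E.tors_divided'[OF carG(2) ZF YT carG(1) dv y1T fyZ])
  obtain q b' where q: "q \<in> E.E.mspan k mm (E.Zs f G k)" and b': "b' \<in> E.B G k" and pq: "p = q \<oplus>\<^bsub>E k\<^esub> b'"
    using p by (auto simp: set_add_def')
  have qc: "q \<in> carrier (E k)" "b' \<in> carrier (E k)" "e \<in> carrier (E k)"
    using subsetD[OF sub(2) q] subsetD[OF B(2) b'] E.T_carrier[OF e] by auto
  have "w = dE k q \<oplus>\<^bsub>E (Suc k)\<^esub> dE k e"
    using dy1 ype pq qc E.d_B[OF carG(1) b'] by (simp add: E.d.add)
  moreover have "dE k q \<in> E.E.mspan (Suc k) mm (E.Z (insert f G) (Suc k))"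
  proof -
    have "dE k q \<in> E.E.mspan (Suc k) mm (dE k ` E.Zs f G k)" by (rule E.d.mspan_image[OF mm Zsc q])
    then show ?thesis using E.E.mspan_mono[of "dE k ` E.Zs f G k" "E.Z (insert f G) (Suc k)" "Suc k" mm]
      by (auto simp: E.Zs_def)
  qed
  ultimately show ?thesis using E.B_SucI[OF e] by metis
qed

text \<open>Multiplication by \<open>\<mu>\<close> annihilates the numerator \<open>f^t y\<close> in
  cohomology, hence the class of the fraction that it represents.\<close>

lemma reduction_step_killed:
  assumes w: "w \<in> F.Z (insert f G) (Suc k)" and \<mu>: "\<mu> \<in> mm"
  shows "\<mu> \<odot>\<^bsub>F (Suc k)\<^esub> w \<in> F.B (insert f G) (Suc k)"
proof -
  have \<mu>S: "\<mu> \<in> carrier S" using \<mu> mm by auto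
  have "w \<in> F.Z G (Suc k)" using w F.Z_mono[of G "insert f G"] by blast
  then have "w \<in> F.B G (Suc k)" using reductionD(2)[OF red, of "Suc k"] by blast
  then obtain y t where y: "y \<in> F.T G k" "w = dF k y" "f [^] (t::nat) \<odot>\<^bsub>F k\<^esub> y \<in> F.Z G k"
    using F.boundary_lift[OF carG(1,2) w] by metis
  have yc: "y \<in> carrier (F k)" using y F.T_carrier by auto
  have "f [^] t \<odot>\<^bsub>F k\<^esub> (\<mu> \<odot>\<^bsub>F k\<^esub> y) = \<mu> \<odot>\<^bsub>F k\<^esub> (f [^] t \<odot>\<^bsub>F k\<^esub> y)"
    by (rule F.E.smult_comm) (use \<mu>S carG yc in auto)
  then have 1: "f [^] t \<odot>\<^bsub>F k\<^esub> (\<mu> \<odot>\<^bsub>F k\<^esub> y) \<in> F.B G k" using reductionD(5)[OF red y(3) \<mu>] by simp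
  have 2: "\<mu> \<odot>\<^bsub>F k\<^esub> y \<in> F.T G k" by (rule F.E.tors_smult[OF carG(1) \<mu>S y(1)])
  have BT: "F.B G k \<subseteq> F.T G k" using F.B_T[OF carG(1)] by auto
  obtain b e where b: "b \<in> F.B G k" and e: "e \<in> F.T (insert f G) k" and be: "\<mu> \<odot>\<^bsub>F k\<^esub> y = b \<oplus>\<^bsub>F k\<^esub> e"
    by (rule F.E.tors_divided'[OF carG(2) F.B_carrier[OF carG(1)] BT carG(1) F.divides_B[OF G f] 2 1])
  have c: "b \<in> carrier (F k)" "e \<in> carrier (F k)" using b BT e F.T_carrier by auto
  have "\<mu> \<odot>\<^bsub>F (Suc k)\<^esub> w = dF k (\<mu> \<odot>\<^bsub>F k\<^esub> y)" using y(2) yc \<mu>S by (simp add: F.d.smult)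
  also have "\<dots> = dF k e" unfolding be using c F.d_B[OF carG(1) b] by (simp add: F.d.add)
  finally show ?thesis using F.B_SucI[OF e] by simp
qed

lemma reduction_step: "reduction (insert f G) (Suc k)"
  unfolding reduction_def
proof (intro conjI ballI allI impI reduction_step_surj reduction_step_ker reduction_step_killed)
  fix i assume "Suc k < i"
  then obtain j where j: "i = Suc j" "k < j" by (cases i) auto
  show "E.Z (insert f G) i \<subseteq> E.B (insert f G) i" unfolding j
    by (rule E.vanish_step[OF G f reductionD(1)[OF red] reductionD(1)[OF red]]) (use j in auto)
  show "F.Z (insert f G) i \<subseteq> F.B (insert f G) i" unfolding j
    by (rule F.vanish_step[OF G f reductionD(2)[OF red] reductionD(2)[OF red]]) (use j in auto)
qed

end

lemma reduction_steps:
  assumes "finite G" "G \<subseteq> H" "reduction G k" "set fs \<subseteq> H"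
  shows "reduction (G \<union> set fs) (k + length fs)"
  using assms(4)
proof (induction fs)
  case Nil then show ?case using assms by simp
next
  case (Cons f fs)
  have "reduction (insert f (G \<union> set fs)) (Suc (k + length fs))"
    by (rule reduction_step) (use assms Cons in auto)
  then show ?case by simp
qed

lemma reduction_cong:
  assumes "reduction G k" "\<And>j. E.T G j = E.T G' j" "\<And>j. F.T G j = F.T G' j"
  shows "reduction G' k"
proof -
  have "E.Z G = E.Z G'" "E.B G = E.B G'" "F.Z G = F.Z G'" "F.B G = F.B G'"
    by (auto simp: fun_eq_iff cocyc_def cobd_def assms split: nat.splits)
  then show ?thesis using assms(1) by (simp add: reduction_def)
qed

text \<open>Both inclusions of torsion complexes are isomorphisms on cohomology and commute with
  \<open>\<phi>\<close>, so every clause can be checked on representatives taken from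
  \<open>G'\<close>.\<close>

lemma reduction_rel_exact:
  assumes red: "reduction G' k" and rE: "E.rel_exact G' G" and rF: "F.rel_exact G' G"
    and sub: "G \<subseteq> G'" "G' \<subseteq> carrier S"
  shows "reduction G k"
  unfolding reduction_def
proof (intro conjI ballI allI impI)
  have G: "G \<subseteq> carrier S" using sub by auto
  fix i assume i: "k < i"
  show "E.Z G i \<subseteq> E.B G i" by (rule E.rel_exact_vanish'[OF rE sub reductionD(1)[OF red i]])
  show "F.Z G i \<subseteq> F.B G i" by (rule F.rel_exact_vanish'[OF rF sub reductionD(2)[OF red i]])
next
  have G: "G \<subseteq> carrier S" using sub by auto
  fix w assume w: "w \<in> F.Z G k"
  obtain b e where be: "b \<in> F.B G k" "e \<in> F.Z G' k" "w = b \<oplus>\<^bsub>F k\<^esub> e" by (rule F.rel_exact_Z[OF rF sub w])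
  obtain z b' where z: "z \<in> E.Z G' k" "b' \<in> F.B G' k" "e = \<phi> k z \<oplus>\<^bsub>F k\<^esub> b'"
    using reductionD(3)[OF red be(2)] by metis
  have z': "z \<in> E.Z G k" "b' \<in> F.B G k" using z E.Z_mono[OF sub(1)] F.B_mono[OF sub(1)] by blast+
  have c: "z \<in> carrier (E k)" "b \<in> carrier (F k)" "b' \<in> carrier (F k)"
    using subsetD[OF E.Z_carrier z'(1)] subsetD[OF F.B_carrier[OF G]] be(1) z'(2) by auto
  have "w = \<phi> k z \<oplus>\<^bsub>F k\<^esub> (b \<oplus>\<^bsub>F k\<^esub> b')" using be(3) z(3) c by (simp add: F.E.M.a_ac)
  then show "\<exists>z\<in>E.Z G k. \<exists>b\<in>F.B G k. w = \<phi> k z \<oplus>\<^bsub>F k\<^esub> b"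
    using z'(1) F.B_add[OF G be(1) z'(2)] by metis
next
  have G: "G \<subseteq> carrier S" using sub by auto
  fix w assume w: "w \<in> E.Z G k" and \<phi>w: "\<phi> k w \<in> F.B G k"
  obtain b e where be: "b \<in> E.B G k" "e \<in> E.Z G' k" "w = b \<oplus>\<^bsub>E k\<^esub> e" by (rule E.rel_exact_Z[OF rE sub w])
  have bc: "b \<in> carrier (E k)" "e \<in> carrier (E k)" using subsetD[OF E.B_carrier[OF G] be(1)] subsetD[OF E.Z_carrier be(2)] by auto
  have e': "e \<in> E.Z G k" using be E.Z_mono[OF sub(1)] by blast
  have G'c: "insert e {} \<subseteq> carrier (E k)" using bc by simp
  \<comment> \<open>The image of \<open>e\<close> is a boundary of a \<open>G\<close>-torsion
    element. Exactness of the quotient complex on the \<open>F\<close> side replaces that element by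
    a \<open>G'\<close>-torsion one.\<close>
  have \<phi>e: "\<phi> k e \<in> F.B G' k"
  proof (cases k)
    case 0
    then have "w = e" using be bc by (simp add: cobd_def)
    then show ?thesis using \<phi>w 0 by (simp add: cobd_def)
  next
    case (Suc j)
    obtain v where v: "v \<in> F.T G j" "\<phi> k w = dF j v" using \<phi>w Suc by (auto simp: cobd_def)
    obtain u where u: "u \<in> E.T G j" "b = dE j u" using be(1) Suc by (auto simp: cobd_def)
    have uv: "v \<in> carrier (F j)" "u \<in> carrier (E j)" using u v E.T_carrier F.T_carrier by auto
    have "\<phi> k e = \<phi> k w \<ominus>\<^bsub>F k\<^esub> \<phi> k b"
      using be(3) bc F.E.eq_diffI[of "\<phi> k b" k "\<phi> k e"] by (simp add: \<phi>.add)
    also have "\<dots> = dF j (v \<ominus>\<^bsub>F j\<^esub> \<phi> j u)" using v u uv Suc by (simp add: F.d.diff \<phi>_d)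
    finally have \<phi>e: "\<phi> k e = dF j (v \<ominus>\<^bsub>F j\<^esub> \<phi> j u)" .
    have 1: "v \<ominus>\<^bsub>F j\<^esub> \<phi> j u \<in> F.T G j" by (rule F.E.tors_diff[OF G v(1) \<phi>.tors[OF G u(1)]])
    have "\<phi> k e \<in> F.T G' k" using be(2) \<phi>.tors[OF sub(2)] by (simp add: cocyc_def)
    then have 2: "dF j (v \<ominus>\<^bsub>F j\<^esub> \<phi> j u) \<in> F.T G' (Suc j)" using \<phi>e Suc by simp
    obtain b1 e1 where be1: "b1 \<in> F.B G j" "e1 \<in> F.T G' j" "v \<ominus>\<^bsub>F j\<^esub> \<phi> j u = b1 \<oplus>\<^bsub>F j\<^esub> e1"
      by (rule F.rel_exactD[OF rF 1 2])
    have "b1 \<in> carrier (F j)" "e1 \<in> carrier (F j)" using subsetD[OF F.B_carrier[OF G] be1(1)] F.T_carrier[OF be1(2)] by auto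
    then have "\<phi> k e = dF j e1" unfolding \<phi>e be1(3) using F.d_B[OF G be1(1)] by (simp add: F.d.add)
    then show ?thesis using F.B_SucI[OF be1(2)] Suc by simp
  qed
  obtain v b' where v: "v \<in> E.E.mspan k mm (E.Z G' k)" "b' \<in> E.B G' k" "e = v \<oplus>\<^bsub>E k\<^esub> b'"
    using reductionD(4)[OF red be(2) \<phi>e] by metis
  have v': "v \<in> E.E.mspan k mm (E.Z G k)" using v(1) E.E.mspan_mono[OF E.Z_mono[OF sub(1)]] by blast
  have b': "b' \<in> E.B G k" using v E.B_mono[OF sub(1)] by blast
  have "v \<in> carrier (E k)" "b' \<in> carrier (E k)"
    using subsetD[OF E.E.mspan_carrier[OF mm E.Z_carrier] v'] subsetD[OF E.B_carrier[OF G] b'] by auto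
  then have "w = v \<oplus>\<^bsub>E k\<^esub> (b \<oplus>\<^bsub>E k\<^esub> b')" using be(3) v(3) bc by (simp add: E.E.M.a_ac)
  then show "\<exists>v\<in>E.E.mspan k mm (E.Z G k). \<exists>b\<in>E.B G k. w = v \<oplus>\<^bsub>E k\<^esub> b"
    using v' E.B_add[OF G be(1) b'] by metis
next
  have G: "G \<subseteq> carrier S" using sub by auto
  fix w \<mu> assume w: "w \<in> F.Z G k" and \<mu>: "\<mu> \<in> mm"
  have \<mu>S: "\<mu> \<in> carrier S" using \<mu> mm by auto
  obtain b e where be: "b \<in> F.B G k" "e \<in> F.Z G' k" "w = b \<oplus>\<^bsub>F k\<^esub> e" by (rule F.rel_exact_Z[OF rF sub w])
  have bc: "b \<in> carrier (F k)" "e \<in> carrier (F k)" using subsetD[OF F.B_carrier[OF G] be(1)] subsetD[OF F.Z_carrier be(2)] by auto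
  have "\<mu> \<odot>\<^bsub>F k\<^esub> e \<in> F.B G k" using reductionD(5)[OF red be(2) \<mu>] F.B_mono[OF sub(1)] by blast
  moreover have "\<mu> \<odot>\<^bsub>F k\<^esub> b \<in> F.B G k"
  proof (cases k)
    case 0 then show ?thesis using be(1) \<mu>S by (simp add: cobd_def)
  next
    case (Suc j)
    then obtain u where u: "u \<in> F.T G j" "b = dF j u" using be(1) by (auto simp: cobd_def)
    have "\<mu> \<odot>\<^bsub>F k\<^esub> b = dF j (\<mu> \<odot>\<^bsub>F j\<^esub> u)" using u Suc \<mu>S F.T_carrier by (simp add: F.d.smult)
    then show ?thesis using F.E.tors_smult[OF G \<mu>S u(1)] Suc by (simp add: cobd_def)
  qed
  ultimately show "\<mu> \<odot>\<^bsub>F k\<^esub> w \<in> F.B G k"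
    using be(3) bc \<mu>S F.B_add[OF G] by (simp add: F.E.smult_r_distr)
qed

text \<open>Adding the elements \<open>G\<close>, which kill the zeroth cohomology, changes no cohomology; after that
  each of the \<open>fs\<close> raises the top degree by one.\<close>

theorem reduction_top:
  assumes red: "reduction {} 0" and G: "finite G" "G \<subseteq> H"
    and killE: "E.Z {} 0 \<subseteq> E.T G 0" and killF: "F.Z {} 0 \<subseteq> F.T G 0"
    and fs: "set fs \<subseteq> H" and Y: "finite Y" "Y \<subseteq> H"
    and eqE: "\<And>j. E.T (G \<union> set fs) j = E.T (G \<union> Y) j"
    and eqF: "\<And>j. F.T (G \<union> set fs) j = F.T (G \<union> Y) j"
  shows "reduction Y (length fs)"
proof -
  have car: "G \<subseteq> carrier S" "G \<union> Y \<subseteq> carrier S" using G Y E.H by auto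
  have rE: "E.rel_exact G {}" by (rule E.rel_exact_killed[OF G reductionD(1)[OF red] killE])
  have rF: "F.rel_exact G {}" by (rule F.rel_exact_killed[OF G reductionD(2)[OF red] killF])
  \<comment> \<open>Every degree 0 cocycle is already \<open>G\<close>-torsion and the degree 0
    coboundaries are zero, so in degree 0 the clauses for \<open>G\<close> and for \<open>{}\<close>
    are literally the same.\<close>
  have Z0: "E.Z G 0 = E.Z {} 0" "F.Z G 0 = F.Z {} 0" using killE killF by (auto simp: cocyc_def tors_def)
  have B0: "E.B G 0 = E.B {} 0" "F.B G 0 = F.B {} 0" by (auto simp: cobd_def)
  have V: "0 < i \<Longrightarrow> E.Z G i \<subseteq> E.B G i" "0 < i \<Longrightarrow> F.Z G i \<subseteq> F.B G i" for i
    using E.rel_exact_vanish[OF rE _ car(1) reductionD(1)[OF red]]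
      F.rel_exact_vanish[OF rF _ car(1) reductionD(2)[OF red]] by auto
  have "reduction G 0"
    using red V unfolding reduction_def Z0 B0 by simp
  then have "reduction (G \<union> set fs) (length fs)" using reduction_steps[OF G _ fs, of 0] by simp
  then have "reduction (G \<union> Y) (length fs)" by (rule reduction_cong) (rule eqE, rule eqF)
  moreover have "E.rel_exact (G \<union> Y) ({} \<union> Y)" by (rule E.rel_exact_Un[OF rE]) (use G Y in auto)
  moreover have "F.rel_exact (G \<union> Y) ({} \<union> Y)" by (rule F.rel_exact_Un[OF rF]) (use G Y in auto)
  ultimately show ?thesis using reduction_rel_exact[of "G \<union> Y" "length fs" Y] car by simp
qed

end

section \<open>Polynomial rings\<close>

lemma finite_submultisets: "finite {v. v \<subseteq># (u :: 'a multiset)}"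
proof (induction u)
  case (add x u)
  have "{v. v \<subseteq># add_mset x u} \<subseteq> {v. v \<subseteq># u} \<union> add_mset x ` {v. v \<subseteq># u}"
  proof (clarsimp)
    fix v assume v: "v \<subseteq># add_mset x u" "v \<notin> add_mset x ` {v. v \<subseteq># u}"
    show "v \<subseteq># u"
    proof (cases "x \<in># v")
      case True
      then have "v = add_mset x (v - {#x#})" by simp
      moreover have "v - {#x#} \<subseteq># u" using v(1) by (simp add: subset_eq_diff_conv)
      ultimately show ?thesis using v(2) by blast
    next
      case False
      then show ?thesis using v(1) by (metis diff_single_trivial subset_eq_diff_conv add_mset_add_single)
    qed
  qed
  then show ?case using add finite_subset by fastforce
qed simp

text \<open>Test modules for injectivity have carriers in the element type of the ring; ideals of
  \<open>S\<close> enter them as submodules of this module.\<close>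

definition self_module :: "'s ring \<Rightarrow> ('s, 's) module" where
  "self_module S = ring.extend S (module.fields (monoid.mult S))"

lemma self_module_sel [simp]:
  "carrier (self_module S) = carrier S" "monoid.mult (self_module S) = monoid.mult S"
  "one (self_module S) = one S" "ring.zero (self_module S) = ring.zero S" "add (self_module S) = add S"
  "smult (self_module S) = monoid.mult S"
  by (simp_all add: self_module_def ring.defs module.defs)

lemma module_self: "cring S \<Longrightarrow> module S (self_module S)"
proof -
  assume "cring S"
  then interpret cring S .
  have "abelian_group (self_module S)"
    by (rule abelian_groupI) (auto simp: a_ac intro!: bexI[of _ "\<ominus>\<^bsub>S\<^esub> _"] l_neg)
  then show ?thesis
    by (intro moduleI) (auto simp: is_cring l_distr r_distr m_assoc)
qed

lemma finsum_self_module [simp]: "finsum (self_module S) f A = finsum S f A"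
  by (simp add: finsum_def finprod_def)

lemma a_inv_self_module [simp]: "\<ominus>\<^bsub>self_module S\<^esub> x = \<ominus>\<^bsub>S\<^esub> x"
  by (simp add: a_inv_def m_inv_def)

lemma submultiset_diff_diff: "v \<subseteq># u \<Longrightarrow> u - (u - v) = v"
  by (rule multiset_eqI) (simp add: subseteq_mset_def)

section \<open>The convolution product and the ring laws\<close>

context cring
begin

text \<open>Meaningful for arbitrary coefficient functions, since a multiset has only finitely many
  submultisets. Commutativity and distributivity therefore hold without finite support.\<close>

definition conv :: "('c multiset \<Rightarrow> 'a) \<Rightarrow> ('c multiset \<Rightarrow> 'a) \<Rightarrow> 'c multiset \<Rightarrow> 'a" where
  "conv P Q u = (\<Oplus>v\<in>{v. v \<subseteq># u}. P v \<otimes> Q (u - v))"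

lemma indexed_padd_assoc:
  "carrier_coeff P \<Longrightarrow> carrier_coeff Q \<Longrightarrow> carrier_coeff T \<Longrightarrow>
    indexed_padd (indexed_padd P Q) T = indexed_padd P (indexed_padd Q T)"
  by (simp add: indexed_padd_def carrier_coeff_def a_assoc)

lemma indexed_padd_comm: "carrier_coeff P \<Longrightarrow> carrier_coeff Q \<Longrightarrow> indexed_padd P Q = indexed_padd Q P"
  unfolding indexed_padd_def carrier_coeff_def by (intro ext a_comm) auto

lemma conv_closed: "carrier_coeff P \<Longrightarrow> carrier_coeff Q \<Longrightarrow> carrier_coeff (conv P Q)"
  by (auto simp: carrier_coeff_def conv_def intro!: finsum_closed)

lemma conv_comm:
  assumes "carrier_coeff P" "carrier_coeff Q"
  shows "conv P Q = conv Q P"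
proof
  fix u
  have "conv P Q u = (\<Oplus>v\<in>(\<lambda>v. u - v) ` {v. v \<subseteq># u}. P v \<otimes> Q (u - v))"
  proof -
    have "(\<lambda>v. u - v) ` {v. v \<subseteq># u} = {v. v \<subseteq># u}"
    proof (intro equalityI subsetI)
      fix v assume "v \<in> {v. v \<subseteq># u}"
      then show "v \<in> (\<lambda>v. u - v) ` {v. v \<subseteq># u}"
        by (intro image_eqI[of _ _ "u - v"]) (auto simp: submultiset_diff_diff)
    qed auto
    then show ?thesis by (simp add: conv_def)
  qed
  also have "\<dots> = (\<Oplus>v\<in>{v. v \<subseteq># u}. P (u - v) \<otimes> Q (u - (u - v)))"
    using assms
    by (intro add.finprod_reindex) (auto simp: carrier_coeff_def intro!: inj_on_inverseI[of _ "\<lambda>v. u - v"] submultiset_diff_diff)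
  also have "\<dots> = conv Q P u"
    unfolding conv_def using assms
    by (intro finsum_cong') (auto simp: carrier_coeff_def m_comm submultiset_diff_diff)
  finally show "conv P Q u = conv Q P u" .
qed

lemma conv_add_left:
  assumes "carrier_coeff P" "carrier_coeff P'" "carrier_coeff Q"
  shows "conv (indexed_padd P P') Q = indexed_padd (conv P Q) (conv P' Q)"
proof
  fix u
  have "conv (indexed_padd P P') Q u = (\<Oplus>v\<in>{v. v \<subseteq># u}. P v \<otimes> Q (u - v) \<oplus> P' v \<otimes> Q (u - v))"
    unfolding conv_def indexed_padd_def using assms
    by (intro finsum_cong') (auto simp: carrier_coeff_def l_distr)
  also have "\<dots> = conv P Q u \<oplus> conv P' Q u"
    unfolding conv_def using assms by (intro finsum_addf) (auto simp: carrier_coeff_def)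
  finally show "conv (indexed_padd P P') Q u = indexed_padd (conv P Q) (conv P' Q) u"
    by (simp add: indexed_padd_def)
qed

lemma conv_add_right:
  "carrier_coeff P \<Longrightarrow> carrier_coeff P' \<Longrightarrow> carrier_coeff Q \<Longrightarrow>
    conv Q (indexed_padd P P') = indexed_padd (conv Q P) (conv Q P')"
  using conv_add_left[of P P' Q] by (simp add: conv_comm[of Q] indexed_padd_in_carrier)

text \<open>Shifting coefficients by one variable commutes with convolution. Together with
  \<open>conv_const_right\<close> this allows laws to be proved by induction over
  \<open>indexed_pset\<close>.\<close>

lemma conv_pmult_right:
  assumes "carrier_coeff P" "carrier_coeff Q"
  shows "conv P (indexed_pmult Q i) = indexed_pmult (conv P Q) i"
proof
  fix u :: "'c multiset"
  show "conv P (indexed_pmult Q i) u = indexed_pmult (conv P Q) i u"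
  proof (cases "i \<in># u")
    case True
    have "conv P (indexed_pmult Q i) u = (\<Oplus>v\<in>{v. v \<subseteq># u - {#i#}}. P v \<otimes> Q (u - {#i#} - v))"
      unfolding conv_def
    proof (rule add.finprod_mono_neutral_cong_right)
      show "{v. v \<subseteq># u - {#i#}} \<subseteq> {v. v \<subseteq># u}"
        using diff_subset_eq_self subset_mset.order_trans by blast
      show "P v \<otimes> indexed_pmult Q i (u - v) = \<zero>"
        if "v \<in> {v. v \<subseteq># u} - {v. v \<subseteq># u - {#i#}}" for v
      proof -
        have "i \<notin># u - v"
        proof
          assume "i \<in># u - v"
          then have "v + {#i#} \<subseteq># u"
            using that by (auto simp: subseteq_mset_def in_diff_count Suc_le_eq)
          then show False using that by (simp add: subset_mset.le_diff_conv2 True)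
        qed
        then show ?thesis using assms by (simp add: indexed_pmult_def carrier_coeff_def)
      qed
      show "P v \<otimes> indexed_pmult Q i (u - v) = P v \<otimes> Q (u - {#i#} - v)" if "v \<in> {v. v \<subseteq># u - {#i#}}" for v
      proof -
        have "v + {#i#} \<subseteq># u" using that True by (simp add: subset_mset.le_diff_conv2)
        then have "i \<in># u - v" using mset_subset_eq_count[of "v + {#i#}" u i] by (simp add: in_diff_count)
        then show ?thesis by (simp add: indexed_pmult_def diff_right_commute[of u v])
      qed
    qed (use assms in \<open>auto simp: finite_submultisets carrier_coeff_def indexed_pmult_def\<close>)
    then show ?thesis using True by (simp add: indexed_pmult_def conv_def)
  next
    case False
    have "P v \<otimes> indexed_pmult Q i (u - v) = \<zero>" for v
      using False assms by (auto simp: indexed_pmult_def carrier_coeff_def dest: in_diffD)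
    then show ?thesis using False by (simp add: indexed_pmult_def conv_def)
  qed
qed

lemma conv_const_right:
  assumes "carrier_coeff P" "k \<in> carrier R"
  shows "conv P (indexed_const k) = (\<lambda>u. P u \<otimes> k)"
proof
  fix u
  have "conv P (indexed_const k) u = (\<Oplus>v\<in>{u}. P v \<otimes> k)"
    unfolding conv_def
  proof (rule add.finprod_mono_neutral_cong_right)
    show "P v \<otimes> indexed_const k (u - v) = \<zero>" if "v \<in> {v. v \<subseteq># u} - {u}" for v
    proof -
      have "u - v \<noteq> {#}" using that by (auto simp: Diff_eq_empty_iff_mset subset_mset.antisym)
      then show ?thesis using assms by (simp add: indexed_const_def carrier_coeff_def)
    qed
  qed (use assms in \<open>auto simp: finite_submultisets carrier_coeff_def indexed_const_def\<close>)
  then show "conv P (indexed_const k) u = P u \<otimes> k" using assms by (simp add: carrier_coeff_def)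
qed

context
  fixes n :: nat
begin

abbreviation "PS \<equiv> indexed_pset {..<n} (carrier R)"
abbreviation "PR \<equiv> mpoly_ring R n"

lemma PS_coeff: "P \<in> PS \<Longrightarrow> carrier_coeff P"
  by (rule indexed_pset_in_carrier[OF subset_refl])

lemma PS_scale: "P \<in> PS \<Longrightarrow> k \<in> carrier R \<Longrightarrow> (\<lambda>u. P u \<otimes> k) \<in> PS"
proof (induction rule: indexed_pset.induct)
  case (indexed_const c)
  have "(\<lambda>u. indexed_const c u \<otimes> k) = (indexed_const (c \<otimes> k) :: nat multiset \<Rightarrow> 'a)"
    using indexed_const by (auto simp: indexed_const_def)
  then show ?case using indexed_const by (simp add: indexed_pset.indexed_const)
next
  case (indexed_padd P Q)
  have "(\<lambda>u. indexed_padd P Q u \<otimes> k) = indexed_padd (\<lambda>u. P u \<otimes> k) (\<lambda>u. Q u \<otimes> k)"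
    using indexed_padd PS_coeff by (auto simp: indexed_padd_def carrier_coeff_def l_distr)
  then show ?case using indexed_padd by (simp add: indexed_pset.indexed_padd)
next
  case (indexed_pmult P i)
  have "(\<lambda>u. indexed_pmult P i u \<otimes> k) = indexed_pmult (\<lambda>u. P u \<otimes> k) i"
    using indexed_pmult by (auto simp: indexed_pmult_def)
  then show ?case using indexed_pmult by (simp add: indexed_pset.indexed_pmult)
qed

lemma PS_conv: assumes "P \<in> PS" shows "Q \<in> PS \<Longrightarrow> conv P Q \<in> PS"
proof (induction Q rule: indexed_pset.induct)
  case (indexed_const c) then show ?case by (simp add: assms conv_const_right PS_coeff PS_scale)
next
  case (indexed_padd Q Q') then show ?case by (simp add: assms conv_add_right PS_coeff indexed_pset.indexed_padd)
next
  case (indexed_pmult Q i) then show ?case by (simp add: assms conv_pmult_right PS_coeff indexed_pset.indexed_pmult)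
qed

text \<open>Induction on the polynomial \<open>T\<close> replaces the reindexing of a double sum
  over submultisets.\<close>

lemma conv_assoc:
  assumes "carrier_coeff P" "carrier_coeff Q" "T \<in> PS"
  shows "conv (conv P Q) T = conv P (conv Q T)"
  using assms(3)
proof (induction T rule: indexed_pset.induct)
  case (indexed_const c)
  have "conv P Q u \<otimes> c = conv P (\<lambda>u. Q u \<otimes> c) u" for u
    unfolding conv_def using assms indexed_const
    by (subst finsum_ldistr) (auto simp: finite_submultisets carrier_coeff_def m_assoc intro!: finsum_cong')
  then show ?case using indexed_const assms by (simp add: conv_const_right conv_closed fun_eq_iff)
next
  case (indexed_padd T T')
  then show ?case using assms by (simp add: conv_add_right PS_coeff conv_closed)
next
  case (indexed_pmult T i)
  then show ?case using assms by (simp add: conv_pmult_right PS_coeff conv_closed)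
qed

lemma mpoly_sel:
  "carrier PR = PS" "P \<otimes>\<^bsub>PR\<^esub> Q = conv P Q" "\<one>\<^bsub>PR\<^esub> = indexed_const \<one>"
  "\<zero>\<^bsub>PR\<^esub> = indexed_const \<zero>" "P \<oplus>\<^bsub>PR\<^esub> Q = indexed_padd P Q"
  by (simp_all add: mpoly_ring_def conv_def fun_eq_iff)

lemma mpoly_cring: "cring PR"
proof (rule cringI)
  show "abelian_group PR"
  proof (rule abelian_groupI)
    fix P assume P: "P \<in> carrier PR"
    then have "(\<lambda>u. P u \<otimes> \<ominus> \<one>) \<in> carrier PR" using PS_scale by (simp add: mpoly_sel)
    moreover have "(\<lambda>u. P u \<otimes> \<ominus> \<one>) \<oplus>\<^bsub>PR\<^esub> P = \<zero>\<^bsub>PR\<^esub>"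
    proof -
      have "P u \<otimes> \<ominus> \<one> \<oplus> P u = \<zero>" for u
      proof -
        have "P u \<in> carrier R" using P carrier_coeffE[OF PS_coeff] by (simp add: mpoly_sel)
        then show ?thesis by (simp add: r_minus l_neg)
      qed
      then show ?thesis by (simp add: mpoly_sel indexed_padd_def indexed_zero_def)
    qed
    ultimately show "\<exists>Q\<in>carrier PR. Q \<oplus>\<^bsub>PR\<^esub> P = \<zero>\<^bsub>PR\<^esub>" by blast
  next
    fix P Q assume "P \<in> carrier PR" "Q \<in> carrier PR"
    then show "P \<oplus>\<^bsub>PR\<^esub> Q \<in> carrier PR" "P \<oplus>\<^bsub>PR\<^esub> Q = Q \<oplus>\<^bsub>PR\<^esub> P"
      using indexed_padd_comm[OF PS_coeff PS_coeff] by (auto simp: mpoly_sel intro: indexed_pset.indexed_padd)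
  next
    fix P Q T assume "P \<in> carrier PR" "Q \<in> carrier PR" "T \<in> carrier PR"
    then show "P \<oplus>\<^bsub>PR\<^esub> Q \<oplus>\<^bsub>PR\<^esub> T = P \<oplus>\<^bsub>PR\<^esub> (Q \<oplus>\<^bsub>PR\<^esub> T)"
      using indexed_padd_assoc[OF PS_coeff PS_coeff PS_coeff] by (simp add: mpoly_sel)
  next
    show "\<zero>\<^bsub>PR\<^esub> \<in> carrier PR" by (simp add: mpoly_sel indexed_pset.indexed_const)
  next
    fix P assume "P \<in> carrier PR"
    then show "\<zero>\<^bsub>PR\<^esub> \<oplus>\<^bsub>PR\<^esub> P = P" using indexed_padd_zero(2)[OF PS_coeff] by (simp add: mpoly_sel)
  qed
  show "comm_monoid PR"
  proof (rule comm_monoidI)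
    fix P Q assume PQ: "P \<in> carrier PR" "Q \<in> carrier PR"
    then show "P \<otimes>\<^bsub>PR\<^esub> Q \<in> carrier PR" "P \<otimes>\<^bsub>PR\<^esub> Q = Q \<otimes>\<^bsub>PR\<^esub> P"
      using PS_conv[of P Q] conv_comm[OF PS_coeff PS_coeff, of P Q] by (simp_all add: mpoly_sel)
  next
    fix P Q T assume "P \<in> carrier PR" "Q \<in> carrier PR" "T \<in> carrier PR"
    then show "P \<otimes>\<^bsub>PR\<^esub> Q \<otimes>\<^bsub>PR\<^esub> T = P \<otimes>\<^bsub>PR\<^esub> (Q \<otimes>\<^bsub>PR\<^esub> T)"
      using conv_assoc[OF PS_coeff PS_coeff] by (simp add: mpoly_sel)
  next
    show "\<one>\<^bsub>PR\<^esub> \<in> carrier PR" by (simp add: mpoly_sel indexed_pset.indexed_const)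
  next
    fix P assume "P \<in> carrier PR"
    then have P: "P \<in> PS" by (simp add: mpoly_sel)
    have "conv (indexed_const \<one>) P = conv P (indexed_const \<one>)"
      by (rule conv_comm) (simp_all add: PS_coeff P indexed_pset.indexed_const)
    also have "\<dots> = P" using carrier_coeffE[OF PS_coeff[OF P]] by (simp add: conv_const_right PS_coeff P)
    finally show "\<one>\<^bsub>PR\<^esub> \<otimes>\<^bsub>PR\<^esub> P = P" by (simp add: mpoly_sel)
  qed
qed (auto simp: mpoly_sel conv_add_left PS_coeff)

lemma const_hom: "indexed_const \<in> ring_hom R PR"
  by (rule ring_hom_memI)
    (auto simp: mpoly_sel indexed_pset.indexed_const conv_const_right PS_coeff indexed_padd_const,
     auto simp: indexed_const_def)

lemma mult_var: "P \<in> carrier PR \<Longrightarrow> P \<otimes>\<^bsub>PR\<^esub> indexed_var i = indexed_pmult P i"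
  by (auto simp: mpoly_sel indexed_var_def conv_pmult_right PS_coeff indexed_pset.indexed_const
      conv_const_right carrier_coeffE[OF PS_coeff])

lemma var_closed: "i < n \<Longrightarrow> indexed_var i \<in> carrier PR"
  by (auto simp: mpoly_sel indexed_var_def intro!: indexed_pset.indexed_const indexed_pset.indexed_pmult)

lemma mpoly_induct [consumes 1, case_names const add var]:
  assumes "P \<in> carrier PR" "\<And>k. k \<in> carrier R \<Longrightarrow> Q (indexed_const k)"
    "\<And>A B. A \<in> carrier PR \<Longrightarrow> B \<in> carrier PR \<Longrightarrow> Q A \<Longrightarrow> Q B \<Longrightarrow> Q (A \<oplus>\<^bsub>PR\<^esub> B)"
    "\<And>A i. A \<in> carrier PR \<Longrightarrow> i < n \<Longrightarrow> Q A \<Longrightarrow> Q (A \<otimes>\<^bsub>PR\<^esub> indexed_var i)"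
  shows "Q P"
  using assms(1) unfolding mpoly_sel
proof (induction rule: indexed_pset.induct)
  case (indexed_const k) then show ?case using assms by simp
next
  case (indexed_padd A B) then show ?case using assms(3) by (simp add: mpoly_sel)
next
  case (indexed_pmult A i) then show ?case using assms(4)[of A i] mult_var[of A i] by (simp add: mpoly_sel)
qed

subsection \<open>The grading\<close>

context
  fixes w :: "nat \<Rightarrow> nat"
begin

abbreviation "Sg \<equiv> mpoly_grading R n w"
abbreviation "dg u \<equiv> (\<Sum>i\<in>#u. int (w i))"

definition hcomp :: "int \<Rightarrow> (nat multiset \<Rightarrow> 'a) \<Rightarrow> nat multiset \<Rightarrow> 'a" where
  "hcomp j P = (\<lambda>u. if dg u = j then P u else \<zero>)"

lemma dg_nonneg: "0 \<le> dg u"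
  by (induction u) auto

lemma hcomp_PS: "P \<in> PS \<Longrightarrow> hcomp j P \<in> PS"
proof (induction arbitrary: j rule: indexed_pset.induct)
  case (indexed_const c)
  have "hcomp j (indexed_const c) = indexed_const (if j = 0 then c else \<zero>)"
    by (auto simp: hcomp_def indexed_const_def)
  then show ?case using indexed_const by (auto intro: indexed_pset.indexed_const)
next
  case (indexed_padd P Q)
  have "hcomp j (indexed_padd P Q) = indexed_padd (hcomp j P) (hcomp j Q)"
    by (auto simp: hcomp_def indexed_padd_def)
  then show ?case using indexed_padd by (auto intro: indexed_pset.indexed_padd)
next
  case (indexed_pmult P i)
  have "hcomp j (indexed_pmult P i) = indexed_pmult (hcomp (j - w i) P) i"
    by (auto simp: hcomp_def indexed_pmult_def fun_eq_iff dest!: multi_member_split)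
  then show ?case using indexed_pmult by (auto intro: indexed_pset.indexed_pmult)
qed

lemma finite_support: "P \<in> PS \<Longrightarrow> finite {u. P u \<noteq> \<zero>}"
proof (induction rule: indexed_pset.induct)
  case (indexed_const c)
  show ?case by (rule finite_subset[of _ "{{#}}"]) (auto simp: indexed_const_def)
next
  case (indexed_padd P Q)
  show ?case
    by (rule finite_subset[of _ "{u. P u \<noteq> \<zero>} \<union> {u. Q u \<noteq> \<zero>}"]) (use indexed_padd in \<open>auto simp: indexed_padd_def\<close>)
next
  case (indexed_pmult P i)
  show ?case
    by (rule finite_subset[of _ "add_mset i ` {u. P u \<noteq> \<zero>}"])
      (use indexed_pmult in \<open>auto simp: indexed_pmult_def split: if_splits dest!: multi_member_split\<close>)
qed

lemma hcomp_Sg: "P \<in> PS \<Longrightarrow> hcomp j P \<in> Sg j"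
  by (auto simp: mpoly_grading_def hcomp_PS mpoly_sel) (auto simp: hcomp_def split: if_splits)

lemma finsum_apply: "finite A \<Longrightarrow> c \<in> A \<rightarrow> carrier PR \<Longrightarrow> finsum PR c A u = (\<Oplus>j\<in>A. c j u)"
proof (induction A rule: finite_induct)
  case empty
  interpret S: cring PR by (rule mpoly_cring)
  show ?case by (simp add: mpoly_sel indexed_zero_def)
next
  case (insert j A)
  interpret S: cring PR by (rule mpoly_cring)
  have "(\<lambda>j. c j u) \<in> A \<rightarrow> carrier R" "c j u \<in> carrier R"
    using insert carrier_coeffE[OF PS_coeff] by (auto simp: mpoly_sel Pi_iff)
  then show ?case using insert by (simp add: mpoly_sel indexed_padd_def)
qed

text \<open>At the monomial \<open>u\<close> only the summand of degree \<open>dg u\<close> can be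
  nonzero. Applied to an arbitrary decomposition, this yields its uniqueness.\<close>

lemma sum_homogeneous_apply:
  assumes A: "finite A" and c: "\<And>j. c j \<in> Sg j" and c0: "\<And>j. j \<notin> A \<Longrightarrow> c j = \<zero>\<^bsub>PR\<^esub>"
  shows "finsum PR c A u = c (dg u) u"
proof -
  have cS: "c j \<in> carrier PR" for j using c by (auto simp: mpoly_grading_def)
  have cu: "c j u \<in> carrier R" for j using carrier_coeffE[OF PS_coeff] cS by (simp add: mpoly_sel)
  have z: "c j u = \<zero>" if "j \<noteq> dg u" for j using c[of j] that by (auto simp: mpoly_grading_def)
  have "finsum PR c A u = (\<Oplus>j\<in>A. c j u)" using A cS by (intro finsum_apply) auto
  also have "\<dots> = c (dg u) u"
  proof (cases "dg u \<in> A")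
    case True
    have "(\<Oplus>j\<in>A. c j u) = (\<Oplus>j\<in>{dg u}. c j u)"
      by (rule add.finprod_mono_neutral_cong_right) (use True A z cu in auto)
    then show ?thesis using cu by simp
  next
    case False
    then have "(\<Oplus>j\<in>A. c j u) = (\<Oplus>j\<in>A. \<zero>)" by (intro finsum_cong') (auto intro!: z)
    then show ?thesis using c0[OF False] by (simp add: mpoly_sel indexed_zero_def)
  qed
  finally show ?thesis .
qed

lemma Sg_mult:
  assumes "a \<in> Sg i" "b \<in> Sg j" shows "a \<otimes>\<^bsub>PR\<^esub> b \<in> Sg (i + j)"
proof -
  interpret S: cring PR by (rule mpoly_cring)
  have ab: "a \<in> PS" "b \<in> PS" using assms by (auto simp: mpoly_grading_def mpoly_sel)
  have "conv a b u = \<zero>" if u: "dg u \<noteq> i + j" for u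
  proof -
    have "a v \<otimes> b (u - v) = \<zero>" if v: "v \<subseteq># u" for v
    proof -
      have "dg u = dg v + dg (u - v)"
        using v by (metis image_mset_union subset_mset.add_diff_inverse sum_mset.union)
      then have "dg v \<noteq> i \<or> dg (u - v) \<noteq> j" using u by auto
      then have "a v = \<zero> \<or> b (u - v) = \<zero>" using assms by (auto simp: mpoly_grading_def)
      then show ?thesis using ab carrier_coeffE[OF PS_coeff] by auto
    qed
    then have "conv a b u = (\<Oplus>v\<in>{v. v \<subseteq># u}. \<zero>)" unfolding conv_def by (intro finsum_cong') auto
    then show ?thesis by simp
  qed
  then show ?thesis using ab by (auto simp: mpoly_grading_def mpoly_sel PS_conv)
qed

lemma mpoly_graded: "graded_module PR Sg (self_module PR) Sg"
  unfolding graded_module_def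
proof (intro conjI allI ballI)
  interpret S: cring PR by (rule mpoly_cring)
  show "module PR (self_module PR)" by (rule module_self[OF mpoly_cring])
  then interpret SM: module PR "self_module PR" .
  fix j
  have neg: "(\<ominus>\<^bsub>PR\<^esub> P) u = \<ominus> P u" if P: "P \<in> carrier PR" for P u
  proof -
    have "(\<ominus>\<^bsub>PR\<^esub> P) u \<in> carrier R" "P u \<in> carrier R"
      using P carrier_coeffE[OF PS_coeff] S.a_inv_closed[OF P] by (simp_all add: mpoly_sel)
    moreover have "(\<ominus>\<^bsub>PR\<^esub> P) u \<oplus> P u = \<zero>"
      using fun_cong[OF S.l_neg[OF P, unfolded mpoly_sel indexed_padd_def indexed_zero_def], of u] .
    ultimately show ?thesis using minus_equality by simp
  qed
  show "subgroup (Sg j) (add_monoid (self_module PR))"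
  proof (rule group.subgroupI[OF SM.M.a_group])
    show "Sg j \<noteq> {}" using S.zero_closed by (auto simp: mpoly_grading_def mpoly_sel indexed_zero_def intro!: exI[of _ "\<lambda>_. \<zero>"])
    fix a assume "a \<in> Sg j"
    then have "\<ominus>\<^bsub>PR\<^esub> a \<in> Sg j" using neg by (auto simp: mpoly_grading_def) (metis minus_zero)
    then show "inv\<^bsub>add_monoid (self_module PR)\<^esub> a \<in> Sg j" using a_inv_self_module[of PR a] by (simp add: a_inv_def)
  next
    fix a b assume ab: "a \<in> Sg j" "b \<in> Sg j"
    then have S: "a \<in> carrier PR" "b \<in> carrier PR" unfolding mpoly_grading_def by blast+
    have "(a \<oplus>\<^bsub>PR\<^esub> b) u = \<zero>" if "dg u \<noteq> j" for u
    proof -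
      have "a u = \<zero>" "b u = \<zero>" using ab that unfolding mpoly_grading_def by blast+
      then show ?thesis by (simp add: mpoly_sel indexed_padd_def)
    qed
    then have "a \<oplus>\<^bsub>PR\<^esub> b \<in> Sg j" using S.a_closed[OF S] unfolding mpoly_grading_def by blast
    then show "a \<otimes>\<^bsub>add_monoid (self_module PR)\<^esub> b \<in> Sg j" by simp
  next
    show "Sg j \<subseteq> carrier (add_monoid (self_module PR))" unfolding mpoly_grading_def by auto
  qed
  show "a \<odot>\<^bsub>self_module PR\<^esub> x \<in> Sg (i + j)" if "a \<in> Sg i" "x \<in> Sg j" for i a x
    using Sg_mult that by simp
next
  interpret S: cring PR by (rule mpoly_cring)
  fix P assume "P \<in> carrier (self_module PR)"
  then have P: "P \<in> PS" by (simp add: mpoly_sel)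
  have hc: "hcomp j P \<in> Sg j" for j using hcomp_Sg[OF P] .
  show "\<exists>!c. (\<forall>j. c j \<in> Sg j) \<and> finite {j. c j \<noteq> \<zero>\<^bsub>self_module PR\<^esub>} \<and>
      P = finsum (self_module PR) c {j. c j \<noteq> \<zero>\<^bsub>self_module PR\<^esub>}"
  proof (rule ex1I[of _ "\<lambda>j. hcomp j P"], intro conjI allI)
    have "{j. hcomp j P \<noteq> \<zero>\<^bsub>PR\<^esub>} \<subseteq> dg ` {u. P u \<noteq> \<zero>}"
    proof (intro subsetI)
      fix j assume "j \<in> {j. hcomp j P \<noteq> \<zero>\<^bsub>PR\<^esub>}"
      then obtain u where "hcomp j P u \<noteq> \<zero>" by (auto simp: mpoly_sel indexed_zero_def fun_eq_iff)
      then have "j = dg u" "P u \<noteq> \<zero>" by (auto simp: hcomp_def split: if_splits)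
      then show "j \<in> dg ` {u. P u \<noteq> \<zero>}" by blast
    qed
    from finite_subset[OF this finite_imageI[OF finite_support[OF P]]]
    show fin: "finite {j. hcomp j P \<noteq> \<zero>\<^bsub>self_module PR\<^esub>}" by simp
    have "finsum PR (\<lambda>j. hcomp j P) {j. hcomp j P \<noteq> \<zero>\<^bsub>PR\<^esub>} u = P u" for u
    proof -
      have "finsum PR (\<lambda>j. hcomp j P) {j. hcomp j P \<noteq> \<zero>\<^bsub>PR\<^esub>} u = hcomp (dg u) P u"
        by (rule sum_homogeneous_apply) (use fin hc in auto)
      then show ?thesis by (simp add: hcomp_def)
    qed
    then show "P = finsum (self_module PR) (\<lambda>j. hcomp j P) {j. hcomp j P \<noteq> \<zero>\<^bsub>self_module PR\<^esub>}"
      by (simp add: fun_eq_iff)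
  next
    fix c assume c: "(\<forall>j. c j \<in> Sg j) \<and> finite {j. c j \<noteq> \<zero>\<^bsub>self_module PR\<^esub>} \<and>
      P = finsum (self_module PR) c {j. c j \<noteq> \<zero>\<^bsub>self_module PR\<^esub>}"
    then have cS: "c j \<in> Sg j" for j by blast
    have fin: "finite {j. c j \<noteq> \<zero>\<^bsub>PR\<^esub>}" and Pc: "P = finsum PR c {j. c j \<noteq> \<zero>\<^bsub>PR\<^esub>}" using c by auto
    have Pu: "P u = c (dg u) u" for u
      unfolding Pc by (rule sum_homogeneous_apply) (use fin cS in auto)
    have "c j u = \<zero>" if "dg u \<noteq> j" for j u using cS[of j] that unfolding mpoly_grading_def by blast
    then have "c j u = hcomp j P u" for j u by (simp add: hcomp_def Pu)
    then show "c = (\<lambda>j. hcomp j P)" by (intro ext)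
  qed (rule hc)
qed

lemma Sg_neg: "j < 0 \<Longrightarrow> Sg j = {\<zero>\<^bsub>PR\<^esub>}"
proof -
  interpret S: cring PR by (rule mpoly_cring)
  assume j: "j < 0"
  have "P u = \<zero>" if "P \<in> Sg j" for P u using that j dg_nonneg[of u] by (force simp: mpoly_grading_def)
  then show ?thesis using S.zero_closed by (auto simp: mpoly_grading_def mpoly_sel indexed_zero_def)
qed

lemma const_Sg: "k \<in> carrier R \<Longrightarrow> indexed_const k \<in> Sg 0"
  by (auto simp: mpoly_grading_def mpoly_sel indexed_pset.indexed_const) (auto simp: indexed_const_def split: if_splits)

lemma var_Sg: "i < n \<Longrightarrow> indexed_var i \<in> Sg (int (w i))"
  using var_closed by (auto simp: mpoly_grading_def)
    (auto simp: indexed_var_def indexed_pmult_def indexed_const_def split: if_splits dest!: multi_member_split)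

text \<open>Weights are known to be positive only for indices below \<open>n\<close>, so
  \<open>supp\<close> first shows that no other variable occurs. A nonempty monomial then has
  positive degree and only the constant term survives.\<close>

lemma Sg_0:
  assumes w: "\<And>i. i < n \<Longrightarrow> w i > 0" and P: "P \<in> Sg 0"
  shows "\<exists>k\<in>carrier R. P = indexed_const k"
proof -
  have supp: "P \<in> PS \<Longrightarrow> P u \<noteq> \<zero> \<Longrightarrow> set_mset u \<subseteq> {..<n}" for P u
  proof (induction arbitrary: u rule: indexed_pset.induct)
    case (indexed_const c)
    then show ?case by (cases "u = {#}") (auto simp: indexed_const_def)
  next
    case (indexed_pmult P i)
    then have iu: "i \<in># u" and "P (u - {#i#}) \<noteq> \<zero>" by (auto simp: indexed_pmult_def split: if_splits)
    then have "set_mset (u - {#i#}) \<subseteq> {..<n}" by (intro indexed_pmult.IH)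
    moreover have "set_mset u = insert i (set_mset (u - {#i#}))" using iu by (metis insert_DiffM set_mset_add_mset_insert)
    ultimately show ?case using indexed_pmult.hyps by auto
  next
    case (indexed_padd P Q)
    then have "P u \<noteq> \<zero> \<or> Q u \<noteq> \<zero>" by (auto simp: indexed_padd_def)
    then show ?case using indexed_padd.IH by blast
  qed
  have PS: "P \<in> PS" using P by (simp add: mpoly_grading_def mpoly_sel)
  have "P u = \<zero>" if un: "u \<noteq> {#}" for u
  proof (rule ccontr)
    assume nz: "P u \<noteq> \<zero>"
    obtain i v where u: "u = add_mset i v" using un by (cases u) auto
    have "i < n" using supp[OF PS nz] unfolding u by simp
    then have "dg u > 0" using w[of i] dg_nonneg[of v] unfolding u by simp
    moreover have "dg u = 0" using P nz unfolding mpoly_grading_def by blast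
    ultimately show False by simp
  qed
  then have "P = indexed_const (P {#})" unfolding indexed_const_def by (intro ext) simp
  then show ?thesis using carrier_coeffE[OF PS_coeff[OF PS]] by blast
qed

end

end

end

section \<open>Graded modules\<close>

locale graded_mod = module S M
  for S :: "('s, 'z) ring_scheme" (structure) and Sg :: "int \<Rightarrow> 's set"
    and M :: "('s, 'm) module" and Mg :: "int \<Rightarrow> 'm set" +
  assumes gm: "graded_module S Sg M Mg" and Sg_carrier: "Sg i \<subseteq> carrier S"
begin

definition gc :: "'m \<Rightarrow> int \<Rightarrow> 'm" where
  "gc x = (THE c. (\<forall>j. c j \<in> Mg j) \<and> finite {j. c j \<noteq> \<zero>\<^bsub>M\<^esub>} \<and> x = (\<Oplus>\<^bsub>M\<^esub>j\<in>{j. c j \<noteq> \<zero>\<^bsub>M\<^esub>}. c j))"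

lemma Mg_subgroup: "subgroup (Mg j) (add_monoid M)"
  using gm by (simp add: graded_module_def)

lemma Mg_carrier: "x \<in> Mg j \<Longrightarrow> x \<in> carrier M"
  using subgroup.mem_carrier[OF Mg_subgroup] by auto

lemma Mg_zero: "\<zero>\<^bsub>M\<^esub> \<in> Mg j"
  using subgroup.one_closed[OF Mg_subgroup] by simp

lemma Mg_add: "x \<in> Mg j \<Longrightarrow> y \<in> Mg j \<Longrightarrow> x \<oplus>\<^bsub>M\<^esub> y \<in> Mg j"
  using subgroup.m_closed[OF Mg_subgroup] by simp

lemma Mg_smult: "a \<in> Sg i \<Longrightarrow> x \<in> Mg j \<Longrightarrow> a \<odot>\<^bsub>M\<^esub> x \<in> Mg (i + j)"
  using gm by (simp add: graded_module_def)

lemma gc_the: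
  assumes "x \<in> carrier M"
  shows "(\<forall>j. gc x j \<in> Mg j) \<and> finite {j. gc x j \<noteq> \<zero>\<^bsub>M\<^esub>} \<and> x = (\<Oplus>\<^bsub>M\<^esub>j\<in>{j. gc x j \<noteq> \<zero>\<^bsub>M\<^esub>}. gc x j)"
proof -
  have "\<exists>!c. (\<forall>j. c j \<in> Mg j) \<and> finite {j. c j \<noteq> \<zero>\<^bsub>M\<^esub>} \<and> x = (\<Oplus>\<^bsub>M\<^esub>j\<in>{j. c j \<noteq> \<zero>\<^bsub>M\<^esub>}. c j)"
    using gm assms unfolding graded_module_def by blast
  from theI'[OF this] show ?thesis unfolding gc_def .
qed

lemma gc_Mg: "x \<in> carrier M \<Longrightarrow> gc x j \<in> Mg j"
  and gc_finite: "x \<in> carrier M \<Longrightarrow> finite {j. gc x j \<noteq> \<zero>\<^bsub>M\<^esub>}"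
  and gc_sum: "x \<in> carrier M \<Longrightarrow> (\<Oplus>\<^bsub>M\<^esub>j\<in>{j. gc x j \<noteq> \<zero>\<^bsub>M\<^esub>}. gc x j) = x"
  using gc_the[of x] by simp_all

lemma gc_closed [simp]: "x \<in> carrier M \<Longrightarrow> gc x j \<in> carrier M"
  by (rule Mg_carrier[OF gc_Mg])

lemma gc_sum_superset:
  assumes "x \<in> carrier M" "finite A" "{j. gc x j \<noteq> \<zero>\<^bsub>M\<^esub>} \<subseteq> A"
  shows "(\<Oplus>\<^bsub>M\<^esub>j\<in>A. gc x j) = x"
proof -
  have "(\<Oplus>\<^bsub>M\<^esub>j\<in>A. gc x j) = (\<Oplus>\<^bsub>M\<^esub>j\<in>{j. gc x j \<noteq> \<zero>\<^bsub>M\<^esub>}. gc x j)"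
    by (rule M.add.finprod_mono_neutral_cong_right) (use assms in auto)
  then show ?thesis using gc_sum[OF assms(1)] by simp
qed

lemma gc_unique:
  assumes A: "finite A" and c: "\<And>j. c j \<in> Mg j" and c0: "\<And>j. j \<notin> A \<Longrightarrow> c j = \<zero>\<^bsub>M\<^esub>"
    and x: "x = (\<Oplus>\<^bsub>M\<^esub>j\<in>A. c j)"
  shows "gc x = c"
proof -
  have sub: "{j. c j \<noteq> \<zero>\<^bsub>M\<^esub>} \<subseteq> A" using c0 by blast
  have cM: "c j \<in> carrier M" for j using c Mg_carrier by blast
  have "x = (\<Oplus>\<^bsub>M\<^esub>j\<in>{j. c j \<noteq> \<zero>\<^bsub>M\<^esub>}. c j)"
    unfolding x by (rule M.add.finprod_mono_neutral_cong_right) (use A sub cM in auto)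
  moreover have xM: "x \<in> carrier M" unfolding x using cM by (intro M.finsum_closed) auto
  moreover have "finite {j. c j \<noteq> \<zero>\<^bsub>M\<^esub>}" using A sub by (rule finite_subset[rotated])
  moreover have "\<exists>!c. (\<forall>j. c j \<in> Mg j) \<and> finite {j. c j \<noteq> \<zero>\<^bsub>M\<^esub>} \<and> x = (\<Oplus>\<^bsub>M\<^esub>j\<in>{j. c j \<noteq> \<zero>\<^bsub>M\<^esub>}. c j)"
    using gm xM unfolding graded_module_def by blast
  ultimately show ?thesis using gc_the[OF xM] c by (blast dest: ex1_implies_ex)
qed

lemma gc_homogeneous: "x \<in> Mg i \<Longrightarrow> gc x j = (if j = i then x else \<zero>\<^bsub>M\<^esub>)"
  by (rule fun_cong[OF gc_unique[of "{i}"]]) (auto simp: Mg_zero Mg_carrier)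

lemma gc_zero [simp]: "gc \<zero>\<^bsub>M\<^esub> j = \<zero>\<^bsub>M\<^esub>"
  using gc_homogeneous[OF Mg_zero, of j j] by simp

lemma gc_add:
  assumes "x \<in> carrier M" "y \<in> carrier M"
  shows "gc (x \<oplus>\<^bsub>M\<^esub> y) j = gc x j \<oplus>\<^bsub>M\<^esub> gc y j"
proof (rule fun_cong[OF gc_unique[of "{j. gc x j \<noteq> \<zero>\<^bsub>M\<^esub>} \<union> {j. gc y j \<noteq> \<zero>\<^bsub>M\<^esub>}"]])
  let ?A = "{j. gc x j \<noteq> \<zero>\<^bsub>M\<^esub>} \<union> {j. gc y j \<noteq> \<zero>\<^bsub>M\<^esub>}"
  show fin: "finite ?A" using assms by (simp add: gc_finite)
  have "(\<Oplus>\<^bsub>M\<^esub>j\<in>?A. gc x j \<oplus>\<^bsub>M\<^esub> gc y j) = (\<Oplus>\<^bsub>M\<^esub>j\<in>?A. gc x j) \<oplus>\<^bsub>M\<^esub> (\<Oplus>\<^bsub>M\<^esub>j\<in>?A. gc y j)"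
    using assms by (intro M.finsum_addf) auto
  moreover have "(\<Oplus>\<^bsub>M\<^esub>j\<in>?A. gc x j) = x" "(\<Oplus>\<^bsub>M\<^esub>j\<in>?A. gc y j) = y"
    by (rule gc_sum_superset; use assms fin in auto)+
  ultimately show "x \<oplus>\<^bsub>M\<^esub> y = (\<Oplus>\<^bsub>M\<^esub>j\<in>?A. gc x j \<oplus>\<^bsub>M\<^esub> gc y j)" by simp
qed (use assms in \<open>auto intro: Mg_add gc_Mg\<close>)

lemma gc_neg: "x \<in> carrier M \<Longrightarrow> gc (\<ominus>\<^bsub>M\<^esub> x) j = \<ominus>\<^bsub>M\<^esub> gc x j"
  by (metis M.a_inv_closed M.l_neg M.minus_equality gc_add gc_closed gc_zero)

lemma gc_diff: "x \<in> carrier M \<Longrightarrow> y \<in> carrier M \<Longrightarrow> gc (x \<ominus>\<^bsub>M\<^esub> y) j = gc x j \<ominus>\<^bsub>M\<^esub> gc y j"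
  by (simp add: M.minus_eq gc_add gc_neg)

lemma gc_smult:
  assumes a: "a \<in> Sg i" and x: "x \<in> carrier M"
  shows "gc (a \<odot>\<^bsub>M\<^esub> x) j = a \<odot>\<^bsub>M\<^esub> gc x (j - i)"
proof (rule fun_cong[OF gc_unique[of "(\<lambda>j. j + i) ` {j. gc x j \<noteq> \<zero>\<^bsub>M\<^esub>}"]])
  let ?A = "{j. gc x j \<noteq> \<zero>\<^bsub>M\<^esub>}"
  have aS: "a \<in> carrier S" using a Sg_carrier by blast
  show "finite ((\<lambda>j. j + i) ` ?A)" using gc_finite[OF x] by simp
  show "a \<odot>\<^bsub>M\<^esub> gc x (j - i) \<in> Mg j" for j using Mg_smult[OF a gc_Mg[OF x], of "j - i"] by simp
  show "a \<odot>\<^bsub>M\<^esub> gc x (j - i) = \<zero>\<^bsub>M\<^esub>" if "j \<notin> (\<lambda>j. j + i) ` ?A" for j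
  proof -
    have "gc x (j - i) = \<zero>\<^bsub>M\<^esub>"
    proof (rule ccontr)
      assume "gc x (j - i) \<noteq> \<zero>\<^bsub>M\<^esub>"
      then have "(j - i) + i \<in> (\<lambda>j. j + i) ` ?A" by blast
      then show False using that by simp
    qed
    then show ?thesis using aS by simp
  qed
  have "a \<odot>\<^bsub>M\<^esub> x = a \<odot>\<^bsub>M\<^esub> (\<Oplus>\<^bsub>M\<^esub>j\<in>?A. gc x j)" using gc_sum[OF x] by simp
  also have "\<dots> = (\<Oplus>\<^bsub>M\<^esub>j\<in>?A. a \<odot>\<^bsub>M\<^esub> gc x j)"
    by (rule finsum_smult_ldistr) (use gc_finite[OF x] aS x in auto)
  also have "\<dots> = (\<Oplus>\<^bsub>M\<^esub>j\<in>?A. a \<odot>\<^bsub>M\<^esub> gc x ((j + i) - i))" by simp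
  also have "\<dots> = (\<Oplus>\<^bsub>M\<^esub>j\<in>(\<lambda>j. j + i) ` ?A. a \<odot>\<^bsub>M\<^esub> gc x (j - i))"
    by (rule M.add.finprod_reindex[symmetric]) (use aS x in \<open>auto simp: inj_on_def\<close>)
  finally show "a \<odot>\<^bsub>M\<^esub> x = (\<Oplus>\<^bsub>M\<^esub>j\<in>(\<lambda>j. j + i) ` ?A. a \<odot>\<^bsub>M\<^esub> gc x (j - i))" .
qed

lemma finsum_induct:
  assumes "finite A" "f \<in> A \<rightarrow> carrier M" "P \<zero>\<^bsub>M\<^esub>" "\<And>i. i \<in> A \<Longrightarrow> P (f i)"
    "\<And>y z. y \<in> carrier M \<Longrightarrow> z \<in> carrier M \<Longrightarrow> P y \<Longrightarrow> P z \<Longrightarrow> P (y \<oplus>\<^bsub>M\<^esub> z)"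
  shows "P (\<Oplus>\<^bsub>M\<^esub>i\<in>A. f i)"
  using assms(1,2,4)
proof (induction A rule: finite_induct)
  case empty then show ?case using assms(3) by simp
next
  case (insert i A)
  have "(\<Oplus>\<^bsub>M\<^esub>i\<in>insert i A. f i) = f i \<oplus>\<^bsub>M\<^esub> (\<Oplus>\<^bsub>M\<^esub>i\<in>A. f i)"
    using insert by (intro M.finsum_insert) auto
  moreover have "(\<Oplus>\<^bsub>M\<^esub>i\<in>A. f i) \<in> carrier M" using insert by (intro M.finsum_closed) auto
  ultimately show ?case using insert assms(5) by auto
qed

text \<open>The case \<open>comp\<close> asks only about components of the given \<open>x\<close>,
  so facts special to \<open>x\<close> may be used there.\<close>

lemma graded_induct [consumes 1, case_names zero comp add]:
  assumes "x \<in> carrier M" "P \<zero>\<^bsub>M\<^esub>" "\<And>j. P (gc x j)"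
    "\<And>y z. y \<in> carrier M \<Longrightarrow> z \<in> carrier M \<Longrightarrow> P y \<Longrightarrow> P z \<Longrightarrow> P (y \<oplus>\<^bsub>M\<^esub> z)"
  shows "P x"
proof -
  have "P (\<Oplus>\<^bsub>M\<^esub>j\<in>{j. gc x j \<noteq> \<zero>\<^bsub>M\<^esub>}. gc x j)"
    by (rule finsum_induct) (use assms gc_finite in auto)
  then show ?thesis using gc_sum[OF assms(1)] by simp
qed

end

section \<open>Graded rings and homogeneous primes\<close>

lemma (in noetherian_ring) maximal_in_family:
  assumes "A \<noteq> {}" "\<And>I. I \<in> A \<Longrightarrow> ideal I R"
  shows "\<exists>J\<in>A. \<forall>I\<in>A. J \<subseteq> I \<longrightarrow> I = J"
proof (rule subset_Zorn_nonempty[OF assms(1)])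
  fix C assume C: "C \<noteq> {}" "subset.chain A C"
  then have "subset.chain {I. ideal I R} C" using assms(2) by (auto simp: subset.chain_def)
  then have "\<Union>C \<in> C" using ideal_chain_is_trivial[OF C(1)] by simp
  then show "\<Union>C \<in> A" using C by (auto simp: subset.chain_def)
qed

lemma (in primeideal) pow_memD:
  assumes "a \<in> carrier R" "a [^] (k::nat) \<in> I" shows "a \<in> I"
  using assms(2)
proof (induction k)
  case 0
  then have "\<one> \<in> I" by simp
  then show ?case using one_imp_carrier I_notcarr by blast
next
  case (Suc k)
  then have "a [^] k \<otimes> a \<in> I" by simp
  then show ?case using I_prime[of "a [^] k" a] Suc assms(1) by auto
qed

definition (in cring) adjoin :: "'a set \<Rightarrow> 'a \<Rightarrow> 'a set" where
  "adjoin I a = set_add R I (PIdl a)"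

lemma (in cring) mem_add_principal: "x \<in> adjoin I a \<longleftrightarrow> (\<exists>i\<in>I. \<exists>s\<in>carrier R. x = i \<oplus> s \<otimes> a)"
  by (auto simp: set_add_def' cgenideal_def adjoin_def)

lemma (in cring) add_principal:
  assumes "ideal I R" "a \<in> carrier R"
  shows "ideal (adjoin I a) R" "I \<subseteq> (adjoin I a)" "a \<in> (adjoin I a)"
    "ideal J R \<Longrightarrow> I \<subseteq> J \<Longrightarrow> a \<in> J \<Longrightarrow> (adjoin I a) \<subseteq> J"
proof -
  interpret I: ideal I R by (rule assms)
  show "ideal (adjoin I a) R" unfolding adjoin_def by (rule add_ideals[OF assms(1) cgenideal_ideal[OF assms(2)]])
  show "I \<subseteq> (adjoin I a)"
  proof
    fix x assume x: "x \<in> I"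
    then have "x = x \<oplus> \<zero> \<otimes> a" using assms I.a_Hcarr by simp
    then show "x \<in> (adjoin I a)" using x zero_closed mem_add_principal by blast
  qed
  have "a = \<zero> \<oplus> \<one> \<otimes> a" using assms by simp
  then show "a \<in> (adjoin I a)" using assms(2) I.zero_closed one_closed mem_add_principal by blast
  assume J: "ideal J R" "I \<subseteq> J" "a \<in> J"
  show "(adjoin I a) \<subseteq> J"
  proof
    fix x assume "x \<in> (adjoin I a)"
    then obtain i s where "i \<in> I" "s \<in> carrier R" "x = i \<oplus> s \<otimes> a" using assms(2) mem_add_principal by blast
    then show "x \<in> J" using J ideal.I_l_closed[OF J(1)] additive_subgroup.a_closed[OF ideal.axioms(1)[OF J(1)]] by blast
  qed
qed

section \<open>Homogeneous ideals, homogeneous primes and prime avoidance\<close>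

locale graded_cring = cring S for S :: "'s ring" (structure) +
  fixes Sg :: "int \<Rightarrow> 's set"
  assumes graded: "graded_module S Sg (self_module S) Sg" and one_Sg: "\<one> \<in> Sg 0"
begin

lemma Sg_closed: "a \<in> Sg i \<Longrightarrow> a \<in> carrier S"
  using subgroup.mem_carrier[of "Sg i" "add_monoid (self_module S)" a] graded by (simp add: graded_module_def)

sublocale SS: graded_mod S Sg "self_module S" Sg
  by (intro graded_mod.intro module_self[OF is_cring] graded_mod_axioms.intro graded) (auto simp: Sg_closed)

abbreviation "hc \<equiv> SS.gc"

lemma comp_Sg: "a \<in> carrier S \<Longrightarrow> hc a j \<in> Sg j"
  using SS.gc_Mg by simp

lemma comp_closed [simp]: "a \<in> carrier S \<Longrightarrow> hc a j \<in> carrier S"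
  using comp_Sg Sg_closed by blast

lemma comp_add: "a \<in> carrier S \<Longrightarrow> b \<in> carrier S \<Longrightarrow> hc (a \<oplus> b) j = hc a j \<oplus> hc b j"
  using SS.gc_add by simp

lemma comp_diff: "a \<in> carrier S \<Longrightarrow> b \<in> carrier S \<Longrightarrow> hc (a \<ominus> b) j = hc a j \<ominus> hc b j"
  using SS.gc_diff[of a b j] by (simp add: a_minus_def)

lemma comp_mult: "a \<in> Sg i \<Longrightarrow> b \<in> carrier S \<Longrightarrow> hc (a \<otimes> b) j = a \<otimes> hc b (j - i)"
  using SS.gc_smult by simp

lemma comp_mult_right: "b \<in> Sg i \<Longrightarrow> a \<in> carrier S \<Longrightarrow> hc (a \<otimes> b) j = hc a (j - i) \<otimes> b"
  using comp_mult[of b i a j] Sg_closed by (simp add: m_comm)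

lemma comp_homogeneous: "a \<in> Sg i \<Longrightarrow> hc a j = (if j = i then a else \<zero>)"
  using SS.gc_homogeneous by simp

lemma comp_zero [simp]: "hc \<zero> j = \<zero>"
  using SS.gc_zero by simp

lemma Sg_mult: "a \<in> Sg i \<Longrightarrow> b \<in> Sg j \<Longrightarrow> a \<otimes> b \<in> Sg (i + j)"
  using SS.Mg_smult by simp

lemma Sg_add: "a \<in> Sg i \<Longrightarrow> b \<in> Sg i \<Longrightarrow> a \<oplus> b \<in> Sg i"
  using SS.Mg_add by simp

lemma Sg_zero: "\<zero> \<in> Sg i"
  using SS.Mg_zero by simp

lemma Sg_pow: "a \<in> Sg i \<Longrightarrow> a [^] (k::nat) \<in> Sg (int k * i)"
proof (induction k)
  case 0 then show ?case using one_Sg by simp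
next
  case (Suc k)
  then have "a [^] k \<otimes> a \<in> Sg (int k * i + i)" by (intro Sg_mult) auto
  then show ?case by (simp add: algebra_simps)
qed

lemma comp_induct [consumes 1, case_names zero comp add]:
  assumes "a \<in> carrier S" "P \<zero>" "\<And>j. P (hc a j)"
    "\<And>y z. y \<in> carrier S \<Longrightarrow> z \<in> carrier S \<Longrightarrow> P y \<Longrightarrow> P z \<Longrightarrow> P (y \<oplus> z)"
  shows "P a"
  using SS.graded_induct[of a P] assms by simp

definition homog :: "'s set \<Rightarrow> bool" where
  "homog I \<longleftrightarrow> ideal I S \<and> (\<forall>a\<in>I. \<forall>j. hc a j \<in> I)"

lemma homogD: "homog I \<Longrightarrow> ideal I S" "homog I \<Longrightarrow> a \<in> I \<Longrightarrow> hc a j \<in> I"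
  by (auto simp: homog_def)

lemma ideal_comps:
  assumes "ideal I S" "a \<in> carrier S" "\<And>j. hc a j \<in> I"
  shows "a \<in> I"
proof -
  interpret ideal I S by (rule assms)
  show ?thesis using assms(2) by (induction rule: comp_induct) (use assms(3) in auto)
qed

lemma homog_add_principal:
  assumes I: "homog I" and a: "a \<in> Sg k"
  shows "homog (adjoin I a)"
  unfolding homog_def
proof (intro conjI ballI allI)
  have aS: "a \<in> carrier S" using a Sg_closed by blast
  show "ideal (adjoin I a) S" by (rule add_principal(1)[OF homogD(1)[OF I] aS])
  fix x j assume "x \<in> (adjoin I a)"
  then obtain i s where ist: "i \<in> I" "s \<in> carrier S" "x = i \<oplus> s \<otimes> a" using mem_add_principal by blast
  then have "hc x j = hc i j \<oplus> hc s (j - k) \<otimes> a"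
    using ideal.Icarr[OF homogD(1)[OF I]] aS a by (simp add: comp_add comp_mult_right)
  then show "hc x j \<in> (adjoin I a)" using homogD(2)[OF I ist(1)] ist(2) mem_add_principal comp_closed by blast
qed

text \<open>Let \<open>p\<close> and \<open>q\<close> be the top degrees in which components of
  \<open>a\<close> and \<open>b\<close> lie outside \<open>P\<close>. Modulo \<open>P\<close>, the
  component of \<open>a \<otimes> b\<close> in degree \<open>p + q\<close> is the product of these
  two components.\<close>

lemma homogeneous_prime:
  assumes P: "homog P" "P \<noteq> carrier S"
    and pr: "\<And>i j a b. a \<in> Sg i \<Longrightarrow> b \<in> Sg j \<Longrightarrow> a \<otimes> b \<in> P \<Longrightarrow> a \<in> P \<or> b \<in> P"
  shows "primeideal P S"
proof (rule primeidealI[OF homogD(1)[OF P(1)] is_cring])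
  interpret P: ideal P S by (rule homogD(1)[OF P(1)])
  show "carrier S \<noteq> P" using P by simp
  fix a b assume ab: "a \<in> carrier S" "b \<in> carrier S" "a \<otimes> b \<in> P"
  show "a \<in> P \<or> b \<in> P"
  proof (rule ccontr)
    assume "\<not> (a \<in> P \<or> b \<in> P)"
    then have n: "\<exists>i. hc a i \<notin> P" "\<exists>i. hc b i \<notin> P" using ideal_comps[OF homogD(1)[OF P(1)]] ab by blast+
    define p where "p = Max {i. hc a i \<notin> P}"
    define q where "q = Max {i. hc b i \<notin> P}"
    have fin: "finite {i. hc c i \<notin> P}" if "c \<in> carrier S" for c
      by (rule finite_subset[OF _ SS.gc_finite]) (use that P.zero_closed in auto)
    have p: "hc a p \<notin> P" and pm: "\<And>i. i > p \<Longrightarrow> hc a i \<in> P"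
      using Max_in[OF fin[OF ab(1)]] Max_ge[OF fin[OF ab(1)]] n(1) unfolding p_def by (blast, force)
    have q: "hc b q \<notin> P" and qm: "\<And>i. i > q \<Longrightarrow> hc b i \<in> P"
      using Max_in[OF fin[OF ab(2)]] Max_ge[OF fin[OF ab(2)]] n(2) unfolding q_def by (blast, force)
    let ?r = "hc a p"
    \<comment> \<open>In total degree \<open>p + q\<close>, any other pair of components has a
      factor of degree above \<open>p\<close> or above \<open>q\<close>, and that factor lies in
      \<open>P\<close>.\<close>
    have low: "hc ((a \<ominus> ?r) \<otimes> b) (p + q) \<in> P"
    proof -
      have main: "hc (hc (a \<ominus> ?r) j \<otimes> b) (p + q) \<in> P" for j
        proof -
          have c: "hc (a \<ominus> ?r) j \<in> carrier S" using ab by simp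
          have e: "hc (hc (a \<ominus> ?r) j \<otimes> b) (p + q) = hc (a \<ominus> ?r) j \<otimes> hc b (p + q - j)"
            by (rule comp_mult) (use ab comp_Sg in auto)
          have d: "hc (a \<ominus> ?r) j = hc a j \<ominus> (if j = p then ?r else \<zero>)"
            using ab comp_homogeneous[OF comp_Sg[OF ab(1)], of p j] by (simp add: comp_diff)
          consider "j = p" | "j > p" | "j < p" by linarith
          then show ?thesis
          proof cases
            case 1
            then have "hc (a \<ominus> ?r) j = \<zero>" using d ab by (simp add: r_neg a_minus_def)
            then show ?thesis unfolding e using ab P.zero_closed by simp
          next
            case 2
            then have "hc (a \<ominus> ?r) j = hc a j" using d ab by (simp add: a_minus_def)
            then show ?thesis unfolding e using pm[OF 2] P.I_r_closed ab by simp
          next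
            case 3
            then have "hc b (p + q - j) \<in> P" using qm by simp
            then show ?thesis unfolding e using P.I_l_closed c by simp
          qed
        qed
      have "a \<ominus> ?r \<in> carrier S" using ab by simp
      then show ?thesis
      proof (induction rule: comp_induct)
        case zero then show ?case using ab P.zero_closed by simp
      next
        case (comp j) then show ?case by (rule main)
      next
        case (add y z)
        then show ?case using ab P.a_closed by (simp add: l_distr comp_add)
      qed
    qed
    have "hc (a \<otimes> b) (p + q) \<in> P" by (rule homogD(2)[OF P(1) ab(3)])
    moreover have "a \<otimes> b = (a \<ominus> ?r) \<otimes> b \<oplus> ?r \<otimes> b"
    proof -
      have "?r \<in> carrier S" using ab by simp
      then show ?thesis using ab(1,2) by algebra
    qed
    then have "hc (a \<otimes> b) (p + q) = hc ((a \<ominus> ?r) \<otimes> b) (p + q) \<oplus> ?r \<otimes> hc b q"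
      using ab comp_mult[OF comp_Sg[OF ab(1)] ab(2), of p "p + q"] by (simp add: comp_add)
    ultimately have "?r \<otimes> hc b q \<in> P"
      using low P.is_additive_subgroup ab
      by (metis P.a_closed P.a_inv_closed comp_closed m_closed minus_closed r_neg1 a_comm P.Icarr)
    then have "?r \<in> P \<or> hc b q \<in> P" using pr[OF comp_Sg[OF ab(1)] comp_Sg[OF ab(2)]] by blast
    then show False using p q by blast
  qed
qed

text \<open>Stands in for the finite set of minimal primes over \<open>I\<close>. The members may
  fail to be minimal, which allows the sets for two larger ideals simply to be united.\<close>

definition decomposes :: "'s set \<Rightarrow> bool" where
  "decomposes I \<longleftrightarrow> (\<exists>Ps. finite Ps \<and> (\<forall>P\<in>Ps. homog P \<and> primeideal P S \<and> I \<subseteq> P) \<and>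
     (\<forall>Q. primeideal Q S \<longrightarrow> I \<subseteq> Q \<longrightarrow> (\<exists>P\<in>Ps. P \<subseteq> Q)) \<and>
     (\<forall>x\<in>carrier S. (\<forall>P\<in>Ps. x \<in> P) \<longrightarrow> (\<exists>k::nat. x [^] k \<in> I)))"

text \<open>A prime over \<open>I\<close> contains \<open>a\<close> or \<open>b\<close>, so the two
  sets of primes together serve for \<open>I\<close>. For the radical condition, an element of
  \<open>I + (a)\<close> times one of \<open>I + (b)\<close> lies in \<open>I\<close>.\<close>

lemma decomposes_split:
  assumes I: "ideal I S" and a: "a \<in> carrier S" and b: "b \<in> carrier S" and ab: "a \<otimes> b \<in> I"
    and da: "decomposes (adjoin I a)" and db: "decomposes (adjoin I b)"
  shows "decomposes I"
proof -
  obtain Pa where Pa: "finite Pa" "\<forall>P\<in>Pa. homog P \<and> primeideal P S \<and> (adjoin I a) \<subseteq> P"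
    "\<forall>Q. primeideal Q S \<longrightarrow> (adjoin I a) \<subseteq> Q \<longrightarrow> (\<exists>P\<in>Pa. P \<subseteq> Q)"
    "\<forall>x\<in>carrier S. (\<forall>P\<in>Pa. x \<in> P) \<longrightarrow> (\<exists>k::nat. x [^] k \<in> (adjoin I a))"
    using da unfolding decomposes_def by blast
  obtain Pb where Pb: "finite Pb" "\<forall>P\<in>Pb. homog P \<and> primeideal P S \<and> (adjoin I b) \<subseteq> P"
    "\<forall>Q. primeideal Q S \<longrightarrow> (adjoin I b) \<subseteq> Q \<longrightarrow> (\<exists>P\<in>Pb. P \<subseteq> Q)"
    "\<forall>x\<in>carrier S. (\<forall>P\<in>Pb. x \<in> P) \<longrightarrow> (\<exists>k::nat. x [^] k \<in> (adjoin I b))"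
    using db unfolding decomposes_def by blast
  interpret I: ideal I S by (rule I)
  show ?thesis unfolding decomposes_def
  proof (rule exI[of _ "Pa \<union> Pb"], intro conjI allI impI ballI)
    show "finite (Pa \<union> Pb)" using Pa Pb by simp
    fix P assume "P \<in> Pa \<union> Pb"
    then show "homog P" "primeideal P S" "I \<subseteq> P"
      using Pa(2) Pb(2) add_principal(2)[OF I a] add_principal(2)[OF I b] by blast+
  next
    fix Q assume Q: "primeideal Q S" "I \<subseteq> Q"
    interpret Q: primeideal Q S by (rule Q)
    have "a \<in> Q \<or> b \<in> Q" using Q.I_prime[OF a b] ab Q(2) by blast
    then show "\<exists>P\<in>Pa \<union> Pb. P \<subseteq> Q"
    proof
      assume "a \<in> Q"
      then have "\<exists>P\<in>Pa. P \<subseteq> Q"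
        using Pa(3)[rule_format, OF Q(1) add_principal(4)[OF I a Q.is_ideal Q(2)]] by simp
      then show ?thesis by blast
    next
      assume "b \<in> Q"
      then have "\<exists>P\<in>Pb. P \<subseteq> Q"
        using Pb(3)[rule_format, OF Q(1) add_principal(4)[OF I b Q.is_ideal Q(2)]] by simp
      then show ?thesis by blast
    qed
  next
    fix x assume x: "x \<in> carrier S" "\<forall>P\<in>Pa \<union> Pb. x \<in> P"
    have "\<exists>k::nat. x [^] k \<in> (adjoin I a)" "\<exists>l::nat. x [^] l \<in> (adjoin I b)"
      using Pa(4)[rule_format, OF x(1)] Pb(4)[rule_format, OF x(1)] x(2) by simp_all
    then obtain k l :: nat where kl: "x [^] k \<in> (adjoin I a)" "x [^] l \<in> (adjoin I b)" by (elim exE)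
    obtain i s where i: "i \<in> I" "s \<in> carrier S" "x [^] k = i \<oplus> s \<otimes> a" using kl(1)[unfolded mem_add_principal] by (elim bexE)
    obtain j t where j: "j \<in> I" "t \<in> carrier S" "x [^] l = j \<oplus> t \<otimes> b" using kl(2)[unfolded mem_add_principal] by (elim bexE)
    have c: "i \<in> carrier S" "j \<in> carrier S" using i j I.Icarr by auto
    have "x [^] (k + l) = (i \<oplus> s \<otimes> a) \<otimes> (j \<oplus> t \<otimes> b)"
      using i(3) j(3) x(1) by (simp add: nat_pow_mult[symmetric])
    also have "\<dots> = i \<otimes> (j \<oplus> t \<otimes> b) \<oplus> (s \<otimes> a \<otimes> j \<oplus> s \<otimes> t \<otimes> (a \<otimes> b))"
      using c a b i(2) j(2) by algebra
    also have "\<dots> \<in> I"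
    proof (intro I.a_closed)
      show "i \<otimes> (j \<oplus> t \<otimes> b) \<in> I" using i(1) j(2) b c by (intro I.I_r_closed) auto
      show "s \<otimes> a \<otimes> j \<in> I" using j(1) i(2) a by (intro I.I_l_closed) auto
      show "s \<otimes> t \<otimes> (a \<otimes> b) \<in> I" using I.I_l_closed[OF ab] i(2) j(2) by simp
    qed
    finally show "\<exists>k::nat. x [^] k \<in> I" by (rule exI)
  qed
qed

text \<open>Noetherian induction with a maximal counterexample \<open>J\<close>. It is not prime,
  and \<open>homogeneous_prime\<close> provides homogeneous witnesses, so the ideals obtained by
  adjoining them are homogeneous again.\<close>

lemma homogeneous_decomposes:
  assumes "noetherian_ring S" "homog I"
  shows "decomposes I"
proof (rule ccontr)
  interpret N: noetherian_ring S by (rule assms)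
  assume "\<not> decomposes I"
  then have ne: "{I. homog I \<and> \<not> decomposes I} \<noteq> {}" using assms(2) by blast
  have id: "ideal I S" if "I \<in> {I. homog I \<and> \<not> decomposes I}" for I using that homogD(1) by simp
  have "\<exists>J\<in>{I. homog I \<and> \<not> decomposes I}. \<forall>I\<in>{I. homog I \<and> \<not> decomposes I}. J \<subseteq> I \<longrightarrow> I = J"
    by (rule N.maximal_in_family[OF ne]) (rule id)
  then obtain J where "J \<in> {I. homog I \<and> \<not> decomposes I}"
    and Jmax: "\<forall>I\<in>{I. homog I \<and> \<not> decomposes I}. J \<subseteq> I \<longrightarrow> I = J"
    by (elim bexE)
  then have J: "homog J" "\<not> decomposes J" by simp_all
  interpret J: ideal J S by (rule homogD(1)[OF J(1)])
  have "J \<noteq> carrier S"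
  proof
    assume JS: "J = carrier S"
    have "decomposes J" unfolding decomposes_def
    proof (rule exI[of _ "{}"], intro conjI allI impI ballI)
      fix Q assume Q: "primeideal Q S" "J \<subseteq> Q"
      then have "\<one> \<in> Q" using JS by auto
      then have "Q = carrier S" using ideal.one_imp_carrier[OF primeideal.axioms(1)[OF Q(1)]] by simp
      then show "\<exists>P\<in>{}. P \<subseteq> Q" using primeideal.I_notcarr[OF Q(1)] by simp
    next
      fix x show "\<exists>k::nat. x [^] k \<in> J" by (rule exI[of _ 0]) (simp add: JS)
    qed auto
    then show False using J by blast
  qed
  moreover have "\<not> primeideal J S"
  proof
    assume "primeideal J S"
    then have "decomposes J" unfolding decomposes_def
    proof (intro exI[of _ "{J}"] conjI ballI allI impI)
      fix x assume "x \<in> carrier S" "\<forall>P\<in>{J}. x \<in> P"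
      then have "x [^] (1::nat) \<in> J" by simp
      then show "\<exists>k::nat. x [^] k \<in> J" by (rule exI)
    qed (use J(1) in simp_all)
    then show False using J(2) by simp
  qed
  ultimately obtain i j a b where ab: "a \<in> Sg i" "b \<in> Sg j" "a \<otimes> b \<in> J" "a \<notin> J" "b \<notin> J"
    using homogeneous_prime[OF J(1)] by metis
  have c: "a \<in> carrier S" "b \<in> carrier S" using ab Sg_closed by blast+
  have "decomposes (adjoin J x)" if "x \<in> Sg k" "x \<notin> J" "x \<in> carrier S" for x k
  proof (rule ccontr)
    assume "\<not> decomposes (adjoin J x)"
    then have "adjoin J x = J"
      using bspec[OF Jmax, of "adjoin J x"] homog_add_principal[OF J(1) that(1)] add_principal(2)[OF J.is_ideal that(3)] by simp
    then show False using add_principal(3)[OF J.is_ideal that(3)] that(2) by simp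
  qed
  then have "decomposes J" using decomposes_split[OF J.is_ideal c ab(3)] ab c by simp
  then show False using J by simp
qed

text \<open>Only powers of elements of positive degree can be brought to a common degree.\<close>

lemma homogeneous_prime_avoidance:
  assumes "finite Ps" "\<And>P. P \<in> Ps \<Longrightarrow> homog P \<and> primeideal P S"
    and pos: "\<And>P. P \<in> Ps \<Longrightarrow> \<exists>k>0. \<exists>y\<in>Sg k. y \<notin> P"
    and neg: "\<And>j. j < 0 \<Longrightarrow> Sg j = {\<zero>}"
  shows "\<exists>k>0. \<exists>f\<in>Sg k. \<forall>P\<in>Ps. f \<notin> P"
  using assms(1-3)
proof (induction Ps rule: finite_psubset_induct)
  case (psubset Ps)
  have IH: "\<exists>k>0. \<exists>f\<in>Sg k. \<forall>P\<in>Ps - {p}. f \<notin> P" if "p \<in> Ps" for p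
    by (rule psubset.IH) (use that psubset.prems in auto)
  consider "Ps = {}" | (sub) p q where "p \<in> Ps" "q \<in> Ps" "p \<noteq> q" "p \<subseteq> q"
    | (anti) p where "p \<in> Ps" "\<forall>q\<in>Ps. q \<noteq> p \<longrightarrow> \<not> q \<subseteq> p" by blast
  then show ?case
  proof cases
    \<comment> \<open>With nothing to avoid, zero is an admissible element of degree 1.\<close>
    case 1 then show ?thesis using Sg_zero[of 1] by (intro exI[of _ 1]) auto
  next
    case sub then show ?thesis using IH[OF sub(1)] by blast
  next
    case anti
    obtain k f where f: "k > 0" "f \<in> Sg k" "\<forall>P\<in>Ps - {p}. f \<notin> P" using IH[OF anti(1)] by blast
    show ?thesis
    proof (cases "f \<in> p")
      case False then show ?thesis using f by blast
    next
      case True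
      interpret p: primeideal p S using psubset.prems(1)[OF anti(1)] by blast
      have "finite (Ps - {p})" using psubset.hyps by simp
      \<comment> \<open>Builds a homogeneous \<open>g\<close> outside \<open>p\<close> that lies in
        all other primes: a given element of positive degree outside \<open>p\<close> is multiplied,
        for each \<open>q\<close>, by a homogeneous component outside \<open>p\<close> of an element
        of \<open>q\<close>. The degree stays positive since nonzero components have nonnegative
        degree.\<close>
      moreover have "finite Q \<Longrightarrow> Q \<subseteq> Ps - {p} \<Longrightarrow> \<exists>l>0. \<exists>g\<in>Sg l. g \<notin> p \<and> (\<forall>q\<in>Q. g \<in> q)" for Q
      proof (induction Q rule: finite_induct)
        case empty then show ?case using psubset.prems(2)[OF anti(1)] by blast
      next
        case (insert q Q)
        have "Q \<subseteq> Ps - {p}" using insert.prems by simp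
        from insert.IH[OF this] obtain l g where g: "l > 0" "g \<in> Sg l" "g \<notin> p" "\<forall>q\<in>Q. g \<in> q"
          by (elim exE conjE bexE)
        have q: "q \<in> Ps" "homog q" "ideal q S"
          using insert.prems psubset.prems(1)[of q] homogD(1)[of q] by simp_all
        have "q \<noteq> p" using insert.prems by simp
        then have "\<not> q \<subseteq> p" using anti(2) q(1) by simp
        then obtain a where a: "a \<in> q" "a \<notin> p" by (auto simp: subset_iff)
        have aS: "a \<in> carrier S" by (rule ideal.Icarr[OF q(3) a(1)])
        obtain i where i: "hc a i \<notin> p" using ideal_comps[OF p.is_ideal aS] a(2) by metis
        have iq: "hc a i \<in> q" by (rule homogD(2)[OF q(2) a(1)])
        have "i \<ge> 0"
        proof (rule ccontr)
          assume "\<not> 0 \<le> i"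
          then have "hc a i = \<zero>" using comp_Sg[OF aS, of i] neg[of i] by simp
          then show False using i p.zero_closed by simp
        qed
        moreover have "g \<otimes> hc a i \<in> Sg (l + i)" by (rule Sg_mult[OF g(2) comp_Sg[OF aS]])
        moreover have gS: "g \<in> carrier S" using g Sg_closed by blast
        then have "g \<otimes> hc a i \<notin> p" using p.I_prime[OF gS comp_closed[OF aS]] g(3) i by metis
        moreover have "g \<otimes> hc a i \<in> q" using ideal.I_l_closed[OF q(3) iq gS] .
        moreover have "g \<otimes> hc a i \<in> q'" if "q' \<in> Q" for q'
        proof -
          have "ideal q' S" using that insert.prems psubset.prems(1)[of q'] homogD(1)[of q'] by auto
          then show ?thesis using g(4) that by (intro ideal.I_r_closed comp_closed aS) auto
        qed
        ultimately have "l + i > 0 \<and> g \<otimes> hc a i \<in> Sg (l + i) \<and> g \<otimes> hc a i \<notin> p \<and> (\<forall>q\<in>insert q Q. g \<otimes> hc a i \<in> q)"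
          using g(1) by simp
        then show ?case by metis
      qed
      ultimately have "\<exists>l>0. \<exists>g\<in>Sg l. g \<notin> p \<and> (\<forall>q\<in>Ps - {p}. g \<in> q)" by simp
      then obtain l g where g: "l > 0" "g \<in> Sg l" "g \<notin> p" "\<forall>q\<in>Ps - {p}. g \<in> q"
        by (elim exE conjE bexE)
      \<comment> \<open>The exponents bring both powers to the common degree \<open>l * k\<close>.
        Each prime contains exactly one of \<open>f\<close> and \<open>g\<close>, so the sum of the
        powers lies in none.\<close>
      let ?F = "f [^] (nat l)" and ?G = "g [^] (nat k)"
      have S: "f \<in> carrier S" "g \<in> carrier S" using f g Sg_closed by blast+
      have F: "?F \<in> Sg (l * k)" "?G \<in> Sg (l * k)"
        using Sg_pow[OF f(2), of "nat l"] Sg_pow[OF g(2), of "nat k"] f(1) g(1) by (simp_all add: mult.commute)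
      have pw: "x [^] (nat j) \<in> I" if A: "ideal I S" "x \<in> I" "j > 0" "x \<in> carrier S" for x I j
      proof -
        obtain r where "nat j = Suc r" using A(3) by (metis gr0_implies_Suc zero_less_nat_eq)
        then show ?thesis using ideal.I_l_closed[OF A(1,2), of "x [^] r"] A(4) by simp
      qed
      have "?F \<oplus> ?G \<notin> P" if P: "P \<in> Ps" for P
      proof
        assume FG: "?F \<oplus> ?G \<in> P"
        interpret P: primeideal P S using psubset.prems(1)[OF P] by blast
        show False
        proof (cases "P = p")
          case True
          have "?F \<in> P" using pw[OF P.is_ideal] \<open>f \<in> p\<close> True g(1) S by blast
          then have "?G \<in> P" using FG S P.a_inv_closed P.a_closed
            by (metis a_comm nat_pow_closed r_neg1)
          then show False using P.pow_memD[OF S(2)] g(3) True by blast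
        next
          case False
          have "?G \<in> P" using pw[OF P.is_ideal] g(4) False P f(1) S by blast
          then have "?F \<in> P" using FG S P.a_inv_closed P.a_closed
            by (metis a_comm nat_pow_closed r_neg1)
          then show False using P.pow_memD[OF S(1)] f(3) P False by blast
        qed
      qed
      then show ?thesis using Sg_add[OF F] f(1) g(1) by (intro exI[of _ "l * k"] conjI bexI) simp_all
    qed
  qed
qed

end

section \<open>Hilbert's basis theorem\<close>

lemma (in cring) ideal_criterion:
  assumes "I \<subseteq> carrier R" "\<zero> \<in> I" "\<And>a b. a \<in> I \<Longrightarrow> b \<in> I \<Longrightarrow> a \<oplus> b \<in> I"
    "\<And>a s. a \<in> I \<Longrightarrow> s \<in> carrier R \<Longrightarrow> s \<otimes> a \<in> I"
  shows "ideal I R"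
proof (rule idealI)
  show "ring R" by (rule ring_axioms)
  show "subgroup I (add_monoid R)"
  proof (rule group.subgroupI[OF a_group])
    fix a assume a: "a \<in> I"
    then have "\<ominus> \<one> \<otimes> a \<in> I" using assms by simp
    moreover have "\<ominus> \<one> \<otimes> a = \<ominus> a" using a assms(1) by (simp add: l_minus subset_iff)
    ultimately show "inv\<^bsub>add_monoid R\<^esub> a \<in> I" by (simp add: a_inv_def)
  qed (use assms in auto)
  fix a s assume "a \<in> I" "s \<in> carrier R"
  then show "s \<otimes> a \<in> I" "a \<otimes> s \<in> I" using assms m_comm[of a s] by auto
qed

lemma (in cring) noetherian_image:
  assumes N: "noetherian_ring A" and h: "h \<in> ring_hom A R"
    and T: "cring (R\<lparr>carrier := h ` carrier A\<rparr>)"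
  shows "noetherian_ring (R\<lparr>carrier := h ` carrier A\<rparr>)"
proof -
  interpret A: noetherian_ring A by (rule N)
  interpret T: cring "R\<lparr>carrier := h ` carrier A\<rparr>" by (rule T)
  have hA: "ideal {a \<in> carrier A. h a \<in> I} A" if I: "ideal I (R\<lparr>carrier := h ` carrier A\<rparr>)" for I
  proof -
    interpret I: ideal I "R\<lparr>carrier := h ` carrier A\<rparr>" by (rule I)
    have h0: "h \<zero>\<^bsub>A\<^esub> = \<zero>"
      by (rule ring_hom_zero[OF h A.ring_axioms ring_axioms])
    show ?thesis
    proof (rule idealI[OF A.ring_axioms])
      show "subgroup {a \<in> carrier A. h a \<in> I} (add_monoid A)"
      proof (rule group.subgroupI[OF A.a_group])
        show "{a \<in> carrier A. h a \<in> I} \<noteq> {}" using I.zero_closed h0 by (auto intro!: exI[of _ "\<zero>\<^bsub>A\<^esub>"])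
        fix a assume a: "a \<in> {a \<in> carrier A. h a \<in> I}"
        have "h (\<ominus>\<^bsub>A\<^esub> a) \<in> I"
        proof -
          have "h (\<ominus>\<^bsub>A\<^esub> \<one>\<^bsub>A\<^esub>) \<otimes> h a \<in> I" using I.I_l_closed[of "h a" "h (\<ominus>\<^bsub>A\<^esub> \<one>\<^bsub>A\<^esub>)"] a by simp
          moreover have "h (\<ominus>\<^bsub>A\<^esub> \<one>\<^bsub>A\<^esub>) \<otimes> h a = h (\<ominus>\<^bsub>A\<^esub> a)"
            using a ring_hom_mult[OF h, of "\<ominus>\<^bsub>A\<^esub> \<one>\<^bsub>A\<^esub>" a] by (simp add: A.l_minus)
          ultimately show ?thesis by simp
        qed
        then show "inv\<^bsub>add_monoid A\<^esub> a \<in> {a \<in> carrier A. h a \<in> I}" using a A.a_inv_closed[of a] by (simp add: a_inv_def)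
      next
        fix a b assume "a \<in> {a \<in> carrier A. h a \<in> I}" "b \<in> {a \<in> carrier A. h a \<in> I}"
        then show "a \<otimes>\<^bsub>add_monoid A\<^esub> b \<in> {a \<in> carrier A. h a \<in> I}"
          using I.a_closed[of "h a" "h b"] ring_hom_add[OF h, of a b] by simp
      qed auto
      fix a s assume a: "a \<in> {a \<in> carrier A. h a \<in> I}" "s \<in> carrier A"
      then show "s \<otimes>\<^bsub>A\<^esub> a \<in> {a \<in> carrier A. h a \<in> I}" "a \<otimes>\<^bsub>A\<^esub> s \<in> {a \<in> carrier A. h a \<in> I}"
        using I.I_l_closed[of "h a" "h s"] I.I_r_closed[of "h a" "h s"] ring_hom_mult[OF h] by auto
    qed
  qed
  show ?thesis
  proof (rule T.noetherian_ringI)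
    fix I assume I: "ideal I (R\<lparr>carrier := h ` carrier A\<rparr>)"
    obtain F where F: "F \<subseteq> carrier A" "finite F" "{a \<in> carrier A. h a \<in> I} = Idl\<^bsub>A\<^esub> F"
      using A.finetely_gen[OF hA[OF I]] by metis
    let ?J = "Idl\<^bsub>R\<lparr>carrier := h ` carrier A\<rparr>\<^esub> (h ` F)"
    have FI: "F \<subseteq> {a \<in> carrier A. h a \<in> I}" using A.genideal_self[OF F(1)] F(3) by simp
    have J: "ideal ?J (R\<lparr>carrier := h ` carrier A\<rparr>)" using F(1) by (intro T.genideal_ideal) auto
    have "h ` F \<subseteq> ?J" using F(1) by (intro T.genideal_self) auto
    then have "F \<subseteq> {a \<in> carrier A. h a \<in> ?J}" using F(1) by auto
    then have "{a \<in> carrier A. h a \<in> I} \<subseteq> {a \<in> carrier A. h a \<in> ?J}"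
      unfolding F(3) by (rule A.genideal_minimal[OF hA[OF J]])
    moreover have "I \<subseteq> h ` carrier A" using ideal.Icarr[OF I] by auto
    ultimately have "I \<subseteq> ?J" by auto
    moreover have "?J \<subseteq> I" using FI by (intro T.genideal_minimal[OF I]) auto
    ultimately show "\<exists>F\<subseteq>carrier (R\<lparr>carrier := h ` carrier A\<rparr>). finite F \<and> I = Idl\<^bsub>R\<lparr>carrier := h ` carrier A\<rparr>\<^esub> F"
      using F(1,2) by (intro exI[of _ "h ` F"]) auto
  qed
qed

text \<open>Subrings \<open>T \<subseteq> T'\<close> of one ambient ring. Since \<open>x\<close> may
  satisfy relations over \<open>T\<close>, degrees refer to expressions in \<open>x\<close> and not
  to elements.\<close>

locale hilbert_step = cring R for R (structure) +
  fixes T T' x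
  assumes T: "noetherian_ring (R\<lparr>carrier := T\<rparr>)" "cring (R\<lparr>carrier := T\<rparr>)" "T \<subseteq> T'"
    and T': "cring (R\<lparr>carrier := T'\<rparr>)" "T' \<subseteq> carrier R"
    and x: "x \<in> T'"
begin

abbreviation "RT \<equiv> R\<lparr>carrier := T\<rparr>"
abbreviation "RT' \<equiv> R\<lparr>carrier := T'\<rparr>"

sublocale T: cring RT by (rule T)
sublocale T': cring RT' by (rule T')

text \<open>Expressions in \<open>x\<close> of degree below \<open>l\<close>, so that index 0 leaves
  only zero and \<open>t x^l \<oplus> s\<close> has the formal leading term
  \<open>t x^l\<close>.\<close>

primrec upto_deg :: "nat \<Rightarrow> 'a set" where
  "upto_deg 0 = {\<zero>}"
| "upto_deg (Suc l) = {t \<otimes> x [^] l \<oplus> s | t s. t \<in> T \<and> s \<in> upto_deg l}"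

lemma TR: "t \<in> T \<Longrightarrow> t \<in> carrier R" using T T' by auto
lemma T'R: "t \<in> T' \<Longrightarrow> t \<in> carrier R" using T' by auto
lemma xR: "x \<in> carrier R" using x T'R by auto
lemma T_ops: "t \<in> T \<Longrightarrow> s \<in> T \<Longrightarrow> t \<oplus> s \<in> T" "t \<in> T \<Longrightarrow> s \<in> T \<Longrightarrow> t \<otimes> s \<in> T" "\<zero> \<in> T" "\<one> \<in> T"
  using T.a_closed T.m_closed T.zero_closed T.one_closed by auto
lemma upto_deg_carrier: "s \<in> upto_deg l \<Longrightarrow> s \<in> carrier R"
  by (induction l arbitrary: s) (auto simp: TR xR)

lemma zero_upto_deg: "\<zero> \<in> upto_deg l"
proof (induction l)
  case (Suc l)
  have "\<zero> = \<zero> \<otimes> x [^] l \<oplus> \<zero>" using xR by simp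
  then show ?case using Suc T_ops by (simp del: l_null l_zero) metis
qed simp

lemma upto_deg_add: "s \<in> upto_deg l \<Longrightarrow> s' \<in> upto_deg l \<Longrightarrow> s \<oplus> s' \<in> upto_deg l"
proof (induction l arbitrary: s s')
  case (Suc l)
  obtain t u t' u' where d: "t \<in> T" "u \<in> upto_deg l" "s = t \<otimes> x [^] l \<oplus> u"
    "t' \<in> T" "u' \<in> upto_deg l" "s' = t' \<otimes> x [^] l \<oplus> u'" using Suc.prems by auto
  have "s \<oplus> s' = (t \<oplus> t') \<otimes> x [^] l \<oplus> (u \<oplus> u')"
    using d TR xR upto_deg_carrier by (simp add: l_distr a_ac)
  moreover have "t \<oplus> t' \<in> T" "u \<oplus> u' \<in> upto_deg l" using Suc.IH d T_ops by auto
  ultimately show ?case unfolding upto_deg.simps mem_Collect_eq by metis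
qed simp

lemma upto_deg_scale: "r \<in> T \<Longrightarrow> s \<in> upto_deg l \<Longrightarrow> r \<otimes> s \<in> upto_deg l"
proof (induction l arbitrary: s)
  case 0 then show ?case using TR by simp
next
  case (Suc l)
  obtain t u where d: "t \<in> T" "u \<in> upto_deg l" "s = t \<otimes> x [^] l \<oplus> u" using Suc.prems by auto
  have "r \<otimes> s = (r \<otimes> t) \<otimes> x [^] l \<oplus> r \<otimes> u"
    using d Suc.prems TR xR upto_deg_carrier by (simp add: r_distr m_assoc)
  moreover have "r \<otimes> t \<in> T" "r \<otimes> u \<in> upto_deg l" using Suc d T_ops by auto
  ultimately show ?case unfolding upto_deg.simps mem_Collect_eq by metis
qed

lemma upto_deg_x: "s \<in> upto_deg l \<Longrightarrow> s \<otimes> x \<in> upto_deg (Suc l)"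
proof (induction l arbitrary: s)
  case 0 then show ?case using zero_upto_deg[of "Suc 0"] xR by simp
next
  case (Suc l)
  obtain t u where d: "t \<in> T" "u \<in> upto_deg l" "s = t \<otimes> x [^] l \<oplus> u" using Suc.prems by auto
  have "s \<otimes> x = t \<otimes> x [^] (Suc l) \<oplus> u \<otimes> x"
    using d TR xR upto_deg_carrier by (simp add: l_distr m_assoc)
  moreover have "u \<otimes> x \<in> upto_deg (Suc l)" by (rule Suc.IH[OF d(2)])
  ultimately show ?case using d(1) unfolding upto_deg.simps(2)[of "Suc l"] mem_Collect_eq by metis
qed

lemma upto_deg_mono: "l \<le> l' \<Longrightarrow> upto_deg l \<subseteq> upto_deg l'"
proof (induction rule: dec_induct)
  case (step l')
  have "s \<in> upto_deg (Suc l')" if "s \<in> upto_deg l'" for s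
  proof -
    have "s = \<zero> \<otimes> x [^] l' \<oplus> s" using that upto_deg_carrier xR by simp
    then show ?thesis using that T_ops unfolding upto_deg.simps mem_Collect_eq by metis
  qed
  then show ?case using step by blast
qed simp

text \<open>The possible leading coefficients in formal degree \<open>l\<close>; one element of
  \<open>I\<close> may contribute several.\<close>

definition lead :: "'a set \<Rightarrow> nat \<Rightarrow> 'a set" where
  "lead I l = {t \<in> T. \<exists>s\<in>upto_deg l. t \<otimes> x [^] l \<oplus> s \<in> I}"

lemma lead_ideal: assumes I: "ideal I RT'" shows "ideal (lead I l) RT"
proof (rule T.ideal_criterion)
  interpret I: ideal I RT' by (rule I)
  show "lead I l \<subseteq> carrier RT" by (auto simp: lead_def)
  have "\<zero> = \<zero> \<otimes> x [^] l \<oplus> \<zero>" using xR by simp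
  then have "\<zero> \<otimes> x [^] l \<oplus> \<zero> \<in> I" using I.zero_closed by simp
  then show "\<zero>\<^bsub>RT\<^esub> \<in> lead I l" using T_ops zero_upto_deg[of l] unfolding lead_def by auto
  fix a b assume "a \<in> lead I l" "b \<in> lead I l"
  then obtain s u where d: "a \<in> T" "b \<in> T" "s \<in> upto_deg l" "u \<in> upto_deg l"
    "a \<otimes> x [^] l \<oplus> s \<in> I" "b \<otimes> x [^] l \<oplus> u \<in> I" by (auto simp: lead_def)
  have "(a \<oplus> b) \<otimes> x [^] l \<oplus> (s \<oplus> u) = (a \<otimes> x [^] l \<oplus> s) \<oplus> (b \<otimes> x [^] l \<oplus> u)"
    using d TR xR upto_deg_carrier by (simp add: l_distr a_ac)
  then have "(a \<oplus> b) \<otimes> x [^] l \<oplus> (s \<oplus> u) \<in> I" using I.a_closed[OF d(5,6)] by simp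
  then show "a \<oplus>\<^bsub>RT\<^esub> b \<in> lead I l"
    using T_ops(1)[OF d(1,2)] upto_deg_add[OF d(3,4)] unfolding lead_def by auto
next
  interpret I: ideal I RT' by (rule I)
  fix a r assume "a \<in> lead I l" "r \<in> carrier RT"
  then obtain s where d: "a \<in> T" "r \<in> T" "s \<in> upto_deg l" "a \<otimes> x [^] l \<oplus> s \<in> I" by (auto simp: lead_def)
  have "(r \<otimes> a) \<otimes> x [^] l \<oplus> (r \<otimes> s) = r \<otimes> (a \<otimes> x [^] l \<oplus> s)"
    using d TR xR upto_deg_carrier by (simp add: r_distr m_assoc)
  moreover have "r \<otimes> (a \<otimes> x [^] l \<oplus> s) \<in> I" using I.I_l_closed[OF d(4), of r] d(2) T(3) by auto
  ultimately have "(r \<otimes> a) \<otimes> x [^] l \<oplus> (r \<otimes> s) \<in> I" by simp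
  then show "r \<otimes>\<^bsub>RT\<^esub> a \<in> lead I l"
    using T_ops(2)[OF d(2,1)] upto_deg_scale[OF d(2,3)] unfolding lead_def by auto
qed

lemma lead_mono: assumes I: "ideal I RT'" and "l \<le> l'" shows "lead I l \<subseteq> lead I l'"
  using assms(2)
proof (induction rule: dec_induct)
  case (step l')
  interpret I: ideal I RT' by (rule I)
  have "lead I l' \<subseteq> lead I (Suc l')"
  proof
    fix a assume "a \<in> lead I l'"
    then obtain s where d: "a \<in> T" "s \<in> upto_deg l'" "a \<otimes> x [^] l' \<oplus> s \<in> I" by (auto simp: lead_def)
    have "a \<otimes> x [^] (Suc l') \<oplus> s \<otimes> x = (a \<otimes> x [^] l' \<oplus> s) \<otimes> x"
      using d TR xR upto_deg_carrier by (simp add: l_distr m_assoc)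
    then have "a \<otimes> x [^] (Suc l') \<oplus> s \<otimes> x \<in> I" using I.I_r_closed[OF d(3), of x] x by simp
    then show "a \<in> lead I (Suc l')" using d(1) upto_deg_x[OF d(2)] unfolding lead_def by blast
  qed
  then show ?case using step by blast
qed simp

text \<open>The ideal generated by chosen preimages of generators of the leading coefficient ideals has
  the same leading coefficients, so it absorbs \<open>I\<close> degree by degree.\<close>

lemma lead_subset_imp:
  assumes I: "ideal I RT'" and J: "ideal J RT'" and JI: "J \<subseteq> I" and le: "\<And>l. lead I l \<subseteq> lead J l"
  shows "I \<inter> upto_deg l \<subseteq> J"
proof (induction l)
  case 0
  interpret J: ideal J RT' by (rule J)
  show ?case using J.zero_closed by auto
next
  case (Suc l)
  interpret I: ideal I RT' by (rule I)
  interpret J: ideal J RT' by (rule J)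
  show ?case
  proof
    fix p assume p: "p \<in> I \<inter> upto_deg (Suc l)"
    then obtain t s where d: "t \<in> T" "s \<in> upto_deg l" "p = t \<otimes> x [^] l \<oplus> s" by auto
    then have "t \<in> lead I l" using p by (auto simp: lead_def)
    then obtain s' where s': "s' \<in> upto_deg l" "t \<otimes> x [^] l \<oplus> s' \<in> J" using le by (auto simp: lead_def)
    define g where "g = t \<otimes> x [^] l \<oplus> s'"
    have pI: "p \<in> I" "g \<in> I" "g \<in> J" "p \<in> T'" "g \<in> T'" using p s' JI I.Icarr unfolding g_def by auto
    have c: "s \<in> carrier R" "s' \<in> carrier R" "t \<otimes> x [^] l \<in> carrier R" using d s' upto_deg_carrier TR xR by auto
    have neg: "\<ominus> \<one> \<in> T"
    proof -
      have b: "\<ominus>\<^bsub>RT\<^esub> \<one> \<in> T" "\<ominus>\<^bsub>RT\<^esub> \<one> \<oplus> \<one> = \<zero>"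
        using T.a_inv_closed[OF T.one_closed] T.l_neg[OF T.one_closed] by simp_all
      then have "\<ominus> \<one> = \<ominus>\<^bsub>RT\<^esub> \<one>" using TR by (intro minus_equality) simp_all
      then show ?thesis using b by simp
    qed
    have e: "p \<oplus> (\<ominus> \<one>) \<otimes> g = s \<oplus> (\<ominus> \<one>) \<otimes> s'"
      unfolding d(3) g_def using c by algebra
    have "(\<ominus> \<one>) \<otimes> g \<in> I" using I.I_l_closed[OF pI(2), of "\<ominus> \<one>"] neg T(3) by auto
    then have "p \<oplus> (\<ominus> \<one>) \<otimes> g \<in> I" using I.a_closed[OF pI(1)] by simp
    moreover have "p \<oplus> (\<ominus> \<one>) \<otimes> g \<in> upto_deg l"
      unfolding e by (intro upto_deg_add upto_deg_scale d s' neg)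
    ultimately have "p \<oplus> (\<ominus> \<one>) \<otimes> g \<in> J" using Suc by blast
    then have "(p \<oplus> (\<ominus> \<one>) \<otimes> g) \<oplus> g \<in> J" using J.a_closed[OF _ pI(3)] by simp
    moreover have "(p \<oplus> (\<ominus> \<one>) \<otimes> g) \<oplus> g = p"
    proof -
      have "p \<in> carrier R" "g \<in> carrier R" using pI T'R by auto
      then show ?thesis by algebra
    qed
    ultimately show "p \<in> J" by simp
  qed
qed

text \<open>The ideals \<open>lead I l\<close> increase with \<open>l\<close> and are constant from
  some \<open>l0\<close> on. Preimages of generators for the degrees up to \<open>l0\<close>
  therefore generate an ideal with the same leading ideals as \<open>I\<close>.\<close>

lemma noetherian_step:
  assumes gen: "T' \<subseteq> (\<Union>l. upto_deg l)"
  shows "noetherian_ring RT'"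
proof (rule T'.noetherian_ringI)
  interpret TN: noetherian_ring RT by (rule T)
  fix I assume I: "ideal I RT'"
  have "\<exists>J\<in>range (lead I). \<forall>I'\<in>range (lead I). J \<subseteq> I' \<longrightarrow> I' = J"
    by (rule TN.maximal_in_family) (use lead_ideal[OF I] in auto)
  then obtain l0 where l0: "\<And>l. lead I l0 \<subseteq> lead I l \<Longrightarrow> lead I l = lead I l0" by auto
  have "\<forall>l. \<exists>A\<subseteq>T. finite A \<and> lead I l = Idl\<^bsub>RT\<^esub> A"
    using TN.finetely_gen[OF lead_ideal[OF I]] by simp
  then obtain A where A: "\<And>l. A l \<subseteq> T" "\<And>l. finite (A l)" "\<And>l. lead I l = Idl\<^bsub>RT\<^esub> (A l)" by metis
  have "\<forall>l a. \<exists>p. a \<in> A l \<longrightarrow> p \<in> I \<and> (\<exists>s\<in>upto_deg l. p = a \<otimes> x [^] l \<oplus> s)"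
  proof (intro allI)
    fix l a
    show "\<exists>p. a \<in> A l \<longrightarrow> p \<in> I \<and> (\<exists>s\<in>upto_deg l. p = a \<otimes> x [^] l \<oplus> s)"
    proof (cases "a \<in> A l")
      case True
      then have "a \<in> lead I l" using T.genideal_self[of "A l"] A by auto
      then show ?thesis unfolding lead_def by blast
    qed auto
  qed
  then obtain p where p: "\<And>l a. a \<in> A l \<Longrightarrow> p l a \<in> I \<and> (\<exists>s\<in>upto_deg l. p l a = a \<otimes> x [^] l \<oplus> s)" by metis
  let ?G = "\<Union>l\<le>l0. p l ` A l" and ?J = "Idl\<^bsub>RT'\<^esub> (\<Union>l\<le>l0. p l ` A l)"
  have GI: "?G \<subseteq> I" using p by auto
  have GT: "?G \<subseteq> carrier RT'" using GI ideal.Icarr[OF I] by auto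
  have J: "ideal ?J RT'" by (rule T'.genideal_ideal[OF GT])
  have JI: "?J \<subseteq> I" by (rule T'.genideal_minimal[OF I GI])
  have GJ: "?G \<subseteq> ?J" by (rule T'.genideal_self[OF GT])
  have low: "lead I l \<subseteq> lead ?J l" if "l \<le> l0" for l
    unfolding A(3)
  proof (rule T.genideal_minimal[OF lead_ideal[OF J]])
    show "A l \<subseteq> lead ?J l"
    proof
      fix a assume a: "a \<in> A l"
      then obtain s where s: "s \<in> upto_deg l" "p l a = a \<otimes> x [^] l \<oplus> s" using p by metis
      have "p l a \<in> ?J" using GJ a that by blast
      then show "a \<in> lead ?J l" using s a A(1) unfolding lead_def by auto
    qed
  qed
  have "lead I l \<subseteq> lead ?J l" for l
  proof (cases "l \<le> l0")
    case False
    then have "lead I l = lead I l0" using l0 lead_mono[OF I, of l0 l] by simp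
    also have "\<dots> \<subseteq> lead ?J l0" by (rule low) simp
    also have "\<dots> \<subseteq> lead ?J l" using False lead_mono[OF J, of l0 l] by simp
    finally show ?thesis .
  qed (rule low)
  then have IJ: "I \<inter> upto_deg l \<subseteq> ?J" for l using lead_subset_imp[OF I J JI] by simp
  have "I \<subseteq> ?J"
  proof
    fix y assume y: "y \<in> I"
    then have "y \<in> T'" using ideal.Icarr[OF I] by auto
    then obtain l where "y \<in> upto_deg l" using gen by auto
    then show "y \<in> ?J" using IJ[of l] y by auto
  qed
  then show "\<exists>A\<subseteq>carrier RT'. finite A \<and> I = Idl\<^bsub>RT'\<^esub> A"
    using JI GT A(2) by (intro exI[of _ ?G]) auto
qed

end

section \<open>Graded algebras generated in positive degrees\<close>

text \<open>What is used of a weighted polynomial ring: \<open>S\<close> is generated over the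
  Noetherian ring \<open>R\<close>, which is its degree 0 part, by finitely many homogeneous
  elements of positive degree. Generation is expressed as the induction rule
  \<open>S_induct\<close>.\<close>

locale graded_algebra = graded_cring S Sg + R: noetherian_ring R + R: cring R
  for S :: "'s ring" (structure) and Sg and R :: "('r, 'z) ring_scheme" +
  fixes h :: "'r \<Rightarrow> 's" and x :: "nat \<Rightarrow> 's" and w :: "nat \<Rightarrow> nat" and n :: nat
  assumes h: "h \<in> ring_hom R S" and h_inj: "inj_on h (carrier R)" and Sg0: "Sg 0 = h ` carrier R"
    and Sg_neg: "j < 0 \<Longrightarrow> Sg j = {\<zero>}"
    and x_Sg: "i < n \<Longrightarrow> x i \<in> Sg (int (w i))" and w_pos: "i < n \<Longrightarrow> w i > 0"
    and S_induct: "\<And>Q a. a \<in> carrier S \<Longrightarrow> (\<And>r. r \<in> carrier R \<Longrightarrow> Q (h r)) \<Longrightarrow>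
      (\<And>a b. a \<in> carrier S \<Longrightarrow> b \<in> carrier S \<Longrightarrow> Q a \<Longrightarrow> Q b \<Longrightarrow> Q (a \<oplus> b)) \<Longrightarrow>
      (\<And>a i. a \<in> carrier S \<Longrightarrow> i < n \<Longrightarrow> Q a \<Longrightarrow> Q (a \<otimes> x i)) \<Longrightarrow> Q a"
begin

lemma h_closed [simp]: "r \<in> carrier R \<Longrightarrow> h r \<in> carrier S"
  by (rule ring_hom_closed[OF h])

lemma x_closed: "i < n \<Longrightarrow> x i \<in> carrier S"
  using x_Sg Sg_closed by blast

inductive_set gens :: "nat \<Rightarrow> 's set" for k where
  const: "r \<in> carrier R \<Longrightarrow> h r \<in> gens k"
| add: "a \<in> gens k \<Longrightarrow> b \<in> gens k \<Longrightarrow> a \<oplus> b \<in> gens k"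
| var: "a \<in> gens k \<Longrightarrow> i < k \<Longrightarrow> a \<otimes> x i \<in> gens k"

lemma gens_closed: "k \<le> n \<Longrightarrow> a \<in> gens k \<Longrightarrow> a \<in> carrier S"
  by (rotate_tac, induction rule: gens.induct) (auto simp: x_closed)

lemma gens_mult:
  assumes k: "k \<le> n" and a: "a \<in> gens k" and b: "b \<in> gens k" shows "a \<otimes> b \<in> gens k"
  using b
proof (induction rule: gens.induct)
  case (const r)
  show ?case using a
  proof (induction rule: gens.induct)
    case (const r')
    then show ?case using \<open>r \<in> carrier R\<close> ring_hom_mult[OF h, of r' r] gens.const[of "r' \<otimes>\<^bsub>R\<^esub> r" k] by simp
  next
    case (add a b)
    then show ?case using \<open>r \<in> carrier R\<close> gens_closed[OF k] gens.add by (simp add: l_distr)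
  next
    case (var a i)
    have "a \<otimes> x i \<otimes> h r = a \<otimes> h r \<otimes> x i"
      using var \<open>r \<in> carrier R\<close> gens_closed[OF k] k x_closed[of i] by (simp add: m_ac)
    then show ?case using var gens.var by simp
  qed
next
  case (add b c)
  then show ?case using a gens_closed[OF k] gens.add by (simp add: r_distr)
next
  case (var b i)
  have "a \<otimes> (b \<otimes> x i) = a \<otimes> b \<otimes> x i" using var a gens_closed[OF k] k x_closed[of i] by (simp add: m_assoc)
  then show ?case using var gens.var by simp
qed

lemma gens_cring: assumes k: "k \<le> n" shows "cring (S\<lparr>carrier := gens k\<rparr>)"
proof -
  note c = gens_closed[OF k]
  have h0: "h \<zero>\<^bsub>R\<^esub> = \<zero>" by (rule ring_hom_zero[OF h R.ring_axioms ring_axioms])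
  have h1: "h \<one>\<^bsub>R\<^esub> = \<one>" by (rule ring_hom_one[OF h])
  have z: "\<zero> \<in> gens k" and o: "\<one> \<in> gens k"
    using gens.const[of "\<zero>\<^bsub>R\<^esub>" k] gens.const[of "\<one>\<^bsub>R\<^esub>" k] h0 h1 by simp_all
  have m: "h (\<ominus>\<^bsub>R\<^esub> \<one>\<^bsub>R\<^esub>) \<oplus> \<one> = \<zero>"
    using ring_hom_add[OF h, of "\<ominus>\<^bsub>R\<^esub> \<one>\<^bsub>R\<^esub>" "\<one>\<^bsub>R\<^esub>"] h0 h1 by (simp add: R.l_neg)
  show ?thesis
  proof (rule cringI)
    show "abelian_group (S\<lparr>carrier := gens k\<rparr>)"
    proof (rule abelian_groupI)
      fix a assume a: "a \<in> carrier (S\<lparr>carrier := gens k\<rparr>)"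
      have "h (\<ominus>\<^bsub>R\<^esub> \<one>\<^bsub>R\<^esub>) \<otimes> a \<oplus> a = (h (\<ominus>\<^bsub>R\<^esub> \<one>\<^bsub>R\<^esub>) \<oplus> \<one>) \<otimes> a"
        using a c by (simp add: l_distr)
      also have "\<dots> = \<zero>" unfolding m using a c by simp
      finally have "h (\<ominus>\<^bsub>R\<^esub> \<one>\<^bsub>R\<^esub>) \<otimes> a \<oplus> a = \<zero>" .
      moreover have "h (\<ominus>\<^bsub>R\<^esub> \<one>\<^bsub>R\<^esub>) \<otimes> a \<in> gens k" using gens_mult[OF k gens.const] a by simp
      ultimately show "\<exists>b\<in>carrier (S\<lparr>carrier := gens k\<rparr>). b \<oplus>\<^bsub>S\<lparr>carrier := gens k\<rparr>\<^esub> a = \<zero>\<^bsub>S\<lparr>carrier := gens k\<rparr>\<^esub>"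
        by auto
    qed (use z c in \<open>auto intro: gens.add simp: a_ac\<close>)
    show "comm_monoid (S\<lparr>carrier := gens k\<rparr>)"
      by (rule comm_monoidI) (use o c gens_mult[OF k] in \<open>auto simp: m_ac\<close>)
  qed (use c in \<open>auto simp: l_distr\<close>)
qed

lemma gens_0: "gens 0 = h ` carrier R"
proof
  show "gens 0 \<subseteq> h ` carrier R"
  proof
    fix a assume "a \<in> gens 0"
    then show "a \<in> h ` carrier R"
    proof (induction rule: gens.induct)
      case (add a b)
      then obtain r s where "r \<in> carrier R" "s \<in> carrier R" "a = h r" "b = h s" by auto
      then show ?case using ring_hom_add[OF h, of r s] by (auto intro!: image_eqI[of _ _ "r \<oplus>\<^bsub>R\<^esub> s"])
    qed auto
  qed
qed (auto intro: gens.const)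

lemma gens_n: "gens n = carrier S"
proof
  show "gens n \<subseteq> carrier S" using gens_closed by auto
  show "carrier S \<subseteq> gens n"
  proof
    fix a assume "a \<in> carrier S"
    then show "a \<in> gens n" by (rule S_induct) (auto intro: gens.intros)
  qed
qed

lemma gens_mono: "k \<le> l \<Longrightarrow> gens k \<subseteq> gens l"
proof
  fix a assume kl: "k \<le> l" and "a \<in> gens k"
  show "a \<in> gens l" using \<open>a \<in> gens k\<close>
    by (induction rule: gens.induct) (use kl in \<open>auto intro: gens.intros\<close>)
qed

text \<open>Adjoins one generator at a time, starting from the image of \<open>R\<close>; the
  subalgebras are records over the same ambient ring, as \<open>hilbert_step\<close>
  expects.\<close>

lemma gens_noetherian: "k \<le> n \<Longrightarrow> noetherian_ring (S\<lparr>carrier := gens k\<rparr>)"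
proof (induction k)
  case 0
  have "cring (S\<lparr>carrier := h ` carrier R\<rparr>)" using gens_cring[of 0] by (simp add: gens_0)
  then show ?case unfolding gens_0 by (rule noetherian_image[OF R.noetherian_ring_axioms h])
next
  case (Suc k)
  have k: "k \<le> n" "k < n" using Suc by auto
  have h1: "h \<one>\<^bsub>R\<^esub> = \<one>" by (rule ring_hom_one[OF h])
  have "h \<one>\<^bsub>R\<^esub> \<otimes> x k \<in> gens (Suc k)" by (rule gens.var[OF gens.const]) auto
  then have xk: "x k \<in> gens (Suc k)" using h1 x_closed[OF k(2)] by simp
  interpret H: hilbert_step S "gens k" "gens (Suc k)" "x k"
    by (intro hilbert_step.intro is_cring hilbert_step_axioms.intro Suc.IH[OF k(1)] gens_cring[OF k(1)]
        gens_cring[OF Suc.prems] gens_mono subsetI[OF gens_closed[OF Suc.prems]] xk) simp_all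
  show ?case
  proof (rule H.noetherian_step, intro subsetI)
    fix a assume "a \<in> gens (Suc k)"
    then show "a \<in> (\<Union>l. H.upto_deg l)"
    proof (induction rule: gens.induct)
      case (const r)
      have "h r = h r \<otimes> x k [^] (0::nat) \<oplus> \<zero>" using const by simp
      then have "h r \<in> H.upto_deg (Suc 0)" using gens.const[OF const, of k] H.zero_upto_deg[of 0]
        unfolding H.upto_deg.simps(2) mem_Collect_eq by metis
      then show ?case by blast
    next
      case (add a b)
      then obtain l l' where "a \<in> H.upto_deg l" "b \<in> H.upto_deg l'" by auto
      then have "a \<in> H.upto_deg (max l l')" "b \<in> H.upto_deg (max l l')"
        using H.upto_deg_mono[of l "max l l'"] H.upto_deg_mono[of l' "max l l'"] by auto
      then show ?case using H.upto_deg_add by blast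
    next
      case (var a i)
      then obtain l where l: "a \<in> H.upto_deg l" by auto
      show ?case
      proof (cases "i = k")
        case True then show ?thesis using H.upto_deg_x[OF l] by blast
      next
        case False
        then have i: "i < k" "i < n" using var k by auto
        have "h \<one>\<^bsub>R\<^esub> \<otimes> x i \<in> gens k" by (rule gens.var[OF gens.const]) (use i in auto)
        then have "x i \<in> gens k" using h1 x_closed[OF i(2)] by simp
        then have "x i \<otimes> a \<in> H.upto_deg l" using H.upto_deg_scale l by simp
        moreover have "x i \<otimes> a = a \<otimes> x i" using H.upto_deg_carrier[OF l] x_closed[OF i(2)] by (rule m_comm[rotated])
        ultimately show ?thesis by auto
      qed
    qed
  qed
qed

lemma noetherian: "noetherian_ring S"
  using gens_noetherian[of n] by (simp add: gens_n)

end

section \<open>Elimination of generators\<close>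

lemma (in ideal) cong_mult:
  assumes c: "cring R" and "a \<in> carrier R" "b \<in> carrier R" "a' \<in> carrier R" "b' \<in> carrier R"
    "a \<ominus> a' \<in> I" "b \<ominus> b' \<in> I"
  shows "a \<otimes> b \<ominus> a' \<otimes> b' \<in> I"
proof -
  interpret cring R by (rule c)
  have "a \<otimes> b \<ominus> a' \<otimes> b' = (a \<ominus> a') \<otimes> b \<oplus> a' \<otimes> (b \<ominus> b')" using assms(2-5) by algebra
  moreover have "(a \<ominus> a') \<otimes> b \<in> I" "a' \<otimes> (b \<ominus> b') \<in> I"
    using I_r_closed[OF assms(6,3)] I_l_closed[OF assms(7,4)] by simp_all
  ultimately show ?thesis by simp
qed

context module
begin

text \<open>The set \<open>I u1 + ... + I ur + N\<close>; recursion on the list lets one generator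
  be split off at a time.\<close>

primrec comb :: "'a set \<Rightarrow> 'c set \<Rightarrow> 'c list \<Rightarrow> 'c set" where
  "comb I N [] = N"
| "comb I N (u # us) = {i \<odot>\<^bsub>M\<^esub> u \<oplus>\<^bsub>M\<^esub> y | i y. i \<in> I \<and> y \<in> comb I N us}"

lemma submodule_zero: "submodule N R M \<Longrightarrow> \<zero>\<^bsub>M\<^esub> \<in> N"
  using subgroup.one_closed[OF submodule.axioms(1)] by fastforce

lemma submodule_criterion:
  assumes "N \<subseteq> carrier M" "\<zero>\<^bsub>M\<^esub> \<in> N" "\<And>a b. a \<in> N \<Longrightarrow> b \<in> N \<Longrightarrow> a \<oplus>\<^bsub>M\<^esub> b \<in> N"
    "\<And>s a. s \<in> carrier R \<Longrightarrow> a \<in> N \<Longrightarrow> s \<odot>\<^bsub>M\<^esub> a \<in> N"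
  shows "submodule N R M"
proof (rule submoduleI)
  fix a assume a: "a \<in> N"
  then have "(\<ominus> \<one>) \<odot>\<^bsub>M\<^esub> a \<in> N" using assms(4) by simp
  moreover have "(\<ominus> \<one>) \<odot>\<^bsub>M\<^esub> a = \<ominus>\<^bsub>M\<^esub> a" using a assms(1) by (simp add: smult_l_minus subset_iff)
  ultimately show "\<ominus>\<^bsub>M\<^esub> a \<in> N" by simp
qed (use assms in simp_all)

lemma comb_submodule:
  assumes I: "ideal I R" and N: "submodule N R M" and us: "set us \<subseteq> carrier M"
  shows "submodule (comb I N us) R M"
  using us
proof (induction us)
  case Nil then show ?case using N by simp
next
  case (Cons u us)
  interpret I: ideal I R by (rule I)
  have C: "submodule (comb I N us) R M" using Cons by simp
  note Cs = submoduleE[OF C]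
  have u: "u \<in> carrier M" using Cons by simp
  show ?case
  proof (rule submodule_criterion)
    show "comb I N (u # us) \<subseteq> carrier M" using u Cs(1) by auto
    have "\<zero>\<^bsub>M\<^esub> = \<zero> \<odot>\<^bsub>M\<^esub> u \<oplus>\<^bsub>M\<^esub> \<zero>\<^bsub>M\<^esub>" using u by simp
    then show "\<zero>\<^bsub>M\<^esub> \<in> comb I N (u # us)" using submodule_zero[OF C] I.zero_closed
      unfolding comb.simps mem_Collect_eq by metis
  next
    fix a b assume "a \<in> comb I N (u # us)" "b \<in> comb I N (u # us)"
    then obtain i y j z where d: "i \<in> I" "y \<in> comb I N us" "a = i \<odot>\<^bsub>M\<^esub> u \<oplus>\<^bsub>M\<^esub> y"
      "j \<in> I" "z \<in> comb I N us" "b = j \<odot>\<^bsub>M\<^esub> u \<oplus>\<^bsub>M\<^esub> z" by auto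
    have c: "y \<in> carrier M" "z \<in> carrier M" using d Cs(1) by auto
    have "a \<oplus>\<^bsub>M\<^esub> b = (i \<oplus> j) \<odot>\<^bsub>M\<^esub> u \<oplus>\<^bsub>M\<^esub> (y \<oplus>\<^bsub>M\<^esub> z)"
      using d c u by (simp add: smult_l_distr M.a_ac)
    then show "a \<oplus>\<^bsub>M\<^esub> b \<in> comb I N (u # us)" using I.a_closed[OF d(1,4)] Cs(5)[OF d(2,5)]
      unfolding comb.simps mem_Collect_eq by metis
  next
    fix s a assume s: "s \<in> carrier R" and "a \<in> comb I N (u # us)"
    then obtain i y where d: "i \<in> I" "y \<in> comb I N us" "a = i \<odot>\<^bsub>M\<^esub> u \<oplus>\<^bsub>M\<^esub> y" by auto
    have c: "y \<in> carrier M" using d Cs(1) by auto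
    have "s \<odot>\<^bsub>M\<^esub> a = (s \<otimes> i) \<odot>\<^bsub>M\<^esub> u \<oplus>\<^bsub>M\<^esub> s \<odot>\<^bsub>M\<^esub> y"
      using d c u s by (simp add: smult_assoc1 smult_r_distr)
    then show "s \<odot>\<^bsub>M\<^esub> a \<in> comb I N (u # us)" using I.I_l_closed[OF d(1) s] Cs(4)[OF s d(2)]
      unfolding comb.simps mem_Collect_eq by metis
  qed
qed

lemma comb_mono: "I \<subseteq> J \<Longrightarrow> comb I N us \<subseteq> comb J N us"
proof (induction us)
  case (Cons u us)
  then have "comb I N us \<subseteq> comb J N us" by simp
  then show ?case using Cons.prems unfolding comb.simps by blast
qed simp

lemma comb_base:
  assumes "ideal I R" "submodule N R M" "set us \<subseteq> carrier M" shows "N \<subseteq> comb I N us"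
  using assms(3)
proof (induction us)
  case (Cons u us)
  show ?case
  proof
    fix y assume y: "y \<in> N"
    then have "y = \<zero> \<odot>\<^bsub>M\<^esub> u \<oplus>\<^bsub>M\<^esub> y" using Cons submoduleE(1)[OF assms(2)] by auto
    moreover have "\<zero> \<in> I" using additive_subgroup.zero_closed[OF ideal.axioms(1)[OF assms(1)]] .
    moreover have "y \<in> comb I N us" using y Cons by auto
    ultimately show "y \<in> comb I N (u # us)" unfolding comb.simps mem_Collect_eq by metis
  qed
qed simp

lemma comb_gens:
  assumes N: "submodule N R M" and us: "set us \<subseteq> carrier M" shows "set us \<subseteq> comb (carrier R) N us"
  using us
proof (induction us)
  case (Cons u us)
  have C: "submodule (comb (carrier R) N us) R M" by (rule comb_submodule[OF R.oneideal N]) (use Cons in simp)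
  note Cs = submoduleE[OF C]
  have "u = \<one> \<odot>\<^bsub>M\<^esub> u \<oplus>\<^bsub>M\<^esub> \<zero>\<^bsub>M\<^esub>" using Cons by simp
  then have 1: "u \<in> comb (carrier R) N (u # us)" using submodule_zero[OF C]
    unfolding comb.simps mem_Collect_eq by (metis R.one_closed)
  have "v \<in> comb (carrier R) N (u # us)" if "v \<in> comb (carrier R) N us" for v
  proof -
    have "v = \<zero> \<odot>\<^bsub>M\<^esub> u \<oplus>\<^bsub>M\<^esub> v" using that Cs(1) Cons by auto
    then show ?thesis using that unfolding comb.simps mem_Collect_eq by (metis R.zero_closed)
  qed
  then show ?case using 1 Cons by auto
qed simp

lemma comb_mult:
  assumes I: "ideal I R" and N: "submodule N R M" and us: "set us \<subseteq> carrier M"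
    and i: "i \<in> I" and z: "z \<in> comb (carrier R) N us"
  shows "i \<odot>\<^bsub>M\<^esub> z \<in> comb I N us"
  using us z
proof (induction us arbitrary: z)
  case Nil
  then show ?case using submoduleE(4)[OF N] ideal.Icarr[OF I i] by simp
next
  case (Cons u us)
  then obtain s y where d: "s \<in> carrier R" "y \<in> comb (carrier R) N us" "z = s \<odot>\<^bsub>M\<^esub> u \<oplus>\<^bsub>M\<^esub> y" by auto
  have "submodule (comb (carrier R) N us) R M" by (rule comb_submodule[OF R.oneideal N]) (use Cons in simp)
  then have c: "y \<in> carrier M" "i \<in> carrier R" using d submoduleE(1) ideal.Icarr[OF I i] by auto
  have "i \<odot>\<^bsub>M\<^esub> z = (i \<otimes> s) \<odot>\<^bsub>M\<^esub> u \<oplus>\<^bsub>M\<^esub> i \<odot>\<^bsub>M\<^esub> y"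
    using d c Cons by (simp add: smult_assoc1 smult_r_distr)
  moreover have "i \<otimes> s \<in> I" by (rule ideal.I_r_closed[OF I i d(1)])
  moreover have "i \<odot>\<^bsub>M\<^esub> y \<in> comb I N us" using Cons d by simp
  ultimately show ?case unfolding comb.simps mem_Collect_eq by metis
qed

lemma submodule_mspan:
  assumes I: "ideal I R" and V: "V \<subseteq> carrier M"
  shows "submodule (mspan I V) R M"
proof (rule submodule_criterion)
  interpret I: ideal I R by (rule I)
  have IR: "I \<subseteq> carrier R" using I.Icarr by auto
  show "mspan I V \<subseteq> carrier M" by (rule mspan_carrier[OF IR V])
  show "\<zero>\<^bsub>M\<^esub> \<in> mspan I V" by (rule mspan_zero)
  show "a \<oplus>\<^bsub>M\<^esub> b \<in> mspan I V" if "a \<in> mspan I V" "b \<in> mspan I V" for a b by (rule mspan_add[OF that])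
  fix s a assume s: "s \<in> carrier R" and a: "a \<in> mspan I V"
  note car = subsetD[OF mspan_carrier[OF IR V]]
  show "s \<odot>\<^bsub>M\<^esub> a \<in> mspan I V" using a IR V
  proof (induction rule: mspan_induct)
    case zero then show ?case using s mspan_zero by simp
  next
    case (smult i v)
    then have "s \<odot>\<^bsub>M\<^esub> (i \<odot>\<^bsub>M\<^esub> v) = (s \<otimes> i) \<odot>\<^bsub>M\<^esub> v" using s V I.Icarr by (auto simp: smult_assoc1)
    then show ?case using mspan_incl[OF I.I_l_closed[OF smult(1) s] smult(2)] by simp
  next
    case (neg y)
    then show ?case using s car mspan_neg[OF IR V] by (simp add: smult_r_minus)
  next
    case (add y z)
    then show ?case using s car mspan_add by (simp add: smult_r_distr)
  qed
qed

text \<open>A determinant-free Cayley-Hamilton argument.  If \<open>c\<close> multiplies \<open>V\<close> into the span of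
  \<open>u, us\<close> modulo \<open>N\<close>, then \<open>c a u = i u + \<dots>\<close> with \<open>i \<in> I\<close>, so \<open>(c a - i) c\<close> multiplies \<open>V\<close> into the
  span of \<open>us\<close>.\<close>

lemma eliminate_generators:
  assumes I: "ideal I R" and N: "submodule N R M" and a: "a \<in> carrier R" and V: "V \<subseteq> carrier M"
    and aV: "\<And>v. v \<in> V \<Longrightarrow> a \<odot>\<^bsub>M\<^esub> v \<in> set_add M (mspan I V) N"
    and us: "set us \<subseteq> V" and c: "c \<in> carrier R" "c \<ominus> a [^] (k::nat) \<in> I"
    and cV: "\<And>v. v \<in> V \<Longrightarrow> c \<odot>\<^bsub>M\<^esub> v \<in> comb (carrier R) N us"
  shows "\<exists>c'\<in>carrier R. \<exists>k'::nat. c' \<ominus> a [^] k' \<in> I \<and> (\<forall>v\<in>V. c' \<odot>\<^bsub>M\<^esub> v \<in> N)"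
  using us c cV
proof (induction us arbitrary: c k)
  case Nil then show ?case by auto
next
  case (Cons u us)
  interpret I: ideal I R by (rule I)
  have IR: "I \<subseteq> carrier R" using I.Icarr by auto
  have uus: "set (u # us) \<subseteq> carrier M" and us: "set us \<subseteq> carrier M" and u: "u \<in> V" "u \<in> carrier M"
    using Cons.prems(1) V by auto
  note cS = Cons.prems(2)
  have CI: "submodule (comb I N (u # us)) R M" by (rule comb_submodule[OF I N uus])
  note CIs = submoduleE[OF CI]
  have C: "submodule (comb (carrier R) N us) R M" by (rule comb_submodule[OF R.oneideal N us])
  note Cs = submoduleE[OF C]
  \<comment> \<open>\<open>c\<close> carries \<open>V\<close> into the span of
    \<open>u # us\<close>, hence the multiples of \<open>V\<close> by elements of \<open>I\<close>
    into the span with coefficients in \<open>I\<close>.\<close>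
  have key: "c \<odot>\<^bsub>M\<^esub> y \<in> comb I N (u # us)" if y: "y \<in> mspan I V" for y
    using y IR V
  proof (induction rule: mspan_induct)
    case zero then show ?case using cS submodule_zero[OF CI] by simp
  next
    case (smult i v)
    have "c \<odot>\<^bsub>M\<^esub> (i \<odot>\<^bsub>M\<^esub> v) = i \<odot>\<^bsub>M\<^esub> (c \<odot>\<^bsub>M\<^esub> v)" by (rule smult_comm) (use cS smult V IR in auto)
    then show ?case using comb_mult[OF I N uus smult(1) Cons.prems(4)[OF smult(2)]] by simp
  next
    case (neg y)
    then show ?case using cS subsetD[OF mspan_carrier[OF IR V]] CIs(3) by (simp add: smult_r_minus)
  next
    case (add y z)
    then show ?case using cS subsetD[OF mspan_carrier[OF IR V]] CIs(5) by (simp add: smult_r_distr)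
  qed
  obtain p q where pq: "p \<in> mspan I V" "q \<in> N" "a \<odot>\<^bsub>M\<^esub> u = p \<oplus>\<^bsub>M\<^esub> q"
    using aV[OF u(1)] by (auto simp: set_add_def')
  have pqc: "p \<in> carrier M" "q \<in> carrier M"
    using subsetD[OF mspan_carrier[OF IR V] pq(1)] submoduleE(1)[OF N] pq(2) by auto
  have "c \<odot>\<^bsub>M\<^esub> q \<in> comb I N (u # us)" using submoduleE(4)[OF N cS pq(2)] comb_base[OF I N uus] by blast
  then have "(c \<otimes> a) \<odot>\<^bsub>M\<^esub> u \<in> comb I N (u # us)"
    using CIs(5)[OF key[OF pq(1)]] pq(3) pqc cS a u by (simp add: smult_assoc1 smult_r_distr)
  then obtain i y where i: "i \<in> I" "y \<in> comb I N us" "(c \<otimes> a) \<odot>\<^bsub>M\<^esub> u = i \<odot>\<^bsub>M\<^esub> u \<oplus>\<^bsub>M\<^esub> y"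
    by auto
  have y: "y \<in> comb (carrier R) N us" "y \<in> carrier M" using i(2) comb_mono[OF IR] Cs(1) by auto
  have iR: "i \<in> carrier R" using i I.Icarr by simp
  \<comment> \<open>The multiplier \<open>c \<otimes> a \<ominus> i\<close> moves \<open>u\<close>
    into the span of \<open>us\<close>. Modulo \<open>I\<close> it is \<open>a^(k + 1)\<close>, so
    its product with \<open>c\<close> is congruent to \<open>a^(2 k + 1)\<close>.\<close>
  let ?d = "c \<otimes> a \<ominus> i"
  have du: "?d \<odot>\<^bsub>M\<^esub> u = y"
  proof -
    have "?d \<odot>\<^bsub>M\<^esub> u = (c \<otimes> a) \<odot>\<^bsub>M\<^esub> u \<ominus>\<^bsub>M\<^esub> i \<odot>\<^bsub>M\<^esub> u"
      using cS a iR u by (simp add: R.minus_eq M.minus_eq smult_l_distr smult_l_minus)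
    then show ?thesis using i(3) eq_diffI[of "i \<odot>\<^bsub>M\<^esub> u" y] iR u y by simp
  qed
  have dR: "?d \<in> carrier R" using cS a iR by simp
  show ?case
  proof (rule Cons.IH)
    show "set us \<subseteq> V" using Cons.prems by simp
    show "?d \<otimes> c \<in> carrier R" using dR cS by simp
    have ak: "a [^] k \<in> carrier R" using a by simp
    have "?d \<ominus> a [^] k \<otimes> a = (c \<ominus> a [^] k) \<otimes> a \<ominus> i"
      using cS a iR ak by algebra
    moreover have "(c \<ominus> a [^] k) \<otimes> a \<in> I" by (rule I.I_r_closed[OF Cons.prems(3) a])
    ultimately have "?d \<ominus> a [^] k \<otimes> a \<in> I" using i(1) by (simp add: R.minus_eq)
    then have "?d \<otimes> c \<ominus> (a [^] k \<otimes> a) \<otimes> a [^] k \<in> I"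
      by (intro I.cong_mult[OF R.is_cring]) (use dR cS ak a Cons.prems(3) in auto)
    moreover have "(a [^] k \<otimes> a) \<otimes> a [^] k = a [^] (Suc k + k)"
      using a by (simp add: R.nat_pow_mult[symmetric] R.m_ac)
    ultimately show "?d \<otimes> c \<ominus> a [^] (Suc k + k) \<in> I" by simp
    fix v assume v: "v \<in> V"
    obtain s z where sz: "s \<in> carrier R" "z \<in> comb (carrier R) N us" "c \<odot>\<^bsub>M\<^esub> v = s \<odot>\<^bsub>M\<^esub> u \<oplus>\<^bsub>M\<^esub> z"
      using Cons.prems(4)[OF v] by auto
    have zc: "z \<in> carrier M" "v \<in> carrier M" using sz Cs(1) v V by auto
    have "(?d \<otimes> c) \<odot>\<^bsub>M\<^esub> v = ?d \<odot>\<^bsub>M\<^esub> (s \<odot>\<^bsub>M\<^esub> u) \<oplus>\<^bsub>M\<^esub> ?d \<odot>\<^bsub>M\<^esub> z"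
      using dR cS zc sz u by (simp add: smult_assoc1 smult_r_distr)
    also have "?d \<odot>\<^bsub>M\<^esub> (s \<odot>\<^bsub>M\<^esub> u) = s \<odot>\<^bsub>M\<^esub> y"
      using smult_comm[OF dR sz(1) u(2)] du by simp
    also have "s \<odot>\<^bsub>M\<^esub> y \<oplus>\<^bsub>M\<^esub> ?d \<odot>\<^bsub>M\<^esub> z \<in> comb (carrier R) N us"
      by (rule Cs(5)[OF Cs(4)[OF sz(1) y(1)] Cs(4)[OF dR sz(2)]])
    finally show "(?d \<otimes> c) \<odot>\<^bsub>M\<^esub> v \<in> comb (carrier R) N us" .
  qed
qed

end

section \<open>Homogeneous systems of parameters\<close>

context graded_cring
begin

text \<open>The elements of the ideal all of whose components stay in it form an ideal that contains
  \<open>G\<close>.\<close>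

lemma homog_Idl:
  assumes G: "\<And>g. g \<in> G \<Longrightarrow> \<exists>j. g \<in> Sg j"
  shows "homog (Idl G)"
proof -
  have GS: "G \<subseteq> carrier S" using G Sg_closed by blast
  have id: "ideal (Idl G) S" by (rule genideal_ideal[OF GS])
  interpret J: ideal "Idl G" S by (rule id)
  let ?K = "{a \<in> Idl G. \<forall>j. hc a j \<in> Idl G}"
  have "ideal ?K S"
  proof (rule ideal_criterion)
    show "?K \<subseteq> carrier S" using J.Icarr by auto
    show "\<zero> \<in> ?K" using J.zero_closed by simp
    fix a b assume "a \<in> ?K" "b \<in> ?K"
    then show "a \<oplus> b \<in> ?K" using J.a_closed J.Icarr by (simp add: comp_add)
  next
    fix a s assume a: "a \<in> ?K" and s: "s \<in> carrier S"
    have aS: "a \<in> carrier S" using a J.Icarr by simp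
    have "\<forall>j. hc (s \<otimes> a) j \<in> Idl G" using s
    proof (induction rule: comp_induct)
      case zero then show ?case using aS J.zero_closed by simp
    next
      case (comp p)
      show ?case
      proof
        fix j
        have "hc (hc s p \<otimes> a) j = hc s p \<otimes> hc a (j - p)" by (rule comp_mult[OF comp_Sg[OF s] aS])
        moreover have "hc s p \<otimes> hc a (j - p) \<in> Idl G" using J.I_l_closed[OF _ comp_closed[OF s]] a by simp
        ultimately show "hc (hc s p \<otimes> a) j \<in> Idl G" by simp
      qed
    next
      case (add y z)
      then show ?case using aS J.a_closed by (simp add: l_distr comp_add)
    qed
    then show "s \<otimes> a \<in> ?K" using a J.I_l_closed s by simp
  qed
  moreover have "G \<subseteq> ?K"
  proof
    fix g assume g: "g \<in> G"
    then have "g \<in> Idl G" using genideal_self[OF GS] by blast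
    moreover obtain i where "g \<in> Sg i" using G[OF g] by blast
    then have "hc g j = (if j = i then g else \<zero>)" for j by (rule comp_homogeneous)
    ultimately show "g \<in> ?K" using J.zero_closed by simp
  qed
  ultimately have "Idl G \<subseteq> ?K" by (rule genideal_minimal)
  then show ?thesis using id by (auto simp: homog_def)
qed

lemma homog_sum:
  assumes I: "homog I" and J: "homog J" shows "homog (set_add S I J)"
  unfolding homog_def
proof (intro conjI ballI allI)
  show "ideal (set_add S I J) S" by (rule add_ideals[OF homogD(1)[OF I] homogD(1)[OF J]])
  fix a j assume "a \<in> set_add S I J"
  then obtain b c where bc: "b \<in> I" "c \<in> J" "a = b \<oplus> c" by (auto simp: set_add_def')
  have "hc a j = hc b j \<oplus> hc c j"
    using bc ideal.Icarr[OF homogD(1)[OF I]] ideal.Icarr[OF homogD(1)[OF J]] by (simp add: comp_add)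
  then show "hc a j \<in> set_add S I J" using homogD(2)[OF I bc(1)] homogD(2)[OF J bc(2)]
    unfolding set_add_def' by auto
qed

lemma sum_upper:
  assumes "ideal I S" "ideal J S" shows "I \<subseteq> set_add S I J" "J \<subseteq> set_add S I J"
proof -
  interpret I: ideal I S by (rule assms)
  interpret J: ideal J S by (rule assms)
  have "a = a \<oplus> \<zero>" if "a \<in> I" for a using that I.Icarr by simp
  then show "I \<subseteq> set_add S I J" using J.zero_closed unfolding set_add_def' by blast
  have "a = \<zero> \<oplus> a" if "a \<in> J" for a using that J.Icarr by simp
  then show "J \<subseteq> set_add S I J" using I.zero_closed unfolding set_add_def' by blast
qed

lemma sum_least:
  assumes "ideal K S" "I \<subseteq> K" "J \<subseteq> K" shows "set_add S I J \<subseteq> K"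
  using additive_subgroup.a_closed[OF ideal.axioms(1)[OF assms(1)]] assms(2,3) by (auto simp: set_add_def')

primrec adjoins :: "'s set \<Rightarrow> 's list \<Rightarrow> 's set" where
  "adjoins I [] = I"
| "adjoins I (f # fs) = adjoins (adjoin I f) fs"

lemma adjoins:
  assumes "ideal I S" "set fs \<subseteq> carrier S"
  shows "ideal (adjoins I fs) S" "I \<subseteq> adjoins I fs" "set fs \<subseteq> adjoins I fs"
    "ideal J S \<Longrightarrow> I \<subseteq> J \<Longrightarrow> set fs \<subseteq> J \<Longrightarrow> adjoins I fs \<subseteq> J"
proof -
  have "ideal (adjoins I fs) S \<and> I \<subseteq> adjoins I fs \<and> set fs \<subseteq> adjoins I fs \<and>
    (\<forall>J. ideal J S \<longrightarrow> I \<subseteq> J \<longrightarrow> set fs \<subseteq> J \<longrightarrow> adjoins I fs \<subseteq> J)"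
    using assms
  proof (induction fs arbitrary: I)
    case Nil then show ?case by simp
  next
    case (Cons f fs)
    have f: "f \<in> carrier S" using Cons by simp
    note a = add_principal[OF Cons.prems(1) f]
    have IH: "ideal (adjoins (adjoin I f) fs) S" "adjoin I f \<subseteq> adjoins (adjoin I f) fs"
      "set fs \<subseteq> adjoins (adjoin I f) fs"
      "\<forall>J. ideal J S \<longrightarrow> adjoin I f \<subseteq> J \<longrightarrow> set fs \<subseteq> J \<longrightarrow> adjoins (adjoin I f) fs \<subseteq> J"
      using Cons.IH[OF a(1)] Cons.prems by simp_all
    have "adjoins (adjoin I f) fs \<subseteq> J" if "ideal J S" "I \<subseteq> J" "f \<in> J" "set fs \<subseteq> J" for J
      using IH(4) a(4)[OF that(1-3)] that by simp
    then show ?case using IH(1-3) a(2,3) by auto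
  qed
  then show "ideal (adjoins I fs) S" "I \<subseteq> adjoins I fs" "set fs \<subseteq> adjoins I fs"
    "ideal J S \<Longrightarrow> I \<subseteq> J \<Longrightarrow> set fs \<subseteq> J \<Longrightarrow> adjoins I fs \<subseteq> J" by auto
qed

lemma ideal_pow_mono:
  assumes I: "ideal I S" and a: "a \<in> carrier S" "a [^] (k::nat) \<in> I" and "k \<le> l" shows "a [^] l \<in> I"
proof -
  have "a [^] l = a [^] (l - k) \<otimes> a [^] k" using a assms(4) by (simp add: nat_pow_mult)
  then show ?thesis using ideal.I_l_closed[OF I a(2), of "a [^] (l - k)"] a(1) by simp
qed

text \<open>By induction on \<open>t\<close>, \<open>Sg j\<close> lies in \<open>B + (y^t)\<close>
  from degree \<open>j1 + t v\<close> on: the cofactor of \<open>y^t\<close> can be taken of degree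
  \<open>j - t v\<close>, so it lies in \<open>B + (y)\<close> itself. At \<open>t = q\<close> the
  power of \<open>y\<close> is absorbed by \<open>B\<close>.\<close>

lemma large_degree_step:
  assumes B: "homog B" and y: "y \<in> Sg v" "v \<ge> 0" "y [^] (q::nat) \<in> B"
    and sub: "\<And>j. j \<ge> j1 \<Longrightarrow> Sg j \<subseteq> adjoin B y" and j: "j \<ge> j1 + int q * v"
  shows "Sg j \<subseteq> B"
proof -
  interpret B: ideal B S by (rule homogD(1)[OF B])
  have yS: "y \<in> carrier S" using y Sg_closed by blast
  have "j \<ge> j1 + int t * v \<Longrightarrow> Sg j \<subseteq> adjoin B (y [^] t)" for t :: nat and j
  proof (induction t arbitrary: j)
    case 0
    have "a \<in> adjoin B (y [^] (0::nat))" if "a \<in> Sg j" for a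
    proof -
      have "a = \<zero> \<oplus> a \<otimes> y [^] (0::nat)" using that Sg_closed by simp
      then show ?thesis using B.zero_closed that Sg_closed mem_add_principal by blast
    qed
    then show ?case by blast
  next
    case (Suc t)
    have jt: "j1 + int t * v \<le> j" "j - int t * v \<ge> j1" using Suc.prems y(2) by (auto simp: algebra_simps)
    show ?case
    proof
      fix a assume a: "a \<in> Sg j"
      then have "a \<in> adjoin B (y [^] t)" using Suc.IH[OF jt(1)] by blast
      then obtain b s where bs: "b \<in> B" "s \<in> carrier S" "a = b \<oplus> s \<otimes> y [^] t"
        unfolding mem_add_principal by (elim bexE)
      have yt: "y [^] t \<in> Sg (int t * v)" by (rule Sg_pow[OF y(1)])
      have "a = hc a j" using comp_homogeneous[OF a] by simp
      also have "\<dots> = hc b j \<oplus> hc s (j - int t * v) \<otimes> y [^] t"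
        using bs yS B.Icarr yt by (simp add: comp_add comp_mult_right)
      finally have ae: "a = hc b j \<oplus> hc s (j - int t * v) \<otimes> y [^] t" .
      have "hc s (j - int t * v) \<in> adjoin B y" using sub[OF jt(2)] comp_Sg[OF bs(2)] by blast
      then obtain b' s' where bs': "b' \<in> B" "s' \<in> carrier S" "hc s (j - int t * v) = b' \<oplus> s' \<otimes> y"
        unfolding mem_add_principal by (elim bexE)
      have c: "hc b j \<in> carrier S" "b' \<in> carrier S" "y [^] t \<in> carrier S" using bs bs' B.Icarr yS by auto
      have "a = (hc b j \<oplus> b' \<otimes> y [^] t) \<oplus> s' \<otimes> (y [^] t \<otimes> y)"
        using c bs'(2) yS unfolding ae bs'(3) by algebra
      moreover have "hc b j \<oplus> b' \<otimes> y [^] t \<in> B"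
        using homogD(2)[OF B bs(1)] B.I_r_closed[OF bs'(1) c(3)] by (rule B.a_closed)
      ultimately show "a \<in> adjoin B (y [^] Suc t)" using bs'(2) unfolding mem_add_principal nat_pow_Suc by blast
    qed
  qed
  then have "Sg j \<subseteq> adjoin B (y [^] q)" using j by blast
  also have "\<dots> \<subseteq> B" using yS by (intro add_principal(4) B.is_ideal y(3)) auto
  finally show ?thesis .
qed

lemma large_degree_list:
  assumes "homog J" "\<And>y. y \<in> set ys \<Longrightarrow> \<exists>v\<ge>0. y \<in> Sg v" "\<And>y. y \<in> set ys \<Longrightarrow> y [^] (q::nat) \<in> J"
    "\<And>j. j \<ge> j1 \<Longrightarrow> Sg j \<subseteq> adjoins J ys"
  shows "\<exists>j2. \<forall>j\<ge>j2. Sg j \<subseteq> J"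
  using assms
proof (induction ys arbitrary: J)
  case Nil then show ?case by auto
next
  case (Cons y ys)
  obtain v where v: "v \<ge> 0" "y \<in> Sg v" using Cons.prems(2) by auto
  have yS: "y \<in> carrier S" using v Sg_closed by blast
  have h: "homog (adjoin J y)" by (rule homog_add_principal[OF Cons.prems(1) v(2)])
  have "\<exists>j2. \<forall>j\<ge>j2. Sg j \<subseteq> adjoin J y"
  proof (rule Cons.IH[OF h])
    show "\<exists>v\<ge>0. z \<in> Sg v" if "z \<in> set ys" for z using Cons.prems(2) that by simp
    show "z [^] q \<in> adjoin J y" if "z \<in> set ys" for z
      using Cons.prems(3)[of z] that add_principal(2)[OF homogD(1)[OF Cons.prems(1)] yS] by auto
    show "Sg j \<subseteq> adjoins (adjoin J y) ys" if "j \<ge> j1" for j using Cons.prems(4)[OF that] by simp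
  qed
  then obtain j2 where j2: "\<And>j. j \<ge> j2 \<Longrightarrow> Sg j \<subseteq> adjoin J y" by blast
  have yq: "y [^] q \<in> J" using Cons.prems(3) by simp
  show ?case using large_degree_step[OF Cons.prems(1) v(2,1) yq j2] by blast
qed

end

section \<open>Ideals that contain powers of all generators\<close>

context graded_algebra
begin

text \<open>Proved for all positive components of an arbitrary element, the form in which induction
  over the generation of \<open>S\<close> goes through.\<close>

lemma positive_degree_mem:
  assumes J: "ideal J S" "\<And>i. i < n \<Longrightarrow> x i \<in> J" and a: "a \<in> Sg j" "j > 0"
  shows "a \<in> J"
proof -
  interpret J: ideal J S by (rule J)
  have "b \<in> carrier S \<Longrightarrow> \<forall>j>0. hc b j \<in> J" for b
  proof (rule S_induct)
    fix r assume "r \<in> carrier R"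
    then have "h r \<in> Sg 0" using Sg0 by auto
    from comp_homogeneous[OF this] show "\<forall>j>0. hc (h r) j \<in> J" using J.zero_closed by simp
  next
    fix a b assume "a \<in> carrier S" "b \<in> carrier S" "\<forall>j>0. hc a j \<in> J" "\<forall>j>0. hc b j \<in> J"
    then show "\<forall>j>0. hc (a \<oplus> b) j \<in> J" using J.a_closed by (simp add: comp_add)
  next
    fix a i assume a: "a \<in> carrier S" "i < n"
    have "hc (a \<otimes> x i) j = hc a (j - int (w i)) \<otimes> x i" for j by (rule comp_mult_right[OF x_Sg[OF a(2)] a(1)])
    then show "\<forall>j>0. hc (a \<otimes> x i) j \<in> J" using J.I_l_closed[OF J(2)[OF a(2)]] a(1) by simp
  qed
  then have "hc a j \<in> J" using a Sg_closed by blast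
  then show ?thesis using comp_homogeneous[OF a(1)] by simp
qed

lemma common_exponent:
  assumes J: "ideal J S" and ex: "\<And>i. i < n \<Longrightarrow> \<exists>k::nat. x i [^] k \<in> J"
  shows "\<exists>q::nat. \<forall>i<n. x i [^] q \<in> J"
proof -
  obtain k where k: "\<And>i. i < n \<Longrightarrow> x i [^] (k i :: nat) \<in> J" using ex by metis
  have "x i [^] (\<Sum>i<n. k i) \<in> J" if i: "i < n" for i
    by (rule ideal_pow_mono[OF J x_closed[OF i] k[OF i]]) (use i in \<open>auto intro: member_le_sum\<close>)
  then show ?thesis by blast
qed

text \<open>From degree 1 on everything lies in \<open>J\<close> plus the ideal of the generators
  \<open>x i\<close>. These are then removed one by one, each at the cost of finitely many
  degrees.\<close>

lemma large_degree:
  assumes J: "homog J" and ex: "\<And>i. i < n \<Longrightarrow> \<exists>k::nat. x i [^] k \<in> J"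
  shows "\<exists>j0. \<forall>j\<ge>j0. Sg j \<subseteq> J"
proof -
  obtain q :: nat where q: "\<forall>i<n. x i [^] q \<in> J" using common_exponent[OF homogD(1)[OF J] ex] by blast
  let ?ys = "map x [0..<n]"
  have ys: "set ?ys \<subseteq> carrier S" using x_closed by auto
  note adj = adjoins[OF homogD(1)[OF J] ys]
  show ?thesis
  proof (rule large_degree_list[OF J])
    show "\<exists>v\<ge>0. y \<in> Sg v" if "y \<in> set ?ys" for y
    proof -
      obtain i where "i < n" "y = x i" using \<open>y \<in> set ?ys\<close> by auto
      then have "y \<in> Sg (int (w i))" "int (w i) \<ge> 0" using x_Sg by simp_all
      then show ?thesis by blast
    qed
    show "y [^] q \<in> J" if "y \<in> set ?ys" for y using that q by auto
    show "Sg j \<subseteq> adjoins J ?ys" if "j \<ge> 1" for j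
    proof
      fix a assume a: "a \<in> Sg j"
      have "x i \<in> adjoins J ?ys" if "i < n" for i using adj(3) that by auto
      then show "a \<in> adjoins J ?ys" using positive_degree_mem[OF adj(1) _ a] \<open>j \<ge> 1\<close> by simp
    qed
  qed
qed

text \<open>There are no negative degrees, so only degree 0 times degree 0 contributes to degree
  0.\<close>

lemma degree_zero_mult:
  assumes s: "s \<in> carrier S" and a: "a \<in> carrier S" shows "hc (s \<otimes> a) 0 = hc s 0 \<otimes> hc a 0"
  using s
proof (induction rule: comp_induct)
  case zero then show ?case using a by simp
next
  case (comp p)
  have e: "hc (hc s p \<otimes> a) 0 = hc s p \<otimes> hc a (0 - p)" by (rule comp_mult[OF comp_Sg[OF s] a])
  have f: "hc (hc s p) 0 = (if 0 = p then hc s p else \<zero>)" by (rule comp_homogeneous[OF comp_Sg[OF s]])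
  consider "p = 0" | "p < 0" | "p > 0" by linarith
  then show ?case
  proof cases
    case 1 then show ?thesis using e f by simp
  next
    case 2
    then have "hc s p = \<zero>" using comp_Sg[OF s, of p] Sg_neg[OF 2] by simp
    then show ?thesis using e f a by simp
  next
    case 3
    then have "hc a (0 - p) = \<zero>" using comp_Sg[OF a, of "0 - p"] Sg_neg[of "0 - p"] by simp
    then show ?thesis using e f 3 s a by simp
  qed
next
  case (add y z) then show ?case using a by (simp add: l_distr comp_add)
qed

end

text \<open>Replaces the binomial formula: one factor \<open>s \<oplus> s'\<close> is distributed
  and absorbed into \<open>z\<close>, which lowers one of the two exponents.\<close>

lemma (in cring) radical_add:
  assumes Q: "ideal Q R" and st: "s \<in> carrier R" "s' \<in> carrier R"
  shows "z \<in> carrier R \<Longrightarrow> s [^] (a::nat) \<otimes> z \<in> Q \<Longrightarrow> s' [^] (b::nat) \<otimes> z \<in> Q \<Longrightarrow> (s \<oplus> s') [^] (a + b) \<otimes> z \<in> Q"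
proof (induction "a + b" arbitrary: a b z)
  case 0 then show ?case by simp
next
  case (Suc k)
  interpret Q: ideal Q R by (rule Q)
  have zc: "(s \<oplus> s') [^] j \<in> carrier R" for j :: nat using st by simp
  show ?case
  proof (cases "a = 0 \<or> b = 0")
    case True
    then have "z \<in> Q" using Suc.prems by auto
    then show ?thesis using Q.I_l_closed zc by simp
  next
    case False
    then obtain a' b' where ab: "a = Suc a'" "b = Suc b'" by (meson not0_implies_Suc)
    have k: "k = a' + b" "k = a + b'" using Suc.hyps(2) ab by auto
    have c: "s [^] a' \<in> carrier R" "s' [^] b' \<in> carrier R" "s [^] a \<in> carrier R" "s' [^] b \<in> carrier R"
      using st by simp_all
    have "s [^] a' \<otimes> (s \<otimes> z) \<in> Q" using Suc.prems ab st c by (simp add: m_assoc)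
    moreover have "s' [^] b \<otimes> (s \<otimes> z) \<in> Q"
    proof -
      have "s' [^] b \<otimes> (s \<otimes> z) = s \<otimes> (s' [^] b \<otimes> z)" using Suc.prems(1) st c by (simp add: m_lcomm)
      then show ?thesis using Q.I_l_closed[OF Suc.prems(3) st(1)] by simp
    qed
    ultimately have 1: "(s \<oplus> s') [^] k \<otimes> (s \<otimes> z) \<in> Q"
      using Suc.hyps(1)[OF k(1), of "s \<otimes> z"] k(1) st Suc.prems(1) by simp
    have "s' [^] b' \<otimes> (s' \<otimes> z) \<in> Q" using Suc.prems ab st c by (simp add: m_assoc)
    moreover have "s [^] a \<otimes> (s' \<otimes> z) \<in> Q"
    proof -
      have "s [^] a \<otimes> (s' \<otimes> z) = s' \<otimes> (s [^] a \<otimes> z)" using Suc.prems(1) st c by (simp add: m_lcomm)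
      then show ?thesis using Q.I_l_closed[OF Suc.prems(2) st(2)] by simp
    qed
    ultimately have 2: "(s \<oplus> s') [^] k \<otimes> (s' \<otimes> z) \<in> Q"
      using Suc.hyps(1)[OF k(2), of "s' \<otimes> z"] k(2) st Suc.prems(1) by simp
    have "(s \<oplus> s') [^] (a + b) = (s \<oplus> s') [^] k \<otimes> (s \<oplus> s')" using Suc.hyps(2)[symmetric] by simp
    then have "(s \<oplus> s') [^] (a + b) \<otimes> z = (s \<oplus> s') [^] k \<otimes> (s \<otimes> z) \<oplus> (s \<oplus> s') [^] k \<otimes> (s' \<otimes> z)"
      using zc[of k] st Suc.prems(1) by (simp add: m_assoc l_distr r_distr)
    then show ?thesis using Q.a_closed[OF 1 2] by simp
  qed
qed

lemma (in cring) radical_ideal: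
  assumes Q: "ideal Q R" shows "ideal {s \<in> carrier R. \<exists>t::nat. s [^] t \<in> Q} R"
proof (rule ideal_criterion)
  interpret Q: ideal Q R by (rule Q)
  have "\<zero> [^] (1::nat) \<in> Q" using Q.zero_closed by simp
  then show "\<zero> \<in> {s \<in> carrier R. \<exists>t::nat. s [^] t \<in> Q}" using zero_closed by blast
next
  fix a b assume "a \<in> {s \<in> carrier R. \<exists>t::nat. s [^] t \<in> Q}" "b \<in> {s \<in> carrier R. \<exists>t::nat. s [^] t \<in> Q}"
  then obtain t u :: nat where d: "a \<in> carrier R" "b \<in> carrier R" "a [^] t \<in> Q" "b [^] u \<in> Q" by auto
  have "(a \<oplus> b) [^] (t + u) \<otimes> \<one> \<in> Q" by (rule radical_add[OF Q]) (use d in auto)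
  then have "(a \<oplus> b) [^] (t + u) \<in> Q" using d by simp
  then show "a \<oplus> b \<in> {s \<in> carrier R. \<exists>t::nat. s [^] t \<in> Q}" using d by blast
next
  interpret Q: ideal Q R by (rule Q)
  fix a s assume "a \<in> {s \<in> carrier R. \<exists>t::nat. s [^] t \<in> Q}" "s \<in> carrier R"
  then obtain t :: nat where d: "a \<in> carrier R" "s \<in> carrier R" "a [^] t \<in> Q" by auto
  have "(s \<otimes> a) [^] t \<in> Q" using d Q.I_l_closed[OF d(3), of "s [^] t"] by (simp add: nat_pow_distrib)
  then show "s \<otimes> a \<in> {s \<in> carrier R. \<exists>t::nat. s [^] t \<in> Q}" using d by blast
qed auto

lemma (in module) annihilator_elem_ideal:
  assumes y: "y \<in> carrier M" shows "ideal {s \<in> carrier R. s \<odot>\<^bsub>M\<^esub> y = \<zero>\<^bsub>M\<^esub>} R"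
  by (rule R.ideal_criterion) (use y in \<open>auto simp: smult_l_distr smult_assoc1\<close>)

text \<open>\<open>y\<close> is power torsion for \<open>s\<close> exactly when \<open>s\<close>
  lies in the radical of the annihilator of \<open>y\<close>. Hence torsion for a set extends to
  every element of the ideal that it generates.\<close>

lemma (in module) tors_radical:
  assumes y: "y \<in> carrier M" shows "ideal {s \<in> carrier R. y \<in> tors R M {s}} R"
proof -
  have "{s \<in> carrier R. y \<in> tors R M {s}} =
      {s \<in> carrier R. \<exists>t::nat. s [^] t \<in> {s \<in> carrier R. s \<odot>\<^bsub>M\<^esub> y = \<zero>\<^bsub>M\<^esub>}}"
    using y by (auto simp: tors_def)
  then show ?thesis using R.radical_ideal[OF annihilator_elem_ideal[OF y]] by simp
qed

lemma tors_singletons: "y \<in> tors S M G \<longleftrightarrow> y \<in> carrier M \<and> (\<forall>g\<in>G. y \<in> tors S M {g})"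
  by (auto simp: tors_def)

section \<open>Torsion with respect to the irrelevant ideal\<close>

context graded_algebra
begin

abbreviation "xs \<equiv> x ` {..<n}"

lemma xs_closed: "xs \<subseteq> carrier S" using x_closed by auto

text \<open>For fixed \<open>y\<close>, the elements for which \<open>y\<close> is torsion form a
  radical ideal. If it contains the \<open>c i\<close>, it contains \<open>fs\<close> exactly when
  it contains the \<open>x i\<close>: a power of \<open>x i\<close> is \<open>c i\<close> modulo
  \<open>(fs)\<close>, and elements of positive degree lie in the ideal of the
  \<open>x i\<close>.\<close>

lemma tors_exchange:
  assumes M: "module S M" and c: "\<And>i. i < n \<Longrightarrow> c i \<in> carrier S"
    and cx: "\<And>i. i < n \<Longrightarrow> \<exists>k::nat. x i [^] k \<ominus> c i \<in> Idl (set fs)"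
    and fs: "\<And>f. f \<in> set fs \<Longrightarrow> \<exists>k>0. f \<in> Sg k"
  shows "tors S M (c ` {..<n} \<union> set fs) = tors S M (c ` {..<n} \<union> xs)"
proof -
  interpret M: module S M by (rule M)
  have fsS: "set fs \<subseteq> carrier S" using fs Sg_closed by blast
  have "set fs \<subseteq> Idl xs"
  proof
    fix f assume "f \<in> set fs"
    then obtain k where k: "k > 0" "f \<in> Sg k" using fs by blast
    show "f \<in> Idl xs"
      by (rule positive_degree_mem[OF genideal_ideal[OF xs_closed] _ k(2,1)]) (use genideal_self[OF xs_closed] in auto)
  qed
  have "y \<in> tors S M (c ` {..<n} \<union> set fs) \<longleftrightarrow> y \<in> tors S M (c ` {..<n} \<union> xs)" for y
  proof (cases "y \<in> carrier M")
    case True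
    define r where "r = {s \<in> carrier S. y \<in> tors S M {s}}"
    have r: "ideal r S" unfolding r_def by (rule M.tors_radical[OF True])
    interpret rI: ideal r S by (rule r)
    have mem: "y \<in> tors S M G \<longleftrightarrow> G \<subseteq> r" if "G \<subseteq> carrier S" for G
      unfolding r_def by (subst tors_singletons) (use that True in blast)
    have cS: "c ` {..<n} \<subseteq> carrier S" by (rule image_subsetI, rule c) (simp only: lessThan_iff)
    have m1: "y \<in> tors S M (c ` {..<n} \<union> set fs) \<longleftrightarrow> c ` {..<n} \<union> set fs \<subseteq> r"
      by (rule mem[OF Un_least[OF cS fsS]])
    have m2: "y \<in> tors S M (c ` {..<n} \<union> xs) \<longleftrightarrow> c ` {..<n} \<union> xs \<subseteq> r"
      by (rule mem[OF Un_least[OF cS xs_closed]])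
    have "c ` {..<n} \<union> set fs \<subseteq> r \<longleftrightarrow> c ` {..<n} \<union> xs \<subseteq> r"
    proof (intro iffI Un_least)
      assume a: "c ` {..<n} \<union> set fs \<subseteq> r"
      have I: "Idl (set fs) \<subseteq> r" using a by (intro genideal_minimal[OF r]) simp
      show "xs \<subseteq> r"
      proof
        fix z assume "z \<in> xs"
        then obtain i where i: "i < n" "z = x i" by auto
        obtain k :: nat where k: "x i [^] k \<ominus> c i \<in> Idl (set fs)" using cx[OF i(1)] by blast
        have "x i [^] k \<ominus> c i \<in> r" using k I by (rule subsetD[rotated])
        moreover have "c i \<in> r" using a i by auto
        ultimately have "(x i [^] k \<ominus> c i) \<oplus> c i \<in> r" by (rule rI.a_closed)
        moreover have "(x i [^] k \<ominus> c i) \<oplus> c i = x i [^] k"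
          using x_closed[OF i(1)] c[OF i(1)] by (simp add: minus_eq a_assoc l_neg)
        ultimately have "x i [^] k \<in> r" by simp
        then have "y \<in> tors S M {x i [^] k}" unfolding r_def by blast
        then obtain t :: nat where "(x i [^] k) [^] t \<odot>\<^bsub>M\<^esub> y = \<zero>\<^bsub>M\<^esub>" by (auto simp: tors_def)
        then have "x i [^] (k * t) \<odot>\<^bsub>M\<^esub> y = \<zero>\<^bsub>M\<^esub>" using x_closed[OF i(1)] by (simp add: nat_pow_pow)
        then show "z \<in> r" unfolding r_def using x_closed[OF i(1)] True i by (auto simp: tors_def)
      qed
    next
      assume a: "c ` {..<n} \<union> xs \<subseteq> r"
      then have "Idl xs \<subseteq> r" by (intro genideal_minimal[OF r]) simp
      then show "set fs \<subseteq> r" using \<open>set fs \<subseteq> Idl xs\<close> by (rule subset_trans[rotated])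
    qed simp_all
    then show ?thesis unfolding m1 m2 .
  qed (simp add: tors_def)
  then show ?thesis by blast
qed

text \<open>A filtration between powers of \<open>S_+\<close> and homogeneous ideals: it contains
  the powers, and from some index on it lies in any homogeneous ideal that contains all large
  degrees.\<close>

definition from_degree :: "nat \<Rightarrow> 's set" where
  "from_degree N = {a \<in> carrier S. \<forall>j<int N. hc a j = \<zero>}"

lemma from_degree_ideal: "ideal (from_degree N) S"
proof (rule ideal_criterion)
  fix a s assume a: "a \<in> from_degree N" and s: "s \<in> carrier S"
  have aS: "a \<in> carrier S" using a by (simp add: from_degree_def)
  have "\<forall>j<int N. hc (s \<otimes> a) j = \<zero>" using s
  proof (induction rule: comp_induct)
    case (comp p)
    have "hc (hc s p \<otimes> a) j = hc s p \<otimes> hc a (j - p)" for j by (rule comp_mult[OF comp_Sg[OF s] aS])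
    moreover have "hc s p \<otimes> hc a (j - p) = \<zero>" if j: "j < int N" for j
    proof (cases "p < 0")
      case True
      then have "hc s p = \<zero>" using comp_Sg[OF s, of p] Sg_neg by simp
      then show ?thesis using aS by simp
    next
      case False
      then have "hc a (j - p) = \<zero>" using a j by (simp add: from_degree_def)
      then show ?thesis using s by simp
    qed
    ultimately show ?case by simp
  qed (use aS in \<open>auto simp: l_distr comp_add\<close>)
  then show "s \<otimes> a \<in> from_degree N" using aS s by (simp add: from_degree_def)
qed (auto simp: from_degree_def comp_add)

lemma from_degree_mult:
  assumes "a \<in> from_degree N" "b \<in> from_degree K"
  shows "a \<otimes> b \<in> from_degree (N + K)"
proof -
  have ab: "a \<in> carrier S" "b \<in> carrier S" using assms by (auto simp: from_degree_def)
  have "\<forall>j<int (N + K). hc (a \<otimes> b) j = \<zero>" using ab(1)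
  proof (induction rule: comp_induct)
    case (comp p)
    have "hc (hc a p \<otimes> b) j = hc a p \<otimes> hc b (j - p)" for j by (rule comp_mult[OF comp_Sg[OF ab(1)] ab(2)])
    moreover have "hc a p \<otimes> hc b (j - p) = \<zero>" if j: "j < int (N + K)" for j
    proof (cases "p < int N")
      case True
      then have "hc a p = \<zero>" using assms by (simp add: from_degree_def)
      then show ?thesis using ab by simp
    next
      case False
      then have "hc b (j - p) = \<zero>" using assms j by (simp add: from_degree_def)
      then show ?thesis using ab by simp
    qed
    ultimately show ?case by simp
  qed (use ab in \<open>auto simp: l_distr comp_add\<close>)
  then show ?thesis using ab by (simp add: from_degree_def)
qed

lemma irrelevant_power: "(Idl xs) [^]\<^bsub>ideals_set S\<^esub> (N::nat) \<subseteq> from_degree N"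
proof (induction N)
  case 0
  have "hc a j = \<zero>" if "a \<in> carrier S" "j < 0" for a j using comp_Sg[OF that(1), of j] Sg_neg[OF that(2)] by simp
  then show ?case by (auto simp: nat_pow_def ideals_set_def from_degree_def)
next
  case (Suc N)
  have "Idl xs \<subseteq> from_degree 1"
  proof (rule genideal_minimal[OF from_degree_ideal], intro subsetI)
    fix z assume "z \<in> xs"
    then obtain i where i: "i < n" "z = x i" by auto
    have "hc z j = \<zero>" if "j < 1" for j
      using comp_homogeneous[OF x_Sg[OF i(1)], of j] that w_pos[OF i(1)] i(2) by auto
    then show "z \<in> from_degree 1" using x_closed i by (simp add: from_degree_def)
  qed
  have e: "(Idl xs) [^]\<^bsub>ideals_set S\<^esub> (Suc N) = ideal_prod S ((Idl xs) [^]\<^bsub>ideals_set S\<^esub> N) (Idl xs)"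
    by (simp add: nat_pow_def ideals_set_def)
  show ?case unfolding e
  proof
    fix a assume "a \<in> ideal_prod S ((Idl xs) [^]\<^bsub>ideals_set S\<^esub> N) (Idl xs)"
    then show "a \<in> from_degree (Suc N)"
    proof (induction rule: ideal_prod.induct)
      case (prod i j)
      then have "i \<otimes> j \<in> from_degree (N + 1)" using Suc \<open>Idl xs \<subseteq> from_degree 1\<close> by (intro from_degree_mult) auto
      then show ?case by simp
    next
      case (sum a b)
      then show ?case using additive_subgroup.a_closed[OF ideal.axioms(1)[OF from_degree_ideal]] by blast
    qed
  qed
qed

lemma irrelevant_power_contains: "i < n \<Longrightarrow> x i [^] (N::nat) \<in> (Idl xs) [^]\<^bsub>ideals_set S\<^esub> N"
proof (induction N)
  case 0 then show ?case by (simp add: nat_pow_def ideals_set_def)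
next
  case (Suc N)
  have "x i \<in> Idl xs" using genideal_self[OF xs_closed] Suc.prems by auto
  then have "x i [^] N \<otimes> x i \<in> ideal_prod S ((Idl xs) [^]\<^bsub>ideals_set S\<^esub> N) (Idl xs)"
    using Suc by (intro ideal_prod.prod) auto
  then show ?case by (simp add: nat_pow_def ideals_set_def)
qed

text \<open>Links torsion for powers of the ideal to elementwise torsion. If a power of each
  \<open>x i\<close> kills \<open>y\<close>, the ideal generated by these powers kills
  \<open>y\<close> too; it contains all large degrees, hence a power of \<open>S_+\<close>.\<close>

lemma torsion_part_eq:
  assumes M: "module S M" shows "torsion_part S (Idl xs) M = tors S M xs"
proof -
  interpret M: module S M by (rule M)
  have "y \<in> torsion_part S (Idl xs) M" if y: "y \<in> tors S M xs" for y
  proof -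
    have yM: "y \<in> carrier M" using y by (simp add: tors_def)
    have "\<forall>i<n. \<exists>k::nat. x i [^] k \<odot>\<^bsub>M\<^esub> y = \<zero>\<^bsub>M\<^esub>" using y by (auto simp: tors_def)
    then obtain k :: "nat \<Rightarrow> nat" where k: "\<And>i. i < n \<Longrightarrow> x i [^] k i \<odot>\<^bsub>M\<^esub> y = \<zero>\<^bsub>M\<^esub>" by metis
    let ?G = "(\<lambda>i. x i [^] k i) ` {..<n}"
    have G: "?G \<subseteq> carrier S" using x_closed by auto
    have hG: "homog (Idl ?G)" by (rule homog_Idl) (use Sg_pow[OF x_Sg] in auto)
    have "x i [^] k i \<in> Idl ?G" if "i < n" for i using genideal_self[OF G] that by auto
    then have "\<exists>j0. \<forall>j\<ge>j0. Sg j \<subseteq> Idl ?G" by (intro large_degree[OF hG]) blast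
    then obtain j0 where j0: "\<And>j. j \<ge> j0 \<Longrightarrow> Sg j \<subseteq> Idl ?G" by blast
    have "Idl ?G \<subseteq> {s \<in> carrier S. s \<odot>\<^bsub>M\<^esub> y = \<zero>\<^bsub>M\<^esub>}"
      by (rule genideal_minimal[OF M.annihilator_elem_ideal[OF yM]]) (use G k in auto)
    moreover have "from_degree (nat j0) \<subseteq> Idl ?G"
    proof
      fix a assume a: "a \<in> from_degree (nat j0)"
      then have aS: "a \<in> carrier S" by (simp add: from_degree_def)
      show "a \<in> Idl ?G"
      proof (rule ideal_comps[OF homogD(1)[OF hG] aS])
        fix j show "hc a j \<in> Idl ?G"
        proof (cases "j < int (nat j0)")
          case True
          then have "hc a j = \<zero>" using a by (simp add: from_degree_def)
          then show ?thesis using additive_subgroup.zero_closed[OF ideal.axioms(1)[OF homogD(1)[OF hG]]] by simp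
        next
          case False
          then have "j0 \<le> j" by linarith
          then show ?thesis using j0 comp_Sg[OF aS] by blast
        qed
      qed
    qed
    ultimately have "\<forall>a\<in>(Idl xs) [^]\<^bsub>ideals_set S\<^esub> (nat j0). a \<odot>\<^bsub>M\<^esub> y = \<zero>\<^bsub>M\<^esub>"
      using irrelevant_power[of "nat j0"] by auto
    then show ?thesis using yM by (auto simp: torsion_part_def)
  qed
  moreover have "y \<in> tors S M xs" if "y \<in> torsion_part S (Idl xs) M" for y
    using that irrelevant_power_contains unfolding torsion_part_def tors_def by auto
  ultimately show ?thesis by blast
qed

end

section \<open>Homogeneous primes over a local base ring\<close>

locale local_graded_algebra = graded_algebra S Sg R h x w n
  for S :: "'s ring" (structure) and Sg and R :: "('r, 'z) ring_scheme" and h x w n +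
  fixes m :: "'r set"
  assumes loc: "local_ring R m"
begin

lemma m_max: "maximalideal m R" using loc by (simp add: local_ring_def)

sublocale m: maximalideal m R by (rule m_max)

lemma m_prime: "primeideal m R" by (rule R.maximalideal_prime[OF m_max])

text \<open>An ideal that contains \<open>r\<close> and is maximal among those without 1 is a
  maximal ideal, hence equal to \<open>m\<close>.\<close>

lemma unit_outside:
  assumes r: "r \<in> carrier R" "r \<notin> m" shows "\<exists>s\<in>carrier R. s \<otimes>\<^bsub>R\<^esub> r = \<one>\<^bsub>R\<^esub>"
proof (rule ccontr)
  assume nu: "\<not> ?thesis"
  let ?A = "{I. ideal I R \<and> r \<in> I \<and> \<one>\<^bsub>R\<^esub> \<notin> I}"
  have "\<one>\<^bsub>R\<^esub> \<notin> PIdl\<^bsub>R\<^esub> r" using nu by (auto simp: cgenideal_def)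
  then have "PIdl\<^bsub>R\<^esub> r \<in> ?A" using R.cgenideal_ideal[OF r(1)] R.cgenideal_self[OF r(1)] by simp
  then have ne: "?A \<noteq> {}" by blast
  have "\<exists>J\<in>?A. \<forall>I\<in>?A. J \<subseteq> I \<longrightarrow> I = J"
    by (rule R.maximal_in_family[OF ne]) simp
  then obtain J where J: "ideal J R" "r \<in> J" "\<one>\<^bsub>R\<^esub> \<notin> J" and max: "\<forall>I\<in>?A. J \<subseteq> I \<longrightarrow> I = J" by auto
  have "maximalideal J R"
  proof (rule maximalidealI[OF J(1)])
    show "carrier R \<noteq> J" using J(3) by auto
    fix I assume I: "ideal I R" "J \<subseteq> I" "I \<subseteq> carrier R"
    show "I = J \<or> I = carrier R"
    proof (cases "\<one>\<^bsub>R\<^esub> \<in> I")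
      case True then show ?thesis using ideal.one_imp_carrier[OF I(1)] by simp
    next
      case False
      then have "I \<in> ?A" using I J(2) by auto
      then show ?thesis using max I(2) by simp
    qed
  qed
  then have "J = m" using loc by (simp add: local_ring_def)
  then show False using J(2) r(2) by simp
qed

definition mS :: "'s set" where "mS = Idl (h ` m)"
text \<open>The ideal \<open>m S + S_+\<close>, which contains every homogeneous prime. As there are
  no negative degrees, membership shows in the component of degree 0.\<close>

definition nn :: "'s set" where "nn = {a \<in> carrier S. hc a 0 \<in> h ` m}"

lemma h_m: "h ` m \<subseteq> carrier S" using m.Icarr by auto

lemma h_m_Sg: "a \<in> h ` m \<Longrightarrow> a \<in> Sg 0" using m.Icarr Sg0 by auto

lemma mS_ideal: "ideal mS S" unfolding mS_def by (rule genideal_ideal[OF h_m])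

lemma mS_homog: "homog mS" unfolding mS_def by (rule homog_Idl) (use h_m_Sg in blast)

lemma h_m_mS: "h ` m \<subseteq> mS" unfolding mS_def by (rule genideal_self[OF h_m])

lemma h_zero: "h \<zero>\<^bsub>R\<^esub> = \<zero>" by (rule ring_hom_zero[OF h R.ring_axioms ring_axioms])

lemma zero_h_m: "\<zero> \<in> h ` m" using imageI[OF m.zero_closed, of h] h_zero by simp

lemma h_mem_m: "r \<in> carrier R \<Longrightarrow> h r \<in> h ` m \<Longrightarrow> r \<in> m"
  using inj_onD[OF h_inj] m.Icarr by blast

lemma nn_ideal: "ideal nn S"
proof (rule ideal_criterion)
  show "nn \<subseteq> carrier S" by (auto simp: nn_def)
  show "\<zero> \<in> nn" using zero_h_m by (simp add: nn_def)
next
  fix a b assume "a \<in> nn" "b \<in> nn"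
  then obtain r s where rs: "a \<in> carrier S" "b \<in> carrier S" "r \<in> m" "s \<in> m" "hc a 0 = h r" "hc b 0 = h s"
    by (auto simp: nn_def)
  then have "hc (a \<oplus> b) 0 = h (r \<oplus>\<^bsub>R\<^esub> s)" using ring_hom_add[OF h, of r s] m.Icarr by (simp add: comp_add)
  then show "a \<oplus> b \<in> nn" using rs m.a_closed by (simp add: nn_def)
next
  fix a s assume "a \<in> nn" and s: "s \<in> carrier S"
  then obtain r where r: "a \<in> carrier S" "r \<in> m" "hc a 0 = h r" by (auto simp: nn_def)
  have "hc s 0 \<in> h ` carrier R" using comp_Sg[OF s, of 0] Sg0 by simp
  then obtain t where t: "t \<in> carrier R" "hc s 0 = h t" by auto
  have "hc (s \<otimes> a) 0 = h (t \<otimes>\<^bsub>R\<^esub> r)"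
    using degree_zero_mult[OF s r(1)] r t ring_hom_mult[OF h t(1), of r] m.Icarr by simp
  then show "s \<otimes> a \<in> nn" using r s m.I_l_closed[OF r(2) t(1)] by (simp add: nn_def)
qed

lemma nn_homog: "homog nn"
  unfolding homog_def
proof (intro conjI ballI allI nn_ideal)
  fix a j assume a: "a \<in> nn"
  then have aS: "a \<in> carrier S" by (simp add: nn_def)
  have "hc (hc a j) 0 = (if 0 = j then hc a j else \<zero>)" by (rule comp_homogeneous[OF comp_Sg[OF aS]])
  then show "hc a j \<in> nn" using a aS zero_h_m by (auto simp: nn_def)
qed

lemma nn_mS: "mS \<subseteq> nn"
  unfolding mS_def
proof (rule genideal_minimal[OF nn_ideal], intro subsetI)
  fix a assume a: "a \<in> h ` m"
  have "hc a 0 = a" using comp_homogeneous[OF h_m_Sg[OF a], of 0] by simp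
  then show "a \<in> nn" using a h_m by (auto simp: nn_def)
qed

lemma nn_prime: "primeideal nn S"
proof (rule homogeneous_prime[OF nn_homog])
  have "hc \<one> 0 = \<one>" using comp_homogeneous[OF one_Sg, of 0] by simp
  moreover have "\<one> \<notin> h ` m"
  proof
    assume "\<one> \<in> h ` m"
    then have "\<one>\<^bsub>R\<^esub> \<in> m" using ring_hom_one[OF h] h_mem_m[of "\<one>\<^bsub>R\<^esub>"] by simp
    then show False using m.one_imp_carrier m.I_notcarr by simp
  qed
  ultimately have "\<one> \<notin> nn" by (simp add: nn_def)
  then show "nn \<noteq> carrier S" by auto
next
  fix i j a b assume ab: "a \<in> Sg i" "b \<in> Sg j" "a \<otimes> b \<in> nn"
  have S: "a \<in> carrier S" "b \<in> carrier S" using ab Sg_closed by auto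
  have c: "hc a 0 = (if 0 = i then a else \<zero>)" "hc b 0 = (if 0 = j then b else \<zero>)"
    by (rule comp_homogeneous[OF ab(1)], rule comp_homogeneous[OF ab(2)])
  show "a \<in> nn \<or> b \<in> nn"
  proof (cases "i = 0 \<and> j = 0")
    case True
    then obtain r s where rs: "r \<in> carrier R" "s \<in> carrier R" "a = h r" "b = h s" using ab Sg0 by auto
    have "hc (a \<otimes> b) 0 = a \<otimes> b" using degree_zero_mult[OF S] c True by simp
    then have "h (r \<otimes>\<^bsub>R\<^esub> s) \<in> h ` m" using ab(3) rs ring_hom_mult[OF h] by (simp add: nn_def)
    then have "r \<otimes>\<^bsub>R\<^esub> s \<in> m" using rs by (intro h_mem_m) auto
    then have "r \<in> m \<or> s \<in> m" by (rule primeideal.I_prime[OF m_prime rs(1,2)])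
    then show ?thesis using c True rs S by (auto simp: nn_def)
  next
    case False
    then show ?thesis using c S zero_h_m by (auto simp: nn_def)
  qed
qed

text \<open>A degree 0 component outside \<open>m\<close> is a unit, and a homogeneous ideal
  contains the components of its elements.\<close>

lemma homogeneous_prime_subset:
  assumes Q: "homog Q" "primeideal Q S" shows "Q \<subseteq> nn"
proof
  interpret Q: primeideal Q S by (rule Q)
  fix a assume a: "a \<in> Q"
  have aS: "a \<in> carrier S" using a Q.Icarr by simp
  obtain r where r: "r \<in> carrier R" "hc a 0 = h r" using comp_Sg[OF aS, of 0] Sg0 by auto
  have "r \<in> m"
  proof (rule ccontr)
    assume "r \<notin> m"
    then obtain s where s: "s \<in> carrier R" "s \<otimes>\<^bsub>R\<^esub> r = \<one>\<^bsub>R\<^esub>" using unit_outside[OF r(1)] by blast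
    have "h r \<in> Q" using homogD(2)[OF Q(1) a, of 0] r by simp
    then have "h s \<otimes> h r \<in> Q" using Q.I_l_closed s by simp
    then have "\<one> \<in> Q" using ring_hom_mult[OF h s(1) r(1)] s(2) ring_hom_one[OF h] by simp
    then show False using Q.one_imp_carrier Q.I_notcarr by simp
  qed
  then show "a \<in> nn" using r aS by (simp add: nn_def)
qed

lemma homogeneous_prime_eq:
  assumes Q: "homog Q" "primeideal Q S" "mS \<subseteq> Q" and xQ: "\<And>i. i < n \<Longrightarrow> x i \<in> Q" shows "Q = nn"
proof
  show "Q \<subseteq> nn" by (rule homogeneous_prime_subset[OF Q(1,2)])
  have id: "ideal Q S" by (rule homogD(1)[OF Q(1)])
  show "nn \<subseteq> Q"
  proof
    fix a assume a: "a \<in> nn"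
    then have aS: "a \<in> carrier S" by (simp add: nn_def)
    show "a \<in> Q"
    proof (rule ideal_comps[OF id aS])
      fix j :: int
      consider "j = 0" | "j < 0" | "j > 0" by linarith
      then show "hc a j \<in> Q"
      proof cases
        case 1 then show ?thesis using a h_m_mS Q(3) by (auto simp: nn_def)
      next
        case 2
        then have "hc a j = \<zero>" using comp_Sg[OF aS, of j] Sg_neg by simp
        then show ?thesis using additive_subgroup.zero_closed[OF ideal.axioms(1)[OF id]] by simp
      next
        case 3 show ?thesis by (rule positive_degree_mem[OF id xQ comp_Sg[OF aS] 3])
      qed
    qed
  qed
qed

text \<open>Dimension above \<open>I\<close> measured by homogeneous primes. These all lie in
  \<open>nn\<close>, so the prime in which their chains must stop is known.\<close>

definition chain_bound :: "'s set \<Rightarrow> nat \<Rightarrow> bool" where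
  "chain_bound I d \<longleftrightarrow> (\<forall>l P. (\<forall>j\<le>l. homog (P j) \<and> primeideal (P j) S \<and> I \<subseteq> P j) \<longrightarrow>
     (\<forall>j<l. P j \<subset> P (Suc j)) \<longrightarrow> l \<le> d)"

lemma chain_boundD:
  assumes "chain_bound I d" "\<forall>j\<le>l. homog (P j) \<and> primeideal (P j) S \<and> I \<subseteq> P j"
    "\<forall>j<l. P j \<subset> P (Suc j)"
  shows "l \<le> d"
  using assms(1)[unfolded chain_bound_def, THEN spec[of _ l], THEN spec[of _ P], THEN mp, OF assms(2), THEN mp, OF assms(3)] .

text \<open>Homogeneous primes containing all \<open>x i\<close> and \<open>mS\<close> equal \<open>nn\<close>; the new parameter avoids the other
  minimal primes, hence shortens all chains.\<close>

lemma homogeneous_parameters: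
  assumes "homog I" "mS \<subseteq> I" "chain_bound I d"
  shows "\<exists>fs. length fs = d \<and> (\<forall>f\<in>set fs. \<exists>k>0. f \<in> Sg k) \<and> (\<forall>i<n. \<exists>k::nat. x i [^] k \<in> adjoins I fs)"
  using assms
proof (induction d arbitrary: I)
  case 0
  obtain Ps where Ps: "\<forall>P\<in>Ps. homog P \<and> primeideal P S \<and> I \<subseteq> P"
    "\<forall>a\<in>carrier S. (\<forall>P\<in>Ps. a \<in> P) \<longrightarrow> (\<exists>k::nat. a [^] k \<in> I)"
    using homogeneous_decomposes[OF noetherian 0(1)] unfolding decomposes_def by (elim exE conjE)
  have "x i \<in> P" if i: "i < n" and P: "P \<in> Ps" for i P
  proof (rule ccontr)
    assume xP: "x i \<notin> P"
    have hP: "homog P" "primeideal P S" "I \<subseteq> P" using Ps(1) P by auto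
    have sub: "P \<subseteq> nn" by (rule homogeneous_prime_subset[OF hP(1,2)])
    have "hc (x i) 0 = \<zero>" using comp_homogeneous[OF x_Sg[OF i], of 0] w_pos[OF i] by simp
    then have "x i \<in> nn" using x_closed[OF i] zero_h_m by (simp add: nn_def)
    then have strict: "P \<subset> nn" using sub xP by auto
    \<comment> \<open>A homogeneous prime over \<open>I\<close> that misses some \<open>x i\<close>
      lies strictly below \<open>nn\<close>, which gives a chain of length 1 against the bound
      0.\<close>
    let ?P = "\<lambda>j::nat. if j = 0 then P else nn"
    have 1: "\<forall>j\<le>1. homog (?P j) \<and> primeideal (?P j) S \<and> I \<subseteq> ?P j"
      using hP nn_homog nn_prime sub by auto
    have 2: "\<forall>j<1. ?P j \<subset> ?P (Suc j)" using strict by simp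
    show False using chain_boundD[OF 0(3) 1 2] by simp
  qed
  then have "\<forall>i<n. \<exists>k::nat. x i [^] k \<in> I" using Ps(2) x_closed by simp
  then show ?case by (intro exI[of _ "[]"]) simp
next
  case (Suc d)
  obtain Ps where Ps: "finite Ps" "\<forall>P\<in>Ps. homog P \<and> primeideal P S \<and> I \<subseteq> P"
    "\<forall>Q. primeideal Q S \<longrightarrow> I \<subseteq> Q \<longrightarrow> (\<exists>P\<in>Ps. P \<subseteq> Q)"
    using homogeneous_decomposes[OF noetherian Suc.prems(1)] unfolding decomposes_def by (elim exE conjE)
  \<comment> \<open>Primes that contain all \<open>x i\<close> cannot be avoided in positive degree.
    Those over \<open>mS\<close> equal \<open>nn\<close>, and chains starting there have length
    0.\<close>
  let ?Ps = "{P \<in> Ps. \<exists>i<n. x i \<notin> P}"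
  have "\<exists>k>0. \<exists>f\<in>Sg k. \<forall>P\<in>?Ps. f \<notin> P"
  proof (rule homogeneous_prime_avoidance)
    show "finite ?Ps" using Ps(1) by simp
    show "homog P \<and> primeideal P S" if "P \<in> ?Ps" for P using that Ps(2) by simp
    show "\<exists>k>0. \<exists>y\<in>Sg k. y \<notin> P" if P: "P \<in> ?Ps" for P
    proof -
      obtain i where i: "i < n" "x i \<notin> P" using P by auto
      then have "int (w i) > 0" "x i \<in> Sg (int (w i))" using x_Sg w_pos by auto
      then show ?thesis using i by blast
    qed
  qed (rule Sg_neg)
  then obtain k f where f: "k > 0" "f \<in> Sg k" "\<forall>P\<in>?Ps. f \<notin> P" by blast
  have fS: "f \<in> carrier S" using f Sg_closed by blast
  note adj = add_principal[OF homogD(1)[OF Suc.prems(1)] fS]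
  have "chain_bound (adjoin I f) d" unfolding chain_bound_def
  proof (intro allI impI)
    fix l P assume P: "\<forall>j\<le>l. homog (P j) \<and> primeideal (P j) S \<and> adjoin I f \<subseteq> P j"
      and strict: "\<forall>j<l. P j \<subset> P (Suc j)"
    have P0: "homog (P 0)" "primeideal (P 0) S" "adjoin I f \<subseteq> P 0" using P by auto
    have IP: "I \<subseteq> P j" if "j \<le> l" for j using P that adj(2) by blast
    obtain p where p: "p \<in> Ps" "p \<subseteq> P 0" using Ps(3) P0(2) IP[of 0] by auto
    show "l \<le> d"
    proof (cases "p \<in> ?Ps")
      case True
      have "f \<in> P 0" using P0(3) adj(3) by blast
      then have sp: "p \<subset> P 0" using p(2) f(3) True by blast
      \<comment> \<open>\<open>f\<close> lies in \<open>P 0\<close> but not in \<open>p\<close>, so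
        \<open>p\<close> can be prepended to the chain and the bound \<open>Suc d\<close> for
        \<open>I\<close> applies.\<close>
      let ?P = "\<lambda>j. case j of 0 \<Rightarrow> p | Suc j \<Rightarrow> P j"
      have 1: "\<forall>j\<le>Suc l. homog (?P j) \<and> primeideal (?P j) S \<and> I \<subseteq> ?P j"
      proof (intro allI impI)
        fix j assume "j \<le> Suc l"
        then show "homog (?P j) \<and> primeideal (?P j) S \<and> I \<subseteq> ?P j"
          using P IP p(1) Ps(2) by (cases j) simp_all
      qed
      have 2: "\<forall>j<Suc l. ?P j \<subset> ?P (Suc j)"
      proof (intro allI impI)
        fix j assume "j < Suc l"
        then show "?P j \<subset> ?P (Suc j)" using strict sp by (cases j) simp_all
      qed
      show ?thesis using chain_boundD[OF Suc.prems(3) 1 2] by simp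
    next
      case False
      then have xP: "x i \<in> P 0" if "i < n" for i using p that by blast
      have "P 0 = nn" by (rule homogeneous_prime_eq[OF P0(1,2) _ xP]) (use Suc.prems(2) IP[of 0] in auto)
      have "l = 0"
      proof (rule ccontr)
        assume "l \<noteq> 0"
        then have "P 0 \<subset> P (Suc 0)" "homog (P (Suc 0))" "primeideal (P (Suc 0)) S" using strict P by auto
        then show False using homogeneous_prime_subset \<open>P 0 = nn\<close> by blast
      qed
      then show ?thesis by simp
    qed
  qed
  moreover have "homog (adjoin I f)" by (rule homog_add_principal[OF Suc.prems(1) f(2)])
  moreover have "mS \<subseteq> adjoin I f" using Suc.prems(2) adj(2) by blast
  ultimately obtain fs where "length fs = d" "\<forall>f\<in>set fs. \<exists>k>0. f \<in> Sg k"
    "\<forall>i<n. \<exists>k::nat. x i [^] k \<in> adjoins (adjoin I f) fs" using Suc.IH by metis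
  then show ?case using f by (intro exI[of _ "f # fs"]) auto
qed

end

section \<open>Graded Nakayama and parameters modulo an annihilator\<close>

lemma set_add_self_module [simp]: "set_add (self_module S) A B = set_add S A B"
  by (simp add: set_add_def')

lemma ideal_of_self_submodule:
  assumes "cring S" "submodule N S (self_module S)" shows "ideal N S"
proof -
  interpret cring S by (rule assms)
  interpret SM: module S "self_module S" by (rule module_self[OF assms(1)])
  note N = SM.submoduleE[OF assms(2)]
  show ?thesis
    by (rule ideal_criterion) (use N SM.submodule_zero[OF assms(2)] in auto)
qed

lemma self_submodule_of_ideal:
  assumes "cring S" "ideal N S" shows "submodule N S (self_module S)"
proof -
  interpret SM: module S "self_module S" by (rule module_self[OF assms(1)])
  interpret N: ideal N S by (rule assms)
  show ?thesis
    by (rule SM.submodule_criterion) (use N.Icarr N.zero_closed N.a_closed N.I_l_closed in auto)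
qed

lemma (in module) mspan_mono_left: "I \<subseteq> J \<Longrightarrow> mspan I V \<subseteq> mspan J V"
  unfolding mspan_def by (rule M.add.mono_generate) auto

context graded_cring
begin

text \<open>Generators are chosen within \<open>V\<close>, so for \<open>V = Sg j\<close> they are
  homogeneous of degree \<open>j\<close>.\<close>

lemma ideal_generated_finitely:
  assumes "noetherian_ring S" and V: "V \<subseteq> carrier S"
  shows "\<exists>us. set us \<subseteq> V \<and> V \<subseteq> Idl (set us)"
proof -
  interpret N: noetherian_ring S by (rule assms)
  let ?A = "{Idl (set us) | us. set us \<subseteq> V}"
  have ne: "?A \<noteq> {}" by (auto intro: exI[of _ "[]"])
  have "\<exists>J\<in>?A. \<forall>I\<in>?A. J \<subseteq> I \<longrightarrow> I = J"
    by (rule N.maximal_in_family[OF ne]) (use V genideal_ideal in auto)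
  then obtain us where us: "set us \<subseteq> V" and mx: "\<forall>I\<in>?A. Idl (set us) \<subseteq> I \<longrightarrow> I = Idl (set us)" by auto
  have "V \<subseteq> Idl (set us)"
  proof
    fix v assume v: "v \<in> V"
    have vus: "set (v # us) \<subseteq> V" "set (v # us) \<subseteq> carrier S" using v us V by auto
    then have "Idl (set (v # us)) \<in> ?A" by blast
    moreover have "Idl (set us) \<subseteq> Idl (set (v # us))"
      using genideal_self[OF vus(2)] by (intro genideal_minimal genideal_ideal[OF vus(2)]) auto
    ultimately have "Idl (set (v # us)) = Idl (set us)" using mx by simp
    then show "v \<in> Idl (set us)" using genideal_self[OF vus(2)] by auto
  qed
  then show ?thesis using us by blast
qed

end

section \<open>Nakayama's lemma in a single degree, and the fibre of a module\<close>

context local_graded_algebra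
begin

text \<open>Confines the Nakayama argument to one degree. As in \<open>homog_Idl\<close>, the
  elements with this property form an ideal that contains the generators of
  \<open>mS\<close>.\<close>

lemma mS_components:
  assumes "\<mu> \<in> mS" shows "hc \<mu> j \<in> SS.mspan mS (Sg j)"
proof -
  have SgS: "Sg j \<subseteq> carrier (self_module S)" for j using Sg_closed by auto
  have mSS: "mS \<subseteq> carrier S" using ideal.Icarr[OF mS_ideal] by auto
  note sm = SS.submoduleE[OF SS.submodule_mspan[OF mS_ideal SgS]]
  define K where "K = {\<mu> \<in> carrier S. \<forall>j. hc \<mu> j \<in> SS.mspan mS (Sg j)}"
  have shift: "s \<otimes> v \<in> SS.mspan mS (Sg (p + j))" if s: "s \<in> Sg p" and v: "v \<in> SS.mspan mS (Sg j)" for s p v j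
    using v mSS SgS
  proof (induction rule: SS.mspan_induct)
    case zero then show ?case using s Sg_closed SS.mspan_zero[of mS "Sg (p + j)"] by simp
  next
    case (smult \<mu> z)
    have "s \<otimes> (\<mu> \<otimes> z) = \<mu> \<otimes> (s \<otimes> z)" using s smult mSS Sg_closed by (intro m_lcomm) auto
    moreover have "\<mu> \<odot>\<^bsub>self_module S\<^esub> (s \<otimes> z) \<in> SS.mspan mS (Sg (p + j))"
      by (rule SS.mspan_incl[OF smult(1) Sg_mult[OF s smult(2)]])
    ultimately show ?case by simp
  next
    case (neg y)
    have "y \<in> carrier S" using subsetD[OF SS.mspan_carrier[OF mSS SgS] neg(1)] by simp
    then show ?case using neg(2) sm(3)[of "s \<otimes> y" "p + j"] s Sg_closed by (simp add: r_minus)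
  next
    case (add y z)
    have "y \<in> carrier S" "z \<in> carrier S"
      using subsetD[OF SS.mspan_carrier[OF mSS SgS] add(1)] subsetD[OF SS.mspan_carrier[OF mSS SgS] add(2)] by simp_all
    then show ?case using SS.mspan_add[OF add(3,4)] s Sg_closed by (simp add: r_distr)
  qed
  have "ideal K S"
  proof (rule ideal_criterion)
    show "K \<subseteq> carrier S" by (auto simp: K_def)
    show "\<zero> \<in> K" using SS.mspan_zero by (simp add: K_def)
    fix a b assume "a \<in> K" "b \<in> K"
    then show "a \<oplus> b \<in> K" using SS.mspan_add unfolding K_def by (simp add: comp_add)
  next
    fix a s assume a: "a \<in> K" and s: "s \<in> carrier S"
    then have aS: "a \<in> carrier S" by (simp add: K_def)
    have "\<forall>j. hc (s \<otimes> a) j \<in> SS.mspan mS (Sg j)" using s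
    proof (induction rule: comp_induct)
      case zero then show ?case using aS SS.mspan_zero by simp
    next
      case (comp p)
      show ?case
      proof
        fix j
        have "hc a (j - p) \<in> SS.mspan mS (Sg (j - p))" using a by (simp add: K_def)
        from shift[OF comp_Sg[OF s] this, of p] show "hc (hc s p \<otimes> a) j \<in> SS.mspan mS (Sg j)"
          using comp_mult[OF comp_Sg[OF s] aS, of p j] by simp
      qed
    next
      case (add y z)
      then show ?case using aS SS.mspan_add by (simp add: l_distr comp_add)
    qed
    then show "s \<otimes> a \<in> K" using aS s by (simp add: K_def)
  qed
  moreover have "h ` m \<subseteq> K"
  proof
    fix a assume a: "a \<in> h ` m"
    have "a \<odot>\<^bsub>self_module S\<^esub> \<one> \<in> SS.mspan mS (Sg 0)"
      by (rule SS.mspan_incl) (use a h_m_mS one_Sg in auto)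
    then have "a \<in> SS.mspan mS (Sg 0)" using a h_m by (auto simp: subset_iff)
    then have "hc a j \<in> SS.mspan mS (Sg j)" for j
      using comp_homogeneous[OF h_m_Sg[OF a], of j] SS.mspan_zero[of mS "Sg j"] by simp
    then show "a \<in> K" using a h_m by (auto simp: K_def)
  qed
  ultimately have "mS \<subseteq> K" unfolding mS_def by (rule genideal_minimal)
  then show ?thesis using assms by (auto simp: K_def)
qed

text \<open>Modulo \<open>m\<close> the degree 0 component of \<open>c\<close> is 1, and in a local
  ring such an element is a unit.\<close>

lemma unit_degree_zero:
  assumes c: "c \<in> carrier S" "c \<ominus> \<one> \<in> nn"
  shows "\<exists>s\<in>carrier S. s \<otimes> hc c 0 = \<one>"
proof -
  obtain t where t: "t \<in> carrier R" "hc c 0 = h t" using comp_Sg[OF c(1), of 0] Sg0 by auto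
  have "hc (c \<ominus> \<one>) 0 = h t \<ominus> \<one>" using c(1) t comp_homogeneous[OF one_Sg, of 0] by (simp add: comp_diff)
  then obtain \<mu> where \<mu>: "\<mu> \<in> m" "h t \<ominus> \<one> = h \<mu>" using c(2) by (auto simp: nn_def)
  have \<mu>R: "\<mu> \<in> carrier R" using \<mu> m.Icarr by simp
  have "t \<notin> m"
  proof
    assume tm: "t \<in> m"
    have "h t = h \<mu> \<oplus> \<one>"
      using \<mu>(2)[symmetric] t(1) by (simp add: minus_eq a_assoc l_neg)
    also have "\<dots> = h (\<mu> \<oplus>\<^bsub>R\<^esub> \<one>\<^bsub>R\<^esub>)" using ring_hom_add[OF h \<mu>R, of "\<one>\<^bsub>R\<^esub>"] ring_hom_one[OF h] by simp
    finally have "t = \<mu> \<oplus>\<^bsub>R\<^esub> \<one>\<^bsub>R\<^esub>" using inj_onD[OF h_inj] t(1) \<mu>R by simp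
    then have "\<one>\<^bsub>R\<^esub> = \<ominus>\<^bsub>R\<^esub> \<mu> \<oplus>\<^bsub>R\<^esub> t" using \<mu>R by (simp add: R.r_neg1)
    then have "\<one>\<^bsub>R\<^esub> \<in> m" using tm \<mu>(1) m.a_closed m.a_inv_closed by simp
    then show False using m.one_imp_carrier m.I_notcarr by simp
  qed
  then obtain s where s: "s \<in> carrier R" "s \<otimes>\<^bsub>R\<^esub> t = \<one>\<^bsub>R\<^esub>" using unit_outside[OF t(1)] by blast
  have "h s \<otimes> hc c 0 = \<one>" using ring_hom_mult[OF h s(1) t(1)] s(2) t(2) ring_hom_one[OF h] by simp
  then show ?thesis using s(1) by (intro bexI[of _ "h s"]) auto
qed

text \<open>In a large degree \<open>j\<close> the hypothesis places \<open>Sg j\<close> in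
  \<open>N\<close> plus the span of products of \<open>mS\<close> with \<open>Sg j\<close>.
  Elimination with multiplier 1 yields \<open>c\<close>, congruent to 1 modulo \<open>mS\<close>,
  that carries \<open>Sg j\<close> into \<open>N\<close>. Comparing components of degree
  \<open>j\<close>, its degree 0 part does the same, and that part is a unit.\<close>

lemma graded_nakayama:
  assumes N: "homog N" and ex: "\<And>i. i < n \<Longrightarrow> \<exists>k::nat. x i [^] k \<in> set_add S N mS" and i: "i < n"
  shows "\<exists>k::nat. x i [^] k \<in> N"
proof -
  interpret N: ideal N S by (rule homogD(1)[OF N])
  have J: "homog (set_add S N mS)" by (rule homog_sum[OF N mS_homog])
  obtain j0 where j0: "\<And>j. j \<ge> j0 \<Longrightarrow> Sg j \<subseteq> set_add S N mS" using large_degree[OF J ex] by blast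
  \<comment> \<open>As \<open>w i \<ge> 1\<close>, the power \<open>x i^k\<close> has degree at
    least \<open>j0\<close>.\<close>
  define k where "k = nat j0"
  define j where "j = int k * int (w i)"
  have "int k * 1 \<le> j" unfolding j_def using w_pos[OF i] by (intro mult_left_mono) auto
  then have jj: "j \<ge> j0" unfolding k_def by linarith
  have V: "Sg j \<subseteq> carrier S" "Sg j \<subseteq> carrier (self_module S)" using Sg_closed by auto
  obtain us where us: "set us \<subseteq> Sg j" "Sg j \<subseteq> Idl (set us)"
    using ideal_generated_finitely[OF noetherian V(1)] by blast
  have usc: "set us \<subseteq> carrier (self_module S)" using us V by auto
  have Ns: "submodule N S (self_module S)" by (rule self_submodule_of_ideal[OF is_cring N.is_ideal])
  have cb: "submodule (SS.comb (carrier S) N us) S (self_module S)"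
    by (rule SS.comb_submodule[OF oneideal Ns usc])
  have "Idl (set us) \<subseteq> SS.comb (carrier S) N us"
    by (rule genideal_minimal[OF ideal_of_self_submodule[OF is_cring cb] SS.comb_gens[OF Ns usc]])
  then have Vc: "Sg j \<subseteq> SS.comb (carrier S) N us" using us(2) by (rule subset_trans[rotated])
  have oneV: "\<one> \<odot>\<^bsub>self_module S\<^esub> v \<in> set_add (self_module S) (SS.mspan mS (Sg j)) N" if v: "v \<in> Sg j" for v
  proof -
    have vS: "v \<in> carrier S" using v Sg_closed by simp
    obtain b \<mu> where b: "b \<in> N" "\<mu> \<in> mS" "v = b \<oplus> \<mu>" using j0[OF jj] v by (auto simp: set_add_def')
    have c: "b \<in> carrier S" "\<mu> \<in> carrier S" using N.Icarr[OF b(1)] ideal.Icarr[OF mS_ideal b(2)] by auto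
    have "v = hc v j" using comp_homogeneous[OF v] by simp
    also have "\<dots> = hc \<mu> j \<oplus> hc b j" using b(3) c by (simp add: comp_add a_comm)
    finally have "v = hc \<mu> j \<oplus> hc b j" .
    moreover have "hc b j \<in> N" by (rule homogD(2)[OF N b(1)])
    ultimately have "v \<in> set_add S (SS.mspan mS (Sg j)) N"
      using mS_components[OF b(2), of j] unfolding set_add_def' by blast
    then show ?thesis using vS by simp
  qed
  have "\<exists>c'\<in>carrier S. \<exists>k'::nat. c' \<ominus> \<one> [^] k' \<in> mS \<and> (\<forall>v\<in>Sg j. c' \<odot>\<^bsub>self_module S\<^esub> v \<in> N)"
  proof (rule SS.eliminate_generators[OF mS_ideal Ns one_closed V(2) oneV us(1) one_closed])
    show "\<one> \<ominus> \<one> [^] (0::nat) \<in> mS"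
      using additive_subgroup.zero_closed[OF ideal.axioms(1)[OF mS_ideal]] by (simp add: r_neg minus_eq)
    show "\<one> \<odot>\<^bsub>self_module S\<^esub> v \<in> SS.comb (carrier S) N us" if "v \<in> Sg j" for v
      using that Vc Sg_closed[OF that] by auto
  qed
  then obtain c where c: "c \<in> carrier S" "c \<ominus> \<one> \<in> mS" "\<forall>v\<in>Sg j. c \<otimes> v \<in> N" by auto
  obtain s where s: "s \<in> carrier S" "s \<otimes> hc c 0 = \<one>" using unit_degree_zero[OF c(1)] c(2) nn_mS by blast
  have xk: "x i [^] k \<in> Sg j" unfolding j_def by (rule Sg_pow[OF x_Sg[OF i]])
  have xkS: "x i [^] k \<in> carrier S" using xk Sg_closed by simp
  have "hc (c \<otimes> x i [^] k) j \<in> N" using homogD(2)[OF N] c(3) xk by blast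
  then have "hc c 0 \<otimes> x i [^] k \<in> N" using comp_mult_right[OF xk c(1), of j] by simp
  then have "s \<otimes> (hc c 0 \<otimes> x i [^] k) \<in> N" by (rule N.I_l_closed[OF _ s(1)])
  moreover have "s \<otimes> (hc c 0 \<otimes> x i [^] k) = x i [^] k"
    using s c(1) xkS by (simp add: m_assoc[symmetric])
  ultimately have "x i [^] k \<in> N" by simp
  then show ?thesis by blast
qed

text \<open>The annihilator of \<open>M / mM\<close>, that is of \<open>M \<otimes> k\<close>,
  expressed without the tensor product.\<close>

definition fiber_ann :: "('s, 'm) module \<Rightarrow> 's set" where
  "fiber_ann M = {s \<in> carrier S. \<forall>v\<in>carrier M. s \<odot>\<^bsub>M\<^esub> v \<in> module.mspan M (h ` m) (carrier M)}"

context
  fixes M :: "('s, 'm) module" and Mg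
  assumes gM: "graded_module S Sg M Mg" and fg: "finitely_generated_module S M"
begin

interpretation MM: graded_mod S Sg M Mg
  using gM Sg_closed by (intro graded_mod.intro graded_mod_axioms.intro) (auto simp: graded_module_def)

abbreviation "Ann \<equiv> annihilator S M"

lemma Ann_ideal: "ideal Ann S"
  by (rule ideal_criterion) (auto simp: annihilator_def MM.smult_l_distr MM.smult_assoc1)

lemma gc_smult_homogeneous:
  assumes a: "a \<in> carrier S" and y: "y \<in> Mg i"
  shows "\<forall>j. MM.gc (a \<odot>\<^bsub>M\<^esub> y) (j + i) = hc a j \<odot>\<^bsub>M\<^esub> y"
  using a
proof (induction rule: comp_induct)
  case zero then show ?case using MM.Mg_carrier[OF y] by simp
next
  case (comp p)
  have "MM.gc (hc a p \<odot>\<^bsub>M\<^esub> y) (j + i) = hc (hc a p) j \<odot>\<^bsub>M\<^esub> y" for j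
  proof -
    have 1: "hc a p \<odot>\<^bsub>M\<^esub> y \<in> Mg (p + i)" by (rule MM.Mg_smult[OF comp_Sg[OF a] y])
    show ?thesis using MM.gc_homogeneous[OF 1, of "j + i"] comp_homogeneous[OF comp_Sg[OF a], of p j] MM.Mg_carrier[OF y]
      by simp
  qed
  then show ?case by simp
next
  case (add b c)
  then show ?case using MM.Mg_carrier[OF y] by (simp add: MM.smult_l_distr MM.gc_add comp_add)
qed

lemma Ann_homog: "homog Ann"
  unfolding homog_def
proof (intro conjI ballI allI Ann_ideal)
  fix a j assume a: "a \<in> Ann"
  then have aS: "a \<in> carrier S" by (simp add: annihilator_def)
  have "hc a j \<odot>\<^bsub>M\<^esub> y = \<zero>\<^bsub>M\<^esub>" if y: "y \<in> carrier M" for y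
    using y
  proof (induction rule: MM.graded_induct)
    case zero then show ?case using aS by simp
  next
    case (comp i)
    have "MM.gc (a \<odot>\<^bsub>M\<^esub> MM.gc y i) (j + i) = hc a j \<odot>\<^bsub>M\<^esub> MM.gc y i"
      using gc_smult_homogeneous[OF aS MM.gc_Mg[OF y]] by blast
    then show ?case using a MM.gc_closed[OF y] by (simp add: annihilator_def)
  next
    case (add y z) then show ?case using aS by (simp add: MM.smult_r_distr)
  qed
  then show "hc a j \<in> Ann" using aS by (simp add: annihilator_def)
qed

text \<open>Elimination with \<open>N = 0\<close> and multiplier \<open>s\<close> gives an element
  that kills \<open>M\<close> and is congruent to a power of \<open>s\<close> modulo
  \<open>mS\<close>. So primes over \<open>Ann + mS\<close>, which the parameters deal with, contain
  the annihilator of the fibre, whose dimension is given.\<close>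

lemma fiber_ann_radical:
  assumes s: "s \<in> fiber_ann M" shows "\<exists>k::nat. s [^] k \<in> set_add S Ann mS"
proof -
  have sS: "s \<in> carrier S" using s by (simp add: fiber_ann_def)
  obtain G where G: "finite G" "G \<subseteq> carrier M" "\<And>N. submodule N S M \<Longrightarrow> G \<subseteq> N \<Longrightarrow> N = carrier M"
    using fg unfolding finitely_generated_module_def by blast
  obtain us where us: "set us = G" using finite_list[OF G(1)] by blast
  have N: "submodule {\<zero>\<^bsub>M\<^esub>} S M" by (rule MM.submodule_criterion) auto
  have usc: "set us \<subseteq> carrier M" using us G by simp
  have cb: "MM.comb (carrier S) {\<zero>\<^bsub>M\<^esub>} us = carrier M"
    by (rule G(3)[OF MM.comb_submodule[OF oneideal N usc]]) (use MM.comb_gens[OF N usc] us in simp)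
  have sV: "s \<odot>\<^bsub>M\<^esub> v \<in> set_add M (MM.mspan mS (carrier M)) {\<zero>\<^bsub>M\<^esub>}" if v: "v \<in> carrier M" for v
  proof -
    have "s \<odot>\<^bsub>M\<^esub> v \<in> MM.mspan mS (carrier M)"
      using s v MM.mspan_mono_left[OF h_m_mS] unfolding fiber_ann_def by blast
    moreover have "s \<odot>\<^bsub>M\<^esub> v = s \<odot>\<^bsub>M\<^esub> v \<oplus>\<^bsub>M\<^esub> \<zero>\<^bsub>M\<^esub>" using sS v by simp
    ultimately show ?thesis unfolding set_add_def' by blast
  qed
  have "\<exists>c'\<in>carrier S. \<exists>k'::nat. c' \<ominus> s [^] k' \<in> mS \<and> (\<forall>v\<in>carrier M. c' \<odot>\<^bsub>M\<^esub> v \<in> {\<zero>\<^bsub>M\<^esub>})"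
  proof (rule MM.eliminate_generators[OF mS_ideal N sS subset_refl sV usc one_closed])
    show "\<one> \<ominus> s [^] (0::nat) \<in> mS"
      using additive_subgroup.zero_closed[OF ideal.axioms(1)[OF mS_ideal]] by (simp add: r_neg minus_eq)
    show "\<one> \<odot>\<^bsub>M\<^esub> v \<in> MM.comb (carrier S) {\<zero>\<^bsub>M\<^esub>} us" if "v \<in> carrier M" for v using that cb by simp
  qed
  then obtain c and k :: nat where c: "c \<in> carrier S" "c \<ominus> s [^] k \<in> mS" "\<forall>v\<in>carrier M. c \<odot>\<^bsub>M\<^esub> v = \<zero>\<^bsub>M\<^esub>" by auto
  have cA: "c \<in> Ann" using c by (simp add: annihilator_def)
  have "\<ominus> (c \<ominus> s [^] k) \<in> mS"
    using additive_subgroup.a_inv_closed[OF ideal.axioms(1)[OF mS_ideal] c(2)] .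
  moreover have "s [^] k = c \<oplus> \<ominus> (c \<ominus> s [^] k)"
  proof -
    have "s [^] k \<in> carrier S" using sS by simp
    then show ?thesis using c(1) by algebra
  qed
  ultimately show ?thesis using cA unfolding set_add_def' by blast
qed

lemma prime_contains_fiber_ann:
  assumes P: "primeideal P S" "set_add S Ann mS \<subseteq> P" shows "fiber_ann M \<subseteq> P"
proof
  fix s assume s: "s \<in> fiber_ann M"
  then obtain k :: nat where "s [^] k \<in> P" using fiber_ann_radical P(2) by blast
  then show "s \<in> P" using primeideal.pow_memD[OF P(1)] s by (simp add: fiber_ann_def)
qed

theorem parameters_modulo_annihilator:
  assumes bound: "\<And>l P. (\<forall>j\<le>l. primeideal (P j) S \<and> fiber_ann M \<subseteq> P j) \<Longrightarrow> (\<forall>j<l. P j \<subset> P (Suc j)) \<Longrightarrow> l \<le> d"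
  shows "\<exists>fs c. length fs = d \<and> (\<forall>f\<in>set fs. \<exists>k>0. f \<in> Sg k) \<and>
    (\<forall>i<n. c i \<in> Ann \<and> (\<exists>j. c i \<in> Sg j) \<and> (\<exists>k::nat. x i [^] k \<ominus> c i \<in> Idl (set fs)))"
proof -
  let ?K = "set_add S Ann mS"
  have K: "homog ?K" by (rule homog_sum[OF Ann_homog mS_homog])
  note up = sum_upper[OF Ann_ideal mS_ideal]
  have "chain_bound ?K d"
    unfolding chain_bound_def
  proof (intro allI impI)
    fix l P assume "\<forall>j\<le>l. homog (P j) \<and> primeideal (P j) S \<and> ?K \<subseteq> P j" "\<forall>j<l. P j \<subset> P (Suc j)"
    then show "l \<le> d" using prime_contains_fiber_ann by (intro bound[of l P]) auto
  qed
  then obtain fs where fs: "length fs = d" "\<forall>f\<in>set fs. \<exists>k>0. f \<in> Sg k" "\<forall>i<n. \<exists>k::nat. x i [^] k \<in> adjoins ?K fs"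
    using homogeneous_parameters[OF K up(2)] by blast
  have fsS: "set fs \<subseteq> carrier S" using fs(2) Sg_closed by blast
  let ?F = "Idl (set fs)" and ?N = "set_add S Ann (Idl (set fs))"
  have F: "ideal ?F S" "homog ?F" "set fs \<subseteq> ?F"
    using genideal_ideal[OF fsS] homog_Idl[of "set fs"] fs(2) genideal_self[OF fsS] by blast+
  have N: "homog ?N" by (rule homog_sum[OF Ann_homog F(2)])
  note Nid = homogD(1)[OF N] and upN = sum_upper[OF Ann_ideal F(1)]
  note upM = sum_upper[OF Nid mS_ideal]
  have NM: "ideal (set_add S ?N mS) S" by (rule add_ideals[OF Nid mS_ideal])
  \<comment> \<open>Regroups the sum of \<open>Ann\<close>, \<open>mS\<close> and
    \<open>(fs)\<close> so that \<open>mS\<close> stands last, the shape in which Nakayama removes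
    it.\<close>
  have "adjoins ?K fs \<subseteq> set_add S ?N mS"
  proof (rule adjoins(4)[OF homogD(1)[OF K] fsS NM])
    show "?K \<subseteq> set_add S ?N mS"
      by (rule sum_least[OF NM subset_trans[OF upN(1) upM(1)] upM(2)])
    show "set fs \<subseteq> set_add S ?N mS"
      by (rule subset_trans[OF F(3) subset_trans[OF upN(2) upM(1)]])
  qed
  then have ex: "\<exists>k::nat. x i [^] k \<in> set_add S ?N mS" if "i < n" for i using fs(3) that by blast
  have "\<exists>c. c \<in> Ann \<and> (\<exists>j. c \<in> Sg j) \<and> (\<exists>k::nat. x i [^] k \<ominus> c \<in> ?F)" if i: "i < n" for i
  proof -
    obtain k :: nat where k: "x i [^] k \<in> ?N" using graded_nakayama[OF N ex i] by blast
    let ?j = "int k * int (w i)"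
    obtain a g where ag: "a \<in> Ann" "g \<in> ?F" "x i [^] k = a \<oplus> g" using k by (auto simp: set_add_def')
    have c: "a \<in> carrier S" "g \<in> carrier S" using ideal.Icarr[OF Ann_ideal ag(1)] ideal.Icarr[OF F(1) ag(2)] by auto
    \<comment> \<open>Taking components in the degree of \<open>x i^k\<close> makes the summand from
      \<open>Ann\<close> homogeneous, so that it may be adjoined in the graded case.\<close>
    have "x i [^] k = hc (x i [^] k) ?j" using comp_homogeneous[OF Sg_pow[OF x_Sg[OF i]], of k ?j] by simp
    also have "\<dots> = hc a ?j \<oplus> hc g ?j" using ag(3) c by (simp add: comp_add)
    finally have e: "x i [^] k = hc a ?j \<oplus> hc g ?j" .
    have "hc a ?j \<in> carrier S" "hc g ?j \<in> carrier S" using c by auto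
    then have "x i [^] k \<ominus> hc a ?j = hc g ?j" unfolding e by algebra
    then have "x i [^] k \<ominus> hc a ?j \<in> ?F" using homogD(2)[OF F(2) ag(2)] by simp
    then show ?thesis using homogD(2)[OF Ann_homog ag(1)] comp_Sg[OF c(1)] by blast
  qed
  then obtain c where "\<forall>i<n. c i \<in> Ann \<and> (\<exists>j. c i \<in> Sg j) \<and> (\<exists>k::nat. x i [^] k \<ominus> c i \<in> ?F)" by metis
  then show ?thesis using fs(1,2) by blast
qed

text \<open>The case of dimension minus infinity. Without primes, 1 lies in \<open>Ann + mS\<close>,
  so some element of \<open>Ann\<close> is congruent to 1 modulo \<open>mS\<close>; its degree 0
  component is a unit that kills \<open>M\<close>.\<close>

lemma zero_if_no_primes:
  assumes no: "\<And>P. primeideal P S \<Longrightarrow> fiber_ann M \<subseteq> P \<Longrightarrow> False"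
  shows "carrier M = {\<zero>\<^bsub>M\<^esub>}"
proof -
  let ?K = "set_add S Ann mS"
  have K: "homog ?K" by (rule homog_sum[OF Ann_homog mS_homog])
  obtain Ps where Ps: "\<forall>P\<in>Ps. homog P \<and> primeideal P S \<and> ?K \<subseteq> P"
    "\<forall>a\<in>carrier S. (\<forall>P\<in>Ps. a \<in> P) \<longrightarrow> (\<exists>k::nat. a [^] k \<in> ?K)"
    using homogeneous_decomposes[OF noetherian K] unfolding decomposes_def by (elim exE conjE)
  have "Ps = {}" using Ps(1) no prime_contains_fiber_ann by blast
  then obtain k :: nat where "\<one> [^] k \<in> ?K" using Ps(2) one_closed by blast
  then obtain a \<mu> where a: "a \<in> Ann" "\<mu> \<in> mS" "\<one> = a \<oplus> \<mu>" by (auto simp: set_add_def')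
  have c: "a \<in> carrier S" "\<mu> \<in> carrier S" using ideal.Icarr[OF Ann_ideal a(1)] ideal.Icarr[OF mS_ideal a(2)] by auto
  have "a \<ominus> \<one> = \<ominus> \<mu>" using c unfolding a(3) by algebra
  then have "a \<ominus> \<one> \<in> mS" using additive_subgroup.a_inv_closed[OF ideal.axioms(1)[OF mS_ideal] a(2)] by simp
  then obtain s where s: "s \<in> carrier S" "s \<otimes> hc a 0 = \<one>" using unit_degree_zero[OF c(1)] nn_mS by blast
  have "s \<otimes> hc a 0 \<in> Ann" by (rule ideal.I_l_closed[OF Ann_ideal homogD(2)[OF Ann_homog a(1)] s(1)])
  then have "\<one> \<in> Ann" using s by simp
  then show ?thesis by (auto simp: annihilator_def)
qed

end

end

section \<open>Krull dimension of a quotient\<close>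

text \<open>Chains of primes over \<open>I\<close> map to chains in the quotient ring, so a bound on
  its dimension bounds chains in \<open>S\<close>.\<close>

lemma krull_dim_quotient:
  assumes S: "cring S" and I: "ideal I S"
    and P: "\<forall>j\<le>l. primeideal (P j) S \<and> I \<subseteq> P j" "\<forall>j<l. P j \<subset> P (Suc j)"
  shows "ereal (real l) \<le> krull_dim (S Quot I)"
proof -
  interpret cring S by (rule S)
  interpret I: ideal I S by (rule I)
  let ?q = "\<lambda>a. I +>\<^bsub>S\<^esub> a"
  have mem: "?q a \<in> ?q ` P j \<longleftrightarrow> a \<in> P j" if a: "a \<in> carrier S" and j: "j \<le> l" for a j
  proof
    interpret P: primeideal "P j" S using P(1) j by blast
    assume "?q a \<in> ?q ` P j"
    then obtain b where b: "b \<in> P j" "?q a = ?q b" by auto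
    have bS: "b \<in> carrier S" using b P.Icarr by simp
    have "a \<ominus>\<^bsub>S\<^esub> b \<in> I" using quotient_eq_iff_same_a_r_cos[OF I a bS] b(2) by simp
    then have "a \<ominus>\<^bsub>S\<^esub> b \<in> P j" using P(1) j by blast
    then have "(a \<ominus>\<^bsub>S\<^esub> b) \<oplus>\<^bsub>S\<^esub> b \<in> P j" using b(1) by (rule P.a_closed)
    moreover have "(a \<ominus>\<^bsub>S\<^esub> b) \<oplus>\<^bsub>S\<^esub> b = a" using a bS by algebra
    ultimately show "a \<in> P j" by simp
  qed simp
  have pr: "primeideal (?q ` P j) (S Quot I)" if j: "j \<le> l" for j
  proof (rule primeidealI)
    interpret P: primeideal "P j" S using P(1) j by blast
    show "ideal (?q ` P j) (S Quot I)" by (rule ring_ideal_imp_quot_ideal[OF I P.is_ideal])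
    show "cring (S Quot I)" by (rule I.quotient_is_cring[OF S])
    have "?q \<one>\<^bsub>S\<^esub> \<notin> ?q ` P j"
    proof
      assume "?q \<one>\<^bsub>S\<^esub> \<in> ?q ` P j"
      then have "\<one>\<^bsub>S\<^esub> \<in> P j" using mem[OF one_closed j] by simp
      then show False using P.one_imp_carrier P.I_notcarr by simp
    qed
    moreover have "?q \<one>\<^bsub>S\<^esub> \<in> carrier (S Quot I)" by (auto simp: FactRing_simps)
    ultimately show "carrier (S Quot I) \<noteq> ?q ` P j" by auto
    fix u v assume "u \<in> carrier (S Quot I)" "v \<in> carrier (S Quot I)" and uv: "u \<otimes>\<^bsub>S Quot I\<^esub> v \<in> ?q ` P j"
    then obtain a b where ab: "a \<in> carrier S" "b \<in> carrier S" "u = ?q a" "v = ?q b" by (auto simp: FactRing_simps)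
    have "u \<otimes>\<^bsub>S Quot I\<^esub> v = ?q (a \<otimes>\<^bsub>S\<^esub> b)"
      using I.rcoset_mult_add[OF ab(1,2)] ab by (simp add: FactRing_def)
    then have "a \<otimes>\<^bsub>S\<^esub> b \<in> P j" using uv mem[of "a \<otimes>\<^bsub>S\<^esub> b" j] ab j by simp
    then show "u \<in> ?q ` P j \<or> v \<in> ?q ` P j" using P.I_prime[OF ab(1,2)] ab by blast
  qed
  have "?q ` P j \<subset> ?q ` P (Suc j)" if j: "j < l" for j
  proof -
    have sub: "P j \<subset> P (Suc j)" using P(2) j by blast
    then obtain a where a: "a \<in> P (Suc j)" "a \<notin> P j" by blast
    have "ideal (P (Suc j)) S" using P(1) j by (simp add: primeideal.axioms(1))
    then have "a \<in> carrier S" using ideal.Icarr a(1) by metis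
    then have "?q a \<notin> ?q ` P j" using mem[of a j] a(2) j by simp
    then show ?thesis using sub a(1) by blast
  qed
  then have "l \<in> {l. \<exists>P. (\<forall>j\<le>l. primeideal (P j) (S Quot I)) \<and> (\<forall>j<l. P j \<subset> P (Suc j))}"
    using pr by (intro CollectI exI[of _ "\<lambda>j. ?q ` P j"]) simp
  then show ?thesis unfolding krull_dim_def by (rule SUP_upper)
qed

section \<open>Injective modules\<close>

lemma tors_divisible_mono: "tors_divisible S H E \<Longrightarrow> H' \<subseteq> H \<Longrightarrow> tors_divisible S H' E"
  unfolding tors_divisible_def by (meson subset_iff)

text \<open>The colon ideals \<open>K : f^N\<close> increase with \<open>N\<close> and become
  stationary.\<close>

lemma (in noetherian_ring) colon_stabilizes:
  assumes R: "cring R" and K: "ideal K R" and f: "f \<in> carrier R"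
  shows "\<exists>N::nat. \<forall>t::nat. \<forall>a\<in>carrier R. a \<otimes> f [^] (N + t) \<in> K \<longrightarrow> a \<otimes> f [^] N \<in> K"
proof -
  interpret cring R by (rule R)
  interpret K: ideal K R by (rule K)
  let ?C = "\<lambda>N::nat. {a \<in> carrier R. a \<otimes> f [^] N \<in> K}"
  have id: "ideal (?C N) R" for N
  proof (rule ideal_criterion)
    fix a b assume ab: "a \<in> ?C N" "b \<in> ?C N"
    then have "a \<otimes> f [^] N \<oplus> b \<otimes> f [^] N \<in> K" by (intro K.a_closed) simp_all
    then show "a \<oplus> b \<in> ?C N" using ab f by (simp add: l_distr)
  next
    fix a s assume as: "a \<in> ?C N" "s \<in> carrier R"
    then have "s \<otimes> (a \<otimes> f [^] N) \<in> K" using K.I_l_closed[of "a \<otimes> f [^] N" s] by simp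
    then show "s \<otimes> a \<in> ?C N" using as f by (simp add: m_assoc)
  qed (use f K.zero_closed in auto)
  have "\<exists>J\<in>range ?C. \<forall>I\<in>range ?C. J \<subseteq> I \<longrightarrow> I = J"
    by (rule maximal_in_family) (use id in auto)
  then obtain N where mx: "\<And>N'. ?C N \<subseteq> ?C N' \<Longrightarrow> ?C N' = ?C N" by auto
  have "a \<otimes> f [^] N \<in> K" if a: "a \<in> carrier R" "a \<otimes> f [^] (N + t) \<in> K" for a and t :: nat
  proof -
    have "?C N \<subseteq> ?C (N + t)"
    proof (rule Collect_mono, rule impI, rule conjI)
      fix b assume "b \<in> carrier R \<and> b \<otimes> f [^] N \<in> K"
      then have b: "b \<in> carrier R" "b \<otimes> f [^] N \<in> K" by simp_all
      show "b \<in> carrier R" by fact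
      have "b \<otimes> f [^] (N + t) = (b \<otimes> f [^] N) \<otimes> f [^] t"
        using b f by (simp add: nat_pow_mult[symmetric] m_assoc)
      then show "b \<otimes> f [^] (N + t) \<in> K" using K.I_r_closed[OF b(2), of "f [^] t"] f by simp
    qed
    then have "?C (N + t) = ?C N" by (rule mx)
    moreover have "a \<in> ?C (N + t)" using a by simp
    ultimately show ?thesis by simp
  qed
  then show ?thesis by blast
qed

section \<open>Baer maps and the divisibility of torsion in injective modules\<close>

context
  fixes S :: "'s ring" (structure) and E :: "('s, 'e) module"
  assumes S: "cring S" and E: "module S E"
begin

interpretation S: cring S by (rule S)
interpretation E: module S E by (rule E)

text \<open>Well defined because \<open>f^t\<close> can be cancelled beyond \<open>N\<close>: if
  \<open>(a \<ominus> b) f^(N + t)\<close> lies in \<open>K\<close>, then so does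
  \<open>(a \<ominus> b) f^N\<close>, and it kills \<open>e\<close>.\<close>

lemma baer_map:
  assumes K: "ideal K S" and f: "f \<in> carrier S" and e: "e \<in> carrier E" and Ke: "\<And>\<kappa>. \<kappa> \<in> K \<Longrightarrow> \<kappa> \<odot>\<^bsub>E\<^esub> e = \<zero>\<^bsub>E\<^esub>"
    and N: "\<And>a. a \<in> carrier S \<Longrightarrow> a \<otimes> f [^] (N + t :: nat) \<in> K \<Longrightarrow> a \<otimes> f [^] (N::nat) \<in> K"
  shows "\<exists>g\<in>module_hom S (self_module S\<lparr>carrier := S.adjoin K (f [^] (N + t))\<rparr>) E.
    \<forall>a\<in>carrier S. \<forall>\<kappa>\<in>K. g (\<kappa> \<oplus> a \<otimes> f [^] (N + t)) = (a \<otimes> f [^] N) \<odot>\<^bsub>E\<^esub> e"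
proof -
  interpret K: ideal K S by (rule K)
  let ?F = "f [^] (N + t)"
  define g where "g z = ((SOME a. a \<in> carrier S \<and> (\<exists>\<kappa>\<in>K. z = \<kappa> \<oplus> a \<otimes> ?F)) \<otimes> f [^] N) \<odot>\<^bsub>E\<^esub> e" for z
  have F: "?F \<in> carrier S" "f [^] N \<in> carrier S" using f by simp_all
  have g: "g (\<kappa> \<oplus> a \<otimes> ?F) = (a \<otimes> f [^] N) \<odot>\<^bsub>E\<^esub> e" if a: "a \<in> carrier S" and \<kappa>: "\<kappa> \<in> K" for a \<kappa>
  proof -
    let ?P = "\<lambda>b. b \<in> carrier S \<and> (\<exists>\<kappa>'\<in>K. \<kappa> \<oplus> a \<otimes> ?F = \<kappa>' \<oplus> b \<otimes> ?F)"
    define b where "b = (SOME b. ?P b)"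
    have "?P b" unfolding b_def by (rule someI[of ?P a]) (use a \<kappa> in blast)
    then obtain \<kappa>' where b: "b \<in> carrier S" "\<kappa>' \<in> K" "\<kappa> \<oplus> a \<otimes> ?F = \<kappa>' \<oplus> b \<otimes> ?F" by blast
    have c: "\<kappa> \<in> carrier S" "\<kappa>' \<in> carrier S" using \<kappa> b K.Icarr by auto
    have "(a \<ominus> b) \<otimes> ?F = (\<kappa> \<oplus> a \<otimes> ?F) \<ominus> \<kappa> \<ominus> b \<otimes> ?F" using a b(1) c F by algebra
    also have "\<dots> = \<kappa>' \<ominus> \<kappa>" unfolding b(3) using b(1) c F by algebra
    finally have "(a \<ominus> b) \<otimes> ?F = \<kappa>' \<ominus> \<kappa>" .
    then have "(a \<ominus> b) \<otimes> ?F \<in> K" using \<kappa> b(2) by (simp add: S.minus_eq)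
    then have "(a \<ominus> b) \<otimes> f [^] N \<in> K" using N[of "a \<ominus> b"] a b(1) by simp
    then have z: "((a \<ominus> b) \<otimes> f [^] N) \<odot>\<^bsub>E\<^esub> e = \<zero>\<^bsub>E\<^esub>" by (rule Ke)
    have "a \<otimes> f [^] N = (a \<ominus> b) \<otimes> f [^] N \<oplus> b \<otimes> f [^] N" using a b(1) F by algebra
    then have "(a \<otimes> f [^] N) \<odot>\<^bsub>E\<^esub> e = (b \<otimes> f [^] N) \<odot>\<^bsub>E\<^esub> e"
      using z a b(1) F e by (simp add: E.smult_l_distr)
    then show ?thesis by (simp add: g_def b_def)
  qed
  have "g \<in> module_hom S (self_module S\<lparr>carrier := S.adjoin K ?F\<rparr>) E"
    unfolding module_hom_def
  proof (intro CollectI conjI ballI Pi_I)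
    fix z assume "z \<in> carrier (self_module S\<lparr>carrier := S.adjoin K ?F\<rparr>)"
    then obtain \<kappa> a where z: "\<kappa> \<in> K" "a \<in> carrier S" "z = \<kappa> \<oplus> a \<otimes> ?F" by (auto simp: S.mem_add_principal)
    show "g z \<in> carrier E" unfolding z(3) g[OF z(2,1)] using z(2) F e by simp
    fix z' assume "z' \<in> carrier (self_module S\<lparr>carrier := S.adjoin K ?F\<rparr>)"
    then obtain \<kappa>' a' where z': "\<kappa>' \<in> K" "a' \<in> carrier S" "z' = \<kappa>' \<oplus> a' \<otimes> ?F" by (auto simp: S.mem_add_principal)
    have c: "\<kappa> \<in> carrier S" "\<kappa>' \<in> carrier S" using z(1) z'(1) K.Icarr by auto
    have "z \<oplus> z' = (\<kappa> \<oplus> \<kappa>') \<oplus> (a \<oplus> a') \<otimes> ?F" unfolding z(3) z'(3) using c z(2) z'(2) F by algebra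
    then have "g (z \<oplus> z') = ((a \<oplus> a') \<otimes> f [^] N) \<odot>\<^bsub>E\<^esub> e" using g[of "a \<oplus> a'" "\<kappa> \<oplus> \<kappa>'"] z z' by simp
    also have "\<dots> = g z \<oplus>\<^bsub>E\<^esub> g z'"
      using g[OF z(2,1)] g[OF z'(2,1)] z z' F e by (simp add: S.l_distr E.smult_l_distr)
    finally show "g (z \<oplus>\<^bsub>self_module S\<lparr>carrier := S.adjoin K ?F\<rparr>\<^esub> z') = g z \<oplus>\<^bsub>E\<^esub> g z'" by simp
  next
    fix s z assume s: "s \<in> carrier S" and "z \<in> carrier (self_module S\<lparr>carrier := S.adjoin K ?F\<rparr>)"
    then obtain \<kappa> a where z: "\<kappa> \<in> K" "a \<in> carrier S" "z = \<kappa> \<oplus> a \<otimes> ?F" by (auto simp: S.mem_add_principal)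
    have c: "\<kappa> \<in> carrier S" using z(1) K.Icarr by auto
    have "s \<otimes> z = (s \<otimes> \<kappa>) \<oplus> (s \<otimes> a) \<otimes> ?F" unfolding z(3) using c z(2) s F by algebra
    then have "g (s \<otimes> z) = ((s \<otimes> a) \<otimes> f [^] N) \<odot>\<^bsub>E\<^esub> e" using g[of "s \<otimes> a" "s \<otimes> \<kappa>"] z s K.I_l_closed by simp
    also have "\<dots> = s \<odot>\<^bsub>E\<^esub> g z" using g[OF z(2,1)] z s F e by (simp add: S.m_assoc E.smult_assoc1)
    finally show "g (s \<odot>\<^bsub>self_module S\<lparr>carrier := S.adjoin K ?F\<rparr>\<^esub> z) = s \<odot>\<^bsub>E\<^esub> g z" by simp
  qed
  then show ?thesis using g by blast
qed

lemma common_torsion_exponent: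
  assumes "finite G" "G \<subseteq> carrier S" "e \<in> tors S E G"
  shows "\<exists>p::nat. \<forall>g\<in>G. g [^] p \<odot>\<^bsub>E\<^esub> e = \<zero>\<^bsub>E\<^esub>"
proof -
  have "\<forall>g\<in>G. \<exists>t::nat. g [^] t \<odot>\<^bsub>E\<^esub> e = \<zero>\<^bsub>E\<^esub>" using assms(3) by (simp add: tors_def)
  then obtain t :: "'s \<Rightarrow> nat" where t: "\<forall>g\<in>G. g [^] t g \<odot>\<^bsub>E\<^esub> e = \<zero>\<^bsub>E\<^esub>" by metis
  have "g [^] (\<Sum>g\<in>G. t g) \<odot>\<^bsub>E\<^esub> e = \<zero>\<^bsub>E\<^esub>" if g: "g \<in> G" for g
  proof (rule E.smult_pow_zero_mono)
    show "t g \<le> (\<Sum>g\<in>G. t g)" using assms(1) g by (intro member_le_sum) auto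
  qed (use g t assms in \<open>auto simp: tors_def\<close>)
  then show ?thesis by blast
qed

lemma power_ideal_kills:
  assumes G: "G \<subseteq> carrier S" and e: "e \<in> carrier E" "\<forall>g\<in>G. g [^] (p::nat) \<odot>\<^bsub>E\<^esub> e = \<zero>\<^bsub>E\<^esub>"
    and \<kappa>: "\<kappa> \<in> Idl ((\<lambda>g. g [^] p) ` G)"
  shows "\<kappa> \<odot>\<^bsub>E\<^esub> e = \<zero>\<^bsub>E\<^esub>"
proof -
  have "Idl ((\<lambda>g. g [^] p) ` G) \<subseteq> {s \<in> carrier S. s \<odot>\<^bsub>E\<^esub> e = \<zero>\<^bsub>E\<^esub>}"
    by (rule S.genideal_minimal[OF E.annihilator_elem_ideal[OF e(1)]]) (use G e(2) in auto)
  then show ?thesis using \<kappa> by blast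
qed

text \<open>Extending the map \<open>\<kappa> + a f\<^sup>N\<^sup>+\<^sup>t \<mapsto> a f\<^sup>N e\<close> to the whole ring divides \<open>e\<close> by \<open>f\<^sup>t\<close> up to torsion.\<close>

lemma divide_by_extension:
  assumes G: "G \<subseteq> carrier S" and f: "f \<in> carrier S"
    and \<gamma>: "\<gamma> \<in> module_hom S (self_module S) E"
    and ext: "\<And>a \<kappa>. a \<in> carrier S \<Longrightarrow> \<kappa> \<in> Idl ((\<lambda>g. g [^] (p::nat)) ` G) \<Longrightarrow>
      \<gamma> (\<kappa> \<oplus> a \<otimes> f [^] (N + t :: nat)) = (a \<otimes> f [^] (N::nat)) \<odot>\<^bsub>E\<^esub> e"
    and e: "e \<in> carrier E"
  shows "\<gamma> \<one> \<in> tors S E G" "f [^] (N + t) \<odot>\<^bsub>E\<^esub> \<gamma> \<one> = f [^] N \<odot>\<^bsub>E\<^esub> e"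
proof -
  interpret SM: module S "self_module S" by (rule module_self[OF S])
  interpret \<gamma>: module_homomorphism S "self_module S" E \<gamma>
    by (intro module_homomorphism.intro module_homomorphism_axioms.intro SM.module_axioms E \<gamma>)
  have Gp: "(\<lambda>g. g [^] p) ` G \<subseteq> carrier S" using G by auto
  have K: "ideal (Idl ((\<lambda>g. g [^] p) ` G)) S" by (rule S.genideal_ideal[OF Gp])
  have F: "f [^] (N + t) \<in> carrier S" "f [^] N \<in> carrier S" using f by simp_all
  have 1: "\<gamma> \<one> \<in> carrier E" using \<gamma>.closed[of \<one>] by simp
  have sc: "s \<odot>\<^bsub>E\<^esub> \<gamma> \<one> = \<gamma> s" if "s \<in> carrier S" for s using \<gamma>.smult[of s \<one>] that by simp
  have z: "\<zero> \<in> Idl ((\<lambda>g. g [^] p) ` G)" by (rule additive_subgroup.zero_closed[OF ideal.axioms(1)[OF K]])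
  have "g [^] p \<odot>\<^bsub>E\<^esub> \<gamma> \<one> = \<zero>\<^bsub>E\<^esub>" if g: "g \<in> G" for g
  proof -
    have gp: "g [^] p \<in> Idl ((\<lambda>g. g [^] p) ` G)" "g [^] p \<in> carrier S" using S.genideal_self[OF Gp] g Gp by auto
    have "\<gamma> (g [^] p) = \<gamma> (g [^] p \<oplus> \<zero> \<otimes> f [^] (N + t))" using gp F by simp
    also have "\<dots> = \<zero>\<^bsub>E\<^esub>" using ext[OF S.zero_closed gp(1)] F e by simp
    finally show ?thesis using sc[OF gp(2)] by simp
  qed
  then show "\<gamma> \<one> \<in> tors S E G" using 1 by (auto simp: tors_def)
  have "\<gamma> (f [^] (N + t)) = \<gamma> (\<zero> \<oplus> \<one> \<otimes> f [^] (N + t))" using F by simp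
  also have "\<dots> = f [^] N \<odot>\<^bsub>E\<^esub> e" using ext[OF S.one_closed z] F by simp
  finally show "f [^] (N + t) \<odot>\<^bsub>E\<^esub> \<gamma> \<one> = f [^] N \<odot>\<^bsub>E\<^esub> e" using sc[OF F(1)] by simp
qed

text \<open>\<open>K\<close> is generated by powers of the elements of \<open>G\<close> that kill
  \<open>e\<close>. The extended map vanishes on \<open>K\<close>, so the element obtained by
  division is again \<open>G\<close>-torsion. Noetherianity enters through the stationary colon
  ideals.\<close>

lemma injective_tors_divisible:
  assumes N: "noetherian_ring S" and inj: "injective_module S E"
  shows "tors_divisible S (carrier S) E"
  unfolding tors_divisible_def divides_into_def
proof (intro allI impI ballI)
  fix G f e and t :: nat
  assume G: "finite G" "G \<subseteq> carrier S" and f: "f \<in> carrier S" and e: "e \<in> tors S E G"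
  have eE: "e \<in> carrier E" using e by (simp add: tors_def)
  obtain p :: nat where p: "\<forall>g\<in>G. g [^] p \<odot>\<^bsub>E\<^esub> e = \<zero>\<^bsub>E\<^esub>" using common_torsion_exponent[OF G e] by blast
  let ?K = "Idl ((\<lambda>g. g [^] p) ` G)"
  have K: "ideal ?K S" using G by (intro S.genideal_ideal) auto
  obtain N :: nat where Nt: "\<forall>t::nat. \<forall>a\<in>carrier S. a \<otimes> f [^] (N + t) \<in> ?K \<longrightarrow> a \<otimes> f [^] N \<in> ?K"
    using noetherian_ring.colon_stabilizes[OF N S K f] by blast
  let ?A = "S.adjoin ?K (f [^] (N + t))"
  have fN: "f [^] (N + t) \<in> carrier S" using f by simp
  obtain g where g: "g \<in> module_hom S (self_module S\<lparr>carrier := ?A\<rparr>) E"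
    "\<forall>a\<in>carrier S. \<forall>\<kappa>\<in>?K. g (\<kappa> \<oplus> a \<otimes> f [^] (N + t)) = (a \<otimes> f [^] N) \<odot>\<^bsub>E\<^esub> e"
    using baer_map[OF K f eE power_ideal_kills[OF G(2) eE p], of N t] Nt by blast
  have "submodule ?A S (self_module S)" by (rule self_submodule_of_ideal[OF S S.add_principal(1)[OF K fN]])
  then obtain \<gamma> where \<gamma>: "\<gamma> \<in> module_hom S (self_module S) E" "\<forall>z\<in>?A. \<gamma> z = g z"
    using inj[unfolded injective_module_def, THEN conjunct2, rule_format, of "self_module S" ?A g] g(1) module_self[OF S] by blast
  have ext: "\<gamma> (\<kappa> \<oplus> a \<otimes> f [^] (N + t)) = (a \<otimes> f [^] N) \<odot>\<^bsub>E\<^esub> e" if "a \<in> carrier S" "\<kappa> \<in> ?K" for a \<kappa>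
  proof -
    have "\<kappa> \<oplus> a \<otimes> f [^] (N + t) \<in> ?A" using that unfolding S.mem_add_principal by blast
    then show ?thesis using \<gamma>(2) g(2) that by simp
  qed
  show "\<exists>y\<in>tors S E G. \<exists>N::nat. f [^] (N + t) \<odot>\<^bsub>E\<^esub> y = f [^] N \<odot>\<^bsub>E\<^esub> e"
    using divide_by_extension[OF G(2) f \<gamma>(1) ext eE] by blast
qed

end

subsection \<open>Graded injective modules\<close>

context graded_mod
begin

text \<open>A Baer map changes degrees by a constant; shifting the grading of its source turns it
  into a graded map.\<close>

lemma shift_graded: "graded_module S Sg M (\<lambda>j. Mg (j - b))"
  unfolding graded_module_def
proof (intro conjI allI ballI)
  show "module S M" by (rule module_axioms)
  show "subgroup (Mg (j - b)) (add_monoid M)" for j by (rule Mg_subgroup)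
  show "a \<odot>\<^bsub>M\<^esub> y \<in> Mg (i + j - b)" if "a \<in> Sg i" "y \<in> Mg (j - b)" for i j a y
    using Mg_smult[OF that] by (simp add: algebra_simps)
  fix y assume y: "y \<in> carrier M"
  let ?D = "{j. gc y j \<noteq> \<zero>\<^bsub>M\<^esub>}"
  have im: "{j. gc y (j - b) \<noteq> \<zero>\<^bsub>M\<^esub>} = (\<lambda>j. j + b) ` ?D"
    by (auto simp: image_iff intro!: exI[of _ "_ - b"])
  show "\<exists>!c. (\<forall>j. c j \<in> Mg (j - b)) \<and> finite {j. c j \<noteq> \<zero>\<^bsub>M\<^esub>} \<and> y = (\<Oplus>\<^bsub>M\<^esub>j\<in>{j. c j \<noteq> \<zero>\<^bsub>M\<^esub>}. c j)"
  proof (rule ex1I[of _ "\<lambda>j. gc y (j - b)"], intro conjI allI)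
    show "gc y (j - b) \<in> Mg (j - b)" for j by (rule gc_Mg[OF y])
    show "finite {j. gc y (j - b) \<noteq> \<zero>\<^bsub>M\<^esub>}" unfolding im using gc_finite[OF y] by simp
    have "(\<Oplus>\<^bsub>M\<^esub>j\<in>(\<lambda>j. j + b) ` ?D. gc y (j - b)) = (\<Oplus>\<^bsub>M\<^esub>j\<in>?D. gc y (j + b - b))"
      by (rule M.add.finprod_reindex) (use y in \<open>auto simp: inj_on_def\<close>)
    then show "y = (\<Oplus>\<^bsub>M\<^esub>j\<in>{j. gc y (j - b) \<noteq> \<zero>\<^bsub>M\<^esub>}. gc y (j - b))" unfolding im using gc_sum[OF y] by simp
  next
    fix c assume c: "(\<forall>j. c j \<in> Mg (j - b)) \<and> finite {j. c j \<noteq> \<zero>\<^bsub>M\<^esub>} \<and> y = (\<Oplus>\<^bsub>M\<^esub>j\<in>{j. c j \<noteq> \<zero>\<^bsub>M\<^esub>}. c j)"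
    have cM: "c j \<in> carrier M" for j using c Mg_carrier by blast
    have c': "c (j + b) \<in> Mg j" for j using c[THEN conjunct1, THEN spec[of _ "j + b"]] by simp
    have inj: "inj_on (\<lambda>j. j - b) A" for A by (auto simp: inj_on_def)
    have "gc y = (\<lambda>j. c (j + b))"
    proof (rule gc_unique[of "(\<lambda>j. j - b) ` {j. c j \<noteq> \<zero>\<^bsub>M\<^esub>}"])
      show "finite ((\<lambda>j. j - b) ` {j. c j \<noteq> \<zero>\<^bsub>M\<^esub>})" using c by simp
      show "c (j + b) = \<zero>\<^bsub>M\<^esub>" if "j \<notin> (\<lambda>j. j - b) ` {j. c j \<noteq> \<zero>\<^bsub>M\<^esub>}" for j
        using that by (auto simp: image_iff dest: spec[of _ "j + b"])
      have "(\<Oplus>\<^bsub>M\<^esub>j\<in>(\<lambda>j. j - b) ` {j. c j \<noteq> \<zero>\<^bsub>M\<^esub>}. c (j + b)) = (\<Oplus>\<^bsub>M\<^esub>j\<in>{j. c j \<noteq> \<zero>\<^bsub>M\<^esub>}. c (j - b + b))"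
        by (rule M.add.finprod_reindex) (use cM inj in auto)
      then show "y = (\<Oplus>\<^bsub>M\<^esub>j\<in>(\<lambda>j. j - b) ` {j. c j \<noteq> \<zero>\<^bsub>M\<^esub>}. c (j + b))" using c by simp
    qed (rule c')
    then show "c = (\<lambda>j. gc y (j - b))" by simp
  qed
qed

lemma finsum_sub:
  assumes A: "submodule A S M" and "finite D" "c \<in> D \<rightarrow> A"
  shows "finsum (M\<lparr>carrier := A\<rparr>) c D = finsum M c D" "finsum M c D \<in> A"
proof -
  note As = submoduleE[OF A]
  interpret A: module S "M\<lparr>carrier := A\<rparr>"
    using submodule.submodule_is_module[OF A module_axioms] .
  have "finsum (M\<lparr>carrier := A\<rparr>) c D = finsum M c D \<and> finsum M c D \<in> A" using assms(2,3)
  proof (induction D rule: finite_induct)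
    case empty then show ?case using submodule_zero[OF A] by simp
  next
    case (insert i D)
    have "c \<in> D \<rightarrow> carrier M" "c i \<in> carrier M" using insert.prems As(1) by auto
    then have "finsum M c (insert i D) = c i \<oplus>\<^bsub>M\<^esub> finsum M c D" by (rule M.finsum_insert[OF insert.hyps])
    moreover have "finsum (M\<lparr>carrier := A\<rparr>) c (insert i D) = c i \<oplus>\<^bsub>M\<lparr>carrier := A\<rparr>\<^esub> finsum (M\<lparr>carrier := A\<rparr>) c D"
      by (rule A.M.finsum_insert[OF insert.hyps]) (use insert.prems in auto)
    ultimately show ?case using insert As(5) by auto
  qed
  then show "finsum (M\<lparr>carrier := A\<rparr>) c D = finsum M c D" "finsum M c D \<in> A" by auto
qed

lemma submodule_graded:
  assumes A: "submodule A S M" and comps: "\<And>y j. y \<in> A \<Longrightarrow> gc y j \<in> A"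
  shows "graded_module S Sg (M\<lparr>carrier := A\<rparr>) (\<lambda>j. A \<inter> Mg j)"
  unfolding graded_module_def
proof (intro conjI allI ballI)
  note As = submoduleE[OF A]
  show m: "module S (M\<lparr>carrier := A\<rparr>)"
    using submodule.submodule_is_module[OF A module_axioms] .
  interpret A: module S "M\<lparr>carrier := A\<rparr>" by (rule m)
  fix j
  have ga: "group (add_monoid (M\<lparr>carrier := A\<rparr>))" by (rule A.M.a_group)
  have neg: "\<ominus>\<^bsub>M\<lparr>carrier := A\<rparr>\<^esub> y = \<ominus>\<^bsub>M\<^esub> y" if y: "y \<in> A" for y
  proof -
    have "\<ominus>\<^bsub>M\<lparr>carrier := A\<rparr>\<^esub> y \<in> A" "\<ominus>\<^bsub>M\<lparr>carrier := A\<rparr>\<^esub> y \<oplus>\<^bsub>M\<^esub> y = \<zero>\<^bsub>M\<^esub>"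
      using A.M.a_inv_closed[of y] A.M.l_neg[of y] y by simp_all
    then show ?thesis using y As(1) by (intro M.minus_equality[symmetric]) auto
  qed
  show "subgroup (A \<inter> Mg j) (add_monoid (M\<lparr>carrier := A\<rparr>))"
  proof (rule group.subgroupI[OF ga])
    show "A \<inter> Mg j \<noteq> {}" using submodule_zero[OF A] Mg_zero by blast
    fix y assume y: "y \<in> A \<inter> Mg j"
    then have "\<ominus>\<^bsub>M\<^esub> y \<in> Mg j" using subgroup.m_inv_closed[OF Mg_subgroup, of y j] by (simp add: a_inv_def)
    then show "inv\<^bsub>add_monoid (M\<lparr>carrier := A\<rparr>)\<^esub> y \<in> A \<inter> Mg j"
      using neg[of y] y As(3)[of y] by (simp add: a_inv_def)
  next
    fix y z assume "y \<in> A \<inter> Mg j" "z \<in> A \<inter> Mg j"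
    then show "y \<otimes>\<^bsub>add_monoid (M\<lparr>carrier := A\<rparr>)\<^esub> z \<in> A \<inter> Mg j" using As(5) Mg_add by simp
  qed simp
  fix i a y assume ay: "a \<in> Sg i" "y \<in> A \<inter> Mg j"
  then show "a \<odot>\<^bsub>M\<lparr>carrier := A\<rparr>\<^esub> y \<in> A \<inter> Mg (i + j)"
    using As(4)[OF subsetD[OF Sg_carrier ay(1)]] Mg_smult[OF ay(1)] by simp
next
  note As = submoduleE[OF A]
  fix y assume "y \<in> carrier (M\<lparr>carrier := A\<rparr>)"
  then have y: "y \<in> A" "y \<in> carrier M" using As(1) by auto
  show "\<exists>!c. (\<forall>j. c j \<in> A \<inter> Mg j) \<and> finite {j. c j \<noteq> \<zero>\<^bsub>M\<lparr>carrier := A\<rparr>\<^esub>} \<and>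
      y = finsum (M\<lparr>carrier := A\<rparr>) c {j. c j \<noteq> \<zero>\<^bsub>M\<lparr>carrier := A\<rparr>\<^esub>}"
  proof (rule ex1I[of _ "gc y"], intro conjI allI)
    show "gc y j \<in> A \<inter> Mg j" for j using comps[OF y(1)] gc_Mg[OF y(2)] by simp
    show fin: "finite {j. gc y j \<noteq> \<zero>\<^bsub>M\<lparr>carrier := A\<rparr>\<^esub>}" using gc_finite[OF y(2)] by simp
    show "y = finsum (M\<lparr>carrier := A\<rparr>) (gc y) {j. gc y j \<noteq> \<zero>\<^bsub>M\<lparr>carrier := A\<rparr>\<^esub>}"
      using finsum_sub(1)[OF A fin, of "gc y"] comps[OF y(1)] gc_sum[OF y(2)] by simp
  next
    fix c assume c: "(\<forall>j. c j \<in> A \<inter> Mg j) \<and> finite {j. c j \<noteq> \<zero>\<^bsub>M\<lparr>carrier := A\<rparr>\<^esub>} \<and>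
      y = finsum (M\<lparr>carrier := A\<rparr>) c {j. c j \<noteq> \<zero>\<^bsub>M\<lparr>carrier := A\<rparr>\<^esub>}"
    then have fin: "finite {j. c j \<noteq> \<zero>\<^bsub>M\<^esub>}" and cA: "\<And>j. c j \<in> A" "\<And>j. c j \<in> Mg j" by auto
    have "y = finsum M c {j. c j \<noteq> \<zero>\<^bsub>M\<^esub>}" using finsum_sub(1)[OF A fin, of c] cA(1) c by simp
    then have "gc y = c" using fin cA(2) by (intro gc_unique[of "{j. c j \<noteq> \<zero>\<^bsub>M\<^esub>}"]) auto
    then show "c = gc y" by simp
  qed
qed

text \<open>Homogeneity of powers appears as a hypothesis because \<open>graded_mod\<close> knows
  the grading of \<open>S\<close> only through its action on \<open>M\<close>.\<close>

lemma gc_tors: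
  assumes G: "\<And>g. g \<in> G \<Longrightarrow> \<exists>j. g \<in> Sg j" and pow: "\<And>g j k. g \<in> Sg j \<Longrightarrow> g [^] (k::nat) \<in> Sg (int k * j)"
    and y: "y \<in> tors S M G"
  shows "gc y i \<in> tors S M G"
proof -
  have yM: "y \<in> carrier M" using y by (simp add: tors_def)
  have "\<exists>t::nat. g [^] t \<odot>\<^bsub>M\<^esub> gc y i = \<zero>\<^bsub>M\<^esub>" if g: "g \<in> G" for g
  proof -
    obtain j where j: "g \<in> Sg j" using G[OF g] by blast
    obtain t :: nat where t: "g [^] t \<odot>\<^bsub>M\<^esub> y = \<zero>\<^bsub>M\<^esub>" using y g by (auto simp: tors_def)
    have "g [^] t \<odot>\<^bsub>M\<^esub> gc y i = gc (g [^] t \<odot>\<^bsub>M\<^esub> y) (i + int t * j)"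
      using gc_smult[OF pow[OF j] yM, of t "i + int t * j"] by simp
    then show ?thesis using t by (intro exI[of _ t]) simp
  qed
  then show ?thesis using yM by (simp add: tors_def)
qed

end

context graded_cring
begin

text \<open>For homogeneous \<open>e\<close> and \<open>f\<close> the Baer map becomes graded after
  a shift of the grading of \<open>S\<close>. A general \<open>e\<close> is divided component by
  component and the results are added.\<close>

lemma graded_injective_tors_divisible:
  assumes N: "noetherian_ring S" and inj: "graded_injective_module S Sg E Eg"
  shows "tors_divisible S {a. \<exists>j. a \<in> Sg j} E"
  unfolding tors_divisible_def divides_into_def
proof (intro allI impI ballI)
  have gE: "graded_module S Sg E Eg" using inj by (simp add: graded_injective_module_def)
  then have mE: "module S E" by (simp add: graded_module_def)
  interpret E: graded_mod S Sg E Eg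
    using mE gE Sg_closed by (intro graded_mod.intro graded_mod_axioms.intro) auto
  fix G f e and t :: nat
  assume G: "finite G" "G \<subseteq> {a. \<exists>j. a \<in> Sg j}" and f': "f \<in> {a. \<exists>j. a \<in> Sg j}" and e: "e \<in> tors S E G"
  obtain v where v: "f \<in> Sg v" using f' by blast
  have f: "f \<in> carrier S" using v Sg_closed by blast
  have Gc: "G \<subseteq> carrier S" using G(2) Sg_closed by blast
  have eE: "e \<in> carrier E" using e by (simp add: tors_def)
  have main: "\<exists>y\<in>tors S E G. \<exists>N::nat. f [^] (N + t) \<odot>\<^bsub>E\<^esub> y = f [^] N \<odot>\<^bsub>E\<^esub> e"
    if e: "e \<in> tors S E G" and ej: "e \<in> Eg j0" for e j0
  proof -
    have eE: "e \<in> carrier E" using e by (simp add: tors_def)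
    obtain p :: nat where p: "\<forall>g\<in>G. g [^] p \<odot>\<^bsub>E\<^esub> e = \<zero>\<^bsub>E\<^esub>"
      using common_torsion_exponent[OF is_cring mE G(1) Gc e] by blast
    let ?K = "Idl ((\<lambda>g. g [^] p) ` G)"
    have hK: "homog ?K" by (rule homog_Idl) (use G(2) Sg_pow in blast)
    note K = homogD(1)[OF hK]
    obtain N :: nat where Nt: "\<forall>t::nat. \<forall>a\<in>carrier S. a \<otimes> f [^] (N + t) \<in> ?K \<longrightarrow> a \<otimes> f [^] N \<in> ?K"
      using noetherian_ring.colon_stabilizes[OF N is_cring K f] by blast
    let ?F = "f [^] (N + t)"
    let ?A = "adjoin ?K ?F"
    have F: "?F \<in> Sg (int (N + t) * v)" "?F \<in> carrier S" "f [^] N \<in> Sg (int N * v)" "f [^] N \<in> carrier S"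
      using Sg_pow[OF v, of "N + t"] Sg_pow[OF v, of N] f by simp_all
    have hA: "homog ?A" by (rule homog_add_principal[OF hK F(1)])
    have sA: "submodule ?A S (self_module S)" by (rule self_submodule_of_ideal[OF is_cring homogD(1)[OF hA]])
    obtain g where g: "g \<in> module_hom S (self_module S\<lparr>carrier := ?A\<rparr>) E"
      "\<forall>a\<in>carrier S. \<forall>\<kappa>\<in>?K. g (\<kappa> \<oplus> a \<otimes> ?F) = (a \<otimes> f [^] N) \<odot>\<^bsub>E\<^esub> e"
      using baer_map[OF is_cring mE K f eE power_ideal_kills[OF is_cring mE Gc eE p], of N t] Nt by blast
    \<comment> \<open>The map sends \<open>a f^(N + t)\<close> to \<open>a f^N e\<close> and thus
      changes degrees by \<open>j0 - t v\<close>, the amount by which the source is shifted.\<close>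
    define b where "b = j0 - int t * v"
    have gB: "graded_module S Sg (self_module S) (\<lambda>j. Sg (j - b))" by (rule SS.shift_graded)
    interpret B: graded_mod S Sg "self_module S" "\<lambda>j. Sg (j - b)"
      using gB SS.module_axioms Sg_closed by (intro graded_mod.intro graded_mod_axioms.intro) auto
    have Bgc: "B.gc z j = hc z (j - b)" if z: "z \<in> carrier S" for z j
    proof -
      have "B.gc z = (\<lambda>j. hc z (j - b))"
        using SS.shift_graded[of b, unfolded graded_module_def, THEN conjunct2, THEN conjunct2, THEN conjunct2, rule_format, of z]
      proof -
        have im: "{j. hc z (j - b) \<noteq> \<zero>} = (\<lambda>j. j + b) ` {j. hc z j \<noteq> \<zero>}"
          by (auto simp: image_iff intro!: exI[of _ "_ - b"])
        show ?thesis
        proof (rule B.gc_unique[of "(\<lambda>j. j + b) ` {j. hc z j \<noteq> \<zero>}"])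
          show "finite ((\<lambda>j. j + b) ` {j. hc z j \<noteq> \<zero>})" using SS.gc_finite[of z] z by simp
          show "hc z (j - b) \<in> Sg (j - b)" for j by (rule comp_Sg[OF z])
          show "hc z (j - b) = \<zero>\<^bsub>self_module S\<^esub>" if "j \<notin> (\<lambda>j. j + b) ` {j. hc z j \<noteq> \<zero>}" for j
            using that unfolding im[symmetric] by simp
          have "finsum S (\<lambda>j. hc z (j - b)) ((\<lambda>j. j + b) ` {j. hc z j \<noteq> \<zero>}) = finsum S (\<lambda>j. hc z (j + b - b)) {j. hc z j \<noteq> \<zero>}"
            by (rule add.finprod_reindex) (use z in \<open>auto simp: inj_on_def\<close>)
          then show "z = finsum (self_module S) (\<lambda>j. hc z (j - b)) ((\<lambda>j. j + b) ` {j. hc z j \<noteq> \<zero>})"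
            using SS.gc_sum[of z] z by simp
        qed
      qed
      then show ?thesis by simp
    qed
    have gA: "graded_module S Sg (self_module S\<lparr>carrier := ?A\<rparr>) (\<lambda>j. ?A \<inter> Sg (j - b))"
    proof (rule B.submodule_graded[OF sA])
      fix z j assume z: "z \<in> ?A"
      then have "z \<in> carrier S" using ideal.Icarr[OF homogD(1)[OF hA]] by simp
      then show "B.gc z j \<in> ?A" using Bgc homogD(2)[OF hA z] by simp
    qed
    have "g ` (?A \<inter> Sg (j - b)) \<subseteq> Eg j" for j
    proof
      fix u assume "u \<in> g ` (?A \<inter> Sg (j - b))"
      then obtain z where z: "z \<in> ?A" "z \<in> Sg (j - b)" "u = g z" by auto
      obtain \<kappa> a where ka: "\<kappa> \<in> ?K" "a \<in> carrier S" "z = \<kappa> \<oplus> a \<otimes> ?F" using z(1) unfolding mem_add_principal by (elim bexE)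
      have \<kappa>S: "\<kappa> \<in> carrier S" using ideal.Icarr[OF K ka(1)] .
      let ?i = "j - b - int (N + t) * v"
      have "z = hc z (j - b)" using comp_homogeneous[OF z(2)] by simp
      also have "\<dots> = hc \<kappa> (j - b) \<oplus> hc a ?i \<otimes> ?F"
        using ka(2,3) \<kappa>S F by (simp add: comp_add comp_mult_right)
      finally have ze: "z = hc \<kappa> (j - b) \<oplus> hc a ?i \<otimes> ?F" .
      have "u = (hc a ?i \<otimes> f [^] N) \<odot>\<^bsub>E\<^esub> e"
        unfolding z(3) using g(2) homogD(2)[OF hK ka(1)] comp_closed[OF ka(2)] by (subst ze) blast
      moreover have "(hc a ?i \<otimes> f [^] N) \<odot>\<^bsub>E\<^esub> e \<in> Eg ((?i + int N * v) + j0)"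
        by (rule E.Mg_smult[OF Sg_mult[OF comp_Sg[OF ka(2)] F(3)] ej])
      moreover have "(?i + int N * v) + j0 = j" by (simp add: b_def algebra_simps)
      ultimately show "u \<in> Eg j" by metis
    qed
    then have "g \<in> graded_hom S (self_module S\<lparr>carrier := ?A\<rparr>) (\<lambda>j. ?A \<inter> Sg (j - b)) E Eg"
      using g(1) by (simp add: graded_hom_def)
    then obtain \<gamma> where \<gamma>: "\<gamma> \<in> graded_hom S (self_module S) (\<lambda>j. Sg (j - b)) E Eg" "\<forall>z\<in>?A. \<gamma> z = g z"
      using inj[unfolded graded_injective_module_def, THEN conjunct2, rule_format, of "self_module S" "\<lambda>j. Sg (j - b)" ?A g]
        gB sA gA by blast
    have ext: "\<gamma> (\<kappa> \<oplus> a \<otimes> ?F) = (a \<otimes> f [^] N) \<odot>\<^bsub>E\<^esub> e" if "a \<in> carrier S" "\<kappa> \<in> ?K" for a \<kappa>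
    proof -
      have "\<kappa> \<oplus> a \<otimes> ?F \<in> ?A" using that unfolding mem_add_principal by blast
      then show ?thesis using \<gamma>(2) g(2) that by simp
    qed
    have \<gamma>h: "\<gamma> \<in> module_hom S (self_module S) E" using \<gamma>(1) by (simp add: graded_hom_def)
    show ?thesis using divide_by_extension[OF is_cring mE Gc f \<gamma>h ext eE] by blast
  qed
  show "\<exists>y\<in>tors S E G. \<exists>N::nat. f [^] (N + t) \<odot>\<^bsub>E\<^esub> y = f [^] N \<odot>\<^bsub>E\<^esub> e"
    using eE
  proof (induction rule: E.graded_induct)
    case zero
    have "f [^] (0 + t) \<odot>\<^bsub>E\<^esub> \<zero>\<^bsub>E\<^esub> = f [^] (0::nat) \<odot>\<^bsub>E\<^esub> \<zero>\<^bsub>E\<^esub>" using f by simp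
    then show ?case using E.zero_tors[OF Gc] by blast
  next
    case (comp j)
    have "E.gc e j \<in> tors S E G" by (rule E.gc_tors[OF _ Sg_pow e]) (use G(2) in auto)
    then show ?case using main E.gc_Mg[OF eE] by blast
  next
    case (add y z)
    obtain u N where u: "u \<in> tors S E G" "f [^] (N + t) \<odot>\<^bsub>E\<^esub> u = f [^] (N::nat) \<odot>\<^bsub>E\<^esub> y" using add.IH(1) by blast
    obtain u' N' where u': "u' \<in> tors S E G" "f [^] (N' + t) \<odot>\<^bsub>E\<^esub> u' = f [^] (N'::nat) \<odot>\<^bsub>E\<^esub> z" using add.IH(2) by blast
    have c: "u \<in> carrier E" "u' \<in> carrier E" using u u' by (auto simp: tors_def)
    have "f [^] (max N N' + t) \<odot>\<^bsub>E\<^esub> u = f [^] (max N N') \<odot>\<^bsub>E\<^esub> y"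
      "f [^] (max N N' + t) \<odot>\<^bsub>E\<^esub> u' = f [^] (max N N') \<odot>\<^bsub>E\<^esub> z"
      using E.divides_into_scale[OF f c(1) add.hyps(1) u(2)] E.divides_into_scale[OF f c(2) add.hyps(2) u'(2)] by simp_all
    then have "f [^] (max N N' + t) \<odot>\<^bsub>E\<^esub> (u \<oplus>\<^bsub>E\<^esub> u') = f [^] (max N N') \<odot>\<^bsub>E\<^esub> (y \<oplus>\<^bsub>E\<^esub> z)"
      using f c add.hyps by (simp add: E.smult_r_distr)
    then show ?case using E.tors_add[OF Gc u(1) u'(1)] by blast
  qed
qed

end

section \<open>Quotient modules\<close>

locale module_quotient = module S M for S :: "('s, 'z) ring_scheme" (structure) and M :: "('s, 'm) module" +
  fixes B :: "'m set"
  assumes B: "submodule B S M"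
begin

abbreviation "Q \<equiv> quotient_module M B"
abbreviation "qc y \<equiv> B +>\<^bsub>M\<^esub> y"

sublocale B: abelian_subgroup B M
  by (rule abelian_subgroupI3[OF additive_subgroup.intro[OF submodule.axioms(1)[OF B]] M.abelian_group_axioms])

lemmas Bs = submoduleE[OF B]

lemma Q_sel: "carrier Q = qc ` carrier M" "\<zero>\<^bsub>Q\<^esub> = B" "C \<oplus>\<^bsub>Q\<^esub> D = set_add M C D"
  by (auto simp: quotient_module_def A_RCOSETS_def' a_r_coset_def')

lemma qc_eq: "y \<in> carrier M \<Longrightarrow> z \<in> carrier M \<Longrightarrow> qc y = qc z \<longleftrightarrow> y \<ominus>\<^bsub>M\<^esub> z \<in> B"
  by (metis B.a_rcos_module B.a_rcos_self B.a_repr_independence' M.minus_eq)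

lemma qc_zero: "y \<in> carrier M \<Longrightarrow> qc y = B \<longleftrightarrow> y \<in> B"
  by (metis B.a_rcos_const B.a_rcos_self)

lemma qc_add: "y \<in> carrier M \<Longrightarrow> z \<in> carrier M \<Longrightarrow> qc y \<oplus>\<^bsub>Q\<^esub> qc z = qc (y \<oplus>\<^bsub>M\<^esub> z)"
  by (simp add: Q_sel B.a_rcos_sum)

lemma qc_absorb: "y \<in> carrier M \<Longrightarrow> b \<in> B \<Longrightarrow> qc (b \<oplus>\<^bsub>M\<^esub> y) = qc y"
  using Bs(1) eq_diffI[of y b] by (subst qc_eq) (auto simp: M.a_comm subset_iff)

lemma qc_mem: "z \<in> qc y \<longleftrightarrow> (\<exists>b\<in>B. z = b \<oplus>\<^bsub>M\<^esub> y)"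
  by (auto simp: a_r_coset_def')

lemma qc_smult: assumes s: "s \<in> carrier S" and y: "y \<in> carrier M" shows "s \<odot>\<^bsub>Q\<^esub> qc y = qc (s \<odot>\<^bsub>M\<^esub> y)"
proof -
  have "qc (s \<odot>\<^bsub>M\<^esub> z) = qc (s \<odot>\<^bsub>M\<^esub> y)" if z: "z \<in> qc y" for z
  proof -
    obtain b where b: "b \<in> B" "z = b \<oplus>\<^bsub>M\<^esub> y" using z[unfolded qc_mem] by (elim bexE)
    have "b \<in> carrier M" by (rule subsetD[OF Bs(1) b(1)])
    then have "s \<odot>\<^bsub>M\<^esub> z = s \<odot>\<^bsub>M\<^esub> b \<oplus>\<^bsub>M\<^esub> s \<odot>\<^bsub>M\<^esub> y" unfolding b(2) by (rule smult_r_distr[OF s _ y])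
    then show ?thesis using qc_absorb[of "s \<odot>\<^bsub>M\<^esub> y" "s \<odot>\<^bsub>M\<^esub> b"] Bs(4)[OF s b(1)] s y by simp
  qed
  moreover have "y \<in> qc y" by (rule B.a_rcos_self[OF y])
  ultimately have "(\<Union>z\<in>qc y. qc (s \<odot>\<^bsub>M\<^esub> z)) = qc (s \<odot>\<^bsub>M\<^esub> y)" by blast
  then show ?thesis by (simp add: quotient_module_def)
qed

lemma quotient_is_module: "module S Q"
proof (rule moduleI)
  show "cring S" by (rule R.is_cring)
  show "abelian_group Q"
  proof (rule abelian_groupI)
    show "\<zero>\<^bsub>Q\<^esub> \<in> carrier Q"
      using submodule_zero[OF B] qc_zero[of "\<zero>\<^bsub>M\<^esub>"] by (auto simp: Q_sel)
    fix C assume "C \<in> carrier Q"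
    then obtain y where y: "y \<in> carrier M" "C = qc y" by (auto simp: Q_sel)
    have z: "qc \<zero>\<^bsub>M\<^esub> = \<zero>\<^bsub>Q\<^esub>" using submodule_zero[OF B] qc_zero[of "\<zero>\<^bsub>M\<^esub>"] by (simp add: Q_sel)
    show "\<zero>\<^bsub>Q\<^esub> \<oplus>\<^bsub>Q\<^esub> C = C" using qc_add[of "\<zero>\<^bsub>M\<^esub>" y] y by (simp flip: z)
    have "qc (\<ominus>\<^bsub>M\<^esub> y) \<oplus>\<^bsub>Q\<^esub> C = \<zero>\<^bsub>Q\<^esub>" using qc_add[of "\<ominus>\<^bsub>M\<^esub> y" y] y by (simp add: M.l_neg flip: z)
    moreover have "qc (\<ominus>\<^bsub>M\<^esub> y) \<in> carrier Q" using y by (auto simp: Q_sel)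
    ultimately show "\<exists>D\<in>carrier Q. D \<oplus>\<^bsub>Q\<^esub> C = \<zero>\<^bsub>Q\<^esub>" by blast
    fix D assume "D \<in> carrier Q"
    then obtain z where z: "z \<in> carrier M" "D = qc z" by (auto simp: Q_sel)
    show "C \<oplus>\<^bsub>Q\<^esub> D \<in> carrier Q" using y z by (auto simp: qc_add) (auto simp: Q_sel)
    show "C \<oplus>\<^bsub>Q\<^esub> D = D \<oplus>\<^bsub>Q\<^esub> C" using y z by (simp add: qc_add M.a_comm)
    fix C' assume "C' \<in> carrier Q"
    then obtain u where u: "u \<in> carrier M" "C' = qc u" by (auto simp: Q_sel)
    show "C \<oplus>\<^bsub>Q\<^esub> D \<oplus>\<^bsub>Q\<^esub> C' = C \<oplus>\<^bsub>Q\<^esub> (D \<oplus>\<^bsub>Q\<^esub> C')" using y z u by (simp add: qc_add M.a_assoc)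
  qed
next
  fix s C assume s: "s \<in> carrier S" and "C \<in> carrier Q"
  then obtain y where y: "y \<in> carrier M" "C = qc y" by (auto simp: Q_sel)
  show "s \<odot>\<^bsub>Q\<^esub> C \<in> carrier Q" using s y by (simp add: qc_smult) (simp add: Q_sel)
  fix t assume t: "t \<in> carrier S"
  show "(s \<oplus> t) \<odot>\<^bsub>Q\<^esub> C = s \<odot>\<^bsub>Q\<^esub> C \<oplus>\<^bsub>Q\<^esub> t \<odot>\<^bsub>Q\<^esub> C" using s t y by (simp add: qc_smult qc_add smult_l_distr)
  show "s \<otimes> t \<odot>\<^bsub>Q\<^esub> C = s \<odot>\<^bsub>Q\<^esub> (t \<odot>\<^bsub>Q\<^esub> C)" using s t y by (simp add: qc_smult smult_assoc1)
next
  fix s C D assume s: "s \<in> carrier S" and "C \<in> carrier Q" "D \<in> carrier Q"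
  then obtain y z where yz: "y \<in> carrier M" "C = qc y" "z \<in> carrier M" "D = qc z" by (auto simp: Q_sel)
  show "s \<odot>\<^bsub>Q\<^esub> (C \<oplus>\<^bsub>Q\<^esub> D) = s \<odot>\<^bsub>Q\<^esub> C \<oplus>\<^bsub>Q\<^esub> s \<odot>\<^bsub>Q\<^esub> D" using s yz by (simp add: qc_smult qc_add smult_r_distr)
next
  fix C assume "C \<in> carrier Q"
  then obtain y where y: "y \<in> carrier M" "C = qc y" by (auto simp: Q_sel)
  show "\<one> \<odot>\<^bsub>Q\<^esub> C = C" using y by (simp add: qc_smult)
qed

end

section \<open>Tensor products with the residue ring\<close>

locale residue_tensor = module S A + RR: cring R + m: ideal m R
  for S :: "('s, 'y) ring_scheme" (structure) and A :: "('s, 'm) module" and R :: "('r, 'z) ring_scheme" and m :: "'r set" +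
  fixes h :: "'r \<Rightarrow> 's"
  assumes h: "h \<in> ring_hom R S"
begin

abbreviation "k \<equiv> residue_module R m"
abbreviation "pairs \<equiv> carrier A \<times> carrier k"
abbreviation "FG \<equiv> free_Abelian_group pairs"
abbreviation "K \<equiv> tensor_relations h R A k"
abbreviation "TM \<equiv> tensor_module h R A k"
abbreviation "pt \<equiv> pure_tensor h R A k"
abbreviation "cl r \<equiv> m +>\<^bsub>R\<^esub> r"

lemma h_closed: "r \<in> carrier R \<Longrightarrow> h r \<in> carrier S"
  by (rule ring_hom_closed[OF h])

lemma k_sel: "carrier k = cl ` carrier R" "C \<oplus>\<^bsub>k\<^esub> D = set_add R C D" "\<one>\<^bsub>k\<^esub> = cl \<one>\<^bsub>R\<^esub>"
  "r \<odot>\<^bsub>k\<^esub> C = cl r \<otimes>\<^bsub>R Quot m\<^esub> C"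
  by (auto simp: residue_module_def ring.defs module.defs FactRing_def A_RCOSETS_def' a_r_coset_def')

lemma k_add: "r \<in> carrier R \<Longrightarrow> s \<in> carrier R \<Longrightarrow> cl r \<oplus>\<^bsub>k\<^esub> cl s = cl (r \<oplus>\<^bsub>R\<^esub> s)"
  by (simp add: k_sel m.a_rcos_sum)

lemma k_smult: "r \<in> carrier R \<Longrightarrow> s \<in> carrier R \<Longrightarrow> r \<odot>\<^bsub>k\<^esub> cl s = cl (r \<otimes>\<^bsub>R\<^esub> s)"
  by (simp add: k_sel FactRing_def m.rcoset_mult_add)

lemma cl_closed: "r \<in> carrier R \<Longrightarrow> cl r \<in> carrier k"
  by (simp add: k_sel)

text \<open>The generators inside \<open>tensor_relations\<close>, named so that they can be treated
  by cases.\<close>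

definition rels :: "('m \<times> 'r set \<Rightarrow>\<^sub>0 int) set" where
  "rels = {frag_of (x \<oplus>\<^bsub>A\<^esub> x', y) - frag_of (x, y) - frag_of (x', y) | x x' y.
        x \<in> carrier A \<and> x' \<in> carrier A \<and> y \<in> carrier k} \<union>
     {frag_of (x, y \<oplus>\<^bsub>k\<^esub> y') - frag_of (x, y) - frag_of (x, y') | x y y'.
        x \<in> carrier A \<and> y \<in> carrier k \<and> y' \<in> carrier k} \<union>
     {frag_of (h r \<odot>\<^bsub>A\<^esub> x, y) - frag_of (x, r \<odot>\<^bsub>k\<^esub> y) | r x y.
        r \<in> carrier R \<and> x \<in> carrier A \<and> y \<in> carrier k}"

lemma rels_cases:
  assumes a: "a \<in> rels"
  obtains (left) x x' y where "x \<in> carrier A" "x' \<in> carrier A" "y \<in> carrier k"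
        "a = frag_of (x \<oplus>\<^bsub>A\<^esub> x', y) - frag_of (x, y) - frag_of (x', y)"
      | (right) x y y' where "x \<in> carrier A" "y \<in> carrier k" "y' \<in> carrier k"
        "a = frag_of (x, y \<oplus>\<^bsub>k\<^esub> y') - frag_of (x, y) - frag_of (x, y')"
      | (balanced) r x y where "r \<in> carrier R" "x \<in> carrier A" "y \<in> carrier k"
        "a = frag_of (h r \<odot>\<^bsub>A\<^esub> x, y) - frag_of (x, r \<odot>\<^bsub>k\<^esub> y)"
  using a unfolding rels_def Un_iff mem_Collect_eq by (elim disjE exE conjE) metis+

lemma cl_cases: assumes "y \<in> carrier k" obtains r where "r \<in> carrier R" "y = cl r"
  using assms unfolding k_sel(1) by (elim imageE)

lemma K_def: "K = generate FG rels"
  by (simp add: tensor_relations_def rels_def)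

lemma frag_pair: "x \<in> carrier A \<Longrightarrow> y \<in> carrier k \<Longrightarrow> frag_of (x, y) \<in> carrier FG"
  by simp

lemma FG_diff: "a \<in> carrier FG \<Longrightarrow> b \<in> carrier FG \<Longrightarrow> a - b \<in> carrier FG"
  using keys_diff[of a b] by auto

lemma k_closed: "y \<in> carrier k \<Longrightarrow> y' \<in> carrier k \<Longrightarrow> y \<oplus>\<^bsub>k\<^esub> y' \<in> carrier k"
  "r \<in> carrier R \<Longrightarrow> y \<in> carrier k \<Longrightarrow> r \<odot>\<^bsub>k\<^esub> y \<in> carrier k"
  unfolding k_sel(1) by (auto simp: k_add k_smult)

lemma rels_FG: "rels \<subseteq> carrier FG"
proof
  fix a assume "a \<in> rels"
  then show "a \<in> carrier FG"
    unfolding rels_def Un_iff mem_Collect_eq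
    by (elim disjE exE conjE) (simp only:, intro FG_diff frag_pair k_closed M.a_closed smult_closed h_closed; assumption)+
qed

lemma K_zero: "0 \<in> K" unfolding K_def using generate.one[of FG rels] by simp
lemma K_incl: "a \<in> rels \<Longrightarrow> a \<in> K" unfolding K_def by (rule generate.incl)
lemma K_add: "a \<in> K \<Longrightarrow> b \<in> K \<Longrightarrow> a + b \<in> K" unfolding K_def using generate.eng[of a FG rels b] by simp
lemma K_subgroup: "subgroup K FG"
  unfolding K_def by (rule group.generate_is_subgroup[OF group_free_Abelian_group rels_FG])
lemma K_FG: "a \<in> K \<Longrightarrow> a \<in> carrier FG" using subgroup.mem_carrier[OF K_subgroup] .
lemma K_neg: "a \<in> K \<Longrightarrow> - a \<in> K"
  using subgroup.m_inv_closed[OF K_subgroup, of a] K_FG[of a] by simp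
lemma K_diff: "a \<in> K \<Longrightarrow> b \<in> K \<Longrightarrow> a - b \<in> K" using K_add[of a "- b"] K_neg[of b] by simp

definition tc :: "('m \<times> 'r set \<Rightarrow>\<^sub>0 int) \<Rightarrow> ('m \<times> 'r set \<Rightarrow>\<^sub>0 int) set" where
  "tc a = (\<lambda>b. b + a) ` K"

lemma r_coset_tc: "K #>\<^bsub>FG\<^esub> a = tc a"
  by (auto simp: r_coset_def tc_def)

lemma tc_eq: "tc a = tc b \<longleftrightarrow> a - b \<in> K"
proof
  assume "tc a = tc b"
  moreover have "0 + a \<in> tc a" using K_zero unfolding tc_def by (rule imageI)
  ultimately obtain c where "c \<in> K" "a = c + b" by (auto simp: tc_def)
  then show "a - b \<in> K" by simp
next
  assume ab: "a - b \<in> K"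
  have "tc a \<subseteq> tc b" if "a - b \<in> K" for a b
  proof
    fix u assume "u \<in> tc a"
    then obtain c where "c \<in> K" "u = c + a" by (auto simp: tc_def)
    then have "u = (c + (a - b)) + b" "c + (a - b) \<in> K" using K_add that by auto
    then show "u \<in> tc b" unfolding tc_def by blast
  qed
  then show "tc a = tc b" using ab K_neg[OF ab] by (simp add: subset_antisym)
qed

lemma TM_sel: "carrier TM = tc ` carrier FG" "\<zero>\<^bsub>TM\<^esub> = K"
  by (auto simp: tensor_module_def Let_def FactGroup_def RCOSETS_def r_coset_tc)

lemma tc_zero: "tc 0 = K" by (simp add: tc_def)

lemma tc_add: "tc a \<oplus>\<^bsub>TM\<^esub> tc b = tc (a + b)"
proof -
  have "tc a \<oplus>\<^bsub>TM\<^esub> tc b = (\<Union>u\<in>tc a. \<Union>v\<in>tc b. {u + v})"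
    by (simp add: tensor_module_def Let_def FactGroup_def set_mult_def)
  also have "\<dots> = tc (a + b)"
  proof (intro equalityI subsetI)
    fix w assume "w \<in> (\<Union>u\<in>tc a. \<Union>v\<in>tc b. {u + v})"
    then obtain c d where "c \<in> K" "d \<in> K" "w = (c + a) + (d + b)" by (auto simp: tc_def)
    then have "w = (c + d) + (a + b)" "c + d \<in> K" using K_add by (auto simp: algebra_simps)
    then show "w \<in> tc (a + b)" unfolding tc_def by blast
  next
    fix w assume "w \<in> tc (a + b)"
    then obtain c where c: "c \<in> K" "w = (c + a) + (0 + b)" by (auto simp: tc_def algebra_simps)
    have "c + a \<in> tc a" "0 + b \<in> tc b" using c(1) K_zero unfolding tc_def by blast+
    then show "w \<in> (\<Union>u\<in>tc a. \<Union>v\<in>tc b. {u + v})" using c(2) by blast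
  qed
  finally show ?thesis .
qed

lemma pt_tc: "pt x c = tc (frag_of (x, c))"
  by (simp add: pure_tensor_def r_coset_tc)

lemma pt_closed: "x \<in> carrier A \<Longrightarrow> c \<in> carrier k \<Longrightarrow> pt x c \<in> carrier TM"
  unfolding pt_tc TM_sel by (rule imageI) simp

lemma pt_add_left:
  assumes "x \<in> carrier A" "x' \<in> carrier A" "c \<in> carrier k"
  shows "pt (x \<oplus>\<^bsub>A\<^esub> x') c = pt x c \<oplus>\<^bsub>TM\<^esub> pt x' c"
proof -
  have "frag_of (x \<oplus>\<^bsub>A\<^esub> x', c) - frag_of (x, c) - frag_of (x', c) \<in> K"
    by (rule K_incl) (unfold rels_def, use assms in blast)
  then show ?thesis unfolding pt_tc tc_add tc_eq by (simp add: diff_diff_eq)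
qed

lemma pt_balanced:
  assumes "r \<in> carrier R" "x \<in> carrier A" "c \<in> carrier k"
  shows "pt (h r \<odot>\<^bsub>A\<^esub> x) c = pt x (r \<odot>\<^bsub>k\<^esub> c)"
proof -
  have "frag_of (h r \<odot>\<^bsub>A\<^esub> x, c) - frag_of (x, r \<odot>\<^bsub>k\<^esub> c) \<in> K"
    by (rule K_incl) (unfold rels_def, use assms in blast)
  then show ?thesis unfolding pt_tc tc_eq .
qed

definition tens :: "'m \<Rightarrow> ('m \<times> 'r set \<Rightarrow>\<^sub>0 int) set" where "tens x = pt x (cl \<one>\<^bsub>R\<^esub>)"

lemma one_k: "cl \<one>\<^bsub>R\<^esub> \<in> carrier k" by (rule cl_closed) simp

text \<open>Every residue class comes from \<open>R\<close>, so scalars move to the left factor and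
  each pure tensor becomes \<open>x \<otimes> 1\<close>. This is what identifies the tensor product
  with \<open>A / mA\<close>.\<close>

lemma pt_tens: assumes "x \<in> carrier A" "r \<in> carrier R" shows "pt x (cl r) = tens (h r \<odot>\<^bsub>A\<^esub> x)"
  unfolding tens_def using pt_balanced[OF assms(2,1) one_k] k_smult[OF assms(2), of "\<one>\<^bsub>R\<^esub>"] assms(2) by simp

lemma tens_add: "x \<in> carrier A \<Longrightarrow> y \<in> carrier A \<Longrightarrow> tens (x \<oplus>\<^bsub>A\<^esub> y) = tens x \<oplus>\<^bsub>TM\<^esub> tens y"
  unfolding tens_def by (rule pt_add_left[OF _ _ one_k])

lemma tens_closed: "x \<in> carrier A \<Longrightarrow> tens x \<in> carrier TM"
  unfolding tens_def by (rule pt_closed[OF _ one_k])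

lemma tens_tc: "tens x = tc (frag_of (x, cl \<one>\<^bsub>R\<^esub>))" by (simp add: tens_def pt_tc)

lemma tens_K: "tens x = K \<longleftrightarrow> frag_of (x, cl \<one>\<^bsub>R\<^esub>) \<in> K"
  using tc_eq[of "frag_of (x, cl \<one>\<^bsub>R\<^esub>)" 0] by (simp add: tens_tc tc_zero)

lemma tens_zero: "tens \<zero>\<^bsub>A\<^esub> = K"
proof -
  have "tens \<zero>\<^bsub>A\<^esub> = tens \<zero>\<^bsub>A\<^esub> \<oplus>\<^bsub>TM\<^esub> tens \<zero>\<^bsub>A\<^esub>" using tens_add[of "\<zero>\<^bsub>A\<^esub>" "\<zero>\<^bsub>A\<^esub>"] by simp
  then have "- frag_of (\<zero>\<^bsub>A\<^esub>, cl \<one>\<^bsub>R\<^esub>) \<in> K" unfolding tens_tc tc_add tc_eq by simp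
  then have "frag_of (\<zero>\<^bsub>A\<^esub>, cl \<one>\<^bsub>R\<^esub>) - 0 \<in> K" using K_neg by force
  then show ?thesis unfolding tens_tc tc_zero[symmetric] tc_eq .
qed

lemma tens_diff:
  assumes "x \<in> carrier A" "y \<in> carrier A"
  shows "tens (x \<ominus>\<^bsub>A\<^esub> y) = tc (frag_of (x, cl \<one>\<^bsub>R\<^esub>) - frag_of (y, cl \<one>\<^bsub>R\<^esub>))"
proof -
  have "tens y \<oplus>\<^bsub>TM\<^esub> tens (x \<ominus>\<^bsub>A\<^esub> y) = tens x"
    using tens_add[of y "x \<ominus>\<^bsub>A\<^esub> y"] assms by (simp add: minus_plus_cancel)
  then show ?thesis unfolding tens_tc tc_add tc_eq by (simp add: algebra_simps)
qed

lemma tens_surj: assumes "T \<in> carrier TM" shows "\<exists>x\<in>carrier A. T = tens x"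
proof -
  obtain a where a: "Poly_Mapping.keys a \<subseteq> pairs" "T = tc a" using assms unfolding TM_sel by auto
  have "\<exists>x\<in>carrier A. tc a = tens x"
  proof (rule free_Abelian_group_induct[OF a(1)])
    show "\<exists>x\<in>carrier A. tc 0 = tens x" using tens_zero tc_zero by (intro bexI[of _ "\<zero>\<^bsub>A\<^esub>"]) auto
  next
    fix a b assume "\<exists>x\<in>carrier A. tc a = tens x" "\<exists>x\<in>carrier A. tc b = tens x"
    then obtain x y where xy: "x \<in> carrier A" "tc a = tens x" "y \<in> carrier A" "tc b = tens y" by blast
    have "a - frag_of (x, cl \<one>\<^bsub>R\<^esub>) - (b - frag_of (y, cl \<one>\<^bsub>R\<^esub>)) \<in> K"
      by (rule K_diff) (use xy in \<open>simp_all add: tens_tc tc_eq\<close>)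
    then have "tc (a - b) = tens (x \<ominus>\<^bsub>A\<^esub> y)" unfolding tens_diff[OF xy(1,3)] tc_eq by (simp add: algebra_simps)
    then show "\<exists>x\<in>carrier A. tc (a - b) = tens x" using xy by (intro bexI[of _ "x \<ominus>\<^bsub>A\<^esub> y"]) auto
  next
    fix p assume "p \<in> pairs"
    then obtain x r where p: "x \<in> carrier A" "r \<in> carrier R" "p = (x, cl r)" by (auto simp: k_sel)
    then show "\<exists>x\<in>carrier A. tc (frag_of p) = tens x"
      using pt_tens[OF p(1,2)] h_closed by (intro bexI[of _ "h r \<odot>\<^bsub>A\<^esub> x"]) (auto simp: pt_tc)
  qed
  then show ?thesis using a by simp
qed

text \<open>Scalar multiplication acts on representatives. The point is that the action on the left
  factor preserves \<open>K\<close>, which is checked on the three kinds of relations.\<close>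

lemma smult_tens: assumes s: "s \<in> carrier S" and x: "x \<in> carrier A" shows "s \<odot>\<^bsub>TM\<^esub> tens x = tens (s \<odot>\<^bsub>A\<^esub> x)"
proof -
  let ?\<sigma> = "frag_extend (\<lambda>(x, y). frag_of (s \<odot>\<^bsub>A\<^esub> x, y))"
  have rel: "?\<sigma> a \<in> K" if a: "a \<in> rels" for a
  proof (rule K_incl)
    have sx: "s \<odot>\<^bsub>A\<^esub> (x \<oplus>\<^bsub>A\<^esub> x') = s \<odot>\<^bsub>A\<^esub> x \<oplus>\<^bsub>A\<^esub> s \<odot>\<^bsub>A\<^esub> x'" if "x \<in> carrier A" "x' \<in> carrier A" for x x'
      by (rule smult_r_distr[OF s that])
    have sh: "s \<odot>\<^bsub>A\<^esub> (h r \<odot>\<^bsub>A\<^esub> x) = h r \<odot>\<^bsub>A\<^esub> (s \<odot>\<^bsub>A\<^esub> x)" if "x \<in> carrier A" "r \<in> carrier R" for x r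
      by (rule smult_comm[OF s h_closed[OF that(2)] that(1)])
    show "?\<sigma> a \<in> rels" using a
    proof (cases rule: rels_cases)
      case (left x x' y)
      have "?\<sigma> a = frag_of (s \<odot>\<^bsub>A\<^esub> x \<oplus>\<^bsub>A\<^esub> s \<odot>\<^bsub>A\<^esub> x', y) - frag_of (s \<odot>\<^bsub>A\<^esub> x, y) - frag_of (s \<odot>\<^bsub>A\<^esub> x', y)"
        using left(4) sx[OF left(1,2)] by (simp add: frag_extend_diff)
      moreover have "s \<odot>\<^bsub>A\<^esub> x \<in> carrier A" "s \<odot>\<^bsub>A\<^esub> x' \<in> carrier A" using s left by auto
      ultimately show ?thesis unfolding rels_def using left(3) by blast
    next
      case (right x y y')
      have "?\<sigma> a = frag_of (s \<odot>\<^bsub>A\<^esub> x, y \<oplus>\<^bsub>k\<^esub> y') - frag_of (s \<odot>\<^bsub>A\<^esub> x, y) - frag_of (s \<odot>\<^bsub>A\<^esub> x, y')"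
        using right(4) by (simp add: frag_extend_diff)
      moreover have "s \<odot>\<^bsub>A\<^esub> x \<in> carrier A" using s right by auto
      ultimately show ?thesis unfolding rels_def using right(2,3) by blast
    next
      case (balanced r x y)
      have "?\<sigma> a = frag_of (h r \<odot>\<^bsub>A\<^esub> (s \<odot>\<^bsub>A\<^esub> x), y) - frag_of (s \<odot>\<^bsub>A\<^esub> x, r \<odot>\<^bsub>k\<^esub> y)"
        using balanced(4) sh[OF balanced(2,1)] by (simp add: frag_extend_diff)
      moreover have "s \<odot>\<^bsub>A\<^esub> x \<in> carrier A" using s balanced by auto
      ultimately show ?thesis unfolding rels_def using balanced(1,3) by blast
    qed
  qed
  have \<sigma>K: "?\<sigma> a \<in> K" if "a \<in> K" for a
    using that unfolding K_def
  proof (induction rule: generate.induct)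
    case one then show ?case using K_zero by (simp add: K_def)
  next
    case (incl a) then show ?case using rel by (simp add: K_def)
  next
    case (inv a)
    then have "Poly_Mapping.keys a \<subseteq> pairs" using subsetD[OF rels_FG, of a] by simp
    then show ?case using K_neg[OF rel[OF inv]] by (simp add: frag_extend_minus K_def)
  next
    case (eng a b) then show ?case using K_add by (simp add: frag_extend_add K_def)
  qed
  have "s \<odot>\<^bsub>TM\<^esub> tens x = (\<Union>t\<in>tens x. tc (?\<sigma> t))"
    by (simp add: tensor_module_def Let_def r_coset_tc)
  moreover have "tc (?\<sigma> t) = tens (s \<odot>\<^bsub>A\<^esub> x)" if t: "t \<in> tens x" for t
  proof -
    obtain c where c: "c \<in> K" "t = c + frag_of (x, cl \<one>\<^bsub>R\<^esub>)" using t by (auto simp: tens_tc tc_def)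
    then show ?thesis unfolding tens_tc tc_eq using \<sigma>K[OF c(1)] by (simp add: frag_extend_add)
  qed
  moreover have "0 + frag_of (x, cl \<one>\<^bsub>R\<^esub>) \<in> tens x" unfolding tens_tc tc_def using K_zero by (rule imageI)
  ultimately show ?thesis by blast
qed

abbreviation "mA \<equiv> mspan (h ` m) (carrier A)"

lemma hm: "h ` m \<subseteq> carrier S" using h_closed m.Icarr by auto

lemma mA_subgroup: "subgroup mA (add_monoid A)" by (rule subgroup_mspan[OF hm subset_refl])

text \<open>The kernel of \<open>x \<mapsto> x \<otimes> 1\<close>: the map \<open>(x, m + r) \<mapsto> r x + m A\<close> is well defined on the tensor
  product.\<close>

lemma tens_eq_zero:
  assumes x: "x \<in> carrier A" shows "tens x = K \<longleftrightarrow> x \<in> mA"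
proof
  interpret mA: abelian_subgroup mA A
    by (rule abelian_subgroupI3[OF additive_subgroup.intro[OF mA_subgroup] M.abelian_group_axioms])
  let ?G = "A A_Mod mA"
  interpret G: comm_group ?G by (rule mA.a_factorgroup_is_comm_group)
  have Gs: "carrier ?G = (\<lambda>y. mA +>\<^bsub>A\<^esub> y) ` carrier A" "\<one>\<^bsub>?G\<^esub> = mA" "\<And>u v. u \<otimes>\<^bsub>?G\<^esub> v = set_add A u v"
    by (auto simp: A_FactGroup_def' A_RCOSETS_def' a_r_coset_def')
  have Geq: "(mA +>\<^bsub>A\<^esub> y = mA +>\<^bsub>A\<^esub> z) = (y \<ominus>\<^bsub>A\<^esub> z \<in> mA)" if "y \<in> carrier A" "z \<in> carrier A" for y z
    using that by (metis mA.a_rcos_module mA.a_rcos_self mA.a_repr_independence' M.minus_eq)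
  have Gadd: "(mA +>\<^bsub>A\<^esub> y) \<otimes>\<^bsub>?G\<^esub> (mA +>\<^bsub>A\<^esub> z) = mA +>\<^bsub>A\<^esub> (y \<oplus>\<^bsub>A\<^esub> z)" if "y \<in> carrier A" "z \<in> carrier A" for y z
    using that by (simp add: Gs mA.a_rcos_sum)
  \<comment> \<open>Chooses a representative of the class \<open>c\<close>. Two choices differ by an
    element of \<open>m\<close>, whose effect is absorbed by \<open>mA\<close>.\<close>
  define F where "F = (\<lambda>(y, c). mA +>\<^bsub>A\<^esub> (h (SOME r. r \<in> carrier R \<and> c = cl r) \<odot>\<^bsub>A\<^esub> y))"
  have F: "F (y, cl r) = mA +>\<^bsub>A\<^esub> (h r \<odot>\<^bsub>A\<^esub> y)" if y: "y \<in> carrier A" and r: "r \<in> carrier R" for y r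
  proof -
    define s where "s = (SOME s. s \<in> carrier R \<and> cl r = cl s)"
    have s: "s \<in> carrier R \<and> cl r = cl s" unfolding s_def by (rule someI[of _ r]) (use r in simp)
    then have sr: "s \<ominus>\<^bsub>R\<^esub> r \<in> m" using RR.quotient_eq_iff_same_a_r_cos[OF m.is_ideal, of s r] r by simp
    have "h s \<odot>\<^bsub>A\<^esub> y \<ominus>\<^bsub>A\<^esub> h r \<odot>\<^bsub>A\<^esub> y = h (s \<ominus>\<^bsub>R\<^esub> r) \<odot>\<^bsub>A\<^esub> y"
    proof -
      have "h s = h (s \<ominus>\<^bsub>R\<^esub> r) \<oplus> h r"
      proof -
        have "s = (s \<ominus>\<^bsub>R\<^esub> r) \<oplus>\<^bsub>R\<^esub> r" using s r by (simp add: RR.minus_eq RR.a_assoc RR.l_neg)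
        then show ?thesis using ring_hom_add[OF h, of "s \<ominus>\<^bsub>R\<^esub> r" r] s r by simp
      qed
      then have "h s \<odot>\<^bsub>A\<^esub> y = h r \<odot>\<^bsub>A\<^esub> y \<oplus>\<^bsub>A\<^esub> h (s \<ominus>\<^bsub>R\<^esub> r) \<odot>\<^bsub>A\<^esub> y"
        using s r y h_closed by (simp add: smult_l_distr M.a_comm)
      then show ?thesis using s r y h_closed eq_diffI by simp
    qed
    moreover have "h (s \<ominus>\<^bsub>R\<^esub> r) \<odot>\<^bsub>A\<^esub> y \<in> mA" by (rule mspan_incl) (use sr y in auto)
    ultimately have "mA +>\<^bsub>A\<^esub> (h s \<odot>\<^bsub>A\<^esub> y) = mA +>\<^bsub>A\<^esub> (h r \<odot>\<^bsub>A\<^esub> y)"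
      using Geq[of "h s \<odot>\<^bsub>A\<^esub> y" "h r \<odot>\<^bsub>A\<^esub> y"] s r y h_closed by simp
    then show ?thesis by (simp add: F_def s_def)
  qed
  have FG: "F ` pairs \<subseteq> carrier ?G"
  proof
    fix u assume "u \<in> F ` pairs"
    then obtain y r where "y \<in> carrier A" "r \<in> carrier R" "u = F (y, cl r)" by (auto simp: k_sel)
    then show "u \<in> carrier ?G" using F h_closed by (auto simp: Gs)
  qed
  \<comment> \<open>The universal property extends \<open>F\<close> to formal sums. The extension
    kills all relations, so \<open>x \<otimes> 1 = 0\<close> forces the coset of \<open>x\<close> to
    be trivial.\<close>
  obtain \<Phi> where \<Phi>: "\<Phi> \<in> hom FG ?G" "\<And>p. p \<in> pairs \<Longrightarrow> \<Phi> (frag_of p) = F p"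
    using G.free_Abelian_group_universal[OF FG] by metis
  interpret \<Phi>: group_hom FG ?G \<Phi>
    by (intro group_hom.intro group_hom_axioms.intro group_free_Abelian_group G.is_group \<Phi>(1))
  have \<Phi>d: "\<Phi> (a - b) = \<one>\<^bsub>?G\<^esub>" if ab: "a \<in> carrier FG" "b \<in> carrier FG" "\<Phi> a = \<Phi> b" for a b
  proof -
    have "a - b \<in> carrier FG" using FG_diff ab by blast
    then have "\<Phi> a = \<Phi> (a - b) \<otimes>\<^bsub>?G\<^esub> \<Phi> b" using \<Phi>.hom_mult[of "a - b" b] ab by simp
    then show ?thesis using ab \<Phi>.hom_closed[of "a - b"] \<open>a - b \<in> carrier FG\<close> \<Phi>.hom_closed[of b]
      by (metis G.r_cancel_one')
  qed
  have \<Phi>a: "\<Phi> (frag_of p + frag_of q) = F p \<otimes>\<^bsub>?G\<^esub> F q" if "p \<in> pairs" "q \<in> pairs" for p q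
    using \<Phi>.hom_mult[of "frag_of p" "frag_of q"] \<Phi>(2) that by simp
  have FGa: "frag_of p + frag_of q \<in> carrier FG" if "p \<in> pairs" "q \<in> pairs" for p q
    using group.is_monoid[OF group_free_Abelian_group] monoid.m_closed[of FG "frag_of p" "frag_of q"] that by simp
  have rel: "\<Phi> a = \<one>\<^bsub>?G\<^esub>" if a: "a \<in> rels" for a
  proof -
    show ?thesis using a
    proof (cases rule: rels_cases)
      case (left y y' c)
      obtain r where r: "r \<in> carrier R" "c = cl r" using left(3) by (rule cl_cases)
      note 1 = left(1,2) r(1) left(4)[unfolded r(2)]
      have p: "(y \<oplus>\<^bsub>A\<^esub> y', cl r) \<in> pairs" "(y, cl r) \<in> pairs" "(y', cl r) \<in> pairs" using 1 cl_closed by auto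
      have "\<Phi> (frag_of (y \<oplus>\<^bsub>A\<^esub> y', cl r)) = \<Phi> (frag_of (y, cl r) + frag_of (y', cl r))"
        unfolding \<Phi>a[OF p(2,3)] \<Phi>(2)[OF p(1)] using 1 F h_closed Gadd by (simp add: smult_r_distr)
      then show ?thesis unfolding 1(4) diff_diff_eq using p by (intro \<Phi>d FGa) simp_all
    next
      case (right y c c')
      obtain r where r: "r \<in> carrier R" "c = cl r" using right(2) by (rule cl_cases)
      obtain r' where r': "r' \<in> carrier R" "c' = cl r'" using right(3) by (rule cl_cases)
      note 2 = right(1) r(1) r'(1) right(4)[unfolded r(2) r'(2)]
      have p: "(y, cl r \<oplus>\<^bsub>k\<^esub> cl r') \<in> pairs" "(y, cl r) \<in> pairs" "(y, cl r') \<in> pairs" using 2 cl_closed k_closed by auto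
      have "\<Phi> (frag_of (y, cl r \<oplus>\<^bsub>k\<^esub> cl r')) = \<Phi> (frag_of (y, cl r) + frag_of (y, cl r'))"
        unfolding \<Phi>a[OF p(2,3)] \<Phi>(2)[OF p(1)]
        using 2 F h_closed Gadd k_add ring_hom_add[OF h 2(2,3)] by (simp add: smult_l_distr)
      then show ?thesis unfolding 2(4) diff_diff_eq using p by (intro \<Phi>d FGa) simp_all
    next
      case (balanced r y c')
      obtain r' where r': "r' \<in> carrier R" "c' = cl r'" using balanced(3) by (rule cl_cases)
      note 3 = balanced(1,2) r'(1) balanced(4)[unfolded r'(2)]
      have p: "(h r \<odot>\<^bsub>A\<^esub> y, cl r') \<in> pairs" "(y, r \<odot>\<^bsub>k\<^esub> cl r') \<in> pairs" using 3 cl_closed k_closed h_closed by auto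
      have "h r' \<odot>\<^bsub>A\<^esub> (h r \<odot>\<^bsub>A\<^esub> y) = h (r \<otimes>\<^bsub>R\<^esub> r') \<odot>\<^bsub>A\<^esub> y"
        using ring_hom_mult[OF h 3(1,3)] smult_comm[of "h r'" "h r" y] 3 h_closed by (simp add: smult_assoc1)
      then have "\<Phi> (frag_of (h r \<odot>\<^bsub>A\<^esub> y, cl r')) = \<Phi> (frag_of (y, r \<odot>\<^bsub>k\<^esub> cl r'))"
        unfolding \<Phi>(2)[OF p(1)] \<Phi>(2)[OF p(2)] using 3 F h_closed k_smult by simp
      then show ?thesis unfolding 3(4) using p by (intro \<Phi>d) simp_all
    qed
  qed
  have ker: "K \<subseteq> kernel FG ?G \<Phi>"
    unfolding K_def
  proof (rule group.generate_subgroup_incl[OF group_free_Abelian_group _ \<Phi>.subgroup_kernel])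
    show "rels \<subseteq> kernel FG ?G \<Phi>" unfolding kernel_def using rel subsetD[OF rels_FG] by blast
  qed
  assume "tens x = K"
  then have "frag_of (x, cl \<one>\<^bsub>R\<^esub>) - 0 \<in> K" unfolding tens_tc tc_zero[symmetric] tc_eq .
  then have "\<Phi> (frag_of (x, cl \<one>\<^bsub>R\<^esub>)) = mA" using ker by (auto simp: kernel_def Gs)
  then have "mA +>\<^bsub>A\<^esub> x = mA" using \<Phi>(2)[of "(x, cl \<one>\<^bsub>R\<^esub>)"] F[OF x, of "\<one>\<^bsub>R\<^esub>"] x one_k ring_hom_one[OF h] by simp
  then show "x \<in> mA" using mA.a_rcos_self[OF x] by simp
next
  assume "x \<in> mA"
  then show "tens x = K" using hm subset_refl
  proof (induction rule: mspan_induct)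
    case zero then show ?case by (rule tens_zero)
  next
    case (smult \<mu> z)
    then obtain r where r: "r \<in> m" "\<mu> = h r" by auto
    have rR: "r \<in> carrier R" using r m.Icarr by simp
    have hz: "h \<zero>\<^bsub>R\<^esub> = \<zero>" by (rule ring_hom_zero[OF h RR.ring_axioms R.ring_axioms])
    \<comment> \<open>\<open>r z \<otimes> 1\<close> equals \<open>z\<close> tensored with the class
      of \<open>r\<close>, and this class is zero.\<close>
    have "cl r = cl \<zero>\<^bsub>R\<^esub>"
      using RR.a_rcos_zero[OF m.is_ideal r(1)] RR.a_rcos_zero[OF m.is_ideal m.zero_closed] by simp
    then have "tens (\<mu> \<odot>\<^bsub>A\<^esub> z) = tens (h \<zero>\<^bsub>R\<^esub> \<odot>\<^bsub>A\<^esub> z)"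
      unfolding r(2) pt_tens[OF smult(2) rR, symmetric] pt_tens[OF smult(2) RR.zero_closed, symmetric] by simp
    then show ?case using hz smult(2) tens_zero by simp
  next
    case (neg y)
    have yA: "y \<in> carrier A" using subsetD[OF mspan_carrier[OF hm subset_refl] neg(1)] .
    have "tens (\<zero>\<^bsub>A\<^esub> \<ominus>\<^bsub>A\<^esub> y) = tc (frag_of (\<zero>\<^bsub>A\<^esub>, cl \<one>\<^bsub>R\<^esub>) - frag_of (y, cl \<one>\<^bsub>R\<^esub>))" by (rule tens_diff) (use yA in auto)
    also have "\<dots> = tc 0"
      using K_diff[OF tens_zero[unfolded tens_K] neg(2)[unfolded tens_K]] by (simp only: tc_eq diff_0_right)
    finally show ?case using yA by (simp add: M.minus_eq tc_zero)
  next
    case (add y z)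
    have c: "y \<in> carrier A" "z \<in> carrier A" using subsetD[OF mspan_carrier[OF hm subset_refl]] add by auto
    show ?case using tens_add[OF c] add tc_add[of 0 0] by (simp add: tc_zero)
  qed
qed

lemma tens_eq:
  assumes "x \<in> carrier A" "y \<in> carrier A" shows "tens x = tens y \<longleftrightarrow> x \<ominus>\<^bsub>A\<^esub> y \<in> mA"
proof -
  have "tens x = tens y \<longleftrightarrow> tens (x \<ominus>\<^bsub>A\<^esub> y) = K"
    unfolding tens_diff[OF assms] tc_zero[symmetric] unfolding tens_tc tc_eq by simp
  then show ?thesis using tens_eq_zero assms by simp
qed

text \<open>Turns the dimension of \<open>M \<otimes> k\<close> into a statement about primes over
  \<open>fiber_ann\<close>.\<close>

lemma tens_annihilator:
  "annihilator S TM = {s \<in> carrier S. \<forall>v\<in>carrier A. s \<odot>\<^bsub>A\<^esub> v \<in> mA}"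
proof -
  have "(\<forall>T\<in>carrier TM. s \<odot>\<^bsub>TM\<^esub> T = \<zero>\<^bsub>TM\<^esub>) \<longleftrightarrow> (\<forall>v\<in>carrier A. s \<odot>\<^bsub>A\<^esub> v \<in> mA)" if s: "s \<in> carrier S" for s
  proof -
    have "(\<forall>T\<in>carrier TM. s \<odot>\<^bsub>TM\<^esub> T = \<zero>\<^bsub>TM\<^esub>) \<longleftrightarrow> (\<forall>v\<in>carrier A. s \<odot>\<^bsub>TM\<^esub> tens v = K)"
      using tens_surj tens_closed TM_sel(2) by metis
    also have "\<dots> \<longleftrightarrow> (\<forall>v\<in>carrier A. s \<odot>\<^bsub>A\<^esub> v \<in> mA)" using s by (simp add: smult_tens tens_eq_zero)
    finally show ?thesis .
  qed
  then show ?thesis by (auto simp: annihilator_def)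
qed

end

section \<open>The cohomology modules\<close>

context module_complex
begin

definition coh :: "'s set \<Rightarrow> nat \<Rightarrow> ('s, 'e set) module" where
  "coh G i = quotient_module ((E i)\<lparr>carrier := Z G i\<rparr>) (B G i)"

abbreviation "cls G i z \<equiv> B G i +>\<^bsub>E i\<^esub> z"

context
  fixes G and i :: nat
  assumes G: "G \<subseteq> carrier S"
begin

lemma Z_zero: "\<zero>\<^bsub>E i\<^esub> \<in> Z G i"
  using E.zero_tors[OF G] by (simp add: cocyc_def)

lemma Z_add: "y \<in> Z G i \<Longrightarrow> z \<in> Z G i \<Longrightarrow> y \<oplus>\<^bsub>E i\<^esub> z \<in> Z G i"
  using E.tors_add[OF G] T_carrier[of _ i G] by (simp add: cocyc_def d.add)

lemma Z_smult: "s \<in> carrier S \<Longrightarrow> z \<in> Z G i \<Longrightarrow> s \<odot>\<^bsub>E i\<^esub> z \<in> Z G i"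
  using E.tors_smult[OF G] T_carrier[of _ i G] by (simp add: cocyc_def d.smult)

lemma Z_neg: "z \<in> Z G i \<Longrightarrow> \<ominus>\<^bsub>E i\<^esub> z \<in> Z G i"
  using E.tors_neg[OF G] T_carrier[of _ i G] by (simp add: cocyc_def d.neg)

lemma submodule_Z: "submodule (Z G i) S (E i)"
  by (rule E.submodule_criterion[OF Z_carrier Z_zero Z_add Z_smult])

lemma module_Z: "module S ((E i)\<lparr>carrier := Z G i\<rparr>)"
  by (rule submodule.submodule_is_module[OF submodule_Z E.module_axioms])

lemma B_smult:
  assumes s: "s \<in> carrier S" and b: "b \<in> B G i" shows "s \<odot>\<^bsub>E i\<^esub> b \<in> B G i"
proof (cases i)
  case 0 then show ?thesis using b s by (simp add: cobd_def)
next
  case (Suc j)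
  then obtain u where u: "u \<in> T G j" "b = d j u" using b by (auto simp: cobd_def)
  then have "s \<odot>\<^bsub>E i\<^esub> b = d j (s \<odot>\<^bsub>E j\<^esub> u)" using Suc s T_carrier by (simp add: d.smult)
  then show ?thesis using E.tors_smult[OF G s u(1)] Suc by (simp add: cobd_def)
qed

lemma submodule_B: "submodule (B G i) S ((E i)\<lparr>carrier := Z G i\<rparr>)"
proof -
  interpret Zm: module S "(E i)\<lparr>carrier := Z G i\<rparr>" by (rule module_Z)
  show ?thesis
    by (rule Zm.submodule_criterion) (use B_Z[OF G] zero_B[OF G] B_add[OF G] B_smult in auto)
qed

interpretation Q: module_quotient S "(E i)\<lparr>carrier := Z G i\<rparr>" "B G i"
  by (intro module_quotient.intro module_quotient_axioms.intro module_Z submodule_B)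

lemma cls_restrict: "B G i +>\<^bsub>(E i)\<lparr>carrier := Z G i\<rparr>\<^esub> z = cls G i z"
  by (simp add: a_r_coset_def')

lemma coh_module: "module S (coh G i)"
  unfolding coh_def by (rule Q.quotient_is_module)

lemma coh_carrier: "carrier (coh G i) = cls G i ` Z G i"
  unfolding coh_def Q.Q_sel(1) cls_restrict by simp

lemma coh_cases: assumes "C \<in> carrier (coh G i)" obtains z where "z \<in> Z G i" "C = cls G i z"
  using assms unfolding coh_carrier by (elim imageE)

lemma coh_zero: "\<zero>\<^bsub>coh G i\<^esub> = B G i"
  unfolding coh_def Q.Q_sel(2) ..

lemma cls_zero: "z \<in> Z G i \<Longrightarrow> cls G i z = B G i \<longleftrightarrow> z \<in> B G i"
  using Q.qc_zero[of z] by (simp add: cls_restrict)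

lemma cls_add: "y \<in> Z G i \<Longrightarrow> z \<in> Z G i \<Longrightarrow> cls G i y \<oplus>\<^bsub>coh G i\<^esub> cls G i z = cls G i (y \<oplus>\<^bsub>E i\<^esub> z)"
  using Q.qc_add[of y z] by (simp add: cls_restrict coh_def)

lemma cls_smult: "s \<in> carrier S \<Longrightarrow> z \<in> Z G i \<Longrightarrow> s \<odot>\<^bsub>coh G i\<^esub> cls G i z = cls G i (s \<odot>\<^bsub>E i\<^esub> z)"
  using Q.qc_smult[of s z] by (simp add: cls_restrict coh_def)

lemma cls_absorb: "z \<in> Z G i \<Longrightarrow> b \<in> B G i \<Longrightarrow> cls G i (z \<oplus>\<^bsub>E i\<^esub> b) = cls G i z"
  using Q.qc_absorb[of z b] B_carrier[OF G] Z_carrier by (simp add: cls_restrict E.M.a_comm subset_iff)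

lemma cls_neg: assumes z: "z \<in> Z G i" shows "cls G i (\<ominus>\<^bsub>E i\<^esub> z) = \<ominus>\<^bsub>coh G i\<^esub> cls G i z"
proof -
  interpret C: module S "coh G i" by (rule coh_module)
  have zE: "z \<in> carrier (E i)" by (rule subsetD[OF Z_carrier z])
  have "cls G i (\<ominus>\<^bsub>E i\<^esub> z) \<oplus>\<^bsub>coh G i\<^esub> cls G i z = cls G i \<zero>\<^bsub>E i\<^esub>"
    using z Z_neg zE by (simp add: cls_add E.M.l_neg)
  also have "\<dots> = \<zero>\<^bsub>coh G i\<^esub>" using cls_zero[OF Z_zero] zero_B[OF G] by (simp add: coh_zero)
  finally show ?thesis
    using z Z_neg by (intro C.M.minus_equality[symmetric]) (auto simp: coh_carrier)
qed

lemma cls_mspan: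
  assumes mm: "mm \<subseteq> carrier S" and v: "v \<in> E.mspan i mm (Z G i)"
  shows "cls G i v \<in> module.mspan (coh G i) mm (carrier (coh G i))" "v \<in> Z G i"
proof -
  interpret C: module S "coh G i" by (rule coh_module)
  have "v \<in> Z G i \<and> cls G i v \<in> C.mspan mm (carrier (coh G i))"
    using v mm Z_carrier
  proof (induction rule: E.mspan_induct)
    case zero
    have "cls G i \<zero>\<^bsub>E i\<^esub> = \<zero>\<^bsub>coh G i\<^esub>" using cls_zero[OF Z_zero] zero_B[OF G] by (simp add: coh_zero)
    then show ?case using Z_zero C.mspan_zero by simp
  next
    case (smult \<mu> z)
    then have "\<mu> \<in> carrier S" using mm by blast
    moreover have "\<mu> \<odot>\<^bsub>coh G i\<^esub> cls G i z \<in> C.mspan mm (carrier (coh G i))"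
      using smult by (intro C.mspan_incl) (auto simp: coh_carrier)
    ultimately show ?case using smult Z_smult by (simp add: cls_smult)
  next
    case (neg x)
    then show ?case using Z_neg C.mspan_neg[OF mm subset_refl] by (simp add: cls_neg)
  next
    case (add x y)
    then show ?case using Z_add C.mspan_add by (simp flip: cls_add)
  qed
  then show "cls G i v \<in> C.mspan mm (carrier (coh G i))" "v \<in> Z G i" by auto
qed

lemma coh_vanish: "Z G i \<subseteq> B G i \<Longrightarrow> carrier (coh G i) = {\<zero>\<^bsub>coh G i\<^esub>}"
  unfolding coh_carrier coh_zero using cls_zero Z_zero by fastforce

end

end

section \<open>Maps that factor through the tensor product, and its grading\<close>

context residue_tensor
begin

text \<open>By \<open>tens_eq\<close> the map \<open>tens\<close> identifies the tensor product with
  \<open>A / mA\<close>, so a surjection with kernel \<open>mA\<close> factors through a bijection.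
  Naturality on all pure tensors follows by moving the scalar to the left.\<close>

lemma factor_map:
  assumes N: "module S N" and q: "q \<in> module_hom S A N"
    and ker: "\<And>v. v \<in> carrier A \<Longrightarrow> q v = \<zero>\<^bsub>N\<^esub> \<longleftrightarrow> v \<in> mA" and onto: "q ` carrier A = carrier N"
  shows "\<exists>\<psi>. natural_tensor_map h R m S A N q \<psi> \<and> bij_betw \<psi> (carrier TM) (carrier N) \<and>
    (\<forall>v\<in>carrier A. \<psi> (tens v) = q v)"
proof -
  interpret N: module S N by (rule N)
  interpret q: module_homomorphism S A N q by unfold_locales (rule q)
  have eq: "q v = q w \<longleftrightarrow> tens v = tens w" if vw: "v \<in> carrier A" "w \<in> carrier A" for v w
  proof -
    have "q v = q w \<longleftrightarrow> q v \<ominus>\<^bsub>N\<^esub> q w = \<zero>\<^bsub>N\<^esub>"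
      using vw N.diff_self N.minus_plus_cancel[of "q v" "q w"] by auto
    also have "\<dots> \<longleftrightarrow> v \<ominus>\<^bsub>A\<^esub> w \<in> mA" using vw ker[of "v \<ominus>\<^bsub>A\<^esub> w"] by (simp add: q.diff)
    finally show ?thesis using tens_eq[OF vw] by simp
  qed
  define \<psi> where "\<psi> = (\<lambda>T. q (SOME v. v \<in> carrier A \<and> T = tens v))"
  have \<psi>: "\<psi> (tens v) = q v" if v: "v \<in> carrier A" for v
  proof -
    define u where "u = (SOME u. u \<in> carrier A \<and> tens v = tens u)"
    have "u \<in> carrier A \<and> tens v = tens u" unfolding u_def by (rule someI[of _ v]) (use v in simp)
    then have "q u = q v" using eq[of u v] v by simp
    then show ?thesis by (simp add: \<psi>_def u_def)
  qed
  have "\<psi> \<in> module_hom S TM N"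
    unfolding module_hom_def mem_Collect_eq
  proof (intro conjI ballI)
    show "\<psi> \<in> carrier TM \<rightarrow> carrier N" using tens_surj \<psi> by fastforce
    fix T U assume "T \<in> carrier TM" "U \<in> carrier TM"
    then obtain v w where vw: "v \<in> carrier A" "w \<in> carrier A" "T = tens v" "U = tens w" using tens_surj by metis
    show "\<psi> (T \<oplus>\<^bsub>TM\<^esub> U) = \<psi> T \<oplus>\<^bsub>N\<^esub> \<psi> U"
      using vw by (simp add: \<psi> q.add flip: tens_add)
  next
    fix s T assume s: "s \<in> carrier S" and "T \<in> carrier TM"
    then obtain v where v: "v \<in> carrier A" "T = tens v" using tens_surj by metis
    show "\<psi> (s \<odot>\<^bsub>TM\<^esub> T) = s \<odot>\<^bsub>N\<^esub> \<psi> T" using s v by (simp add: \<psi> q.smult smult_tens)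
  qed
  moreover have "\<psi> (pt v (cl r)) = h r \<odot>\<^bsub>N\<^esub> q v" if "v \<in> carrier A" "r \<in> carrier R" for v r
    using that h_closed by (simp add: pt_tens \<psi> q.smult)
  moreover have "bij_betw \<psi> (carrier TM) (carrier N)"
  proof (rule bij_betw_imageI)
    show "inj_on \<psi> (carrier TM)"
    proof (rule inj_onI)
      fix T U assume "T \<in> carrier TM" "U \<in> carrier TM" and e: "\<psi> T = \<psi> U"
      then obtain v w where "v \<in> carrier A" "w \<in> carrier A" "T = tens v" "U = tens w" using tens_surj by metis
      then show "T = U" using e eq[of v w] by (simp add: \<psi>)
    qed
    have "carrier TM = tens ` carrier A" using tens_surj tens_closed by blast
    then show "\<psi> ` carrier TM = carrier N" unfolding onto[symmetric] by (simp add: image_image \<psi>)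
  qed
  ultimately show ?thesis using \<psi> unfolding natural_tensor_map_def by blast
qed

lemma tensor_group: "group (add_monoid TM)"
proof (rule groupI)
  show "\<one>\<^bsub>add_monoid TM\<^esub> \<in> carrier (add_monoid TM)"
    using tens_closed[of "\<zero>\<^bsub>A\<^esub>"] tens_zero by (simp add: TM_sel)
  fix T assume "T \<in> carrier (add_monoid TM)"
  then obtain x where x: "x \<in> carrier A" "T = tens x" using tens_surj by auto
  have z: "\<zero>\<^bsub>TM\<^esub> = tens \<zero>\<^bsub>A\<^esub>" by (simp add: TM_sel tens_zero)
  show "\<one>\<^bsub>add_monoid TM\<^esub> \<otimes>\<^bsub>add_monoid TM\<^esub> T = T" using x by (simp add: z flip: tens_add)
  show "\<exists>U\<in>carrier (add_monoid TM). U \<otimes>\<^bsub>add_monoid TM\<^esub> T = \<one>\<^bsub>add_monoid TM\<^esub>"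
    using x tens_closed by (intro bexI[of _ "tens (\<ominus>\<^bsub>A\<^esub> x)"]) (simp_all add: z M.l_neg flip: tens_add)
  fix U assume "U \<in> carrier (add_monoid TM)"
  then obtain y where y: "y \<in> carrier A" "U = tens y" using tens_surj by auto
  show "T \<otimes>\<^bsub>add_monoid TM\<^esub> U \<in> carrier (add_monoid TM)" using x y tens_closed by (simp flip: tens_add)
  fix V assume "V \<in> carrier (add_monoid TM)"
  then obtain v where v: "v \<in> carrier A" "V = tens v" using tens_surj by auto
  show "T \<otimes>\<^bsub>add_monoid TM\<^esub> U \<otimes>\<^bsub>add_monoid TM\<^esub> V = T \<otimes>\<^bsub>add_monoid TM\<^esub> (U \<otimes>\<^bsub>add_monoid TM\<^esub> V)"
    using x y v by (simp add: M.a_assoc flip: tens_add)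
qed

text \<open>The elements \<open>x \<otimes> 1\<close> with \<open>x\<close> of degree
  \<open>j\<close> already form a subgroup and include all generators, since scalars from
  \<open>R\<close> preserve degrees.\<close>

lemma tensor_grading_eq:
  assumes Ag: "Ag j \<subseteq> carrier A" "\<zero>\<^bsub>A\<^esub> \<in> Ag j"
    and add: "\<And>v w. v \<in> Ag j \<Longrightarrow> w \<in> Ag j \<Longrightarrow> v \<oplus>\<^bsub>A\<^esub> w \<in> Ag j"
    and neg: "\<And>v. v \<in> Ag j \<Longrightarrow> \<ominus>\<^bsub>A\<^esub> v \<in> Ag j"
    and sm: "\<And>r v. r \<in> carrier R \<Longrightarrow> v \<in> Ag j \<Longrightarrow> h r \<odot>\<^bsub>A\<^esub> v \<in> Ag j"
  shows "tensor_grading h R A Ag k j = tens ` Ag j"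
proof -
  let ?g = "{pt x y | x y. x \<in> Ag j \<and> y \<in> carrier k}"
  have g: "?g = tens ` Ag j"
  proof (intro equalityI subsetI)
    fix T assume "T \<in> ?g"
    then obtain v r where v: "v \<in> Ag j" "r \<in> carrier R" "T = pt v (cl r)" by (auto simp: k_sel)
    then show "T \<in> tens ` Ag j" using pt_tens[of v r] Ag(1) sm by auto
  next
    fix T assume "T \<in> tens ` Ag j"
    then obtain v where "v \<in> Ag j" "T = pt v (cl \<one>\<^bsub>R\<^esub>)" by (auto simp: tens_def)
    then show "T \<in> ?g" using one_k by blast
  qed
  have minus: "inv\<^bsub>add_monoid TM\<^esub> (tens v) = tens (\<ominus>\<^bsub>A\<^esub> v)" if v: "v \<in> Ag j" for v
  proof -
    have vA: "v \<in> carrier A" using v Ag(1) by blast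
    have "tens (\<ominus>\<^bsub>A\<^esub> v) \<oplus>\<^bsub>TM\<^esub> tens v = \<zero>\<^bsub>TM\<^esub>"
      using tens_add[of "\<ominus>\<^bsub>A\<^esub> v" v] vA tens_zero by (simp add: M.l_neg TM_sel)
    then show ?thesis using group.inv_equality[OF tensor_group, of "tens (\<ominus>\<^bsub>A\<^esub> v)" "tens v"] vA tens_closed by simp
  qed
  have "T \<in> tens ` Ag j" if "T \<in> generate (add_monoid TM) ?g" for T
    using that
  proof (induction rule: generate.induct)
    case one
    have "\<one>\<^bsub>add_monoid TM\<^esub> = tens \<zero>\<^bsub>A\<^esub>" by (simp add: TM_sel tens_zero)
    then show ?case using Ag(2) by simp
  next
    case (incl T) then show ?case unfolding g .
  next
    case (inv T)
    then obtain v where "v \<in> Ag j" "T = tens v" unfolding g by (elim imageE)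
    then show ?case using minus neg by simp
  next
    case (eng T U)
    then obtain v w where vw: "v \<in> Ag j" "w \<in> Ag j" "T = tens v" "U = tens w" by (elim imageE)
    then have "T \<otimes>\<^bsub>add_monoid TM\<^esub> U = tens (v \<oplus>\<^bsub>A\<^esub> w)" using tens_add[of v w] Ag(1) by auto
    then show ?case using add vw by simp
  qed
  moreover have "tens ` Ag j \<subseteq> generate (add_monoid TM) ?g" unfolding g by (rule subsetI, rule generate.incl)
  ultimately show ?thesis unfolding tensor_grading_def by blast
qed

end

section \<open>The induced map on cohomology modules\<close>

context module_complex_map
begin

abbreviation "coh_map G i C \<equiv> \<Union>x\<in>C. F.B G i +>\<^bsub>F i\<^esub> \<phi> i x"

lemma coh_map_cls:
  assumes G: "G \<subseteq> carrier S" and z: "z \<in> E.Z G i" shows "coh_map G i (E.cls G i z) = F.cls G i (\<phi> i z)"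
proof -
  have zE: "z \<in> carrier (E i)" by (rule subsetD[OF E.Z_carrier z])
  have "F.cls G i (\<phi> i x) = F.cls G i (\<phi> i z)" if x: "x \<in> E.cls G i z" for x
  proof -
    obtain b where b: "b \<in> E.B G i" "x = b \<oplus>\<^bsub>E i\<^esub> z" using x by (auto simp: a_r_coset_def')
    have bE: "b \<in> carrier (E i)" by (rule subsetD[OF E.B_carrier[OF G] b(1)])
    have "\<phi> i x = \<phi> i z \<oplus>\<^bsub>F i\<^esub> \<phi> i b" unfolding b(2) using \<phi>.add[OF bE zE] bE zE by (simp add: F.E.M.a_comm)
    then show ?thesis using F.cls_absorb[OF G \<phi>_Z[OF G z] \<phi>_B[OF G b(1)]] by simp
  qed
  moreover have "\<zero>\<^bsub>E i\<^esub> \<oplus>\<^bsub>E i\<^esub> z \<in> E.cls G i z" unfolding a_r_coset_def' using E.zero_B[OF G] by blast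
  ultimately show ?thesis by blast
qed

text \<open>Of the clauses of \<open>reduction\<close>, the third gives surjectivity, the fourth
  bounds the kernel by the multiples of \<open>mm\<close>, and the fifth sends these multiples to
  zero.\<close>

lemma reduction_coh_map:
  assumes G: "G \<subseteq> carrier S" and red: "reduction G i"
  shows "coh_map G i \<in> module_hom S (E.coh G i) (F.coh G i)"
    "C \<in> carrier (E.coh G i) \<Longrightarrow>
      coh_map G i C = \<zero>\<^bsub>F.coh G i\<^esub> \<longleftrightarrow> C \<in> module.mspan (E.coh G i) mm (carrier (E.coh G i))"
    "coh_map G i ` carrier (E.coh G i) = carrier (F.coh G i)"
proof -
  interpret CE: module S "E.coh G i" by (rule E.coh_module[OF G])
  interpret CF: module S "F.coh G i" by (rule F.coh_module[OF G])
  let ?q = "coh_map G i"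
  note cls = coh_map_cls[OF G]
  show q: "?q \<in> module_hom S (E.coh G i) (F.coh G i)"
    unfolding module_hom_def mem_Collect_eq
  proof (intro conjI ballI funcsetI)
    fix C assume "C \<in> carrier (E.coh G i)"
    then obtain z where z: "z \<in> E.Z G i" "C = E.cls G i z" by (rule E.coh_cases[OF G])
    show "?q C \<in> carrier (F.coh G i)" unfolding z(2) cls[OF z(1)] F.coh_carrier[OF G] by (rule imageI[OF \<phi>_Z[OF G z(1)]])
  next
    fix C D assume "C \<in> carrier (E.coh G i)" "D \<in> carrier (E.coh G i)"
    then obtain y z where yz: "y \<in> E.Z G i" "C = E.cls G i y" "z \<in> E.Z G i" "D = E.cls G i z"
      by (elim E.coh_cases[OF G])
    note c = subsetD[OF E.Z_carrier yz(1)] subsetD[OF E.Z_carrier yz(3)]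
    show "?q (C \<oplus>\<^bsub>E.coh G i\<^esub> D) = ?q C \<oplus>\<^bsub>F.coh G i\<^esub> ?q D"
      unfolding yz(2,4) E.cls_add[OF G yz(1,3)] cls[OF yz(1)] cls[OF yz(3)] cls[OF E.Z_add[OF G yz(1,3)]]
        F.cls_add[OF G \<phi>_Z[OF G yz(1)] \<phi>_Z[OF G yz(3)]] \<phi>.add[OF c] ..
  next
    fix s C assume s: "s \<in> carrier S" and "C \<in> carrier (E.coh G i)"
    then obtain z where z: "z \<in> E.Z G i" "C = E.cls G i z" by (elim E.coh_cases[OF G])
    note c = subsetD[OF E.Z_carrier z(1)]
    show "?q (s \<odot>\<^bsub>E.coh G i\<^esub> C) = s \<odot>\<^bsub>F.coh G i\<^esub> ?q C"
      unfolding z(2) E.cls_smult[OF G s z(1)] cls[OF z(1)] cls[OF E.Z_smult[OF G s z(1)]]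
        F.cls_smult[OF G s \<phi>_Z[OF G z(1)]] \<phi>.smult[OF s c] ..
  qed
  interpret q: module_homomorphism S "E.coh G i" "F.coh G i" ?q by unfold_locales (rule q)
  show "?q C = \<zero>\<^bsub>F.coh G i\<^esub> \<longleftrightarrow> C \<in> CE.mspan mm (carrier (E.coh G i))" if C: "C \<in> carrier (E.coh G i)"
  proof
    obtain v where v: "v \<in> E.Z G i" "C = E.cls G i v" using C by (rule E.coh_cases[OF G])
    assume "?q C = \<zero>\<^bsub>F.coh G i\<^esub>"
    then have "\<phi> i v \<in> F.B G i"
      unfolding v(2) cls[OF v(1)] F.coh_zero[OF G] F.cls_zero[OF G \<phi>_Z[OF G v(1)]] .
    then have "\<exists>u\<in>E.E.mspan i mm (E.Z G i). \<exists>b\<in>E.B G i. v = u \<oplus>\<^bsub>E i\<^esub> b"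
      by (rule reductionD(4)[OF red v(1)])
    then obtain u b where ub: "u \<in> E.E.mspan i mm (E.Z G i)" "b \<in> E.B G i" "v = u \<oplus>\<^bsub>E i\<^esub> b" by (elim bexE)
    show "C \<in> CE.mspan mm (carrier (E.coh G i))"
      unfolding v(2) ub(3) E.cls_absorb[OF G E.cls_mspan(2)[OF G mm ub(1)] ub(2)]
      by (rule E.cls_mspan(1)[OF G mm ub(1)])
  next
    note car = subsetD[OF CE.mspan_carrier[OF mm subset_refl]]
    assume "C \<in> CE.mspan mm (carrier (E.coh G i))"
    then show "?q C = \<zero>\<^bsub>F.coh G i\<^esub>" using mm subset_refl
    proof (induction rule: CE.mspan_induct)
      case zero show ?case by (rule q.zero)
    next
      case (smult \<mu> C)
      obtain z where z: "z \<in> E.Z G i" "C = E.cls G i z" using smult(2) by (rule E.coh_cases[OF G])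
      have \<mu>: "\<mu> \<in> carrier S" by (rule subsetD[OF mm smult(1)])
      show ?case
        unfolding q.smult[OF \<mu> smult(2)] unfolding z(2) cls[OF z(1)] F.cls_smult[OF G \<mu> \<phi>_Z[OF G z(1)]] F.coh_zero[OF G]
          F.cls_zero[OF G F.Z_smult[OF G \<mu> \<phi>_Z[OF G z(1)]]]
        by (rule reductionD(5)[OF red \<phi>_Z[OF G z(1)] smult(1)])
    next
      case (neg C) show ?case unfolding q.neg[OF car[OF neg(1)]] neg(2) by simp
    next
      case (add C D) show ?case unfolding q.add[OF car[OF add(1)] car[OF add(2)]] add(3,4) by simp
    qed
  qed
  show "?q ` carrier (E.coh G i) = carrier (F.coh G i)"
  proof (intro equalityI subsetI)
    fix D assume "D \<in> ?q ` carrier (E.coh G i)"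
    then show "D \<in> carrier (F.coh G i)" using q.closed by (elim imageE) simp
  next
    fix D assume "D \<in> carrier (F.coh G i)"
    then obtain w where w: "w \<in> F.Z G i" "D = F.cls G i w" by (rule F.coh_cases[OF G])
    obtain z b where zb: "z \<in> E.Z G i" "b \<in> F.B G i" "w = \<phi> i z \<oplus>\<^bsub>F i\<^esub> b"
      using reductionD(3)[OF red w(1)] by (elim bexE)
    have "D = ?q (E.cls G i z)"
      unfolding w(2) zb(3) cls[OF zb(1)] by (rule F.cls_absorb[OF G \<phi>_Z[OF G zb(1)] zb(2)])
    then show "D \<in> ?q ` carrier (E.coh G i)" unfolding E.coh_carrier[OF G] using zb(1) by blast
  qed
qed

end

lemma graded_hom_gc:
  assumes A: "graded_mod S Sg A Ag" and B: "graded_mod S Sg B Bg" and f: "f \<in> graded_hom S A Ag B Bg"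
    and y: "y \<in> carrier A"
  shows "f (graded_mod.gc A Ag y j) = graded_mod.gc B Bg (f y) j"
proof -
  interpret A: graded_mod S Sg A Ag by (rule A)
  interpret B: graded_mod S Sg B Bg by (rule B)
  interpret f: module_homomorphism S A B f by unfold_locales (use f in \<open>simp add: graded_hom_def\<close>)
  have hm: "f z \<in> Bg i" if "z \<in> Ag i" for z i using f that by (auto simp: graded_hom_def)
  show ?thesis using y
  proof (induction rule: A.graded_induct)
    case zero then show ?case by simp
  next
    case (comp i)
    have "A.gc y i \<in> Ag i" by (rule A.gc_Mg[OF y])
    then show ?case using A.gc_homogeneous[of "A.gc y i" i j] B.gc_homogeneous[OF hm, of "A.gc y i" i j] by simp
  next
    case (add u v) then show ?case by (simp add: A.gc_add B.gc_add f.add)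
  qed
qed

lemma graded_module_imp_module: "graded_module S Sg M Mg \<Longrightarrow> module S M"
  by (simp add: graded_module_def)

section \<open>Local cohomology of a graded module\<close>

context local_graded_algebra
begin

definition homogeneous_elems :: "'s set" where "homogeneous_elems = {a. \<exists>j. a \<in> Sg j}"

text \<open>All that is needed of injective and of graded injective resolutions.\<close>

definition divisible_resolution ::
    "('s, 'm) module \<Rightarrow> (nat \<Rightarrow> ('s, 'e) module) \<Rightarrow> (nat \<Rightarrow> 'e \<Rightarrow> 'e) \<Rightarrow> ('m \<Rightarrow> 'e) \<Rightarrow> bool" where
  "divisible_resolution M E d e \<longleftrightarrow> right_resolution S M E d e \<and> (\<forall>j. module S (E j)) \<and>
    (\<forall>j. tors_divisible S homogeneous_elems (E j))"

lemma homogeneous_closed: "homogeneous_elems \<subseteq> carrier S"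
  using Sg_closed by (auto simp: homogeneous_elems_def)

lemma injective_divisible:
  assumes "injective_resolution S M E d e" shows "divisible_resolution M E d e"
proof -
  have inj: "injective_module S (E j)" for j using assms by (simp add: injective_resolution_def)
  have m: "module S (E j)" for j using inj[of j] by (simp add: injective_module_def)
  have "tors_divisible S homogeneous_elems (E j)" for j
    by (rule tors_divisible_mono[OF injective_tors_divisible[OF is_cring m noetherian inj] homogeneous_closed])
  then show ?thesis using assms m by (simp add: divisible_resolution_def injective_resolution_def)
qed

lemma graded_injective_graded:
  "graded_injective_resolution S Sg M Mg E Eg d e \<Longrightarrow> graded_module S Sg (E j) (Eg j)"
  unfolding graded_injective_resolution_def graded_injective_module_def by (elim conjE allE)

lemma graded_injective_divisible:
  assumes "graded_injective_resolution S Sg M Mg E Eg d e" shows "divisible_resolution M E d e"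
proof -
  have r: "right_resolution S M E d e" and inj: "graded_injective_module S Sg (E j) (Eg j)" for j
    using assms by (simp_all only: graded_injective_resolution_def)
  have m: "module S (E j)" for j using graded_injective_graded[OF assms, of j] by (simp only: graded_module_def)
  have "tors_divisible S homogeneous_elems (E j)" for j
    unfolding homogeneous_elems_def by (rule graded_injective_tors_divisible[OF noetherian inj])
  then show ?thesis using r m by (simp only: divisible_resolution_def simp_thms)
qed

lemma resolution_complex:
  assumes "divisible_resolution M E d e"
  shows "module_complex S E d homogeneous_elems" "i > 0 \<Longrightarrow> cocyc S E d {} i \<subseteq> cobd S E d {} i"
    "cocyc S E d {} 0 = e ` carrier M" "e \<in> module_hom S M (E 0)" "inj_on e (carrier M)"
proof -
  have r: "right_resolution S M E d e" using assms by (simp add: divisible_resolution_def)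
  have ex: "d j ` carrier (E j) = {y \<in> carrier (E (Suc j)). d (Suc j) y = \<zero>\<^bsub>E (Suc (Suc j))\<^esub>}" for j
    using r by (simp add: right_resolution_def)
  show "module_complex S E d homogeneous_elems"
  proof (rule module_complex.intro)
    show "d (Suc j) (d j y) = \<zero>\<^bsub>E (Suc (Suc j))\<^esub>" if "y \<in> carrier (E j)" for j y
      using imageI[OF that, of "d j"] unfolding ex by simp
  qed (use assms r homogeneous_closed in \<open>auto simp: divisible_resolution_def right_resolution_def\<close>)
  show "cocyc S E d {} i \<subseteq> cobd S E d {} i" if "i > 0"
    using that ex by (cases i) (simp_all add: cocyc_def cobd_def)
  show "cocyc S E d {} 0 = e ` carrier M" "e \<in> module_hom S M (E 0)" "inj_on e (carrier M)"
    using r by (simp_all add: right_resolution_def cocyc_def)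
qed

lemma torsion_cocycles_eq:
  assumes "\<And>j. module S (E j)" shows "torsion_cocycles S (Idl xs) E d i = cocyc S E d xs i"
  by (simp add: torsion_cocycles_def cocyc_def torsion_part_eq[OF assms])

lemma torsion_coboundaries_eq:
  assumes "\<And>j. module S (E j)" shows "torsion_coboundaries S (Idl xs) E d i = cobd S E d xs i"
  by (cases i) (simp_all add: torsion_coboundaries_def cobd_def torsion_part_eq[OF assms])

lemma annihilator_kills:
  assumes M: "module S M" and N: "module S N" and e: "e \<in> module_hom S M N"
    and c: "c ` {..<n} \<subseteq> annihilator S M"
  shows "e ` carrier M \<subseteq> tors S N (c ` {..<n})"
proof -
  interpret e: module_homomorphism S M N e by (intro module_homomorphism.intro module_homomorphism_axioms.intro assms)
  have "c i [^] (1::nat) \<odot>\<^bsub>N\<^esub> e y = \<zero>\<^bsub>N\<^esub>" if "i < n" "y \<in> carrier M" for i y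
  proof -
    have ci: "c i \<in> carrier S" "c i \<odot>\<^bsub>M\<^esub> y = \<zero>\<^bsub>M\<^esub>" using c that by (auto simp: annihilator_def)
    then show ?thesis using e.smult[OF ci(1) that(2)] by simp
  qed
  then show ?thesis using e.closed unfolding tors_def by blast
qed

lemma parameters_tors:
  assumes "module S N" "c ` {..<n} \<subseteq> homogeneous_elems" "\<forall>i<n. \<exists>k::nat. x i [^] k \<ominus> c i \<in> Idl (set fs)"
    "\<forall>f\<in>set fs. \<exists>k>0. f \<in> Sg k"
  shows "tors S N (c ` {..<n} \<union> set fs) = tors S N (c ` {..<n} \<union> xs)"
  by (rule tors_exchange[OF assms(1)]) (use assms(2-4) homogeneous_closed in auto)

lemma xs_homogeneous: "xs \<subseteq> homogeneous_elems"
  using x_Sg by (auto simp: homogeneous_elems_def)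

context
  fixes M :: "('s, 'm) module" and Mg
  assumes gM: "graded_module S Sg M Mg" and fg: "finitely_generated_module S M"
begin

lemma parameters:
  assumes bound: "\<And>l P. (\<forall>j\<le>l. primeideal (P j) S \<and> fiber_ann M \<subseteq> P j) \<Longrightarrow> (\<forall>j<l. P j \<subset> P (Suc j)) \<Longrightarrow> l \<le> d"
  shows "\<exists>fs c. length fs = d \<and> set fs \<subseteq> homogeneous_elems \<and> c ` {..<n} \<subseteq> annihilator S M \<and>
    c ` {..<n} \<subseteq> homogeneous_elems \<and> (\<forall>i<n. \<exists>k::nat. x i [^] k \<ominus> c i \<in> Idl (set fs)) \<and>
    (\<forall>f\<in>set fs. \<exists>k>0. f \<in> Sg k)"
proof -
  have "\<exists>fs c. length fs = d \<and> (\<forall>f\<in>set fs. \<exists>k>0. f \<in> Sg k) \<and>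
    (\<forall>i<n. c i \<in> annihilator S M \<and> (\<exists>j. c i \<in> Sg j) \<and> (\<exists>k::nat. x i [^] k \<ominus> c i \<in> Idl (set fs)))"
    by (rule parameters_modulo_annihilator[OF gM fg], rule bound)
  then obtain fs c where p: "length fs = d" "\<forall>f\<in>set fs. \<exists>k>0. f \<in> Sg k"
    "\<forall>i<n. c i \<in> annihilator S M \<and> (\<exists>j. c i \<in> Sg j) \<and> (\<exists>k::nat. x i [^] k \<ominus> c i \<in> Idl (set fs))"
    by (elim exE conjE)
  have "set fs \<subseteq> homogeneous_elems" "c ` {..<n} \<subseteq> annihilator S M" "c ` {..<n} \<subseteq> homogeneous_elems"
    using p(2,3) by (auto simp: homogeneous_elems_def)
  then show ?thesis using p by blast
qed

text \<open>The bound is adapted to \<open>i\<close> and not to the exact dimension: for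
  \<open>i = k + 1\<close> all chains have length at most \<open>k\<close>, and then
  \<open>k\<close> parameters can be found even if the dimension is smaller.\<close>

theorem local_cohomology_vanish:
  fixes E :: "nat \<Rightarrow> ('s, 'e) module"
  assumes res: "divisible_resolution M E d e"
    and bound: "\<And>l P. (\<forall>j\<le>l. primeideal (P j) S \<and> fiber_ann M \<subseteq> P j) \<Longrightarrow> (\<forall>j<l. P j \<subset> P (Suc j)) \<Longrightarrow> l < i"
  shows "carrier (local_cohomology S (Idl xs) E d i) = {\<zero>\<^bsub>local_cohomology S (Idl xs) E d i\<^esub>}"
proof -
  note rc = resolution_complex[OF res]
  interpret E: module_complex S E d homogeneous_elems by (rule rc(1))
  have "E.Z xs i \<subseteq> E.B xs i"
  proof (cases i)
    \<comment> \<open>Degree 0 satisfies the bound only if there are no primes over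
      \<open>fiber_ann\<close>, and then \<open>M\<close> is zero.\<close>
    case 0
    have "carrier M = {\<zero>\<^bsub>M\<^esub>}"
    proof (rule zero_if_no_primes[OF gM fg])
      show False if "primeideal P S" "fiber_ann M \<subseteq> P" for P
        using bound[of 0 "\<lambda>_. P"] that 0 by simp
    qed
    moreover interpret e: module_homomorphism S M "E 0" e
      by (intro module_homomorphism.intro module_homomorphism_axioms.intro graded_module_imp_module[OF gM] E.mod rc(4))
    have "E.Z xs 0 \<subseteq> e ` carrier M" using E.Z_mono[of "{}" xs 0] rc(3) by simp
    ultimately show ?thesis using 0 by (simp add: cobd_def)
  next
    case (Suc k)
    have ex: "\<exists>fs c. length fs = k \<and> set fs \<subseteq> homogeneous_elems \<and> c ` {..<n} \<subseteq> annihilator S M \<and>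
      c ` {..<n} \<subseteq> homogeneous_elems \<and> (\<forall>i<n. \<exists>k::nat. x i [^] k \<ominus> c i \<in> Idl (set fs)) \<and>
      (\<forall>f\<in>set fs. \<exists>k>0. f \<in> Sg k)"
      by (rule parameters) (use bound[unfolded Suc less_Suc_eq_le] in blast)
    obtain fs c where p: "length fs = k" "set fs \<subseteq> homogeneous_elems" "c ` {..<n} \<subseteq> annihilator S M"
      "c ` {..<n} \<subseteq> homogeneous_elems"
      "\<forall>i<n. \<exists>k::nat. x i [^] k \<ominus> c i \<in> Idl (set fs)" "\<forall>f\<in>set fs. \<exists>k>0. f \<in> Sg k"
      using ex by (elim exE conjE)
    show ?thesis
      by (rule E.vanish[OF _ p(4) rc(2) _ p(2) _ xs_homogeneous parameters_tors[OF E.mod p(4-6)]])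
        (use annihilator_kills[OF graded_module_imp_module[OF gM] E.mod rc(4) p(3)] rc(3) p(1) Suc in auto)
  qed
  then have "carrier (E.coh xs i) = {\<zero>\<^bsub>E.coh xs i\<^esub>}" by (rule E.coh_vanish[OF xs_closed])
  then show ?thesis
    by (simp add: local_cohomology_def E.coh_def torsion_cocycles_eq[OF E.mod] torsion_coboundaries_eq[OF E.mod])
qed

end

end

section \<open>Comparison with the fibre in the top degree\<close>

context local_graded_algebra
begin

context
  fixes M :: "('s, 'm) module" and Mg
  assumes gM: "graded_module S Sg M Mg" and fg: "finitely_generated_module S M"
begin

interpretation T: residue_tensor S M R m h
  by (intro residue_tensor.intro graded_module_imp_module[OF gM] residue_tensor_axioms.intro h R.is_cring m.is_ideal)

text \<open>The start is the pair of resolutions without torsion condition: their cohomology is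
  \<open>M\<close> and \<open>M \<otimes> k\<close> in degree 0, where \<open>\<phi>\<close> induces
  \<open>x \<mapsto> x \<otimes> 1\<close>, onto with kernel \<open>mM\<close>. The same
  \<open>c i\<close> serve both sides, since what kills \<open>M\<close> kills its image.\<close>

lemma reduction_local_cohomology:
  fixes E :: "nat \<Rightarrow> ('s, 'e) module" and F :: "nat \<Rightarrow> ('s, 'f) module"
  assumes resE: "divisible_resolution M E dE eE" and resF: "divisible_resolution T.TM F dF eF"
    and lift: "resolution_lift S M T.tens E dE eE F dF eF \<phi>"
    and bound: "\<And>l P. (\<forall>j\<le>l. primeideal (P j) S \<and> fiber_ann M \<subseteq> P j) \<Longrightarrow> (\<forall>j<l. P j \<subset> P (Suc j)) \<Longrightarrow> l \<le> d"
  shows "module_complex_map S E dE F dF homogeneous_elems \<phi> (h ` m)"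
    "module_complex_map.reduction S E dE F dF \<phi> (h ` m) xs d"
proof -
  note rE = resolution_complex[OF resE] and rF = resolution_complex[OF resF]
  interpret E: module_complex S E dE homogeneous_elems by (rule rE(1))
  interpret F: module_complex S F dF homogeneous_elems by (rule rF(1))
  show mcm: "module_complex_map S E dE F dF homogeneous_elems \<phi> (h ` m)"
    by (intro module_complex_map.intro module_complex_map_axioms.intro rE(1) rF(1) T.hm)
      (use lift in \<open>auto simp: resolution_lift_def\<close>)
  interpret f: module_complex_map S E dE F dF homogeneous_elems \<phi> "h ` m" by (rule mcm)
  interpret e: module_homomorphism S M "E 0" eE
    by (intro module_homomorphism.intro module_homomorphism_axioms.intro graded_module_imp_module[OF gM] E.mod rE(4))
  \<comment> \<open>The composite of \<open>M\<close>, its fibre and \<open>F 0\<close>. Its image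
    is the group of degree 0 cocycles, and its kernel is \<open>mM\<close>.\<close>
  define \<alpha> where "\<alpha> = (\<lambda>y. eF (T.tens y))"
  have \<alpha>h: "\<alpha> \<in> module_hom S M (F 0)"
    unfolding module_hom_def mem_Collect_eq \<alpha>_def
  proof (intro conjI ballI funcsetI)
    note e = rF(4)[unfolded module_hom_def mem_Collect_eq]
    show "eF (T.tens y) \<in> carrier (F 0)" if "y \<in> carrier M" for y
      using funcset_mem[OF conjunct1[OF e] T.tens_closed[OF that]] .
    show "eF (T.tens (y \<oplus>\<^bsub>M\<^esub> z)) = eF (T.tens y) \<oplus>\<^bsub>F 0\<^esub> eF (T.tens z)"
      if y: "y \<in> carrier M" and z: "z \<in> carrier M" for y z
      unfolding T.tens_add[OF y z] using e T.tens_closed[OF y] T.tens_closed[OF z] by blast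
    show "eF (T.tens (a \<odot>\<^bsub>M\<^esub> y)) = a \<odot>\<^bsub>F 0\<^esub> eF (T.tens y)"
      if a: "a \<in> carrier S" and y: "y \<in> carrier M" for a y
      unfolding T.smult_tens[OF a y, symmetric] using e a T.tens_closed[OF y] by blast
  qed
  interpret \<alpha>: module_homomorphism S M "F 0" \<alpha>
    by (intro module_homomorphism.intro module_homomorphism_axioms.intro graded_module_imp_module[OF gM] F.mod \<alpha>h)
  have \<alpha>0: "\<alpha> y = \<zero>\<^bsub>F 0\<^esub> \<longleftrightarrow> y \<in> T.mA" if y: "y \<in> carrier M" for y
  proof -
    have "\<alpha> y = \<alpha> \<zero>\<^bsub>M\<^esub> \<longleftrightarrow> T.tens y = T.tens \<zero>\<^bsub>M\<^esub>"
      unfolding \<alpha>_def by (rule inj_on_eq_iff[OF rF(5) T.tens_closed T.tens_closed]) (use y in auto)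
    then show ?thesis using T.tens_eq_zero[OF y] T.tens_zero by simp
  qed
  have \<phi>0: "\<phi> 0 (eE y) = \<alpha> y" if "y \<in> carrier M" for y
    using lift that by (simp add: resolution_lift_def \<alpha>_def)
  have ZF: "F.Z {} 0 = \<alpha> ` carrier M"
  proof -
    have "carrier T.TM = T.tens ` carrier M" using T.tens_surj T.tens_closed by blast
    then show ?thesis unfolding rF(3) by (simp add: image_image \<alpha>_def)
  qed
  have red0: "f.reduction {} 0"
    unfolding f.reduction_def
  proof (intro conjI allI impI ballI)
    fix i :: nat assume i: "i > 0"
    show "E.Z {} i \<subseteq> E.B {} i" by (rule rE(2)[OF i])
    show "F.Z {} i \<subseteq> F.B {} i" by (rule rF(2)[OF i])
  next
    fix w assume "w \<in> F.Z {} 0"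
    then obtain y where y: "y \<in> carrier M" "w = \<alpha> y" unfolding ZF by (elim imageE)
    show "\<exists>z\<in>E.Z {} 0. \<exists>b\<in>F.B {} 0. w = \<phi> 0 z \<oplus>\<^bsub>F 0\<^esub> b"
    proof (intro bexI)
      show "w = \<phi> 0 (eE y) \<oplus>\<^bsub>F 0\<^esub> \<zero>\<^bsub>F 0\<^esub>" using y \<phi>0 \<alpha>.closed by simp
      show "eE y \<in> E.Z {} 0" unfolding rE(3) using y(1) by (rule imageI)
    qed (simp add: cobd_def)
    fix \<mu> assume "\<mu> \<in> h ` m"
    then have \<mu>: "\<mu> \<odot>\<^bsub>M\<^esub> y \<in> T.mA" "\<mu> \<in> carrier S" using T.mspan_incl[OF _ y(1)] T.hm by auto
    have "\<mu> \<odot>\<^bsub>F 0\<^esub> w = \<alpha> (\<mu> \<odot>\<^bsub>M\<^esub> y)" unfolding y(2) by (rule \<alpha>.smult[OF \<mu>(2) y(1), symmetric])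
    also have "\<dots> = \<zero>\<^bsub>F 0\<^esub>" using \<alpha>0 \<mu> y(1) by simp
    finally show "\<mu> \<odot>\<^bsub>F 0\<^esub> w \<in> F.B {} 0" by (simp add: cobd_def)
  next
    fix w assume "w \<in> E.Z {} 0" and b: "\<phi> 0 w \<in> F.B {} 0"
    then obtain y where y: "y \<in> carrier M" "w = eE y" unfolding rE(3) by (elim imageE)
    then have "y \<in> T.mA" using b \<phi>0 \<alpha>0 by (simp add: cobd_def)
    then have "w \<in> E.E.mspan 0 (h ` m) (E.Z {} 0)"
      unfolding rE(3) y(2) by (rule e.mspan_image[OF T.hm subset_refl])
    moreover have "w = w \<oplus>\<^bsub>E 0\<^esub> \<zero>\<^bsub>E 0\<^esub>" using y e.closed by simp
    moreover have "\<zero>\<^bsub>E 0\<^esub> \<in> E.B {} 0" by (simp add: cobd_def)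
    ultimately show "\<exists>v\<in>E.E.mspan 0 (h ` m) (E.Z {} 0). \<exists>b\<in>E.B {} 0. w = v \<oplus>\<^bsub>E 0\<^esub> b" by (intro bexI)
  qed
  have ex: "\<exists>fs c. length fs = d \<and> set fs \<subseteq> homogeneous_elems \<and> c ` {..<n} \<subseteq> annihilator S M \<and>
    c ` {..<n} \<subseteq> homogeneous_elems \<and> (\<forall>i<n. \<exists>k::nat. x i [^] k \<ominus> c i \<in> Idl (set fs)) \<and>
    (\<forall>f\<in>set fs. \<exists>k>0. f \<in> Sg k)"
    by (rule parameters[OF gM fg], rule bound)
  obtain fs c where p: "length fs = d" "set fs \<subseteq> homogeneous_elems" "c ` {..<n} \<subseteq> annihilator S M"
    "c ` {..<n} \<subseteq> homogeneous_elems"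
    "\<forall>i<n. \<exists>k::nat. x i [^] k \<ominus> c i \<in> Idl (set fs)" "\<forall>f\<in>set fs. \<exists>k>0. f \<in> Sg k"
    using ex by (elim exE conjE)
  have killE: "E.Z {} 0 \<subseteq> E.T (c ` {..<n}) 0"
    unfolding rE(3) by (rule annihilator_kills[OF graded_module_imp_module[OF gM] E.mod rE(4) p(3)])
  have killF: "F.Z {} 0 \<subseteq> F.T (c ` {..<n}) 0"
    unfolding ZF by (rule annihilator_kills[OF graded_module_imp_module[OF gM] F.mod \<alpha>h p(3)])
  have fin: "finite (c ` {..<n})" "finite xs" by simp_all
  show "f.reduction xs d"
    unfolding p(1)[symmetric]
    by (rule f.reduction_top[OF red0 fin(1) p(4) killE killF p(2) fin(2) xs_homogeneous
        parameters_tors[OF E.mod p(4-6)] parameters_tors[OF F.mod p(4-6)]])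
qed

end

lemma graded_modI: "graded_module S Sg E Eg \<Longrightarrow> graded_mod S Sg E Eg"
  using Sg_closed by (intro graded_mod.intro graded_mod_axioms.intro) (auto simp: graded_module_def)

lemma graded_components:
  assumes E: "module_complex S E d homogeneous_elems"
    and gE: "\<And>i. graded_module S Sg (E i) (Eg i)" and gd: "\<And>i. d i \<in> graded_hom S (E i) (Eg i) (E (Suc i)) (Eg (Suc i))"
  shows "z \<in> cocyc S E d xs i \<Longrightarrow> graded_mod.gc (E i) (Eg i) z j \<in> cocyc S E d xs i"
    "b \<in> cobd S E d xs i \<Longrightarrow> graded_mod.gc (E i) (Eg i) b j \<in> cobd S E d xs i"
proof -
  interpret E: module_complex S E d homogeneous_elems by (rule E)
  note gm = graded_modI[OF gE]
  have t: "graded_mod.gc (E i) (Eg i) z j \<in> E.T xs i" if "z \<in> E.T xs i" for i z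
    by (rule graded_mod.gc_tors[OF gm _ Sg_pow that]) (use x_Sg in auto)
  note gc_d = graded_hom_gc[OF gm gm gd E.T_carrier]
  show "graded_mod.gc (E i) (Eg i) z j \<in> cocyc S E d xs i" if z: "z \<in> cocyc S E d xs i"
  proof -
    have zT: "z \<in> E.T xs i" "d i z = \<zero>\<^bsub>E (Suc i)\<^esub>" using z by (auto simp: cocyc_def)
    then show ?thesis using t[OF zT(1)] gc_d[OF zT(1)] graded_mod.gc_zero[OF gm] by (simp add: cocyc_def)
  qed
  show "graded_mod.gc (E i) (Eg i) b j \<in> cobd S E d xs i" if b: "b \<in> cobd S E d xs i"
  proof (cases i)
    case 0 then show ?thesis using b graded_mod.gc_zero[OF gm] by (simp add: cobd_def)
  next
    case (Suc k)
    then obtain u where u: "u \<in> E.T xs k" "b = d k u" using b by (auto simp: cobd_def)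
    then show ?thesis using Suc gc_d[OF u(1), of j] t[OF u(1)] by (simp add: cobd_def flip: gc_d[OF u(1)])
  qed
qed

lemma local_cohomology_coh:
  assumes "module_complex S E d homogeneous_elems"
  shows "local_cohomology S (Idl xs) E d i = module_complex.coh S E d xs i"
  unfolding module_complex.coh_def[OF assms] local_cohomology_def
    torsion_cocycles_eq[OF module_complex.mod[OF assms]] torsion_coboundaries_eq[OF module_complex.mod[OF assms]] ..

lemma local_cohomology_grading_coh:
  assumes "module_complex S E d homogeneous_elems"
  shows "local_cohomology_grading S (Idl xs) E Eg d i j =
    (\<lambda>z. cobd S E d xs i +>\<^bsub>E i\<^esub> z) ` (cocyc S E d xs i \<inter> Eg i j)"
  unfolding local_cohomology_grading_def
    torsion_cocycles_eq[OF module_complex.mod[OF assms]] torsion_coboundaries_eq[OF module_complex.mod[OF assms]] ..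

text \<open>The last conjunct ranges over all compatible gradings, so that a single
  \<open>\<psi>\<close> serves both the ungraded and the graded assertion.\<close>

theorem natural_tensor_map_iso:
  assumes mcm: "module_complex_map S E dE F dF homogeneous_elems \<phi> (h ` m)"
    and red: "module_complex_map.reduction S E dE F dF \<phi> (h ` m) xs d"
  shows "\<exists>\<psi>. natural_tensor_map h R m S
       (local_cohomology S (Idl xs) E dE d) (local_cohomology S (Idl xs) F dF d)
       (local_cohomology_map S (Idl xs) F dF \<phi> d) \<psi> \<and>
     bij_betw \<psi> (carrier (tensor_module h R (local_cohomology S (Idl xs) E dE d) (residue_module R m)))
       (carrier (local_cohomology S (Idl xs) F dF d)) \<and>
     (\<forall>Eg Fg. (\<forall>i. graded_module S Sg (E i) (Eg i)) \<longrightarrow> (\<forall>i. graded_module S Sg (F i) (Fg i)) \<longrightarrow>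
       (\<forall>i. dE i \<in> graded_hom S (E i) (Eg i) (E (Suc i)) (Eg (Suc i))) \<longrightarrow>
       (\<forall>i. dF i \<in> graded_hom S (F i) (Fg i) (F (Suc i)) (Fg (Suc i))) \<longrightarrow>
       (\<forall>i. \<phi> i \<in> graded_hom S (E i) (Eg i) (F i) (Fg i)) \<longrightarrow>
       (\<forall>j. \<psi> ` tensor_grading h R (local_cohomology S (Idl xs) E dE d)
               (local_cohomology_grading S (Idl xs) E Eg dE d) (residue_module R m) j
            = local_cohomology_grading S (Idl xs) F Fg dF d j))"
proof -
  interpret f: module_complex_map S E dE F dF homogeneous_elems \<phi> "h ` m" by (rule mcm)
  note E = f.E.module_complex_axioms and F = f.F.module_complex_axioms
  note r = f.reduction_coh_map[OF xs_closed red]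
  interpret CE: module S "f.E.coh xs d" by (rule f.E.coh_module[OF xs_closed])
  interpret T: residue_tensor S "f.E.coh xs d" R m h
    by (intro residue_tensor.intro CE.module_axioms residue_tensor_axioms.intro h R.is_cring m.is_ideal)
  have map_eq: "local_cohomology_map S (Idl xs) F dF \<phi> d = f.coh_map xs d"
    by (simp add: fun_eq_iff local_cohomology_map_def torsion_coboundaries_eq[OF f.F.mod])
  have ex: "\<exists>\<psi>. natural_tensor_map h R m S (f.E.coh xs d) (f.F.coh xs d) (f.coh_map xs d) \<psi> \<and>
    bij_betw \<psi> (carrier T.TM) (carrier (f.F.coh xs d)) \<and>
    (\<forall>v\<in>carrier (f.E.coh xs d). \<psi> (T.tens v) = f.coh_map xs d v)"
    by (rule T.factor_map[OF f.F.coh_module[OF xs_closed] r(1)]) (rule r(2), assumption, rule r(3))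
  obtain \<psi> where \<psi>: "natural_tensor_map h R m S (f.E.coh xs d) (f.F.coh xs d) (f.coh_map xs d) \<psi>"
    "bij_betw \<psi> (carrier T.TM) (carrier (f.F.coh xs d))"
    "\<forall>v\<in>carrier (f.E.coh xs d). \<psi> (T.tens v) = f.coh_map xs d v"
    using ex by (elim exE conjE)
  have graded: "\<psi> ` tensor_grading h R (f.E.coh xs d) (\<lambda>j. f.E.cls xs d ` (f.E.Z xs d \<inter> Eg d j)) (residue_module R m) j
      = f.F.cls xs d ` (f.F.Z xs d \<inter> Fg d j)"
    if gE: "\<And>i. graded_module S Sg (E i) (Eg i)" and gF: "\<And>i. graded_module S Sg (F i) (Fg i)"
      and dE: "\<And>i. dE i \<in> graded_hom S (E i) (Eg i) (E (Suc i)) (Eg (Suc i))"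
      and dF: "\<And>i. dF i \<in> graded_hom S (F i) (Fg i) (F (Suc i)) (Fg (Suc i))"
      and \<phi>: "\<And>i. \<phi> i \<in> graded_hom S (E i) (Eg i) (F i) (Fg i)" for Eg Fg j
  proof -
    interpret GE: graded_mod S Sg "E d" "Eg d" by (rule graded_modI[OF gE])
    interpret GF: graded_mod S Sg "F d" "Fg d" by (rule graded_modI[OF gF])
    note X = xs_closed
    let ?Ag = "\<lambda>j. f.E.cls xs d ` (f.E.Z xs d \<inter> Eg d j)"
    have z0: "\<zero>\<^bsub>f.E.coh xs d\<^esub> = f.E.cls xs d \<zero>\<^bsub>E d\<^esub>"
      using f.E.cls_zero[OF X f.E.Z_zero[OF X]] f.E.zero_B[OF X] by (simp add: f.E.coh_zero[OF X])
    have tg: "tensor_grading h R (f.E.coh xs d) ?Ag (residue_module R m) j = T.tens ` ?Ag j"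
    proof (rule T.tensor_grading_eq)
      show "?Ag j \<subseteq> carrier (f.E.coh xs d)" unfolding f.E.coh_carrier[OF X] by blast
      show "\<zero>\<^bsub>f.E.coh xs d\<^esub> \<in> ?Ag j" unfolding z0 by (intro imageI IntI f.E.Z_zero[OF X] GE.Mg_zero)
    next
      fix v w assume "v \<in> ?Ag j" "w \<in> ?Ag j"
      then obtain y z where yz: "y \<in> f.E.Z xs d" "y \<in> Eg d j" "v = f.E.cls xs d y" "z \<in> f.E.Z xs d" "z \<in> Eg d j" "w = f.E.cls xs d z"
        by (elim imageE IntE)
      show "v \<oplus>\<^bsub>f.E.coh xs d\<^esub> w \<in> ?Ag j"
        unfolding yz(3,6) f.E.cls_add[OF X yz(1,4)] by (intro imageI IntI f.E.Z_add[OF X] GE.Mg_add yz)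
    next
      fix v assume "v \<in> ?Ag j"
      then obtain y where y: "y \<in> f.E.Z xs d" "y \<in> Eg d j" "v = f.E.cls xs d y" by (elim imageE IntE)
      have "\<ominus>\<^bsub>E d\<^esub> y \<in> Eg d j" using subgroup.m_inv_closed[OF GE.Mg_subgroup y(2)] by (simp add: a_inv_def)
      then show "\<ominus>\<^bsub>f.E.coh xs d\<^esub> v \<in> ?Ag j"
        unfolding y(3) f.E.cls_neg[OF X y(1), symmetric] by (intro imageI IntI f.E.Z_neg[OF X] y)
      fix r assume r: "r \<in> carrier R"
      have hr: "h r \<in> Sg 0" "h r \<in> carrier S" using r Sg0 by auto
      have "h r \<odot>\<^bsub>E d\<^esub> y \<in> Eg d j" using GE.Mg_smult[OF hr(1) y(2)] by simp
      then show "h r \<odot>\<^bsub>f.E.coh xs d\<^esub> v \<in> ?Ag j"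
        unfolding y(3) f.E.cls_smult[OF X hr(2) y(1)] by (intro imageI IntI f.E.Z_smult[OF X] hr y)
    qed
    have im: "\<psi> (T.tens (f.E.cls xs d z)) = f.F.cls xs d (\<phi> d z)" if "z \<in> f.E.Z xs d" for z
    proof -
      have "f.E.cls xs d z \<in> carrier (f.E.coh xs d)" unfolding f.E.coh_carrier[OF X] using that by (rule imageI)
      then show ?thesis using \<psi>(3) f.coh_map_cls[OF X that] by simp
    qed
    show ?thesis
      unfolding tg
    proof (intro equalityI subsetI)
      fix D assume "D \<in> \<psi> ` T.tens ` ?Ag j"
      then obtain z where z: "z \<in> f.E.Z xs d" "z \<in> Eg d j" "D = \<psi> (T.tens (f.E.cls xs d z))" by (elim imageE IntE) simp
      have "\<phi> d z \<in> Fg d j" using \<phi>[of d] z(2) by (auto simp: graded_hom_def)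
      then show "D \<in> f.F.cls xs d ` (f.F.Z xs d \<inter> Fg d j)"
        unfolding z(3) im[OF z(1)] by (intro imageI IntI f.\<phi>_Z[OF X z(1)])
    next
      fix D assume "D \<in> f.F.cls xs d ` (f.F.Z xs d \<inter> Fg d j)"
      then obtain w where w: "w \<in> f.F.Z xs d" "w \<in> Fg d j" "D = f.F.cls xs d w" by (elim imageE IntE)
      obtain z b where zb: "z \<in> f.E.Z xs d" "b \<in> f.F.B xs d" "w = \<phi> d z \<oplus>\<^bsub>F d\<^esub> b"
        using f.reductionD(3)[OF red w(1)] by (elim bexE)
      have zE: "z \<in> carrier (E d)" by (rule subsetD[OF f.E.Z_carrier zb(1)])
      have bF: "b \<in> carrier (F d)" by (rule subsetD[OF f.F.B_carrier[OF X] zb(2)])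
      have zj: "GE.gc z j \<in> f.E.Z xs d" by (rule graded_components(1)[OF E gE dE zb(1)])
      have bj: "GF.gc b j \<in> f.F.B xs d" by (rule graded_components(2)[OF F gF dF zb(2)])
      \<comment> \<open>A lift of a homogeneous class need not be homogeneous. Its component of
        degree \<open>j\<close> is also a lift, because cocycles, coboundaries and
        \<open>\<phi>\<close> are compatible with components.\<close>
      have "w = GF.gc w j" using GF.gc_homogeneous[OF w(2), of j] by simp
      also have "\<dots> = GF.gc (\<phi> d z) j \<oplus>\<^bsub>F d\<^esub> GF.gc b j"
        unfolding zb(3) by (rule GF.gc_add[OF f.\<phi>.closed[OF zE] bF])
      also have "GF.gc (\<phi> d z) j = \<phi> d (GE.gc z j)"
        by (rule graded_hom_gc[OF GE.graded_mod_axioms GF.graded_mod_axioms \<phi> zE, symmetric])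
      finally have "D = f.F.cls xs d (\<phi> d (GE.gc z j))"
        unfolding w(3) using f.F.cls_absorb[OF X f.\<phi>_Z[OF X zj] bj] by simp
      also have "\<dots> = \<psi> (T.tens (f.E.cls xs d (GE.gc z j)))" by (rule im[OF zj, symmetric])
      finally show "D \<in> \<psi> ` T.tens ` ?Ag j"
        using zj GE.gc_Mg[OF zE] by (auto intro!: imageI)
    qed
  qed
  show ?thesis
    unfolding local_cohomology_coh[OF E] local_cohomology_coh[OF F] map_eq
      local_cohomology_grading_coh[OF E, abs_def] local_cohomology_grading_coh[OF F]
    by (intro exI[of _ \<psi>] conjI \<psi>(1,2) allI impI graded) auto
qed

end

section \<open>From the Krull dimension to chains of primes, and the polynomial ring as an
  instance\<close>

context local_graded_algebra
begin

lemma fiber_ann_ideal: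
  assumes "module S M" shows "ideal (fiber_ann M) S"
proof -
  interpret M: module S M by (rule assms)
  show ?thesis
  proof (rule ideal_criterion)
    show "fiber_ann M \<subseteq> carrier S" by (auto simp: fiber_ann_def)
    show "\<zero> \<in> fiber_ann M" using M.mspan_zero by (simp add: fiber_ann_def)
    fix a assume a: "a \<in> fiber_ann M"
    show "a \<oplus> b \<in> fiber_ann M" if "b \<in> fiber_ann M" for b
      using a that M.mspan_add by (simp add: fiber_ann_def M.smult_l_distr)
    show "s \<otimes> a \<in> fiber_ann M" if "s \<in> carrier S" for s
      using a that by (simp add: fiber_ann_def m_comm[of s a] M.smult_assoc1)
  qed
qed

lemma prime_chain_module_dim:
  assumes M: "module S M"
    and P: "\<forall>j\<le>l. primeideal (P j) S \<and> fiber_ann M \<subseteq> P j" "\<forall>j<l. P j \<subset> P (Suc j)"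
  shows "ereal (real l) \<le> module_dim S (tensor_module h R M (residue_module R m))"
proof -
  interpret T: residue_tensor S M R m h
    by (intro residue_tensor.intro M residue_tensor_axioms.intro h R.is_cring m.is_ideal)
  have "annihilator S T.TM = fiber_ann M" unfolding T.tens_annihilator fiber_ann_def ..
  then show ?thesis
    unfolding module_dim_def using krull_dim_quotient[OF is_cring fiber_ann_ideal[OF M] P] by simp
qed

end

lemma (in cring) indexed_const_inj: "inj_on (indexed_const :: 'a \<Rightarrow> 'c multiset \<Rightarrow> 'a) (carrier R)"
proof (rule inj_onI)
  fix a b assume "(indexed_const a :: 'c multiset \<Rightarrow> 'a) = indexed_const b"
  from fun_cong[OF this, of "{#}"] show "a = b" by (simp add: indexed_const_def)
qed

lemma mpoly_local_graded_algebra: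
  assumes N: "noetherian_ring R" and L: "local_ring R m" and w: "\<And>i. i < n \<Longrightarrow> w i > 0"
  shows "local_graded_algebra (mpoly_ring R n) (mpoly_grading R n w) R (ring.indexed_const R) (ring.indexed_var R) w n m"
proof -
  have R: "cring R" using L by (simp add: local_ring_def)
  interpret cring R by (rule R)
  have one: "\<one>\<^bsub>mpoly_ring R n\<^esub> \<in> mpoly_grading R n w 0"
    using const_Sg[of "\<one>\<^bsub>R\<^esub>" n w] by (simp add: mpoly_sel)
  have Sg0: "mpoly_grading R n w 0 = indexed_const ` carrier R"
    using Sg_0[of n w, OF w] const_Sg[of _ n w] by (auto simp: image_iff)
  show ?thesis
  proof (intro local_graded_algebra.intro local_graded_algebra_axioms.intro graded_algebra.intro
      graded_algebra_axioms.intro graded_cring.intro graded_cring_axioms.intro)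
    fix Q a
    assume a: "a \<in> carrier (mpoly_ring R n)" and "\<And>r. r \<in> carrier R \<Longrightarrow> Q (indexed_const r)"
      "\<And>a b. a \<in> carrier (mpoly_ring R n) \<Longrightarrow> b \<in> carrier (mpoly_ring R n) \<Longrightarrow> Q a \<Longrightarrow> Q b \<Longrightarrow> Q (a \<oplus>\<^bsub>mpoly_ring R n\<^esub> b)"
      "\<And>a i. a \<in> carrier (mpoly_ring R n) \<Longrightarrow> i < n \<Longrightarrow> Q a \<Longrightarrow> Q (a \<otimes>\<^bsub>mpoly_ring R n\<^esub> indexed_var i)"
    then show "Q a" by (rule mpoly_induct)
  qed (rule mpoly_cring mpoly_graded one N R const_hom indexed_const_inj Sg0 Sg_neg var_Sg w L; assumption?)+
qed

theorem lemma1p3: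
  fixes R :: "('r, 'z) ring_scheme" and m :: "'r set" and n :: nat and w :: "nat \<Rightarrow> nat"
    and S :: "(nat multiset \<Rightarrow> 'r) ring" and Sg :: "int \<Rightarrow> (nat multiset \<Rightarrow> 'r) set"
    and Sp :: "(nat multiset \<Rightarrow> 'r) set"
    and M :: "(nat multiset \<Rightarrow> 'r, 'm) module" and Mg :: "int \<Rightarrow> 'm set"
    and k :: "('r, 'r set) module" and h :: "'r \<Rightarrow> nat multiset \<Rightarrow> 'r"
    and Mk :: "(nat multiset \<Rightarrow> 'r, ('m \<times> 'r set \<Rightarrow>\<^sub>0 int) set) module"
    and Mkg :: "int \<Rightarrow> ('m \<times> 'r set \<Rightarrow>\<^sub>0 int) set set"
    and \<iota> :: "'m \<Rightarrow> ('m \<times> 'r set \<Rightarrow>\<^sub>0 int) set"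
  assumes "noetherian_ring R" and "local_ring R m"
    and "\<And>i. i < n \<Longrightarrow> w i > 0"
    and S: "S = mpoly_ring R n" and Sg: "Sg = mpoly_grading R n w"
    and Sp: "Sp = irrelevant_ideal R n"
    and "graded_module S Sg M Mg" and "finitely_generated_module S M"
    and k: "k = residue_module R m" and h: "h = ring.indexed_const R"
    and Mk: "Mk = tensor_module h R M k" and Mkg: "Mkg = tensor_grading h R M Mg k"
    and \<iota>: "\<iota> = (\<lambda>x. pure_tensor h R M k x \<one>\<^bsub>k\<^esub>)"
  shows
    \<comment> \<open>local cohomology modules computed by injective resolutions\<close>
    "(\<forall>(E :: nat \<Rightarrow> (nat multiset \<Rightarrow> 'r, 'e) module) dE eE i.
        injective_resolution S M E dE eE \<and> module_dim S Mk < ereal (real i) \<longrightarrow>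
        carrier (local_cohomology S Sp E dE i) = {\<zero>\<^bsub>local_cohomology S Sp E dE i\<^esub>})
   \<and> (\<forall>(E :: nat \<Rightarrow> (nat multiset \<Rightarrow> 'r, 'e) module) dE eE
       (F :: nat \<Rightarrow> (nat multiset \<Rightarrow> 'r, 'f) module) dF eF \<phi> d.
        injective_resolution S M E dE eE \<and> injective_resolution S Mk F dF eF \<and>
        resolution_lift S M \<iota> E dE eE F dF eF \<phi> \<and> module_dim S Mk = ereal (real d) \<longrightarrow>
        (\<exists>\<psi>. natural_tensor_map h R m S
               (local_cohomology S Sp E dE d) (local_cohomology S Sp F dF d)
               (local_cohomology_map S Sp F dF \<phi> d) \<psi> \<and>
             bij_betw \<psi> (carrier (tensor_module h R (local_cohomology S Sp E dE d) k))
               (carrier (local_cohomology S Sp F dF d))))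
    \<comment> \<open>the same for the graded local cohomology modules, computed by graded injective resolutions\<close>
   \<and> (\<forall>(E :: nat \<Rightarrow> (nat multiset \<Rightarrow> 'r, 'e) module) Eg dE eE i.
        graded_injective_resolution S Sg M Mg E Eg dE eE \<and> module_dim S Mk < ereal (real i) \<longrightarrow>
        carrier (local_cohomology S Sp E dE i) = {\<zero>\<^bsub>local_cohomology S Sp E dE i\<^esub>})
   \<and> (\<forall>(E :: nat \<Rightarrow> (nat multiset \<Rightarrow> 'r, 'e) module) Eg dE eE
       (F :: nat \<Rightarrow> (nat multiset \<Rightarrow> 'r, 'f) module) Fg dF eF \<phi> d.
        graded_injective_resolution S Sg M Mg E Eg dE eE \<and>
        graded_injective_resolution S Sg Mk Mkg F Fg dF eF \<and>
        resolution_lift S M \<iota> E dE eE F dF eF \<phi> \<and>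
        (\<forall>j. \<phi> j \<in> graded_hom S (E j) (Eg j) (F j) (Fg j)) \<and>
        module_dim S Mk = ereal (real d) \<longrightarrow>
        (\<exists>\<psi>. natural_tensor_map h R m S
               (local_cohomology S Sp E dE d) (local_cohomology S Sp F dF d)
               (local_cohomology_map S Sp F dF \<phi> d) \<psi> \<and>
             bij_betw \<psi> (carrier (tensor_module h R (local_cohomology S Sp E dE d) k))
               (carrier (local_cohomology S Sp F dF d)) \<and>
             (\<forall>j. \<psi> ` tensor_grading h R (local_cohomology S Sp E dE d)
                        (local_cohomology_grading S Sp E Eg dE d) k j
                  = local_cohomology_grading S Sp F Fg dF d j)))"
proof -
  interpret L: local_graded_algebra S Sg R h "ring.indexed_var R" w n m
    unfolding S Sg h by (rule mpoly_local_graded_algebra[OF assms(1-3)])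
  have M: "module S M" by (rule graded_module_imp_module[OF assms(7)])
  interpret T: residue_tensor S M R m h
    by (intro residue_tensor.intro M residue_tensor_axioms.intro L.h L.R.is_cring L.m.is_ideal)
  have Sp': "Sp = genideal S L.xs" unfolding Sp S irrelevant_ideal_def ..
  have Mk': "Mk = T.TM" unfolding Mk k ..
  have \<iota>': "\<iota> = T.tens" unfolding \<iota> k T.k_sel(3) by (simp add: fun_eq_iff T.tens_def)
  note chain = L.prime_chain_module_dim[OF M, folded k, folded Mk]
  \<comment> \<open>For \<open>i = 0\<close> the conclusion is impossible, so a negative dimension
    excludes all primes over \<open>fiber_ann\<close>.\<close>
  have below: "l < i" if dim: "module_dim S Mk < ereal (real i)"
    and P: "\<forall>j\<le>l. primeideal (P j) S \<and> L.fiber_ann M \<subseteq> P j" "\<forall>j<l. P j \<subset> P (Suc j)" for i l P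
    using le_less_trans[OF chain[OF P] dim] by simp
  have upto: "l \<le> d" if dim: "module_dim S Mk = ereal (real d)"
    and P: "\<forall>j\<le>l. primeideal (P j) S \<and> L.fiber_ann M \<subseteq> P j" "\<forall>j<l. P j \<subset> P (Suc j)" for d l P
    using chain[OF P] unfolding dim by simp
  note vanish = L.local_cohomology_vanish[OF assms(7,8), folded Sp']
  have iso: "\<exists>\<psi>. natural_tensor_map h R m S
               (local_cohomology S Sp E dE d) (local_cohomology S Sp F dF d)
               (local_cohomology_map S Sp F dF \<phi> d) \<psi> \<and>
             bij_betw \<psi> (carrier (tensor_module h R (local_cohomology S Sp E dE d) k))
               (carrier (local_cohomology S Sp F dF d)) \<and>
      (\<forall>Eg Fg. (\<forall>i. graded_module S Sg (E i) (Eg i)) \<longrightarrow> (\<forall>i. graded_module S Sg (F i) (Fg i)) \<longrightarrow>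
       (\<forall>i. dE i \<in> graded_hom S (E i) (Eg i) (E (Suc i)) (Eg (Suc i))) \<longrightarrow>
       (\<forall>i. dF i \<in> graded_hom S (F i) (Fg i) (F (Suc i)) (Fg (Suc i))) \<longrightarrow>
       (\<forall>i. \<phi> i \<in> graded_hom S (E i) (Eg i) (F i) (Fg i)) \<longrightarrow>
       (\<forall>j. \<psi> ` tensor_grading h R (local_cohomology S Sp E dE d) (local_cohomology_grading S Sp E Eg dE d) k j
            = local_cohomology_grading S Sp F Fg dF d j))"
    if res: "L.divisible_resolution M E dE eE" "L.divisible_resolution Mk F dF eF"
      and lift: "resolution_lift S M \<iota> E dE eE F dF eF \<phi>" and dim: "module_dim S Mk = ereal (real d)"
    for E :: "nat \<Rightarrow> (nat multiset \<Rightarrow> 'r, 'e) module" and dE eE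
      and F :: "nat \<Rightarrow> (nat multiset \<Rightarrow> 'r, 'f) module" and dF eF \<phi> d
  proof -
    note red = L.reduction_local_cohomology[OF assms(7,8), folded Mk' \<iota>', OF res lift]
    have "module_complex_map S E dE F dF L.homogeneous_elems \<phi> (h ` m)"
      by (rule red(1)) (rule upto[OF dim])
    moreover have "module_complex_map.reduction S E dE F dF \<phi> (h ` m) L.xs d"
      by (rule red(2)) (rule upto[OF dim])
    ultimately show ?thesis by (rule L.natural_tensor_map_iso[folded k Sp'])
  qed
  show ?thesis
  proof (intro conjI allI impI; elim conjE)
    fix E :: "nat \<Rightarrow> (nat multiset \<Rightarrow> 'r, 'e) module" and dE eE i
    assume "injective_resolution S M E dE eE" and "module_dim S Mk < ereal (real i)"
    then show "carrier (local_cohomology S Sp E dE i) = {\<zero>\<^bsub>local_cohomology S Sp E dE i\<^esub>}"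
      by (intro vanish[OF L.injective_divisible] below)
  next
    fix E :: "nat \<Rightarrow> (nat multiset \<Rightarrow> 'r, 'e) module" and Eg dE eE i
    assume "graded_injective_resolution S Sg M Mg E Eg dE eE" and "module_dim S Mk < ereal (real i)"
    then show "carrier (local_cohomology S Sp E dE i) = {\<zero>\<^bsub>local_cohomology S Sp E dE i\<^esub>}"
      by (intro vanish[OF L.graded_injective_divisible] below)
  next
    fix E :: "nat \<Rightarrow> (nat multiset \<Rightarrow> 'r, 'e) module" and dE eE
      and F :: "nat \<Rightarrow> (nat multiset \<Rightarrow> 'r, 'f) module" and dF eF \<phi> d
    assume "injective_resolution S M E dE eE" "injective_resolution S Mk F dF eF"
      and lift: "resolution_lift S M \<iota> E dE eE F dF eF \<phi>" and dim: "module_dim S Mk = ereal (real d)"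
    then have res: "L.divisible_resolution M E dE eE" "L.divisible_resolution Mk F dF eF"
      by (auto intro: L.injective_divisible)
    show "\<exists>\<psi>. natural_tensor_map h R m S
               (local_cohomology S Sp E dE d) (local_cohomology S Sp F dF d)
               (local_cohomology_map S Sp F dF \<phi> d) \<psi> \<and>
             bij_betw \<psi> (carrier (tensor_module h R (local_cohomology S Sp E dE d) k))
               (carrier (local_cohomology S Sp F dF d))"
      using iso[OF res lift dim]
      by (elim exE conjE) (rule exI, rule conjI)
  next
    fix E :: "nat \<Rightarrow> (nat multiset \<Rightarrow> 'r, 'e) module" and Eg dE eE
      and F :: "nat \<Rightarrow> (nat multiset \<Rightarrow> 'r, 'f) module" and Fg dF eF \<phi> d
    assume E: "graded_injective_resolution S Sg M Mg E Eg dE eE"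
      and F: "graded_injective_resolution S Sg Mk Mkg F Fg dF eF"
      and lift: "resolution_lift S M \<iota> E dE eE F dF eF \<phi>"
      and \<phi>: "\<forall>j. \<phi> j \<in> graded_hom S (E j) (Eg j) (F j) (Fg j)" and dim: "module_dim S Mk = ereal (real d)"
    note res = L.graded_injective_divisible[OF E] L.graded_injective_divisible[OF F]
    have hom: "\<forall>j. dE j \<in> graded_hom S (E j) (Eg j) (E (Suc j)) (Eg (Suc j))"
      "\<forall>j. dF j \<in> graded_hom S (F j) (Fg j) (F (Suc j)) (Fg (Suc j))"
      by (rule E[unfolded graded_injective_resolution_def, THEN conjunct2, THEN conjunct2, THEN conjunct2],
          rule F[unfolded graded_injective_resolution_def, THEN conjunct2, THEN conjunct2, THEN conjunct2])
    have gr: "\<forall>j. graded_module S Sg (E j) (Eg j)" "\<forall>j. graded_module S Sg (F j) (Fg j)"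
      using L.graded_injective_graded[OF E] L.graded_injective_graded[OF F] by auto
    obtain \<psi> where \<psi>: "natural_tensor_map h R m S
               (local_cohomology S Sp E dE d) (local_cohomology S Sp F dF d)
               (local_cohomology_map S Sp F dF \<phi> d) \<psi>"
      "bij_betw \<psi> (carrier (tensor_module h R (local_cohomology S Sp E dE d) k))
               (carrier (local_cohomology S Sp F dF d))"
      "\<forall>Eg Fg. (\<forall>i. graded_module S Sg (E i) (Eg i)) \<longrightarrow> (\<forall>i. graded_module S Sg (F i) (Fg i)) \<longrightarrow>
       (\<forall>i. dE i \<in> graded_hom S (E i) (Eg i) (E (Suc i)) (Eg (Suc i))) \<longrightarrow>
       (\<forall>i. dF i \<in> graded_hom S (F i) (Fg i) (F (Suc i)) (Fg (Suc i))) \<longrightarrow>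
       (\<forall>i. \<phi> i \<in> graded_hom S (E i) (Eg i) (F i) (Fg i)) \<longrightarrow>
       (\<forall>j. \<psi> ` tensor_grading h R (local_cohomology S Sp E dE d) (local_cohomology_grading S Sp E Eg dE d) k j
            = local_cohomology_grading S Sp F Fg dF d j)"
      using iso[OF res lift dim] by (elim exE conjE)
    show "\<exists>\<psi>. natural_tensor_map h R m S
               (local_cohomology S Sp E dE d) (local_cohomology S Sp F dF d)
               (local_cohomology_map S Sp F dF \<phi> d) \<psi> \<and>
             bij_betw \<psi> (carrier (tensor_module h R (local_cohomology S Sp E dE d) k))
               (carrier (local_cohomology S Sp F dF d)) \<and>
             (\<forall>j. \<psi> ` tensor_grading h R (local_cohomology S Sp E dE d)
                        (local_cohomology_grading S Sp E Eg dE d) k j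
                  = local_cohomology_grading S Sp F Fg dF d j)"
      using \<psi>(1,2) \<psi>(3)[THEN spec, of Eg, THEN spec, of Fg, THEN mp, OF gr(1), THEN mp, OF gr(2),
          THEN mp, OF hom(1), THEN mp, OF hom(2), THEN mp, OF \<phi>]
      by (intro exI conjI)
  qed
qed

end
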